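(* Let $k$ be an algebraically closed field of characteristic zero and let $q \in k^{\times}$ be not a root of unity. There is a homeomorphism $\psi': \mathrm{spec}(\mathcal{O}_q(GL_2)) \longrightarrow \mathrm{pspec}(\mathcal{O}(GL_2))$, which restricts to a homeomorphism $\mathrm{prim}(\mathcal{O}_q(GL_2))\longrightarrow \mathrm{pprim}(\mathcal{O}(GL_2))$.
   Context: Quantum side: $\mathcal{O}_q(M_2)$ is the $k$-algebra generated by $a,b,c,d$ with relations $ab=qba$, $ac=qca$, $bd=qdb$, $cd=qdc$, $bc=cb$, $ad-da=(q-q^{-1})bc$. Its quantum determinant $D_q=ad-qbc$ is central, and $\mathcal{O}_q(GL_2)=\mathcal{O}_q(M_2)[D_q^{-1}]$. $\mathrm{spec}(A)$ is the set of prime ideals of $A$ with the Zariski topology, whose closed sets are $\{P\in \mathrm{spec}(A): P\supseteq I\}$ for ideals $I$; $\mathrm{prim}(A)$ is the subspace of primitive ideals. Poisson side: $\mathcal{O}(M_2)=k[a,b,c,d]$ with Poisson bracket $\{a,b\}=ab$, $\{a,c\}=ac$, $\{b,d\}=bd$, $\{c,d\}=cd$, $\{b,c\}=0$, $\{a,d\}=2bc$. The determinant $D=ad-bc$ is Poisson central and $\mathcal{O}(GL_2)=\mathcal{O}(M_2)[D^{-1}]$ with the unique extension of the bracket. For a commutative Poisson algebra $R$: a Poisson ideal is an ideal $I$ with $\{I,R\}\subseteq I$; a Poisson prime ideal is a Poisson ideal which is a prime ideal; a Poisson primitive ideal is an ideal which is the largest Poisson ideal contained in some maximal ideal of $R$.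 $\mathrm{pspec}(R)$ is the set of Poisson primes, with closed sets $V(I)=\{P\in \mathrm{pspec}(R):P\supseteq I\}$, and $\mathrm{pprim}(R)\subseteq \mathrm{pspec}(R)$ is the set of Poisson primitive ideals with the subspace topology. *)

theory Defs
  imports
    "HOL-Analysis.Abstract_Topology"
    "HOL-Library.Poly_Mapping"
    "HOL-Algebra.Algebraic_Closure_Type"
    "HOL-Algebra.Ideal_Product"
    "HOL-Algebra.QuotRing"
    "HOL-Algebra.Module"
begin

section \<open>Prime, primitive, Poisson prime and Poisson primitive ideals\<close>

definition prime_ideal_nc :: "'a set \<Rightarrow> ('a, 'm) ring_scheme \<Rightarrow> bool" where
  "prime_ideal_nc P R \<longleftrightarrow> ideal P R \<and> P \<noteq> carrier R \<and>
     (\<forall>I J. ideal I R \<longrightarrow> ideal J R \<longrightarrow> ideal_prod R I J \<subseteq> P \<longrightarrow> I \<subseteq> P \<or> J \<subseteq> P)"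

definition spec :: "('a, 'm) ring_scheme \<Rightarrow> 'a set set" where
  "spec R = {P. prime_ideal_nc P R}"

text \<open>The locale \<^locale>\<open>module\<close> of the library requires a commutative ring of scalars.\<close>

locale left_module = R?: ring R + M?: abelian_group M
  for R :: "('a, 'm) ring_scheme" (structure) and M :: "('a, 'b, 'n) module_scheme" (structure) +
  assumes smult_closed: "\<lbrakk>a \<in> carrier R; x \<in> carrier M\<rbrakk> \<Longrightarrow> a \<odot>\<^bsub>M\<^esub> x \<in> carrier M"
    and smult_l_distr: "\<lbrakk>a \<in> carrier R; b \<in> carrier R; x \<in> carrier M\<rbrakk> \<Longrightarrow>
      (a \<oplus>\<^bsub>R\<^esub> b) \<odot>\<^bsub>M\<^esub> x = a \<odot>\<^bsub>M\<^esub> x \<oplus>\<^bsub>M\<^esub> b \<odot>\<^bsub>M\<^esub> x"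
    and smult_r_distr: "\<lbrakk>a \<in> carrier R; x \<in> carrier M; y \<in> carrier M\<rbrakk> \<Longrightarrow>
      a \<odot>\<^bsub>M\<^esub> (x \<oplus>\<^bsub>M\<^esub> y) = a \<odot>\<^bsub>M\<^esub> x \<oplus>\<^bsub>M\<^esub> a \<odot>\<^bsub>M\<^esub> y"
    and smult_assoc: "\<lbrakk>a \<in> carrier R; b \<in> carrier R; x \<in> carrier M\<rbrakk> \<Longrightarrow>
      (a \<otimes>\<^bsub>R\<^esub> b) \<odot>\<^bsub>M\<^esub> x = a \<odot>\<^bsub>M\<^esub> (b \<odot>\<^bsub>M\<^esub> x)"
    and smult_one: "x \<in> carrier M \<Longrightarrow> \<one>\<^bsub>R\<^esub> \<odot>\<^bsub>M\<^esub> x = x"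

definition simple_left_module :: "('a, 'm) ring_scheme \<Rightarrow> ('a, 'b, 'n) module_scheme \<Rightarrow> bool" where
  "simple_left_module R M \<longleftrightarrow> left_module R M \<and> carrier M \<noteq> {\<zero>\<^bsub>M\<^esub>} \<and>
     (\<forall>N. submodule N R M \<longrightarrow> N = {\<zero>\<^bsub>M\<^esub>} \<or> N = carrier M)"

definition annihilator :: "('a, 'm) ring_scheme \<Rightarrow> ('a, 'b, 'n) module_scheme \<Rightarrow> 'a set" where
  "annihilator R M = {a \<in> carrier R. \<forall>x\<in>carrier M. a \<odot>\<^bsub>M\<^esub> x = \<zero>\<^bsub>M\<^esub>}"

text \<open>A simple left module over \<open>R\<close> is isomorphic to \<open>R / L\<close> for a maximal left ideal \<open>L\<close>, so
  letting the module range over structures on the type \<^typ>\<open>'a set\<close> of cosets loses nothing;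
  see \<open>annihilator_simple_in_prim\<close> below.\<close>

definition prim :: "('a, 'm) ring_scheme \<Rightarrow> 'a set set" where
  "prim R = {annihilator R M |M :: ('a, 'a set) module. simple_left_module R M}"

definition poisson_ideal :: "'a set \<Rightarrow> ('a, 'm) ring_scheme \<Rightarrow> ('a \<Rightarrow> 'a \<Rightarrow> 'a) \<Rightarrow> bool" where
  "poisson_ideal I R br \<longleftrightarrow> ideal I R \<and> (\<forall>x\<in>I. \<forall>r\<in>carrier R. br x r \<in> I)"

definition pspec :: "('a, 'm) ring_scheme \<Rightarrow> ('a \<Rightarrow> 'a \<Rightarrow> 'a) \<Rightarrow> 'a set set" where
  "pspec R br = {P. poisson_ideal P R br \<and> primeideal P R}"

definition pprim :: "('a, 'm) ring_scheme \<Rightarrow> ('a \<Rightarrow> 'a \<Rightarrow> 'a) \<Rightarrow> 'a set set" where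
  "pprim R br = {P. \<exists>M. maximalideal M R \<and> poisson_ideal P R br \<and> P \<subseteq> M \<and>
     (\<forall>J. poisson_ideal J R br \<longrightarrow> J \<subseteq> M \<longrightarrow> J \<subseteq> P)}"

text \<open>The topology on a set \<open>Ps\<close> of ideals whose closed sets are the
  \<open>{P \<in> Ps. I \<subseteq> P}\<close> for ideals \<open>I\<close>.\<close>

definition zariski :: "('a, 'm) ring_scheme \<Rightarrow> 'a set set \<Rightarrow> 'a set topology" where
  "zariski R Ps = topology (\<lambda>U. \<exists>I. ideal I R \<and> U = {P \<in> Ps. \<not> I \<subseteq> P})"

section \<open>Localization at a central element\<close>

text \<open>\<open>R[s\<^sup>-\<^sup>1]\<close> for central \<open>s\<close>; the pair \<open>(x, n)\<close> stands for the fraction \<open>x s\<^sup>-\<^sup>n\<close>.\<close>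

definition loc_rel :: "('a, 'm) ring_scheme \<Rightarrow> 'a \<Rightarrow> (('a \<times> nat) \<times> ('a \<times> nat)) set" where
  "loc_rel R s = {((x, n), (y, m)). x \<in> carrier R \<and> y \<in> carrier R \<and>
     (\<exists>k. (s [^]\<^bsub>R\<^esub> (k + m)) \<otimes>\<^bsub>R\<^esub> x = (s [^]\<^bsub>R\<^esub> (k + n)) \<otimes>\<^bsub>R\<^esub> y)}"

definition loc_frac :: "('a, 'm) ring_scheme \<Rightarrow> 'a \<Rightarrow> 'a \<Rightarrow> nat \<Rightarrow> ('a \<times> nat) set" where
  "loc_frac R s x n = loc_rel R s `` {(x, n)}"

definition localization :: "('a, 'm) ring_scheme \<Rightarrow> 'a \<Rightarrow> ('a \<times> nat) set ring" where
  "localization R s = \<lparr>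
     carrier = (carrier R \<times> UNIV) // loc_rel R s,
     monoid.mult = (\<lambda>U V. \<Union>(x, n)\<in>U. \<Union>(y, m)\<in>V. loc_frac R s (x \<otimes>\<^bsub>R\<^esub> y) (n + m)),
     one = loc_frac R s \<one>\<^bsub>R\<^esub> 0,
     ring.zero = loc_frac R s \<zero>\<^bsub>R\<^esub> 0,
     add = (\<lambda>U V. \<Union>(x, n)\<in>U. \<Union>(y, m)\<in>V. loc_frac R s
       ((s [^]\<^bsub>R\<^esub> m) \<otimes>\<^bsub>R\<^esub> x \<oplus>\<^bsub>R\<^esub> (s [^]\<^bsub>R\<^esub> n) \<otimes>\<^bsub>R\<^esub> y) (n + m))\<rparr>"

text \<open>If \<open>s\<close> is Poisson central, the unique extension of the bracket is
  \<open>{x s\<^sup>-\<^sup>n, y s\<^sup>-\<^sup>m} = {x, y} s\<^sup>-\<^sup>n\<^sup>-\<^sup>m\<close>; see \<open>loc_bracket_extends\<close> and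
  \<open>loc_bracket_unique\<close> below.\<close>

definition loc_bracket :: "('a, 'm) ring_scheme \<Rightarrow> 'a \<Rightarrow> ('a \<Rightarrow> 'a \<Rightarrow> 'a) \<Rightarrow>
    ('a \<times> nat) set \<Rightarrow> ('a \<times> nat) set \<Rightarrow> ('a \<times> nat) set" where
  "loc_bracket R s br U V = (\<Union>(x, n)\<in>U. \<Union>(y, m)\<in>V. loc_frac R s (br x y) (n + m))"


section \<open>The quantized coordinate ring of \<open>GL\<^sub>2\<close>\<close>

datatype gen = Ga | Gb | Gc | Gd

instantiation list :: (type) monoid_add
begin
definition zero_list :: "'a list" where "zero_list = []"
definition plus_list :: "'a list \<Rightarrow> 'a list \<Rightarrow> 'a list" where "plus_list = (@)"
instance by standard (simp_all add: zero_list_def plus_list_def)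
end

text \<open>With concatenation as the addition of words, the convolution product on finitely supported
  functions makes \<open>'x list \<Rightarrow>\<^sub>0 'k\<close> the free \<open>'k\<close>-algebra on \<open>'x\<close>.\<close>

type_synonym ('x, 'k) free_alg = "'x list \<Rightarrow>\<^sub>0 'k"

definition fgen :: "'x \<Rightarrow> ('x, 'k::field) free_alg" where
  "fgen x = Poly_Mapping.single [x] 1"

definition fscalar :: "'k::field \<Rightarrow> ('x, 'k) free_alg" where
  "fscalar c = Poly_Mapping.single [] c"

definition OqM2_relations :: "'k::field \<Rightarrow> (gen, 'k) free_alg set" where
  "OqM2_relations q = (let a = fgen Ga; b = fgen Gb; c = fgen Gc; d = fgen Gd in
     {a * b - fscalar q * b * a,
      a * c - fscalar q * c * a,
      b * d - fscalar q * d * b,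
      c * d - fscalar q * d * c,
      b * c - c * b,
      a * d - d * a - fscalar (q - inverse q) * b * c})"

definition OqM2_ideal :: "'k::field \<Rightarrow> (gen, 'k) free_alg set" where
  "OqM2_ideal q = Idl\<^bsub>ring_of_type_algebra\<^esub> (OqM2_relations q)"

definition OqM2 :: "'k::field \<Rightarrow> (gen, 'k) free_alg set ring" where
  "OqM2 q = ring_of_type_algebra Quot OqM2_ideal q"

definition qdet :: "'k::field \<Rightarrow> (gen, 'k) free_alg set" where
  "qdet q = OqM2_ideal q +>\<^bsub>ring_of_type_algebra\<^esub>
     (fgen Ga * fgen Gd - fscalar q * fgen Gb * fgen Gc)"

definition OqGL2 :: "'k::field \<Rightarrow> ((gen, 'k) free_alg set \<times> nat) set ring" where
  "OqGL2 q = localization (OqM2 q) (qdet q)"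


section \<open>The Poisson algebra of functions on \<open>GL\<^sub>2\<close>\<close>

type_synonym ('x, 'k) mpoly = "('x \<Rightarrow>\<^sub>0 nat) \<Rightarrow>\<^sub>0 'k"

definition mvar :: "'x \<Rightarrow> ('x, 'k::field) mpoly" where
  "mvar x = Poly_Mapping.single (Poly_Mapping.single x 1) 1"

definition mderiv :: "'x \<Rightarrow> ('x, 'k::field) mpoly \<Rightarrow> ('x, 'k) mpoly" where
  "mderiv x f = (\<Sum>m\<in>Poly_Mapping.keys f.
     Poly_Mapping.single (m - Poly_Mapping.single x 1)
       (of_nat (Poly_Mapping.lookup m x) * Poly_Mapping.lookup f m))"

fun gen_bracket :: "gen \<Rightarrow> gen \<Rightarrow> (gen, 'k::field) mpoly" where
  "gen_bracket Ga Gb = mvar Ga * mvar Gb"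
| "gen_bracket Ga Gc = mvar Ga * mvar Gc"
| "gen_bracket Gb Gd = mvar Gb * mvar Gd"
| "gen_bracket Gc Gd = mvar Gc * mvar Gd"
| "gen_bracket Ga Gd = 2 * mvar Gb * mvar Gc"
| "gen_bracket Gb Ga = - (mvar Ga * mvar Gb)"
| "gen_bracket Gc Ga = - (mvar Ga * mvar Gc)"
| "gen_bracket Gd Gb = - (mvar Gb * mvar Gd)"
| "gen_bracket Gd Gc = - (mvar Gc * mvar Gd)"
| "gen_bracket Gd Ga = - (2 * mvar Gb * mvar Gc)"
| "gen_bracket _ _ = 0"

text \<open>A Poisson bracket is a biderivation, so on a polynomial ring it is determined by its
  values on the variables:
  \<open>{f, g} = \<Sum>x y. {x, y} (\<partial>f/\<partial>x) (\<partial>g/\<partial>y)\<close>.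
  See \<open>M2_bracket_gen\<close> and \<open>poisson_bracket_M2\<close> below.\<close>

definition M2_bracket :: "(gen, 'k::field) mpoly \<Rightarrow> (gen, 'k) mpoly \<Rightarrow> (gen, 'k) mpoly" where
  "M2_bracket f g =
     (\<Sum>x\<in>{Ga, Gb, Gc, Gd}. \<Sum>y\<in>{Ga, Gb, Gc, Gd}. gen_bracket x y * mderiv x f * mderiv y g)"

definition OM2 :: "(gen, 'k::field) mpoly ring" where
  "OM2 = ring_of_type_algebra"

definition M2_det :: "(gen, 'k::field) mpoly" where
  "M2_det = mvar Ga * mvar Gd - mvar Gb * mvar Gc"

definition OGL2 :: "((gen, 'k::field) mpoly \<times> nat) set ring" where
  "OGL2 = localization OM2 M2_det"

definition GL2_bracket :: "((gen, 'k::field) mpoly \<times> nat) set \<Rightarrow>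
    ((gen, 'k) mpoly \<times> nat) set \<Rightarrow> ((gen, 'k) mpoly \<times> nat) set" where
  "GL2_bracket = loc_bracket OM2 M2_det M2_bracket"


section \<open>The Zariski topology; primitive ideals are prime\<close>

lemma istopology_zariski:
  assumes "ring R" and prime: "Ps \<subseteq> spec R"
  shows "istopology (\<lambda>U. \<exists>I. ideal I R \<and> U = {P \<in> Ps. \<not> I \<subseteq> P})"
proof -
  interpret ring R by fact
  show ?thesis
    unfolding istopology_def
  proof (intro conjI allI impI)
    fix U V
    assume "\<exists>I. ideal I R \<and> U = {P \<in> Ps. \<not> I \<subseteq> P}" "\<exists>I. ideal I R \<and> V = {P \<in> Ps. \<not> I \<subseteq> P}"
    then obtain I J where I: "ideal I R" "U = {P \<in> Ps. \<not> I \<subseteq> P}"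
      and J: "ideal J R" "V = {P \<in> Ps. \<not> J \<subseteq> P}" by blast
    have "ideal_prod R I J \<subseteq> P \<longleftrightarrow> I \<subseteq> P \<or> J \<subseteq> P" if "P \<in> Ps" for P
      using ideal_prod_inter[OF I(1) J(1)] prime I(1) J(1) that
      by (auto simp: spec_def prime_ideal_nc_def)
    then have "U \<inter> V = {P \<in> Ps. \<not> ideal_prod R I J \<subseteq> P}"
      using I(2) J(2) by auto
    then show "\<exists>K. ideal K R \<and> U \<inter> V = {P \<in> Ps. \<not> K \<subseteq> P}"
      using ideal_prod_is_ideal[OF I(1) J(1)] by blast
  next
    fix \<U> :: "'a set set set"
    assume "\<forall>U\<in>\<U>. \<exists>I. ideal I R \<and> U = {P \<in> Ps. \<not> I \<subseteq> P}"
    then obtain I where I: "\<And>U. U \<in> \<U> \<Longrightarrow> ideal (I U) R \<and> U = {P \<in> Ps. \<not> I U \<subseteq> P}" by metis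
    define S where "S = (\<Union>U\<in>\<U>. I U)"
    have S: "S \<subseteq> carrier R"
      unfolding S_def using I ideal.Icarr[of "I _" R] by auto
    have "Idl\<^bsub>R\<^esub> S \<subseteq> P \<longleftrightarrow> S \<subseteq> P" if "P \<in> Ps" for P
    proof -
      have "ideal P R" using that prime by (auto simp: spec_def prime_ideal_nc_def)
      then show ?thesis using genideal_minimal genideal_self[OF S] by blast
    qed
    moreover have "P \<in> U \<longleftrightarrow> P \<in> Ps \<and> \<not> I U \<subseteq> P" if "U \<in> \<U>" for U P
      using I[OF that] by auto
    then have "\<Union>\<U> = {P \<in> Ps. \<not> S \<subseteq> P}"
      unfolding S_def by auto
    ultimately have "\<Union>\<U> = {P \<in> Ps. \<not> Idl\<^bsub>R\<^esub> S \<subseteq> P}" by auto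
    then show "\<exists>K. ideal K R \<and> \<Union>\<U> = {P \<in> Ps. \<not> K \<subseteq> P}"
      using genideal_ideal[OF S] by blast
  qed
qed

lemma closedin_zariski:
  assumes "ring R" and "Ps \<subseteq> spec R"
  shows "topspace (zariski R Ps) = Ps"
    and "closedin (zariski R Ps) C \<longleftrightarrow> (\<exists>I. ideal I R \<and> C = {P \<in> Ps. I \<subseteq> P})"
proof -
  interpret ring R by fact
  have op: "openin (zariski R Ps) U \<longleftrightarrow> (\<exists>I. ideal I R \<and> U = {P \<in> Ps. \<not> I \<subseteq> P})" for U
    unfolding zariski_def using topology_inverse'[OF istopology_zariski[OF assms]] by simp
  have "\<not> carrier R \<subseteq> P" if "P \<in> Ps" for P
  proof -
    have "ideal P R" "P \<noteq> carrier R" using assms(2) that by (auto simp: spec_def prime_ideal_nc_def)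
    then show ?thesis using ideal.Icarr by (metis subsetI subset_antisym)
  qed
  then have "Ps = {P \<in> Ps. \<not> carrier R \<subseteq> P}" by auto
  then have "openin (zariski R Ps) Ps" unfolding op using oneideal by (intro exI conjI)
  moreover have "U \<subseteq> Ps" if "openin (zariski R Ps) U" for U using that op by auto
  ultimately show ts: "topspace (zariski R Ps) = Ps"
    by (meson openin_subset openin_topspace subset_antisym)
  have "C \<subseteq> Ps \<and> Ps - C = {P \<in> Ps. \<not> I \<subseteq> P} \<longleftrightarrow> C = {P \<in> Ps. I \<subseteq> P}" for I by auto
  moreover have "closedin (zariski R Ps) C \<longleftrightarrow>
      (\<exists>I. ideal I R \<and> (C \<subseteq> Ps \<and> Ps - C = {P \<in> Ps. \<not> I \<subseteq> P}))"
    unfolding closedin_def ts op by (rule iffI; elim conjE exE; intro conjI exI)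
  ultimately show "closedin (zariski R Ps) C \<longleftrightarrow> (\<exists>I. ideal I R \<and> C = {P \<in> Ps. I \<subseteq> P})"
    by simp
qed

lemma primeideal_imp_prime_ideal_nc:
  assumes "primeideal P R"
  shows "prime_ideal_nc P R"
proof -
  interpret primeideal P R by fact
  have "I \<subseteq> P \<or> J \<subseteq> P" if "ideal I R" "ideal J R" "ideal_prod R I J \<subseteq> P" for I J
  proof (rule ccontr)
    assume "\<not> (I \<subseteq> P \<or> J \<subseteq> P)"
    then obtain x y where xy: "x \<in> I" "x \<notin> P" "y \<in> J" "y \<notin> P" by auto
    have "x \<otimes>\<^bsub>R\<^esub> y \<in> P" using subsetD[OF that(3) ideal_prod.prod[OF xy(1,3)]] .
    then show False
      using I_prime xy ideal.Icarr[OF that(1)] ideal.Icarr[OF that(2)] by auto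
  qed
  then show ?thesis using I_notcarr ideal_axioms unfolding prime_ideal_nc_def by auto
qed

lemma pspec_subset_spec: "pspec R br \<subseteq> spec R"
  by (auto simp: pspec_def spec_def intro: primeideal_imp_prime_ideal_nc)

context
  fixes R :: "('a, 'm) ring_scheme" (structure) and M :: "('a, 'b, 'n) module_scheme"
  assumes simple: "simple_left_module R M"
begin

interpretation left_module R M
  using simple unfolding simple_left_module_def by blast

lemma smult_zero_right: assumes "a \<in> carrier R" shows "a \<odot>\<^bsub>M\<^esub> \<zero>\<^bsub>M\<^esub> = \<zero>\<^bsub>M\<^esub>"
proof -
  have "a \<odot>\<^bsub>M\<^esub> \<zero>\<^bsub>M\<^esub> \<oplus>\<^bsub>M\<^esub> a \<odot>\<^bsub>M\<^esub> \<zero>\<^bsub>M\<^esub> = a \<odot>\<^bsub>M\<^esub> \<zero>\<^bsub>M\<^esub>"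
    using smult_r_distr[of a "\<zero>\<^bsub>M\<^esub>" "\<zero>\<^bsub>M\<^esub>"] assms by simp
  then show ?thesis by (metis M.add.r_cancel_one' M.zero_closed assms smult_closed)
qed

lemma smult_zero_left: assumes "x \<in> carrier M" shows "\<zero> \<odot>\<^bsub>M\<^esub> x = \<zero>\<^bsub>M\<^esub>"
proof -
  have "\<zero> \<odot>\<^bsub>M\<^esub> x \<oplus>\<^bsub>M\<^esub> \<zero> \<odot>\<^bsub>M\<^esub> x = \<zero> \<odot>\<^bsub>M\<^esub> x"
    using smult_l_distr[of \<zero> \<zero> x] assms by simp
  then show ?thesis by (metis M.add.r_cancel_one' assms smult_closed R.zero_closed)
qed

lemma smult_uminus: assumes "a \<in> carrier R" "x \<in> carrier M"
  shows "(\<ominus> a) \<odot>\<^bsub>M\<^esub> x = \<ominus>\<^bsub>M\<^esub> (a \<odot>\<^bsub>M\<^esub> x)"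
proof -
  have "(\<ominus> a) \<odot>\<^bsub>M\<^esub> x \<oplus>\<^bsub>M\<^esub> a \<odot>\<^bsub>M\<^esub> x = \<zero>\<^bsub>M\<^esub>"
    using smult_l_distr[of "\<ominus> a" a x] assms smult_zero_left by (simp add: R.l_neg)
  then show ?thesis using assms smult_closed by (metis M.minus_equality R.a_inv_closed)
qed

lemma submodule_ideal_smult:
  assumes "ideal I R" "x \<in> carrier M"
  shows "submodule ((\<lambda>a. a \<odot>\<^bsub>M\<^esub> x) ` I) R M"
proof -
  interpret I: ideal I R by fact
  show ?thesis
  proof (intro submodule.intro submodule_axioms.intro M.add.subgroupI)
    show "(\<lambda>a. a \<odot>\<^bsub>M\<^esub> x) ` I \<subseteq> carrier M" using assms(2) smult_closed by auto
    show "(\<lambda>a. a \<odot>\<^bsub>M\<^esub> x) ` I \<noteq> {}" using I.zero_closed by blast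
    fix y assume "y \<in> (\<lambda>a. a \<odot>\<^bsub>M\<^esub> x) ` I"
    then obtain a where a: "a \<in> I" "y = a \<odot>\<^bsub>M\<^esub> x" by blast
    then show "\<ominus>\<^bsub>M\<^esub> y \<in> (\<lambda>a. a \<odot>\<^bsub>M\<^esub> x) ` I"
      using smult_uminus[of a x] assms(2) I.a_inv_closed I.Icarr
      by (metis (no_types, lifting) image_eqI)
    { fix r assume "r \<in> carrier R"
      then show "r \<odot>\<^bsub>M\<^esub> y \<in> (\<lambda>a. a \<odot>\<^bsub>M\<^esub> x) ` I"
        using a smult_assoc[of r a x] assms(2) I.I_l_closed by (metis I.Icarr image_eqI) }
    fix z assume "z \<in> (\<lambda>a. a \<odot>\<^bsub>M\<^esub> x) ` I"
    then obtain b where b: "b \<in> I" "z = b \<odot>\<^bsub>M\<^esub> x" by blast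
    then show "y \<oplus>\<^bsub>M\<^esub> z \<in> (\<lambda>a. a \<odot>\<^bsub>M\<^esub> x) ` I"
      using a smult_l_distr[of a b x] assms(2) I.a_closed I.Icarr
      by (metis (no_types, lifting) image_eqI)
  qed
qed

lemma simple_generates:
  assumes "ideal I R" "x \<in> carrier M" "a \<in> I" "a \<odot>\<^bsub>M\<^esub> x \<noteq> \<zero>\<^bsub>M\<^esub>"
  shows "(\<lambda>a. a \<odot>\<^bsub>M\<^esub> x) ` I = carrier M"
  using submodule_ideal_smult[OF assms(1,2)] simple assms(3,4)
  unfolding simple_left_module_def by blast

lemma annihilator_simple_in_spec: "annihilator R M \<in> spec R"
proof -
  have id: "ideal (annihilator R M) R"
  proof (intro idealI R.ring_axioms R.add.subgroupI)
    show "annihilator R M \<subseteq> carrier (R)" by (auto simp: annihilator_def)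
    show "annihilator R M \<noteq> {}" using smult_zero_left by (auto simp: annihilator_def)
    fix a assume a: "a \<in> annihilator R M"
    then show "\<ominus> a \<in> annihilator R M"
      using smult_uminus unfolding annihilator_def by (auto simp: a_inv_def[symmetric])
    { fix b assume "b \<in> annihilator R M"
      with a show "a \<oplus> b \<in> annihilator R M"
        using smult_l_distr by (auto simp: annihilator_def) }
    fix r assume "r \<in> carrier R"
    with a show "r \<otimes> a \<in> annihilator R M" "a \<otimes> r \<in> annihilator R M"
      using smult_assoc smult_closed smult_zero_right by (auto simp: annihilator_def)
  qed
  have "\<exists>x\<in>carrier M. x \<noteq> \<zero>\<^bsub>M\<^esub>"
    using simple M.zero_closed unfolding simple_left_module_def by blast
  then have "\<one> \<notin> annihilator R M" using smult_one by (auto simp: annihilator_def)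
  then have ne: "annihilator R M \<noteq> carrier R" by auto
  have "I \<subseteq> annihilator R M \<or> J \<subseteq> annihilator R M"
    if I: "ideal I R" and J: "ideal J R" and IJ: "ideal_prod R I J \<subseteq> annihilator R M" for I J
  proof (rule ccontr)
    assume "\<not> ?thesis"
    then obtain a b where "a \<in> I" "a \<notin> annihilator R M" "b \<in> J" "b \<notin> annihilator R M" by blast
    moreover have "I \<subseteq> carrier R" "J \<subseteq> carrier R"
      using ideal.Icarr[OF I] ideal.Icarr[OF J] by auto
    ultimately obtain x y where ab: "a \<in> carrier R" "b \<in> carrier R" and x: "x \<in> carrier M" "a \<odot>\<^bsub>M\<^esub> x \<noteq> \<zero>\<^bsub>M\<^esub>"
      and y: "y \<in> carrier M" "b \<odot>\<^bsub>M\<^esub> y \<noteq> \<zero>\<^bsub>M\<^esub>" by (auto simp: annihilator_def)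
    obtain c where c: "c \<in> J" "x = c \<odot>\<^bsub>M\<^esub> y"
      using simple_generates[OF J y(1) \<open>b \<in> J\<close> y(2)] x(1) by blast
    have "a \<otimes> c \<in> annihilator R M" using subsetD[OF IJ ideal_prod.prod[OF \<open>a \<in> I\<close> c(1)]] .
    then have "(a \<otimes> c) \<odot>\<^bsub>M\<^esub> y = \<zero>\<^bsub>M\<^esub>" using y by (auto simp: annihilator_def)
    then show False using smult_assoc[of a c y] ab c x y \<open>J \<subseteq> carrier R\<close> by auto
  qed
  with id ne show ?thesis by (auto simp: spec_def prime_ideal_nc_def)
qed

lemma annihilator_simple_in_prim: "annihilator R M \<in> prim R"
proof -
  obtain x where x: "x \<in> carrier M" "x \<noteq> \<zero>\<^bsub>M\<^esub>"
    using simple M.zero_closed unfolding simple_left_module_def by blast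
  define F where "F y = {a \<in> carrier R. a \<odot>\<^bsub>M\<^esub> x = y}" for y
  define G where "G = inv_into (carrier M) F"
  have gen: "(\<lambda>a. a \<odot>\<^bsub>M\<^esub> x) ` carrier R = carrier M"
    using simple_generates[OF R.oneideal x(1) R.one_closed] x smult_one by simp
  have inj: "inj_on F (carrier M)"
  proof (rule inj_onI)
    fix y z assume yz: "y \<in> carrier M" "z \<in> carrier M" "F y = F z"
    obtain a where a: "a \<in> carrier R" "y = a \<odot>\<^bsub>M\<^esub> x" using gen yz(1) by blast
    then have "a \<in> F z" using yz(3) by (auto simp: F_def)
    then show "y = z" using a by (simp add: F_def)
  qed
  have GF [simp]: "G (F y) = y" if "y \<in> carrier M" for y
    unfolding G_def using inj that by simp
  define M' :: "('a, 'a set) module" where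
    "M' = \<lparr>carrier = F ` carrier M, monoid.mult = undefined, one = undefined, ring.zero = F \<zero>\<^bsub>M\<^esub>,
       add = (\<lambda>U V. F (G U \<oplus>\<^bsub>M\<^esub> G V)), module.smult = (\<lambda>a U. F (a \<odot>\<^bsub>M\<^esub> G U))\<rparr>"
  have sel [simp]: "carrier M' = F ` carrier M" "\<zero>\<^bsub>M'\<^esub> = F \<zero>\<^bsub>M\<^esub>"
    "\<And>U V. U \<oplus>\<^bsub>M'\<^esub> V = F (G U \<oplus>\<^bsub>M\<^esub> G V)" "\<And>a U. a \<odot>\<^bsub>M'\<^esub> U = F (a \<odot>\<^bsub>M\<^esub> G U)"
    by (simp_all add: M'_def)
  have ag: "abelian_group M'"
  proof (rule abelian_groupI)
    fix U assume "U \<in> carrier M'"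
    then obtain y where "y \<in> carrier M" "U = F y" by auto
    then show "\<exists>V\<in>carrier M'. V \<oplus>\<^bsub>M'\<^esub> U = \<zero>\<^bsub>M'\<^esub>"
      by (intro bexI[of _ "F (\<ominus>\<^bsub>M\<^esub> y)"]) (auto simp: M.l_neg)
  qed (auto simp: M.a_ac)
  have lm: "left_module R M'"
  proof (intro left_module.intro left_module_axioms.intro ag R.ring_axioms)
  qed (simp only: sel, elim imageE, simp add: smult_closed smult_l_distr smult_r_distr smult_assoc smult_one)+
  have "N = {\<zero>\<^bsub>M'\<^esub>} \<or> N = carrier M'" if N: "submodule N R M'" for N
  proof -
    interpret N: submodule N R M' by fact
    interpret M': abelian_group M' by fact
    have sub: "N \<subseteq> F ` carrier M" using N.subset by simp
    have FG: "F (G U) = U" if "U \<in> N" for U using sub that by auto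
    have GM: "G U \<in> carrier M" if "U \<in> N" for U using sub that by auto
    have "submodule (G ` N) R M"
    proof (intro submodule.intro submodule_axioms.intro M.add.subgroupI)
      show "G ` N \<subseteq> carrier M" using GM by auto
      show "G ` N \<noteq> {}" using N.one_closed by auto
      fix y assume "y \<in> G ` N"
      then obtain U where U: "U \<in> N" "y = G U" by blast
      { fix r assume "r \<in> carrier R"
        then have "F (r \<odot>\<^bsub>M\<^esub> y) \<in> N" using N.smult_closed[of r U] U by simp
        then show "r \<odot>\<^bsub>M\<^esub> y \<in> G ` N" using GM U \<open>r \<in> carrier R\<close> smult_closed by (metis GF imageI) }
      from this[of "\<ominus> \<one>"] show "\<ominus>\<^bsub>M\<^esub> y \<in> G ` N"
        using smult_uminus[of \<one> y] smult_one[of y] GM U by (simp add: a_inv_def)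
      fix z assume "z \<in> G ` N"
      then obtain V where V: "V \<in> N" "z = G V" by blast
      have "F (y \<oplus>\<^bsub>M\<^esub> z) \<in> N" using N.m_closed[of U V] U V by simp
      then show "y \<oplus>\<^bsub>M\<^esub> z \<in> G ` N"
        using GM U V by (metis GF M.a_closed imageI)
    qed
    then have "G ` N = {\<zero>\<^bsub>M\<^esub>} \<or> G ` N = carrier M"
      using simple unfolding simple_left_module_def by blast
    moreover have "N = F ` (G ` N)" using FG by (auto simp: image_image)
    ultimately show ?thesis by auto
  qed
  moreover have "carrier M' \<noteq> {\<zero>\<^bsub>M'\<^esub>}"
    using x inj M.zero_closed by (auto simp: inj_on_def)
  ultimately have "simple_left_module R M'"
    using lm unfolding simple_left_module_def by blast
  moreover have "annihilator R M' = annihilator R M"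
  proof -
    have "F (a \<odot>\<^bsub>M\<^esub> y) = F \<zero>\<^bsub>M\<^esub> \<longleftrightarrow> a \<odot>\<^bsub>M\<^esub> y = \<zero>\<^bsub>M\<^esub>" if "a \<in> carrier R" "y \<in> carrier M" for a y
      using inj smult_closed that by (auto simp: inj_on_def)
    then show ?thesis by (auto simp: annihilator_def)
  qed
  ultimately show ?thesis unfolding prim_def by blast
qed

end

lemma prim_subset_spec: "prim R \<subseteq> spec R"
  by (auto simp: prim_def intro: annihilator_simple_in_spec)


section \<open>The localization is a ring\<close>

locale central_element = ring R for R :: "('a, 'm) ring_scheme" (structure) +
  fixes s :: 'a
  assumes s_closed [simp]: "s \<in> carrier R"
    and s_central: "x \<in> carrier R \<Longrightarrow> s \<otimes> x = x \<otimes> s"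
begin

lemma pow_central: "x \<in> carrier R \<Longrightarrow> x \<otimes> s [^] n = s [^] n \<otimes> x" for n :: nat
proof (induction n)
  case (Suc n)
  have "x \<otimes> s [^] Suc n = (x \<otimes> s [^] n) \<otimes> s" using Suc by (simp add: m_assoc[symmetric])
  also have "\<dots> = s [^] n \<otimes> (x \<otimes> s)" using Suc by (simp add: m_assoc)
  also have "\<dots> = s [^] Suc n \<otimes> x" using Suc s_central[of x, symmetric] by (simp add: m_assoc)
  finally show ?case .
qed simp

lemma pow_left_comm: "x \<in> carrier R \<Longrightarrow> y \<in> carrier R \<Longrightarrow> x \<otimes> (s [^] n \<otimes> y) = s [^] n \<otimes> (x \<otimes> y)" for n :: nat
  using pow_central[of x n] by (simp add: m_assoc[symmetric])

lemma pow_pow: "y \<in> carrier R \<Longrightarrow> s [^] n \<otimes> (s [^] m \<otimes> y) = s [^] (n + m) \<otimes> y" for n m :: nat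
  by (simp add: m_assoc[symmetric] nat_pow_mult)

lemma pow_mult_pow:
  "x \<in> carrier R \<Longrightarrow> y \<in> carrier R \<Longrightarrow>
    (s [^] n \<otimes> x) \<otimes> (s [^] m \<otimes> y) = s [^] (n + m) \<otimes> (x \<otimes> y)" for n m :: nat
  using pow_left_comm[of x y m] by (simp add: m_assoc pow_pow)

lemma loc_equiv: "equiv (carrier R \<times> UNIV) (loc_rel R s)"
proof (rule equivI)
  show "loc_rel R s \<subseteq> (carrier R \<times> UNIV) \<times> (carrier R \<times> UNIV)" by (auto simp: loc_rel_def)
  show "refl_on (carrier R \<times> UNIV) (loc_rel R s)" by (auto simp: refl_on_def loc_rel_def)
  show "sym (loc_rel R s)" by (rule symI) (auto simp: loc_rel_def intro: sym)
  show "trans (loc_rel R s)"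
  proof (rule transI, clarify)
    fix x n y m z p
    assume "((x, n), (y, m)) \<in> loc_rel R s" "((y, m), (z, p)) \<in> loc_rel R s"
    then obtain k l where xyz: "x \<in> carrier R" "y \<in> carrier R" "z \<in> carrier R"
      and k: "s [^] (k + m) \<otimes> x = s [^] (k + n) \<otimes> y"
      and l: "s [^] (l + p) \<otimes> y = s [^] (l + m) \<otimes> z" by (auto simp: loc_rel_def)
    have "s [^] (k + l + m + p) \<otimes> x = s [^] (l + p) \<otimes> (s [^] (k + m) \<otimes> x)"
      using xyz by (simp add: pow_pow add_ac)
    also have "\<dots> = s [^] (k + n) \<otimes> (s [^] (l + p) \<otimes> y)" unfolding k using xyz by (simp add: pow_pow add_ac)
    also have "\<dots> = s [^] (k + l + m + n) \<otimes> z" unfolding l using xyz by (simp add: pow_pow add_ac)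
    finally show "((x, n), (z, p)) \<in> loc_rel R s" using xyz unfolding loc_rel_def by blast
  qed
qed

lemma loc_frac_eq_iff:
  assumes "x \<in> carrier R" "y \<in> carrier R"
  shows "loc_frac R s x n = loc_frac R s y m \<longleftrightarrow> (\<exists>k. s [^] (k + m) \<otimes> x = s [^] (k + n) \<otimes> y)"
  unfolding loc_frac_def using eq_equiv_class_iff[OF loc_equiv, of "(x, n)" "(y, m)"] assms
  by (simp add: loc_rel_def)

lemma loc_frac_eqI:
  assumes "x \<in> carrier R" "y \<in> carrier R" "s [^] (k + m) \<otimes> x = s [^] (k + n) \<otimes> y"
  shows "loc_frac R s x n = loc_frac R s y m"
  using loc_frac_eq_iff assms by blast

lemma mem_loc_frac: "(y, m) \<in> loc_frac R s x n \<longleftrightarrow>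
    x \<in> carrier R \<and> y \<in> carrier R \<and> (\<exists>k. s [^] (k + m) \<otimes> x = s [^] (k + n) \<otimes> y)"
  by (auto simp: loc_frac_def loc_rel_def)

lemma loc_carrier: "U \<in> carrier (localization R s) \<longleftrightarrow> (\<exists>x n. x \<in> carrier R \<and> U = loc_frac R s x n)"
  by (auto simp: localization_def loc_frac_def quotient_def)

lemma loc_frac_closed [simp]: "x \<in> carrier R \<Longrightarrow> loc_frac R s x n \<in> carrier (localization R s)"
  using loc_carrier by blast

lemma loc_union2:
  assumes "x \<in> carrier R" "y \<in> carrier R"
    and "\<And>x' n' y' m'. (x', n') \<in> loc_frac R s x n \<Longrightarrow> (y', m') \<in> loc_frac R s y m \<Longrightarrow>
      F x' n' y' m' = F x n y m"
  shows "(\<Union>(x, n)\<in>loc_frac R s x n. \<Union>(y, m)\<in>loc_frac R s y m. F x n y m) = F x n y m"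
proof -
  have "(x, n) \<in> loc_frac R s x n" "(y, m) \<in> loc_frac R s y m"
    using assms(1,2) by (auto simp: mem_loc_frac)
  then have ne: "loc_frac R s x n \<noteq> {}" "loc_frac R s y m \<noteq> {}" by auto
  have "(\<Union>(x, n)\<in>loc_frac R s x n. \<Union>(y, m)\<in>loc_frac R s y m. F x n y m) =
      (\<Union>p\<in>loc_frac R s x n. \<Union>p'\<in>loc_frac R s y m. F x n y m)"
    by (intro SUP_cong refl) (auto simp: assms(3) split: prod.splits)
  then show ?thesis using ne by simp
qed

lemma loc_mult:
  assumes "x \<in> carrier R" "y \<in> carrier R"
  shows "loc_frac R s x n \<otimes>\<^bsub>localization R s\<^esub> loc_frac R s y m = loc_frac R s (x \<otimes> y) (n + m)"
  unfolding localization_def monoid.simps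
proof (rule loc_union2[OF assms])
  fix x' n' y' m' assume "(x', n') \<in> loc_frac R s x n" "(y', m') \<in> loc_frac R s y m"
  then obtain k l where xy: "x' \<in> carrier R" "y' \<in> carrier R"
    and k: "s [^] (k + n') \<otimes> x = s [^] (k + n) \<otimes> x'"
    and l: "s [^] (l + m') \<otimes> y = s [^] (l + m) \<otimes> y'" by (auto simp: mem_loc_frac)
  have "s [^] (k + l + (n + m)) \<otimes> (x' \<otimes> y') = (s [^] (k + n) \<otimes> x') \<otimes> (s [^] (l + m) \<otimes> y')"
    using xy by (simp add: pow_mult_pow add_ac)
  also have "\<dots> = s [^] (k + l + (n' + m')) \<otimes> (x \<otimes> y)"
    unfolding k[symmetric] l[symmetric] using assms by (simp add: pow_mult_pow add_ac)
  finally show "loc_frac R s (x' \<otimes> y') (n' + m') = loc_frac R s (x \<otimes> y) (n + m)"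
    using xy assms by (intro loc_frac_eqI) auto
qed

lemma loc_add:
  assumes "x \<in> carrier R" "y \<in> carrier R"
  shows "loc_frac R s x n \<oplus>\<^bsub>localization R s\<^esub> loc_frac R s y m =
    loc_frac R s (s [^] m \<otimes> x \<oplus> s [^] n \<otimes> y) (n + m)"
  unfolding localization_def ring.simps
proof (rule loc_union2[OF assms])
  fix x' n' y' m' assume "(x', n') \<in> loc_frac R s x n" "(y', m') \<in> loc_frac R s y m"
  then obtain k l where xy: "x' \<in> carrier R" "y' \<in> carrier R"
    and k: "s [^] (k + n') \<otimes> x = s [^] (k + n) \<otimes> x'"
    and l: "s [^] (l + m') \<otimes> y = s [^] (l + m) \<otimes> y'" by (auto simp: mem_loc_frac)
  have "s [^] (k + l + (n + m)) \<otimes> (s [^] m' \<otimes> x' \<oplus> s [^] n' \<otimes> y') =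
      s [^] (l + m + m') \<otimes> (s [^] (k + n) \<otimes> x') \<oplus> s [^] (k + n + n') \<otimes> (s [^] (l + m) \<otimes> y')"
    using xy by (simp add: r_distr pow_pow add_ac)
  also have "\<dots> = s [^] (k + l + (n' + m')) \<otimes> (s [^] m \<otimes> x \<oplus> s [^] n \<otimes> y)"
    unfolding k[symmetric] l[symmetric] using assms by (simp add: r_distr pow_pow add_ac)
  finally show "loc_frac R s (s [^] m' \<otimes> x' \<oplus> s [^] n' \<otimes> y') (n' + m') =
      loc_frac R s (s [^] m \<otimes> x \<oplus> s [^] n \<otimes> y) (n + m)"
    using xy assms by (intro loc_frac_eqI) auto
qed

lemma loc_one: "\<one>\<^bsub>localization R s\<^esub> = loc_frac R s \<one> 0"
  and loc_zero: "\<zero>\<^bsub>localization R s\<^esub> = loc_frac R s \<zero> 0"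
  by (simp_all add: localization_def)

lemma loc_frac_cancel: "x \<in> carrier R \<Longrightarrow> loc_frac R s (s [^] k \<otimes> x) (k + n) = loc_frac R s x n"
  by (rule loc_frac_eqI[where k = 0]) (auto simp: pow_pow add_ac)

lemma loc_zero_frac: "loc_frac R s \<zero> n = \<zero>\<^bsub>localization R s\<^esub>"
  unfolding loc_zero by (rule loc_frac_eqI[where k = 0]) auto

lemma loc_ring: "ring (localization R s)"
proof (rule ringI)
  show "abelian_group (localization R s)"
  proof (rule abelian_groupI, unfold loc_carrier, goal_cases)
    case (1 U V)
    then have "U \<oplus>\<^bsub>localization R s\<^esub> V \<in> carrier (localization R s)"
      by (elim exE conjE) (simp add: loc_add)
    then show ?case unfolding loc_carrier .
  next
    case 2
    then show ?case using loc_zero by auto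
  next
    case (3 U V W)
    then show ?case
      by (elim exE conjE) (simp add: loc_add r_distr pow_pow a_assoc add_ac)
  next
    case (4 U V)
    then show ?case
      by (elim exE conjE) (simp add: loc_add a_comm add_ac)
  next
    case (5 U)
    then show ?case by (elim exE conjE) (simp add: loc_add loc_zero)
  next
    case (6 U)
    then obtain x n where x: "x \<in> carrier R" "U = loc_frac R s x n" by blast
    then have "loc_frac R s (\<ominus> x) n \<oplus>\<^bsub>localization R s\<^esub> U = \<zero>\<^bsub>localization R s\<^esub>"
      by (simp add: loc_add loc_zero_frac r_minus l_neg)
    with x show ?case unfolding Bex_def loc_carrier by (metis a_inv_closed)
  qed
  show "monoid (localization R s)"
  proof (rule monoidI, unfold loc_carrier, goal_cases)
    case (1 U V)
    then have "U \<otimes>\<^bsub>localization R s\<^esub> V \<in> carrier (localization R s)"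
      by (elim exE conjE) (simp add: loc_mult)
    then show ?case unfolding loc_carrier .
  next
    case 2
    then show ?case using loc_one by auto
  next
    case (3 U V W)
    then show ?case by (elim exE conjE) (simp add: loc_mult m_assoc add_ac)
  qed (elim exE conjE; simp add: loc_mult loc_one)+
next
  fix U V W
  assume "U \<in> carrier (localization R s)" "V \<in> carrier (localization R s)" "W \<in> carrier (localization R s)"
  then obtain x n y m z p where xyz: "x \<in> carrier R" "y \<in> carrier R" "z \<in> carrier R"
    "U = loc_frac R s x n" "V = loc_frac R s y m" "W = loc_frac R s z p" unfolding loc_carrier by blast
  have "loc_frac R s ((s [^] m \<otimes> x \<oplus> s [^] n \<otimes> y) \<otimes> z) (n + m + p) =
      loc_frac R s (s [^] p \<otimes> ((s [^] m \<otimes> x \<oplus> s [^] n \<otimes> y) \<otimes> z)) (p + (n + m + p))"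
    using xyz by (simp add: loc_frac_cancel)
  then show "(U \<oplus>\<^bsub>localization R s\<^esub> V) \<otimes>\<^bsub>localization R s\<^esub> W =
      U \<otimes>\<^bsub>localization R s\<^esub> W \<oplus>\<^bsub>localization R s\<^esub> V \<otimes>\<^bsub>localization R s\<^esub> W"
    using xyz by (simp add: loc_add loc_mult l_distr r_distr pow_pow m_assoc add_ac)
  have "loc_frac R s (z \<otimes> (s [^] m \<otimes> x \<oplus> s [^] n \<otimes> y)) (p + (n + m)) =
      loc_frac R s (s [^] p \<otimes> (z \<otimes> (s [^] m \<otimes> x \<oplus> s [^] n \<otimes> y))) (p + (p + (n + m)))"
    using xyz by (simp add: loc_frac_cancel)
  then show "W \<otimes>\<^bsub>localization R s\<^esub> (U \<oplus>\<^bsub>localization R s\<^esub> V) =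
      W \<otimes>\<^bsub>localization R s\<^esub> U \<oplus>\<^bsub>localization R s\<^esub> W \<otimes>\<^bsub>localization R s\<^esub> V"
    using xyz by (simp add: loc_add loc_mult r_distr pow_pow pow_left_comm[OF xyz(3) xyz(1)] pow_left_comm[OF xyz(3) xyz(2)] add_ac)
qed

end

lemma loc_cring:
  assumes "cring R" "s \<in> carrier R"
  shows "cring (localization R s)"
proof -
  interpret cring R by fact
  interpret central_element R s by unfold_locales (use assms(2) m_comm in auto)
  interpret L: ring "localization R s" by (rule loc_ring)
  show ?thesis
  proof (intro cring.intro comm_monoid.intro comm_monoid_axioms.intro L.ring_axioms L.monoid_axioms, goal_cases)
    case (1 U V)
    then show ?case unfolding loc_carrier by (elim exE conjE) (simp add: loc_mult m_comm add_ac)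
  qed
qed


section \<open>The quantum determinant is central\<close>

lemma ring_from_type: "ring (ring_of_type_algebra :: 'a::ring_1 ring)"
proof -
  have "\<exists>y. y + x = 0" for x :: 'a
    using add.left_inverse by blast
  then show ?thesis
    unfolding ring_of_type_algebra_def
    by (intro ringI abelian_groupI monoidI) (auto simp: algebra_simps)
qed

lemma fscalar_mult: "fscalar c * fscalar d = (fscalar (c * d) :: ('x, 'k::field) free_alg)"
  by (simp add: fscalar_def mult_single plus_list_def)

lemma fscalar_one: "fscalar 1 = (1 :: ('x, 'k::field) free_alg)"
  by (simp add: fscalar_def zero_list_def[symmetric])

lemma fscalar_central: "f * fscalar c = fscalar c * (f :: ('x, 'k::field) free_alg)"
proof (induction f rule: update_induct)
  case const
  then show ?case by simp
next
  case (update f a b)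
  have "Poly_Mapping.update a b f = f + Poly_Mapping.single a b"
    using update(1) by (intro poly_mapping_eqI) (auto simp: lookup_update lookup_add lookup_single in_keys_iff when_def)
  then show ?case
    using update(3) by (simp add: algebra_simps fscalar_def mult_single plus_list_def)
qed

lemma ring_OqM2: "ring (OqM2 q)"
proof -
  interpret ring "ring_of_type_algebra :: (gen, 'a) free_alg ring" by (rule ring_from_type)
  have "ideal (OqM2_ideal q) ring_of_type_algebra"
    unfolding OqM2_ideal_def by (rule genideal_ideal) (simp add: ring_of_type_algebra_def)
  then show ?thesis unfolding OqM2_def by (rule ideal.quotient_is_ring)
qed

lemma qdet_commutes_gen:
  fixes q :: "'k::field"
  assumes "q \<noteq> 0"
  defines "D \<equiv> fgen Ga * fgen Gd - fscalar q * fgen Gb * fgen Gc"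
  shows "fgen x * D - D * fgen x \<in> OqM2_ideal q"
proof -
  interpret F: ring "ring_of_type_algebra :: (gen, 'k) free_alg ring" by (rule ring_from_type)
  interpret ideal "OqM2_ideal q" "ring_of_type_algebra :: (gen, 'k) free_alg ring"
    unfolding OqM2_ideal_def by (rule F.genideal_ideal) (simp add: ring_of_type_algebra_def)
  have l: "f * r \<in> OqM2_ideal q" and r: "r * f \<in> OqM2_ideal q" if "r \<in> OqM2_ideal q" for f r
    using I_l_closed[OF that, of f] I_r_closed[OF that, of f] by (auto simp: ring_of_type_algebra_def)
  have add: "r + r' \<in> OqM2_ideal q" if "r \<in> OqM2_ideal q" "r' \<in> OqM2_ideal q" for r r'
    using a_closed[OF that] by (auto simp: ring_of_type_algebra_def)
  have minus: "r - r' \<in> OqM2_ideal q" if "r \<in> OqM2_ideal q" "r' \<in> OqM2_ideal q" for r r'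
    using add[OF that(1) l[OF that(2), of "-1"]] by simp
  define a b c d :: "(gen, 'k) free_alg" where "a = fgen Ga" "b = fgen Gb" "c = fgen Gc" "d = fgen Gd"
  note abcd = this
  define s p :: "(gen, 'k) free_alg" where "s = fscalar q" "p = fscalar (inverse q)"
  note sp_def = this
  have pp: "fscalar (q - inverse q) = s - p"
    by (simp add: sp_def fscalar_def single_diff)
  have sp: "s * p = 1" "p * s = 1"
    using assms(1) by (simp_all add: sp_def fscalar_mult fscalar_one)
  have sp2: "s * (p * f) = f" "p * (s * f) = f" for f
    using sp by (simp_all add: mult.assoc[symmetric])
  have central: "f * s = s * f" "f * p = p * f" for f
    unfolding sp_def by (rule fscalar_central)+
  have lcentral: "f * (s * g) = s * (f * g)" "f * (p * g) = p * (f * g)" for f g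
    using central[of f] by (simp_all add: mult.assoc[symmetric])
  note cs = central[of a] central[of b] central[of c] central[of d]
    lcentral[of a] lcentral[of b] lcentral[of c] lcentral[of d] sp sp2
  have rel: "OqM2_relations q \<subseteq> OqM2_ideal q"
    unfolding OqM2_ideal_def by (rule F.genideal_self) (simp add: ring_of_type_algebra_def)
  define rab rac rbd rcd rbc rad where
    "rab = a * b - s * b * a" "rac = a * c - s * c * a" "rbd = b * d - s * d * b"
    "rcd = c * d - s * d * c" "rbc = b * c - c * b" "rad = a * d - d * a - (s - p) * b * c"
  note r_def = this
  have mem: "rab \<in> OqM2_ideal q" "rac \<in> OqM2_ideal q" "rbd \<in> OqM2_ideal q" "rcd \<in> OqM2_ideal q"
    "rbc \<in> OqM2_ideal q" "rad \<in> OqM2_ideal q"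
    using rel unfolding r_def OqM2_relations_def Let_def pp[symmetric] by (simp_all add: abcd sp_def)
  have D: "D = a * d - s * b * c" by (simp add: D_def abcd sp_def)
  have "a * D - D * a = a * rad - p * (rab * c + s * b * rac)"
    unfolding D r_def by (simp add: algebra_simps cs)
  moreover have "b * D - D * b = p * (a * rbd - rab * d) - s * b * rbc"
    unfolding D r_def by (simp add: algebra_simps cs)
  moreover have "c * D - D * c = p * (a * rcd - rac * d) + s * rbc * c"
    unfolding D r_def by (simp add: algebra_simps cs)
  moreover have "d * D - D * d = p * (b * rcd + s * rbd * c) - rad * d"
    unfolding D r_def by (simp add: algebra_simps cs)
  ultimately show ?thesis
    by (cases x) (simp_all only: abcd[symmetric], simp_all add: add minus l r mem)
qed

lemma qdet_central:
  fixes q :: "'k::field"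
  assumes "q \<noteq> 0"
  shows "central_element (OqM2 q) (qdet q)"
proof -
  define D where "D = fgen Ga * fgen Gd - fscalar q * fgen Gb * fgen Gc"
  let ?F = "ring_of_type_algebra :: (gen, 'k) free_alg ring"
  interpret F: ring ?F by (rule ring_from_type)
  interpret ideal "OqM2_ideal q" ?F
    unfolding OqM2_ideal_def by (rule F.genideal_ideal) (simp add: ring_of_type_algebra_def)
  have sel: "carrier ?F = UNIV" "f \<otimes>\<^bsub>?F\<^esub> g = f * g" "f \<oplus>\<^bsub>?F\<^esub> g = f + g" for f g
    by (auto simp: ring_of_type_algebra_def)
  have l: "f * r \<in> OqM2_ideal q" and r: "r * f \<in> OqM2_ideal q" if "r \<in> OqM2_ideal q" for f r
    using I_l_closed[OF that, of f] I_r_closed[OF that, of f] by (auto simp: sel)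
  have add: "r + r' \<in> OqM2_ideal q" if "r \<in> OqM2_ideal q" "r' \<in> OqM2_ideal q" for r r'
    using a_closed[OF that] by (auto simp: sel)
  have word: "Poly_Mapping.single w 1 * D - D * Poly_Mapping.single w 1 \<in> OqM2_ideal q" for w
  proof (induction w)
    case Nil
    have "Poly_Mapping.single [] 1 = (1 :: (gen, 'k) free_alg)"
      using fscalar_one by (simp add: fscalar_def)
    then show ?case using zero_closed by (simp add: ring_of_type_algebra_def)
  next
    case (Cons x w)
    have "Poly_Mapping.single (x # w) 1 = fgen x * (Poly_Mapping.single w 1 :: (gen, 'k) free_alg)"
      by (simp add: fgen_def mult_single plus_list_def)
    moreover have "fgen x * (Poly_Mapping.single w 1 * D - D * Poly_Mapping.single w 1) +
        (fgen x * D - D * fgen x) * Poly_Mapping.single w 1 \<in> OqM2_ideal q"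
      using qdet_commutes_gen[OF assms, of x] Cons unfolding D_def[symmetric] by (intro add l r)
    ultimately show ?case by (simp add: algebra_simps)
  qed
  have comm: "f * D - D * f \<in> OqM2_ideal q" for f
  proof (induction f rule: update_induct)
    case const
    then show ?case using zero_closed by (simp add: ring_of_type_algebra_def)
  next
    case (update f w c)
    have "Poly_Mapping.update w c f = f + Poly_Mapping.single w c"
      using update(1) by (intro poly_mapping_eqI) (auto simp: lookup_update lookup_add lookup_single in_keys_iff when_def)
    also have "Poly_Mapping.single w c = fscalar c * Poly_Mapping.single w 1"
      by (simp add: fscalar_def mult_single plus_list_def)
    finally have upd: "Poly_Mapping.update w c f = f + fscalar c * Poly_Mapping.single w 1" .
    have "D * (fscalar c * g) = fscalar c * (D * g)" for g
      by (metis fscalar_central mult.assoc)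
    then have "Poly_Mapping.update w c f * D - D * Poly_Mapping.update w c f =
        (f * D - D * f) + fscalar c * (Poly_Mapping.single w 1 * D - D * Poly_Mapping.single w 1)"
      unfolding upd by (simp add: algebra_simps)
    then show ?case using add l update(3) word by auto
  qed
  have qd: "qdet q = OqM2_ideal q +>\<^bsub>?F\<^esub> D" by (simp add: qdet_def D_def)
  have carr: "carrier (OqM2 q) = (\<lambda>f. OqM2_ideal q +>\<^bsub>?F\<^esub> f) ` UNIV"
    by (auto simp: OqM2_def FactRing_def A_RCOSETS_def' sel)
  interpret Q: ring "OqM2 q" by (rule ring_OqM2)
  show ?thesis
  proof (unfold_locales)
    show "qdet q \<in> carrier (OqM2 q)" by (simp add: qd carr)
    fix x assume "x \<in> carrier (OqM2 q)"
    then obtain f where f: "x = OqM2_ideal q +>\<^bsub>?F\<^esub> f" using carr by blast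
    have "f \<otimes>\<^bsub>?F\<^esub> D \<ominus>\<^bsub>?F\<^esub> D \<otimes>\<^bsub>?F\<^esub> f = f * D - D * f"
    proof -
      have "\<ominus>\<^bsub>?F\<^esub> g = - g" for g
        by (rule F.minus_equality) (simp_all add: ring_of_type_algebra_def)
      then show ?thesis by (simp add: a_minus_def sel)
    qed
    then have "OqM2_ideal q +>\<^bsub>?F\<^esub> (f \<otimes>\<^bsub>?F\<^esub> D) = OqM2_ideal q +>\<^bsub>?F\<^esub> (D \<otimes>\<^bsub>?F\<^esub> f)"
      using comm[of f] F.quotient_eq_iff_same_a_r_cos[OF ideal_axioms, of "f * D" "D * f"] by (simp add: sel)
    then show "qdet q \<otimes>\<^bsub>OqM2 q\<^esub> x = x \<otimes>\<^bsub>OqM2 q\<^esub> qdet q"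
      using rcoset_mult_add[of D f] rcoset_mult_add[of f D] by (simp add: OqM2_def FactRing_def qd f sel)
  qed
qed

lemma ring_OqGL2: "q \<noteq> 0 \<Longrightarrow> ring (OqGL2 q)"
  unfolding OqGL2_def by (intro central_element.loc_ring qdet_central)

lemma cring_OGL2: "cring OGL2"
  unfolding OGL2_def OM2_def by (rule loc_cring[OF cring_from_type_algebra]) (simp add: ring_of_type_algebra_def)


section \<open>The Poisson bracket and its extension to the localization\<close>

lemma mderiv_superset:
  assumes "finite S" "Poly_Mapping.keys f \<subseteq> S"
  shows "mderiv x f = (\<Sum>m\<in>S. Poly_Mapping.single (m - Poly_Mapping.single x 1)
     (of_nat (Poly_Mapping.lookup m x) * Poly_Mapping.lookup f m))"
  unfolding mderiv_def using assms by (intro sum.mono_neutral_left) (auto simp: in_keys_iff)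

lemma mderiv_add: "mderiv x (f + g) = mderiv x f + mderiv x g"
proof -
  let ?S = "Poly_Mapping.keys f \<union> Poly_Mapping.keys g"
  have "Poly_Mapping.keys (f + g) \<subseteq> ?S" by (rule keys_add)
  then show ?thesis
    by (simp add: mderiv_superset[of ?S] lookup_add distrib_left single_add sum.distrib)
qed

lemma mderiv_single:
  "mderiv x (Poly_Mapping.single m c) =
    Poly_Mapping.single (m - Poly_Mapping.single x 1) (of_nat (Poly_Mapping.lookup m x) * c)"
  by (subst mderiv_superset[of "{m}"]) auto

lemma mderiv_zero [simp]: "mderiv x 0 = 0"
  by (simp add: mderiv_def)

lemma mderiv_mvar: "mderiv x (mvar y) = (if x = y then 1 else 0)"
  by (simp add: mvar_def mderiv_single lookup_single single_one)

lemma update_eq_add_single: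
  "a \<notin> Poly_Mapping.keys f \<Longrightarrow> Poly_Mapping.update a b f = f + Poly_Mapping.single a b"
  by (intro poly_mapping_eqI) (auto simp: lookup_update lookup_add lookup_single in_keys_iff when_def)

lemma mderiv_mult_single:
  "mderiv x (Poly_Mapping.single m c * Poly_Mapping.single n d) =
    Poly_Mapping.single m c * mderiv x (Poly_Mapping.single n d) +
    mderiv x (Poly_Mapping.single m c) * Poly_Mapping.single n d"
proof -
  let ?e = "Poly_Mapping.single x (1::nat)"
  have 1: "m + (n - ?e) = m + n - ?e" if "Poly_Mapping.lookup n x \<noteq> 0"
    using that by (intro poly_mapping_eqI) (auto simp: lookup_add lookup_minus lookup_single when_def)
  have 2: "(m - ?e) + n = m + n - ?e" if "Poly_Mapping.lookup m x \<noteq> 0"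
    using that by (intro poly_mapping_eqI) (auto simp: lookup_add lookup_minus lookup_single when_def)
  show ?thesis
    using 1 2 by (cases "Poly_Mapping.lookup n x = 0"; cases "Poly_Mapping.lookup m x = 0")
      (simp_all add: mderiv_single mult_single lookup_add single_add[symmetric] algebra_simps)
qed

lemma mderiv_mult: "mderiv x (f * g) = f * mderiv x g + mderiv x f * g"
proof (induction f rule: update_induct)
  case (update f m c)
  have "mderiv x (Poly_Mapping.single m c * g) =
      Poly_Mapping.single m c * mderiv x g + mderiv x (Poly_Mapping.single m c) * g"
  proof (induction g rule: update_induct)
    case (update g n d)
    then show ?case
      by (simp add: update_eq_add_single mderiv_add mderiv_mult_single algebra_simps)
  qed simp
  with update show ?case
    by (simp add: update_eq_add_single mderiv_add algebra_simps)
qed simp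

lemma mpoly_induct [case_names const var add mult]:
  fixes P :: "('x, 'k::field) mpoly \<Rightarrow> bool"
  assumes const: "\<And>c. P (Poly_Mapping.single 0 c)" and var: "\<And>x. P (mvar x)"
    and add: "\<And>f g. P f \<Longrightarrow> P g \<Longrightarrow> P (f + g)" and mult: "\<And>f g. P f \<Longrightarrow> P g \<Longrightarrow> P (f * g)"
  shows "P f"
proof (induction f rule: update_induct)
  case const
  then show ?case using assms(1)[of 0] by simp
next
  case (update f m c)
  have pow: "P (Poly_Mapping.single (Poly_Mapping.single x n) 1)" for x n
  proof (induction n)
    case 0
    then show ?case using assms(1)[of 1] by simp
  next
    case (Suc n)
    have "Poly_Mapping.single (Poly_Mapping.single x (Suc n)) (1::'k) =
        mvar x * Poly_Mapping.single (Poly_Mapping.single x n) 1"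
      by (simp add: mvar_def mult_single single_add[symmetric])
    then show ?case using Suc var mult by metis
  qed
  have "P (Poly_Mapping.single m 1)"
  proof (induction m rule: update_induct)
    case const
    then show ?case using assms(1)[of 1] by simp
  next
    case (update m x n)
    have "Poly_Mapping.single (Poly_Mapping.update x n m) (1::'k) =
        Poly_Mapping.single m 1 * Poly_Mapping.single (Poly_Mapping.single x n) 1"
      using update(1) by (simp add: update_eq_add_single mult_single)
    then show ?case using update(3) pow mult by metis
  qed
  then have "P (Poly_Mapping.single 0 c * Poly_Mapping.single m 1)" using mult assms(1) by blast
  then have "P (Poly_Mapping.single m c)" by (simp add: mult_single)
  then show ?case using update(1,3) add by (simp add: update_eq_add_single)
qed

lemma M2_bracket_skew: "M2_bracket g f = - M2_bracket f g"
  by (simp add: M2_bracket_def algebra_simps)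

lemma M2_bracket_add: "M2_bracket (f + g) h = M2_bracket f h + M2_bracket g h"
  by (simp add: M2_bracket_def mderiv_add algebra_simps)

lemma M2_bracket_mult: "M2_bracket (f * g) h = f * M2_bracket g h + M2_bracket f h * g"
  by (simp add: M2_bracket_def mderiv_mult algebra_simps)

lemma M2_bracket_const: "M2_bracket (Poly_Mapping.single 0 c) h = 0"
  by (simp add: M2_bracket_def mderiv_single)

lemma M2_bracket_gen: "M2_bracket (mvar x) (mvar y) = gen_bracket x y"
  by (cases x; cases y) (simp_all add: M2_bracket_def mderiv_mvar)

lemma M2_bracket_add_right: "M2_bracket h (f + g) = M2_bracket h f + M2_bracket h g"
  using M2_bracket_add[of f g h] M2_bracket_skew[of h "f + g"] M2_bracket_skew[of h f] M2_bracket_skew[of h g]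
  by simp

lemma M2_bracket_mult_right: "M2_bracket h (f * g) = f * M2_bracket h g + M2_bracket h f * g"
  using M2_bracket_mult[of f g h] M2_bracket_skew[of h "f * g"] M2_bracket_skew[of h f] M2_bracket_skew[of h g]
  by simp

lemma M2_bracket_const_right: "M2_bracket h (Poly_Mapping.single 0 c) = 0"
  using M2_bracket_const[of c h] M2_bracket_skew[of h "Poly_Mapping.single 0 c"] by simp

lemma M2_bracket_minus: "M2_bracket (- f) h = - M2_bracket f h"
  using M2_bracket_add[of f "- f" h] M2_bracket_const[of 0 h] by (simp add: eq_neg_iff_add_eq_0 add.commute)

lemma M2_bracket_minus_right: "M2_bracket h (- f) = - M2_bracket h f"
  using M2_bracket_minus[of f h] M2_bracket_skew[of h "- f"] M2_bracket_skew[of h f] by simp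

lemma M2_bracket_diff_right: "M2_bracket h (f - g) = M2_bracket h f - M2_bracket h g"
  using M2_bracket_add_right[of h f "- g"] by (simp add: M2_bracket_minus_right)

lemma M2_bracket_jacobi:
  "M2_bracket f (M2_bracket g h) + M2_bracket g (M2_bracket h f) + M2_bracket h (M2_bracket f g) = 0"
  (is "?J f g h = 0")
proof -
  have step: "?J f g h = 0" if "\<And>x. ?J (mvar x) g h = 0" for f g h
  proof (induction f rule: mpoly_induct)
    case (const c)
    then show ?case by (simp add: M2_bracket_const M2_bracket_const_right M2_bracket_const[of 0, simplified] M2_bracket_const_right[of _ 0, simplified])
  next
    case (var x)
    then show ?case by (rule that)
  next
    case (add f1 f2)
    have "?J (f1 + f2) g h = ?J f1 g h + ?J f2 g h"
      by (simp add: M2_bracket_add M2_bracket_add_right algebra_simps)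
    then show ?case using add by simp
  next
    case (mult f1 f2)
    have "?J (f1 * f2) g h = f1 * ?J f2 g h + ?J f1 g h * f2"
      using M2_bracket_skew[of f1 g] M2_bracket_skew[of f2 g] M2_bracket_skew[of f1 h] M2_bracket_skew[of f2 h]
      by (simp add: M2_bracket_mult M2_bracket_mult_right M2_bracket_add_right M2_bracket_minus_right M2_bracket_diff_right algebra_simps)
    then show ?case using mult by simp
  qed
  have cyc: "?J f g h = ?J g h f" for f g h by (simp add: add_ac)
  have two: "(2 :: (gen, 'a) mpoly) = Poly_Mapping.single 0 2" by simp
  have c2: "M2_bracket 2 f = 0" "M2_bracket f 2 = 0" for f :: "(gen, 'a) mpoly"
    unfolding two by (rule M2_bracket_const M2_bracket_const_right)+
  have c0: "M2_bracket 0 f = 0" "M2_bracket f 0 = 0" for f :: "(gen, 'a) mpoly"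
    using M2_bracket_const[of 0 f] M2_bracket_const_right[of f 0] by simp_all
  have base: "?J (mvar x) (mvar y) (mvar z) = 0" for x y z
    by (cases x; cases y; cases z)
      (simp_all add: M2_bracket_gen M2_bracket_mult M2_bracket_mult_right M2_bracket_minus
        M2_bracket_minus_right c0 c2 algebra_simps)
  have 1: "?J f (mvar y) (mvar z) = 0" for f y z by (rule step) (rule base)
  have 2: "?J f g (mvar z) = 0" for f g z
    by (subst cyc, rule step, subst cyc, subst cyc, rule 1)
  have "?J h f g = 0" by (rule step) (use 2 cyc in metis)
  then show ?thesis using cyc[of h f g] by metis
qed

lemma M2_det_poisson_central: "M2_bracket M2_det f = 0"
proof (induction f rule: mpoly_induct)
  case (var x)
  have det: "M2_det = mvar Ga * mvar Gd + - (mvar Gb * mvar Gc :: (gen, 'a) mpoly)" by (simp add: M2_det_def)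
  have brdet: "M2_bracket M2_det h = mvar Ga * M2_bracket (mvar Gd) h + M2_bracket (mvar Ga) h * mvar Gd
      - (mvar Gb * M2_bracket (mvar Gc) h + M2_bracket (mvar Gb) h * mvar Gc)" for h :: "(gen, 'a) mpoly"
    unfolding det M2_bracket_add M2_bracket_minus M2_bracket_mult by simp
  show ?case unfolding brdet by (cases x) (simp_all add: M2_bracket_gen algebra_simps)
qed (simp_all add: M2_bracket_const_right M2_bracket_add_right M2_bracket_mult_right)

lemma OM2_simps: "carrier OM2 = UNIV" "x \<otimes>\<^bsub>OM2\<^esub> y = x * y" "x \<oplus>\<^bsub>OM2\<^esub> y = x + y"
  "\<one>\<^bsub>OM2\<^esub> = 1" "\<zero>\<^bsub>OM2\<^esub> = 0"
  by (simp_all add: OM2_def ring_of_type_algebra_def)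

lemma cring_OM2: "cring OM2"
  unfolding OM2_def by (rule cring_from_type_algebra)

lemma OM2_uminus: "\<ominus>\<^bsub>OM2\<^esub> x = - x"
proof -
  interpret cring OM2 by (rule cring_OM2)
  show ?thesis by (rule minus_equality) (simp_all add: OM2_simps)
qed

text \<open>The scalars are not part of \<^typ>\<open>'a ring\<close>, so linearity over the ground field is not mentioned
  here; for \<^const>\<open>M2_bracket\<close> it is \<open>M2_bracket_const\<close> together with the Leibniz rule.\<close>

definition poisson_bracket :: "('a, 'm) ring_scheme \<Rightarrow> ('a \<Rightarrow> 'a \<Rightarrow> 'a) \<Rightarrow> bool" where
  "poisson_bracket R br \<longleftrightarrow>
     (\<forall>x\<in>carrier R. \<forall>y\<in>carrier R. br x y \<in> carrier R) \<and>
     (\<forall>x\<in>carrier R. \<forall>y\<in>carrier R. br y x = \<ominus>\<^bsub>R\<^esub> br x y) \<and>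
     (\<forall>x\<in>carrier R. \<forall>y\<in>carrier R. \<forall>z\<in>carrier R. br (x \<oplus>\<^bsub>R\<^esub> y) z = br x z \<oplus>\<^bsub>R\<^esub> br y z) \<and>
     (\<forall>x\<in>carrier R. \<forall>y\<in>carrier R. \<forall>z\<in>carrier R.
        br (x \<otimes>\<^bsub>R\<^esub> y) z = x \<otimes>\<^bsub>R\<^esub> br y z \<oplus>\<^bsub>R\<^esub> br x z \<otimes>\<^bsub>R\<^esub> y) \<and>
     (\<forall>x\<in>carrier R. \<forall>y\<in>carrier R. \<forall>z\<in>carrier R.
        br x (br y z) \<oplus>\<^bsub>R\<^esub> br y (br z x) \<oplus>\<^bsub>R\<^esub> br z (br x y) = \<zero>\<^bsub>R\<^esub>)"

lemma poisson_bracket_M2: "poisson_bracket OM2 M2_bracket"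
  unfolding poisson_bracket_def OM2_simps OM2_uminus
  using M2_bracket_skew M2_bracket_add M2_bracket_mult M2_bracket_jacobi by blast

locale poisson_central = cring R for R :: "('a, 'm) ring_scheme" (structure) +
  fixes br :: "'a \<Rightarrow> 'a \<Rightarrow> 'a" and s :: 'a
  assumes s_carrier: "s \<in> carrier R"
    and br: "poisson_bracket R br"
    and s_br: "x \<in> carrier R \<Longrightarrow> br s x = \<zero>"
begin

sublocale central_element R s
  by unfold_locales (use s_carrier m_comm in auto)

abbreviation "L \<equiv> localization R s"

lemma br_closed [simp]: "x \<in> carrier R \<Longrightarrow> y \<in> carrier R \<Longrightarrow> br x y \<in> carrier R"
  and br_skew: "x \<in> carrier R \<Longrightarrow> y \<in> carrier R \<Longrightarrow> br y x = \<ominus> br x y"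
  and br_add: "x \<in> carrier R \<Longrightarrow> y \<in> carrier R \<Longrightarrow> z \<in> carrier R \<Longrightarrow> br (x \<oplus> y) z = br x z \<oplus> br y z"
  and br_mult: "x \<in> carrier R \<Longrightarrow> y \<in> carrier R \<Longrightarrow> z \<in> carrier R \<Longrightarrow>
    br (x \<otimes> y) z = x \<otimes> br y z \<oplus> br x z \<otimes> y"
  and br_jacobi: "x \<in> carrier R \<Longrightarrow> y \<in> carrier R \<Longrightarrow> z \<in> carrier R \<Longrightarrow>
    br x (br y z) \<oplus> br y (br z x) \<oplus> br z (br x y) = \<zero>"
  using br unfolding poisson_bracket_def by blast+

lemma br_pow: "x \<in> carrier R \<Longrightarrow> br (s [^] k) x = \<zero>" for k :: nat
proof (induction k)
  case 0
  then have "br \<one> x \<oplus> br \<one> x = br \<one> x" using br_mult[of \<one> \<one> x] by simp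
  then show ?case using 0 by (simp add: add.r_cancel_one')
next
  case (Suc k)
  then show ?case using br_mult[of "s [^] k" s x] s_br by simp
qed

lemma br_pow_mult: "x \<in> carrier R \<Longrightarrow> y \<in> carrier R \<Longrightarrow> br (s [^] k \<otimes> x) y = s [^] k \<otimes> br x y" for k :: nat
  using br_mult[of "s [^] k" x y] br_pow by simp

lemma br_pow_mult_right:
  "x \<in> carrier R \<Longrightarrow> y \<in> carrier R \<Longrightarrow> br x (s [^] k \<otimes> y) = s [^] k \<otimes> br x y" for k :: nat
  using br_skew[of "s [^] k \<otimes> y" x] br_skew[of y x] br_pow_mult[of y x k] by (simp add: r_minus)

lemma loc_bracket_frac:
  assumes "x \<in> carrier R" "y \<in> carrier R"
  shows "loc_bracket R s br (loc_frac R s x n) (loc_frac R s y m) = loc_frac R s (br x y) (n + m)"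
  unfolding loc_bracket_def
proof (rule loc_union2[OF assms])
  fix x' n' y' m' assume "(x', n') \<in> loc_frac R s x n" "(y', m') \<in> loc_frac R s y m"
  then obtain k l where xy: "x' \<in> carrier R" "y' \<in> carrier R"
    and k: "s [^] (k + n') \<otimes> x = s [^] (k + n) \<otimes> x'"
    and l: "s [^] (l + m') \<otimes> y = s [^] (l + m) \<otimes> y'" by (auto simp: mem_loc_frac)
  have "s [^] (k + l + (n + m)) \<otimes> br x' y' = br (s [^] (k + n) \<otimes> x') (s [^] (l + m) \<otimes> y')"
    using xy by (simp add: br_pow_mult br_pow_mult_right pow_pow add_ac)
  also have "\<dots> = s [^] (k + l + (n' + m')) \<otimes> br x y"
    unfolding k[symmetric] l[symmetric] using assms by (simp add: br_pow_mult br_pow_mult_right pow_pow add_ac)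
  finally show "loc_frac R s (br x' y') (n' + m') = loc_frac R s (br x y) (n + m)"
    using xy assms by (intro loc_frac_eqI) auto
qed

lemma loc_bracket_extends:
  "x \<in> carrier R \<Longrightarrow> y \<in> carrier R \<Longrightarrow>
    loc_bracket R s br (loc_frac R s x 0) (loc_frac R s y 0) = loc_frac R s (br x y) 0"
  using loc_bracket_frac[of x y 0 0] by simp

lemma loc_add_same:
  assumes "x \<in> carrier R" "y \<in> carrier R"
  shows "loc_frac R s x n \<oplus>\<^bsub>L\<^esub> loc_frac R s y n = loc_frac R s (x \<oplus> y) n"
  using assms loc_frac_cancel[of "x \<oplus> y" n n] by (simp add: loc_add r_distr)

lemma loc_uminus: "x \<in> carrier R \<Longrightarrow> \<ominus>\<^bsub>L\<^esub> loc_frac R s x n = loc_frac R s (\<ominus> x) n"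
proof -
  interpret L: ring L by (rule loc_ring)
  assume "x \<in> carrier R"
  then show ?thesis
    by (intro L.minus_equality) (simp_all add: loc_add_same loc_zero_frac l_neg)
qed

lemma loc_bracket_poisson: "poisson_bracket L (loc_bracket R s br)"
  unfolding poisson_bracket_def
proof (intro conjI ballI)
  fix U V assume "U \<in> carrier L" "V \<in> carrier L"
  then obtain x n y m where xy: "x \<in> carrier R" "y \<in> carrier R"
    "U = loc_frac R s x n" "V = loc_frac R s y m" unfolding loc_carrier by blast
  then show "loc_bracket R s br U V \<in> carrier L" by (simp add: loc_bracket_frac)
  show "loc_bracket R s br V U = \<ominus>\<^bsub>L\<^esub> loc_bracket R s br U V"
    using xy br_skew[of x y] by (simp add: loc_bracket_frac loc_uminus add_ac)
next
  fix U V W assume "U \<in> carrier L" "V \<in> carrier L" "W \<in> carrier L"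
  then obtain x n y m z p where xyz: "x \<in> carrier R" "y \<in> carrier R" "z \<in> carrier R"
    "U = loc_frac R s x n" "V = loc_frac R s y m" "W = loc_frac R s z p" unfolding loc_carrier by blast
  show "loc_bracket R s br (U \<oplus>\<^bsub>L\<^esub> V) W = loc_bracket R s br U W \<oplus>\<^bsub>L\<^esub> loc_bracket R s br V W"
    using xyz loc_frac_cancel[of "s [^] m \<otimes> br x z \<oplus> s [^] n \<otimes> br y z" p "n + m + p"]
    by (simp add: loc_bracket_frac loc_add br_add br_pow_mult r_distr pow_pow add_ac)
  show "loc_bracket R s br (U \<otimes>\<^bsub>L\<^esub> V) W =
      U \<otimes>\<^bsub>L\<^esub> loc_bracket R s br V W \<oplus>\<^bsub>L\<^esub> loc_bracket R s br U W \<otimes>\<^bsub>L\<^esub> V"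
    using xyz loc_add_same[of "x \<otimes> br y z" "br x z \<otimes> y" "n + m + p"]
    by (simp add: loc_bracket_frac loc_mult br_mult add_ac)
  show "loc_bracket R s br U (loc_bracket R s br V W) \<oplus>\<^bsub>L\<^esub> loc_bracket R s br V (loc_bracket R s br W U) \<oplus>\<^bsub>L\<^esub>
      loc_bracket R s br W (loc_bracket R s br U V) = \<zero>\<^bsub>L\<^esub>"
    using xyz br_jacobi[of x y z] loc_add_same[of "br x (br y z)" "br y (br z x)" "n + m + p"]
      loc_add_same[of "br x (br y z) \<oplus> br y (br z x)" "br z (br x y)" "n + m + p"]
    by (simp add: loc_bracket_frac loc_zero_frac add_ac)
qed

lemma loc_bracket_unique:
  assumes br': "poisson_bracket L br'"
    and ext: "\<And>x y. x \<in> carrier R \<Longrightarrow> y \<in> carrier R \<Longrightarrow>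
      br' (loc_frac R s x 0) (loc_frac R s y 0) = loc_frac R s (br x y) 0"
    and UV: "U \<in> carrier L" "V \<in> carrier L"
  shows "br' U V = loc_bracket R s br U V"
proof -
  interpret L: ring L by (rule loc_ring)
  have closed: "br' U V \<in> carrier L" if "U \<in> carrier L" "V \<in> carrier L" for U V
    using br' that unfolding poisson_bracket_def by blast
  have skew: "br' V U = \<ominus>\<^bsub>L\<^esub> br' U V" if "U \<in> carrier L" "V \<in> carrier L" for U V
    using br' that unfolding poisson_bracket_def by blast
  have leib: "br' (U \<otimes>\<^bsub>L\<^esub> V) W = U \<otimes>\<^bsub>L\<^esub> br' V W \<oplus>\<^bsub>L\<^esub> br' U W \<otimes>\<^bsub>L\<^esub> V"
    if "U \<in> carrier L" "V \<in> carrier L" "W \<in> carrier L" for U V W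
    using br' that unfolding poisson_bracket_def by blast
  have s0: "br' (loc_frac R s (s [^] k) 0) (loc_frac R s y m) = \<zero>\<^bsub>L\<^esub>"
    if "\<And>x. x \<in> carrier R \<Longrightarrow> br' (loc_frac R s x 0) (loc_frac R s y m) = loc_frac R s (br x y) m"
      "y \<in> carrier R" for k :: nat and y m
    using that(1)[of "s [^] k"] br_pow[of y k] that(2) by (simp add: loc_zero_frac)
  have inv: "loc_frac R s \<one> k \<otimes>\<^bsub>L\<^esub> (loc_frac R s (s [^] k) 0 \<otimes>\<^bsub>L\<^esub> W) = W" if W: "W \<in> carrier L" for k W
  proof -
    obtain w p where "w \<in> carrier R" "W = loc_frac R s w p" using W unfolding loc_carrier by blast
    then show ?thesis by (simp add: loc_mult loc_frac_cancel)
  qed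
  have step: "br' (loc_frac R s x n) (loc_frac R s y m) = loc_frac R s (br x y) (n + m)"
    if h: "\<And>x. x \<in> carrier R \<Longrightarrow> br' (loc_frac R s x 0) (loc_frac R s y m) = loc_frac R s (br x y) m"
      and xy: "x \<in> carrier R" "y \<in> carrier R" for x n y m
  proof -
    let ?S = "loc_frac R s (s [^] n) 0"
    have "?S \<otimes>\<^bsub>L\<^esub> loc_frac R s x n = loc_frac R s x 0"
      using xy loc_frac_cancel[of x n 0] by (simp add: loc_mult)
    then have "loc_frac R s (br x y) m = ?S \<otimes>\<^bsub>L\<^esub> br' (loc_frac R s x n) (loc_frac R s y m)"
      using leib[of ?S "loc_frac R s x n" "loc_frac R s y m"] s0[OF h] h[of x] xy closed by simp
    then have "br' (loc_frac R s x n) (loc_frac R s y m) = loc_frac R s \<one> n \<otimes>\<^bsub>L\<^esub> loc_frac R s (br x y) m"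
      using inv closed xy by simp
    then show ?thesis using xy by (simp add: loc_mult)
  qed
  obtain x n y m where xy: "x \<in> carrier R" "y \<in> carrier R"
    "U = loc_frac R s x n" "V = loc_frac R s y m" using UV unfolding loc_carrier by blast
  have "br' (loc_frac R s x' 0) (loc_frac R s y m) = loc_frac R s (br x' y) m" if x': "x' \<in> carrier R" for x'
  proof -
    have "br' (loc_frac R s y m) (loc_frac R s x' 0) = loc_frac R s (br y x') m"
      using step[of x' 0 y m] ext xy x' by simp
    then show ?thesis
      using skew[of "loc_frac R s y m" "loc_frac R s x' 0"] br_skew[of y x'] xy x' by (simp add: loc_uminus)
  qed
  then have "br' U V = loc_frac R s (br x y) (n + m)" using step xy by simp
  then show ?thesis using xy by (simp add: loc_bracket_frac)
qed

end

lemma poisson_central_M2: "poisson_central OM2 M2_bracket M2_det"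
  by (intro poisson_central.intro poisson_central_axioms.intro cring_OM2 poisson_bracket_M2)
    (simp_all add: OM2_simps M2_det_poisson_central)

lemma poisson_bracket_GL2: "poisson_bracket OGL2 GL2_bracket"
  unfolding OGL2_def GL2_bracket_def
  by (rule poisson_central.loc_bracket_poisson[OF poisson_central_M2])

end

theory Submission
  imports Defs "HOL-Library.Product_Plus" "HOL-Library.Product_Lexorder"
begin

text \<open>Let \<open>e_n\<close> be \<open>a^n\<close> for \<open>n \<ge> 0\<close> and \<open>d^(-n)\<close> for \<open>n < 0\<close>. Both coordinate rings are free over
  \<open>B = k[b, c, D, D^(-1)]\<close> on the \<open>e_n\<close>, and \<open>\<psi>'\<close> is induced by the resulting \<^emph>\<open>linear\<close> identification
  of \<open>O_q(GL_2)\<close> with \<open>O(GL_2)\<close>: a subspace is a prime ideal for the quantum product if and only if it is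
  a Poisson prime ideal, so the topologies agree at once. Indeed, if \<open>b\<close> or \<open>c\<close> is not in \<open>P\<close>, that
  normal (Poisson normal) element separates the powers \<open>q^n\<close> (the integers \<open>n\<close>), so \<open>P\<close> consists of the
  elements with coefficients in a prime \<open>p\<close> of \<open>B\<close> that is homogeneous in \<open>b, c\<close>; conversely every such
  \<open>p\<close> yields a prime on either side. If \<open>b, c\<close> are in \<open>P\<close>, the two products agree modulo \<open>(b, c)\<close>.

  On the first stratum the primitive ideals on either side are those where \<open>D\<close> and the ratio of \<open>b\<close>
  and \<open>c\<close> are scalars modulo \<open>p\<close> (by Quillen's lemma: endomorphisms of simple modules are scalar), on the
  second one they are the maximal ideals.\<close>

section \<open>The model\<close>

text \<open>The obstacle is that \<open>a\<close> and \<open>d\<close> are not invertible: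
  conjugating a coefficient by them gives the dilation \<open>sg\<close> only up to a factor. From
  \<open>\<beta>\<close> in \<open>base P\<close> one gets \<open>tt q * sg q \<beta>\<close> and
  \<open>tt (inverse q) * sg (inverse q) \<beta>\<close>, where \<open>tt r = D + r b c\<close>, so
  homogeneity of \<open>base P\<close> is not a formal consequence of invariance. Eliminating
  degrees accumulates factors \<open>tt (q powi m)\<close>, with \<open>m > 0\<close> for the one
  operation and \<open>m < 0\<close> for the other; two such factors differ by a nonzero multiple of
  \<open>b c\<close> and \<open>D\<close> is a unit, so the two products are comaximal and both
  disappear. Classically all these factors collapse to \<open>tt 1\<close> and this argument breaks
  down; there a second-order identity, from the iterated bracket with \<open>a\<close> and
  \<open>d\<close>, lowers the power of \<open>tt 1\<close> step by step.

  The other difficulty is to realise a candidate as a primitive ideal. It is put inside a maximal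
  left ideal attached to a point where the normal element has value 1, which keeps that element out,
  and a graded prime that fixes \<open>D\<close> and the ratio of \<open>b\<close> and
  \<open>c\<close> is maximal among the graded primes avoiding it.\<close>

text \<open>The exponent \<open>(i, j, l)\<close> stands for \<open>b^i c^j D^l\<close>, and \<open>Poly_Mapping.single n \<beta>\<close> in
  \<open>wspace\<close> for \<open>\<beta> e_n\<close>, where \<open>e_n = a^n\<close> if \<open>n \<ge> 0\<close> and \<open>e_n = d^(-n)\<close> otherwise.\<close>

type_synonym 'k bpoly = "(nat \<times> nat \<times> int) \<Rightarrow>\<^sub>0 'k"
type_synonym 'k wspace = "int \<Rightarrow>\<^sub>0 'k bpoly"

lemma poly_mapping_single_induct [case_names single add]:
  fixes f :: "'i \<Rightarrow>\<^sub>0 'c::comm_monoid_add"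
  assumes single: "\<And>k c. P (Poly_Mapping.single k c)" and add: "\<And>f g. P f \<Longrightarrow> P g \<Longrightarrow> P (f + g)"
  shows "P f"
proof (induction f rule: update_induct)
  case const
  then show ?case using single[of undefined 0] by simp
next
  case (update f k c)
  have "Poly_Mapping.update k c f = f + Poly_Mapping.single k c"
    using update(1) by (intro poly_mapping_eqI) (auto simp: lookup_update lookup_add lookup_single in_keys_iff when_def)
  then show ?case using update(3) single add by simp
qed

section \<open>The coefficient ring\<close>

text \<open>A diagonal operator for the grading by total degree in \<open>b\<close> and
  \<open>c\<close>. Dilations, projections to a degree and the Euler derivation all have this form,
  so linearity and the stability of homogeneous ideals are proved once.\<close>

lift_definition wt :: "(nat \<Rightarrow> 'k::field) \<Rightarrow> 'k bpoly \<Rightarrow> 'k bpoly"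
  is "\<lambda>h f k. h (fst k + fst (snd k)) * f k"
  by (auto elim: rev_finite_subset)

lemma lookup_wt: "Poly_Mapping.lookup (wt h f) k = h (fst k + fst (snd k)) * Poly_Mapping.lookup f k"
  by transfer simp

lemma wt_zero [simp]: "wt h 0 = 0"
  by (rule poly_mapping_eqI) (simp add: lookup_wt)

lemma wt_add: "wt h (f + g) = wt h f + wt h g"
  by (rule poly_mapping_eqI) (simp add: lookup_wt lookup_add algebra_simps)

lemma wt_diff: "wt h (f - g) = wt h f - wt h g"
  by (rule poly_mapping_eqI) (simp add: lookup_wt lookup_minus algebra_simps)

lemma wt_sum: "wt h (sum F A) = (\<Sum>a\<in>A. wt h (F a))"
  by (induction A rule: infinite_finite_induct) (auto simp: wt_add)

lemma wt_single: "wt h (Poly_Mapping.single k c) = Poly_Mapping.single k (h (fst k + fst (snd k)) * c)"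
  by (rule poly_mapping_eqI) (simp add: lookup_wt lookup_single when_def)

lemma wt_wt: "wt h (wt h' f) = wt (\<lambda>i. h i * h' i) f"
  by (rule poly_mapping_eqI) (simp add: lookup_wt)

text \<open>With respect to the degree in \<open>b\<close> and \<open>c\<close>: \<open>sg r\<close> substitutes \<open>r b, r c\<close> for \<open>b, c\<close>,
  \<open>hc j\<close> is the homogeneous component and \<open>eul\<close> the Euler derivation.\<close>

abbreviation sg :: "'k::field \<Rightarrow> 'k bpoly \<Rightarrow> 'k bpoly" where "sg r \<equiv> wt (\<lambda>i. r ^ i)"
abbreviation hc :: "nat \<Rightarrow> 'k::field bpoly \<Rightarrow> 'k bpoly" where "hc j \<equiv> wt (\<lambda>i. if i = j then 1 else 0)"
abbreviation eul :: "'k::field bpoly \<Rightarrow> 'k bpoly" where "eul \<equiv> wt of_nat"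

lemma sg_mult: "sg r (f * g) = sg r f * sg r g"
proof (induction f rule: poly_mapping_single_induct)
  case (single k c)
  show ?case
    by (induction g rule: poly_mapping_single_induct)
      (auto simp: wt_single mult_single wt_add distrib_left power_add algebra_simps)
qed (simp add: wt_add distrib_right)

lemma eul_mult: "eul (f * g) = f * eul g + eul f * g"
proof (induction f rule: poly_mapping_single_induct)
  case (single k c)
  show ?case
    by (induction g rule: poly_mapping_single_induct)
      (auto simp: wt_single mult_single wt_add distrib_left single_add[symmetric] algebra_simps)
qed (simp add: wt_add algebra_simps)

lemma sg_one [simp]: "sg 1 f = f"
  by (rule poly_mapping_eqI) (simp add: lookup_wt)

lemma wt_const_one [simp]: "wt (\<lambda>i. 1) f = f"
  by (rule poly_mapping_eqI) (simp add: lookup_wt)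

lemma sg_sg: "sg r (sg s f) = sg (r * s) f"
  by (simp add: wt_wt power_mult_distrib)

lemma wt_hc: "hc j (wt h f) = Poly_Mapping.single 0 (h j) * hc j f" 
  by (induction f rule: poly_mapping_single_induct) (auto simp: wt_single mult_single wt_add algebra_simps)

lemma wt_one: "wt h 1 = Poly_Mapping.single 0 (h 0)"
  by (simp add: wt_single flip: single_one)

lemma sg_one_right [simp]: "sg r 1 = 1"
  by (simp add: wt_one)

abbreviation cst :: "'k::field \<Rightarrow> 'k bpoly" where "cst \<equiv> Poly_Mapping.single 0"
definition bv :: "'k::field bpoly" where "bv = Poly_Mapping.single (1, 0, 0) 1"
definition cv :: "'k::field bpoly" where "cv = Poly_Mapping.single (0, 1, 0) 1"
definition Dv :: "int \<Rightarrow> 'k::field bpoly" where "Dv l = Poly_Mapping.single (0, 0, l) 1"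

text \<open>The products are \<open>d a = tt (1/q)\<close> and \<open>a d = tt q\<close>.\<close>

definition tt :: "'k::field \<Rightarrow> 'k bpoly" where "tt r = Dv 1 + cst r * bv * cv"

lemma bpoly_zero_index: "(0, 0, 0) = (0 :: nat \<times> nat \<times> int)"
  by (simp add: zero_prod_def)

lemma cst_mult: "cst x * cst y = cst (x * y)"
  by (simp add: mult_single)

lemma cst_one [simp]: "cst 1 = 1" by simp

lemma wt_bv: "wt h bv = cst (h 1) * bv" and wt_cv: "wt h cv = cst (h 1) * cv"
  and wt_Dv: "wt h (Dv l) = cst (h 0) * Dv l" and wt_cst: "wt h (cst x) = cst (h 0 * x)"
  by (simp_all add: bv_def cv_def Dv_def wt_single mult_single)

lemma wt_cst_mult: "wt h (cst x * f) = cst x * wt h f"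
  by (induction f rule: poly_mapping_single_induct) (auto simp: wt_single mult_single wt_add algebra_simps)

lemma Dv_mult: "Dv l * Dv m = Dv (l + m)" and Dv_zero: "Dv 0 = 1"
  by (simp_all add: Dv_def mult_single bpoly_zero_index)

lemma tt_single: "tt r * Poly_Mapping.single (i, j, l) x =
    Poly_Mapping.single (i, j, l + 1) x + Poly_Mapping.single (Suc i, Suc j, l) (r * x)"
  by (simp add: tt_def Dv_def bv_def cv_def mult_single distrib_right add.commute)

lemma sg_tt: "sg r (tt s) = tt (r ^ 2 * s)"
  by (simp add: tt_def wt_add sg_mult wt_cst wt_bv wt_cv wt_Dv power2_eq_square cst_mult[symmetric] algebra_simps)

text \<open>Multiplication on the model is assembled from these twisted shifts.\<close>

lift_definition lsh :: "int \<Rightarrow> (int \<Rightarrow> 'k::field bpoly) \<Rightarrow> 'k \<Rightarrow> 'k wspace \<Rightarrow> 'k wspace"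
  is "\<lambda>n \<kappa> r w N. \<kappa> (N - n) * sg r (w (N - n))"
proof -
  fix n \<kappa> and r :: 'k and w :: "int \<Rightarrow> 'k bpoly"
  assume "finite {k. w k \<noteq> 0}"
  then have "finite ((\<lambda>k. k + n) ` {k. w k \<noteq> 0})" by simp
  moreover have "{N. \<kappa> (N - n) * sg r (w (N - n)) \<noteq> 0} \<subseteq> (\<lambda>k. k + n) ` {k. w k \<noteq> 0}"
  proof
    fix N assume "N \<in> {N. \<kappa> (N - n) * sg r (w (N - n)) \<noteq> 0}"
    then have "w (N - n) \<noteq> 0" by (metis (mono_tags, lifting) mem_Collect_eq mult_zero_right wt_zero)
    then show "N \<in> (\<lambda>k. k + n) ` {k. w k \<noteq> 0}" by (intro image_eqI[of _ _ "N - n"]) auto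
  qed
  ultimately show "finite {N. \<kappa> (N - n) * sg r (w (N - n)) \<noteq> 0}" by (rule rev_finite_subset)
qed

lemma lookup_lsh: "Poly_Mapping.lookup (lsh n \<kappa> r w) N = \<kappa> (N - n) * sg r (Poly_Mapping.lookup w (N - n))"
  by (simp add: lsh.rep_eq)

lemma lsh_add: "lsh n \<kappa> r (v + w) = lsh n \<kappa> r v + lsh n \<kappa> r w"
  by (rule poly_mapping_eqI) (simp add: lookup_lsh lookup_add wt_add algebra_simps)

lemma lsh_zero [simp]: "lsh n \<kappa> r 0 = 0"
  by (rule poly_mapping_eqI) (simp add: lookup_lsh)

lemma lsh_lsh: "lsh n \<kappa> r (lsh m \<mu> s w) = lsh (n + m) (\<lambda>k. \<kappa> (k + m) * sg r (\<mu> k)) (r * s) w"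
  by (rule poly_mapping_eqI) (simp add: lookup_lsh sg_mult sg_sg mult.assoc diff_diff_eq2 algebra_simps)

lemma lsh_single: "lsh n \<kappa> r (Poly_Mapping.single m \<beta>) = Poly_Mapping.single (n + m) (\<kappa> m * sg r \<beta>)"
  by (rule poly_mapping_eqI) (auto simp: lookup_lsh lookup_single when_def)

text \<open>The coefficients of \<open>a e_m\<close> and \<open>d e_m\<close>. They are
  \<open>1\<close> unless the product moves towards \<open>0\<close>, where \<open>a d^(-m)\<close>
  contains \<open>a d = tt q\<close> and \<open>d a^m\<close> contains
  \<open>d a = tt (1/q)\<close>.\<close>

definition kA :: "'k::field \<Rightarrow> int \<Rightarrow> 'k bpoly" where "kA q m = (if m \<ge> 0 then 1 else tt q)"
definition kD :: "'k::field \<Rightarrow> int \<Rightarrow> 'k bpoly" where "kD q m = (if m \<le> 0 then 1 else tt (inverse q))"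

definition lA :: "'k::field \<Rightarrow> 'k wspace \<Rightarrow> 'k wspace" where "lA q = lsh 1 (kA q) q"
definition lD :: "'k::field \<Rightarrow> 'k wspace \<Rightarrow> 'k wspace" where "lD q = lsh (- 1) (kD q) (inverse q)"
definition scl :: "'k::field bpoly \<Rightarrow> 'k wspace \<Rightarrow> 'k wspace" where "scl \<beta> = lsh 0 (\<lambda>_. \<beta>) 1"

lemma lookup_scl: "Poly_Mapping.lookup (scl \<beta> w) n = \<beta> * Poly_Mapping.lookup w n"
  by (simp add: scl_def lookup_lsh)

lemma scl_add: "scl \<beta> (v + w) = scl \<beta> v + scl \<beta> w" and scl_zero [simp]: "scl \<beta> 0 = 0"
  and scl_add_left: "scl (\<beta> + \<gamma>) w = scl \<beta> w + scl \<gamma> w" and scl_zero_left [simp]: "scl 0 w = 0"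
  and scl_one [simp]: "scl 1 w = w" and scl_scl: "scl \<beta> (scl \<gamma> w) = scl (\<beta> * \<gamma>) w"
  by (rule poly_mapping_eqI; simp add: lookup_scl lookup_add lookup_minus algebra_simps)+

lemma scl_single: "scl \<beta> (Poly_Mapping.single n \<gamma>) = Poly_Mapping.single n (\<beta> * \<gamma>)"
  by (simp add: scl_def lsh_single)

text \<open>The structure constants: \<open>e_n e_k = kap q n k e_(n + k)\<close>.\<close>

fun kapP :: "'k::field \<Rightarrow> nat \<Rightarrow> int \<Rightarrow> 'k bpoly" where
  "kapP q 0 k = 1"
| "kapP q (Suc n) k = kA q (k + int n) * sg q (kapP q n k)"

fun kapN :: "'k::field \<Rightarrow> nat \<Rightarrow> int \<Rightarrow> 'k bpoly" where
  "kapN q 0 k = 1"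
| "kapN q (Suc n) k = kD q (k - int n) * sg (inverse q) (kapN q n k)"

definition kap :: "'k::field \<Rightarrow> int \<Rightarrow> int \<Rightarrow> 'k bpoly" where
  "kap q n k = (if n \<ge> 0 then kapP q (nat n) k else kapN q (nat (- n)) k)"

lemma kA_kD: "q \<noteq> 0 \<Longrightarrow> kA q k * sg q (kD q (k + 1)) = tt q"
  and kD_kA: "q \<noteq> 0 \<Longrightarrow> kD q (k + 1) * sg (inverse q) (kA q k) = tt (inverse q)"
  by (auto simp: kA_def kD_def sg_tt power2_eq_square wt_one mult.assoc)

lemma kap_zero [simp]: "kap q 0 k = 1" by (simp add: kap_def)

text \<open>This compares \<open>(a e_n) e_k\<close> with \<open>a (e_n e_k)\<close>. For
  \<open>n \<ge> 0\<close> it is the recursion of \<open>kapP\<close>; for \<open>n < 0\<close> one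
  step of \<open>kapN\<close> is undone, and \<open>kA_kD\<close> turns the resulting
  \<open>a d\<close> into the \<open>tt q\<close> on the left.\<close>

lemma kap_A: 
  assumes "q \<noteq> 0"
  shows "kA q n * kap q (n + 1) k = kA q (k + n) * sg q (kap q n k)"
proof (cases "n \<ge> 0")
  case True
  then have "nat (n + 1) = Suc (nat n)" by simp
  then show ?thesis using True by (simp add: kap_def kA_def)
next
  case False
  define m where "m = nat (- n - 1)"
  have m: "n = - int m - 1" using False by (simp add: m_def)
  have "kap q (n + 1) k = kapN q m k" using m by (cases m) (auto simp: kap_def nat_add_distrib)
  moreover have "kap q n k = kD q (k - int m) * sg (inverse q) (kapN q m k)"
    using m by (simp add: kap_def nat_add_distrib)
  moreover have "kA q (k + n) * sg q (kD q (k - int m)) = tt q"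
    using kA_kD[OF assms, of "k + n"] by (simp add: m add.assoc)
  moreover have "kA q n = tt q" using False by (simp add: kA_def)
  ultimately show ?thesis using assms by (simp add: sg_mult sg_sg mult.assoc[symmetric])
qed

lemma kap_D: 
  assumes "q \<noteq> 0"
  shows "kD q n * kap q (n - 1) k = kD q (k + n) * sg (inverse q) (kap q n k)"
proof (cases "n \<le> 0")
  case True
  define m where "m = nat (- n)"
  have m: "n = - int m" using True by (simp add: m_def)
  have "kap q (n - 1) k = kapN q (Suc m) k" using m by (simp add: kap_def nat_add_distrib del: kapN.simps) 
  moreover have "kap q n k = kapN q m k" using m by (cases m) (auto simp: kap_def nat_add_distrib)
  ultimately show ?thesis using True m by (simp add: kD_def)
next
  case False
  define m where "m = nat (n - 1)"
  have m: "n = int m + 1" using False by (simp add: m_def)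
  have "kap q (n - 1) k = kapP q m k" using m by (simp add: kap_def)
  moreover have "kap q n k = kA q (k + int m) * sg q (kapP q m k)"
    using m by (simp add: kap_def nat_add_distrib)
  moreover have "kD q (k + n) * sg (inverse q) (kA q (k + int m)) = tt (inverse q)"
    using kD_kA[OF assms, of "k + int m"] m by (simp add: algebra_simps)
  moreover have "kD q n = tt (inverse q)" using False by (simp add: kD_def)
  ultimately show ?thesis using assms by (simp add: sg_mult sg_sg mult.assoc[symmetric])
qed

section \<open>The product of the model and its associativity\<close>

definition mul :: "'k::field \<Rightarrow> 'k wspace \<Rightarrow> 'k wspace \<Rightarrow> 'k wspace" where
  "mul q x y = (\<Sum>n\<in>Poly_Mapping.keys x. lsh n (\<lambda>k. Poly_Mapping.lookup x n * kap q n k) (q powi n) y)"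

lemma mul_superset:
  assumes "finite S" "Poly_Mapping.keys x \<subseteq> S"
  shows "mul q x y = (\<Sum>n\<in>S. lsh n (\<lambda>k. Poly_Mapping.lookup x n * kap q n k) (q powi n) y)"
proof -
  have "lsh n (\<lambda>k. 0 * kap q n k) r y = 0" for n r
    by (rule poly_mapping_eqI) (simp add: lookup_lsh)
  then show ?thesis unfolding mul_def using assms 
    by (intro sum.mono_neutral_left ballI) (simp_all add: in_keys_iff)
qed

lemma mul_add_left: "mul q (x + y) z = mul q x z + mul q y z"
proof -
  let ?S = "Poly_Mapping.keys x \<union> Poly_Mapping.keys y"
  have *: "lsh n (\<lambda>k. (b + c) * kap q n k) r z = lsh n (\<lambda>k. b * kap q n k) r z + lsh n (\<lambda>k. c * kap q n k) r z" for n b c r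
    by (rule poly_mapping_eqI) (simp add: lookup_lsh lookup_add algebra_simps)
  have "Poly_Mapping.keys (x + y) \<subseteq> ?S" by (rule keys_add)
  then show ?thesis
    by (simp add: mul_superset[of ?S] lookup_add * sum.distrib)
qed

lemma mul_add_right: "mul q x (y + z) = mul q x y + mul q x z"
  by (simp add: mul_def lsh_add sum.distrib)

lemma mul_zero [simp]: "mul q 0 x = 0" "mul q x 0 = 0"
  by (simp_all add: mul_def)

lemma mul_single_left:
  "mul q (Poly_Mapping.single n \<beta>) y = lsh n (\<lambda>k. \<beta> * kap q n k) (q powi n) y"
  by (subst mul_superset[of "{n}"]) auto

lemma mul_single_single:
  "mul q (Poly_Mapping.single n \<beta>) (Poly_Mapping.single m \<gamma>) =
    Poly_Mapping.single (n + m) (\<beta> * kap q n m * sg (q powi n) \<gamma>)"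
  by (simp add: mul_single_left lsh_single)

lemma lookup_mul: "Poly_Mapping.lookup (mul q x y) N =
   (\<Sum>n\<in>Poly_Mapping.keys x. Poly_Mapping.lookup x n * kap q n (N - n) * sg (q powi n) (Poly_Mapping.lookup y (N - n)))"
  by (simp add: mul_def lookup_sum lookup_lsh)

abbreviation e0 :: "'k::field wspace" where "e0 \<equiv> 1"

lemma mul_e0 [simp]: "mul q e0 x = x"
  unfolding single_one[symmetric] mul_single_left by (rule poly_mapping_eqI) (simp add: lookup_lsh)

lemma mul_coef: "mul q (Poly_Mapping.single 0 \<beta>) x = scl \<beta> x"
  unfolding mul_single_left scl_def by simp

lemma kap_zero_right [simp]: "kap q n 0 = 1"
proof -
  have "kapP q m 0 = 1" for m by (induction m) (auto simp: kA_def wt_one)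
  moreover have "kapN q m 0 = 1" for m by (induction m) (auto simp: kD_def wt_one)
  ultimately show ?thesis by (simp add: kap_def)
qed

lemma lookup_mul_coef_right:
  "Poly_Mapping.lookup (mul q x (Poly_Mapping.single 0 \<beta>)) n = Poly_Mapping.lookup x n * sg (q powi n) \<beta>"
proof (induction x rule: poly_mapping_single_induct)
  case (single k c)
  then show ?case by (auto simp: mul_single_single lookup_single when_def)
qed (simp add: mul_add_left lookup_add algebra_simps)

lemma mul_e0_right [simp]: "mul q x e0 = x"
  unfolding single_one[symmetric] by (rule poly_mapping_eqI) (simp add: lookup_mul_coef_right wt_one del: single_one)

lemma mul_lA: assumes "q \<noteq> 0" shows "mul q (lA q x) y = lA q (mul q x y)"
proof (induction x rule: poly_mapping_single_induct)
  case (single n \<beta>)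
  have "Poly_Mapping.lookup (mul q (lA q (Poly_Mapping.single n \<beta>)) y) N = Poly_Mapping.lookup (lA q (mul q (Poly_Mapping.single n \<beta>) y)) N" for N
  proof -
    have "kA q n * kap q (1 + n) (N - (1 + n)) = kA q (N - 1) * sg q (kap q n (N - (1 + n)))"
      using kap_A[OF assms, of n "N - (1 + n)"] by (simp add: add.commute)
    then have "(kA q n * kap q (1 + n) (N - (1 + n))) * (sg q \<beta> * sg (q * q powi n) (Poly_Mapping.lookup y (N - (1 + n)))) =
        (kA q (N - 1) * sg q (kap q n (N - (1 + n)))) * (sg q \<beta> * sg (q * q powi n) (Poly_Mapping.lookup y (N - (1 + n))))"
      by simp
    then show ?thesis
      using assms by (simp add: lA_def lsh_single mul_single_left lookup_lsh sg_mult sg_sg power_int_add diff_diff_eq mult_ac)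
  qed
  then show ?case by (rule poly_mapping_eqI)
qed (simp add: lA_def lsh_add mul_add_left)

lemma mul_lD: assumes "q \<noteq> 0" shows "mul q (lD q x) y = lD q (mul q x y)"
proof (induction x rule: poly_mapping_single_induct)
  case (single n \<beta>)
  have "Poly_Mapping.lookup (mul q (lD q (Poly_Mapping.single n \<beta>)) y) N = Poly_Mapping.lookup (lD q (mul q (Poly_Mapping.single n \<beta>) y)) N" for N
  proof -
    have pw: "q powi (n - 1) = inverse q * q powi n" using assms by (simp add: power_int_diff field_simps)
    have "kD q n * kap q (n - 1) (N + 1 - n) = kD q (N + 1) * sg (inverse q) (kap q n (N + 1 - n))"
      using kap_D[OF assms, of n "N + 1 - n"] by (simp add: add.commute)
    then have "(kD q n * kap q (n - 1) (N + 1 - n)) * (sg (inverse q) \<beta> * sg (inverse q * q powi n) (Poly_Mapping.lookup y (N + 1 - n))) =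
        (kD q (N + 1) * sg (inverse q) (kap q n (N + 1 - n))) * (sg (inverse q) \<beta> * sg (inverse q * q powi n) (Poly_Mapping.lookup y (N + 1 - n)))"
      by simp
    then show ?thesis
      using assms by (simp add: lD_def lsh_single mul_single_left lookup_lsh sg_mult sg_sg pw diff_diff_eq2 mult_ac)
  qed
  then show ?case by (rule poly_mapping_eqI)
qed (simp add: lD_def lsh_add mul_add_left)

lemma mul_scl: "mul q (scl \<beta> x) y = scl \<beta> (mul q x y)"
proof (induction x rule: poly_mapping_single_induct)
  case (single n \<gamma>)
  then show ?case by (intro poly_mapping_eqI) (simp add: scl_single mul_single_left lookup_lsh lookup_scl mult.assoc)
qed (simp add: scl_add mul_add_left)

lemma lA_pow: "(lA q ^^ m) e0 = Poly_Mapping.single (int m) 1"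
  by (induction m) (simp_all add: lA_def lsh_single kA_def wt_one add.commute)

lemma lD_pow: "(lD q ^^ m) e0 = Poly_Mapping.single (- int m) 1"
  by (induction m) (simp_all add: lD_def lsh_single kD_def wt_one)

text \<open>Left multiplications by coefficients, \<open>a\<close> and \<open>d\<close> produce
  everything from \<open>1\<close>. As each of them commutes with right multiplication,
  associativity becomes an induction on the left factor, and no general cocycle identity for
  \<open>kap\<close> has to be checked.\<close>

lemma wspace_gen_induct [case_names one add scl A D]:
  fixes P :: "'k::field wspace \<Rightarrow> bool"
  assumes "P e0" "\<And>x y. P x \<Longrightarrow> P y \<Longrightarrow> P (x + y)" "\<And>\<beta> x. P x \<Longrightarrow> P (scl \<beta> x)"
    "\<And>x. P x \<Longrightarrow> P (lA q x)" "\<And>x. P x \<Longrightarrow> P (lD q x)"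
  shows "P x"
proof (induction x rule: poly_mapping_single_induct)
  case (single n \<beta>)
  have "P ((lA q ^^ m) e0)" "P ((lD q ^^ m) e0)" for m by (induction m) (auto intro: assms)
  then have "P (Poly_Mapping.single n 1)" 
    by (cases n) (metis lA_pow, metis lD_pow)
  then have "P (scl \<beta> (Poly_Mapping.single n 1))" by (rule assms)
  then show ?case by (simp add: scl_single)
qed (rule assms)

lemma mul_assoc: assumes "q \<noteq> 0" shows "mul q (mul q x y) z = mul q x (mul q y z)"
  by (induction x rule: wspace_gen_induct[where q = q])
    (simp_all add: mul_add_left mul_scl mul_lA[OF assms] mul_lD[OF assms])

section \<open>The model as a ring, commutative at parameter 1\<close>

definition Wring :: "'k::field \<Rightarrow> 'k wspace ring" where
  "Wring q = \<lparr>carrier = UNIV, monoid.mult = mul q, one = e0, ring.zero = 0, add = (+)\<rparr>"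

lemma Wring_simps [simp]: "carrier (Wring q) = UNIV" "x \<otimes>\<^bsub>Wring q\<^esub> y = mul q x y" "x \<oplus>\<^bsub>Wring q\<^esub> y = x + y"
  "\<one>\<^bsub>Wring q\<^esub> = e0" "\<zero>\<^bsub>Wring q\<^esub> = 0"
  by (simp_all add: Wring_def)

lemma ring_Wring: assumes "q \<noteq> 0" shows "ring (Wring q)"
proof -
  have "\<exists>y. y + x = 0" for x :: "'a wspace" using add.left_inverse by blast
  then show ?thesis
    by (intro ringI abelian_groupI monoidI)
      (auto simp: mul_assoc[OF assms] mul_add_left mul_add_right add_ac)
qed

lemma lA_eq: "lA q x = mul q (Poly_Mapping.single 1 1) x"
  by (simp add: mul_single_left lA_def kap_def)

lemma lD_eq: "lD q x = mul q (Poly_Mapping.single (- 1) 1) x"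
  by (simp add: mul_single_left lD_def kap_def wt_one)

lemma lA_lD: "q \<noteq> 0 \<Longrightarrow> lA q (lD q x) = scl (tt q) x"
  using kA_kD[of q "k - 1" for k] by (simp add: lA_def lD_def lsh_lsh scl_def)

lemma lD_lA: "q \<noteq> 0 \<Longrightarrow> lD q (lA q x) = scl (tt (inverse q)) x"
  using kD_kA[of q] by (simp add: lA_def lD_def lsh_lsh scl_def)

lemma lA_scl: "lA q (scl \<beta> x) = scl (sg q \<beta>) (lA q x)"
  by (simp add: lA_def scl_def lsh_lsh mult.commute)

lemma lD_scl: "lD q (scl \<beta> x) = scl (sg (inverse q) \<beta>) (lD q x)"
  by (simp add: lD_def scl_def lsh_lsh mult.commute)

text \<open>At parameter \<open>1\<close>, right multiplication by \<open>a\<close>,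
  \<open>d\<close> or a coefficient equals left multiplication by it; associativity extends this to
  all \<open>y\<close> by induction over the generators.\<close>

lemma mul_one_commute: "mul 1 x y = mul (1::'k::field) y x"
proof -
  note as = mul_assoc[of "1::'k"]
  have kP: "kapP 1 m 1 = (1::'k bpoly)" for m by (induction m) (auto simp: kA_def wt_one)
  have kN: "kapN 1 m 1 = (if m = 0 then 1 else tt (1::'k))" for m by (induction m) (auto simp: kD_def)
  have kP': "kapP 1 m (- 1) = (if m = 0 then 1 else tt (1::'k))" for m by (induction m) (auto simp: kA_def)
  have kN': "kapN 1 m (- 1) = (1::'k bpoly)" for m by (induction m) (auto simp: kD_def wt_one)
  have A: "mul 1 x (Poly_Mapping.single 1 1) = lA (1::'k) x" for x
  proof (induction x rule: poly_mapping_single_induct)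
    case (single n \<beta>)
    show ?case by (simp add: mul_single_single lA_def lsh_single kap_def kP kN kA_def wt_one mult.commute add.commute)
  qed (simp add: mul_add_left lA_def lsh_add)
  have D: "mul 1 x (Poly_Mapping.single (- 1) 1) = lD (1::'k) x" for x
  proof (induction x rule: poly_mapping_single_induct)
    case (single n \<beta>)
    show ?case by (simp add: mul_single_single lD_def lsh_single kap_def kP' kN' kD_def wt_one mult.commute add.commute)
  qed (simp add: mul_add_left lD_def lsh_add)
  have B: "mul 1 x (Poly_Mapping.single 0 \<beta>) = scl \<beta> (x::'k wspace)" for x \<beta>
    by (rule poly_mapping_eqI) (simp add: lookup_mul_coef_right lookup_scl mult.commute)
  show ?thesis
  proof (induction y rule: wspace_gen_induct[where q = 1])
    case (scl \<beta> y)
    have "mul 1 x (scl \<beta> y) = mul 1 (mul 1 x (Poly_Mapping.single 0 \<beta>)) y" by (simp add: as mul_coef)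
    also have "\<dots> = scl \<beta> (mul 1 x y)" by (simp add: B mul_scl)
    finally show ?case using scl by (simp add: mul_scl)
  next
    case (A y)
    have "mul 1 x (lA 1 y) = mul 1 (mul 1 x (Poly_Mapping.single 1 1)) y" by (simp add: as lA_eq)
    also have "\<dots> = lA 1 (mul 1 x y)" by (simp add: \<open>\<And>x. mul 1 x (Poly_Mapping.single 1 1) = lA (1::'k) x\<close> mul_lA)
    finally show ?case using A by (simp add: mul_lA)
  next
    case (D y)
    have "mul 1 x (lD 1 y) = mul 1 (mul 1 x (Poly_Mapping.single (- 1) 1)) y" by (simp add: as lD_eq)
    also have "\<dots> = lD 1 (mul 1 x y)" by (simp add: \<open>\<And>x. mul 1 x (Poly_Mapping.single (- 1) 1) = lD (1::'k) x\<close> mul_lD)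
    finally show ?case using D by (simp add: mul_lD)
  qed (simp_all add: mul_add_left mul_add_right)
qed

lemma cring_Wring_one: "cring (Wring (1::'k::field))"
proof -
  interpret ring "Wring (1::'k)" by (rule ring_Wring) simp
  show ?thesis
    by (intro cring.intro comm_monoid.intro comm_monoid_axioms.intro ring_axioms monoid_axioms)
      (simp add: mul_one_commute)
qed

section \<open>Algebras presented by the relations\<close>

text \<open>Linear extension from basis elements. The coefficient is an argument of
  \<open>F\<close>, so the two-level space \<open>wspace\<close> is handled by nesting.\<close>

definition plin :: "('i \<Rightarrow> 'c::zero \<Rightarrow> 'd::comm_monoid_add) \<Rightarrow> ('i \<Rightarrow>\<^sub>0 'c) \<Rightarrow> 'd" where
  "plin F w = (\<Sum>k\<in>Poly_Mapping.keys w. F k (Poly_Mapping.lookup w k))"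

lemma plin_superset:
  assumes "\<And>k. F k 0 = 0" "finite S" "Poly_Mapping.keys w \<subseteq> S"
  shows "plin F w = (\<Sum>k\<in>S. F k (Poly_Mapping.lookup w k))"
  unfolding plin_def using assms by (intro sum.mono_neutral_left ballI) (simp_all add: in_keys_iff)

lemma plin_add:
  fixes F :: "'i \<Rightarrow> 'c::comm_monoid_add \<Rightarrow> 'd::comm_monoid_add"
  assumes "\<And>k. F k 0 = 0" "\<And>k x y. F k (x + y) = F k x + F k y"
  shows "plin F (v + w) = plin F v + plin F w"
proof -
  let ?S = "Poly_Mapping.keys v \<union> Poly_Mapping.keys w"
  have "Poly_Mapping.keys (v + w) \<subseteq> ?S" by (rule keys_add)
  then show ?thesis
    using assms(1) by (simp add: plin_superset[of F ?S] lookup_add assms(2) sum.distrib)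
qed

lemma plin_single: "F k 0 = 0 \<Longrightarrow> plin F (Poly_Mapping.single k c) = F k c"
  by (cases "c = 0") (simp_all add: plin_def)

lemma plin_zero [simp]: "plin F 0 = 0"
  by (simp add: plin_def)

lemma poly_mapping_eq_sum_single:
  fixes w :: "'i \<Rightarrow>\<^sub>0 'c::comm_monoid_add"
  shows "w = (\<Sum>k\<in>Poly_Mapping.keys w. Poly_Mapping.single k (Poly_Mapping.lookup w k))"
proof -
  have "plin Poly_Mapping.single w = w"
    by (induction w rule: poly_mapping_single_induct) (simp_all add: plin_single plin_add single_add)
  then show ?thesis by (simp add: plin_def)
qed

text \<open>The part without negative powers of \<open>D\<close>; it turns out to be the image of
  the coordinate ring of \<open>M_2\<close>.\<close>

definition wpos :: "'k::field wspace \<Rightarrow> bool" where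
  "wpos w \<longleftrightarrow> (\<forall>n i j l. Poly_Mapping.lookup (Poly_Mapping.lookup w n) (i, j, l) \<noteq> 0 \<longrightarrow> l \<ge> 0)"

lemma wpos_induct [consumes 1, case_names zero add single]:
  assumes "wpos w" and "P 0" and "\<And>v w. wpos v \<Longrightarrow> wpos w \<Longrightarrow> P v \<Longrightarrow> P w \<Longrightarrow> P (v + w)"
    and "\<And>n i j l x. P (Poly_Mapping.single n (Poly_Mapping.single (i, j, int l) x))"
  shows "P w"
proof -
  let ?Q = "\<lambda>w. wpos w \<and> P w"
  have add: "?Q (v + w)" if "?Q v" "?Q w" for v w
    using that assms(3) unfolding wpos_def by (simp add: lookup_add) (metis add.right_neutral)
  have zero: "?Q 0" using assms(2) by (simp add: wpos_def)
  have sum: "?Q (sum F A)" if "\<And>a. a \<in> A \<Longrightarrow> ?Q (F a)" for F and A :: "'b set"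
    using that by (induction A rule: infinite_finite_induct) (auto simp: zero add simp del: plus_poly_mapping.rep_eq)
  have sum': "?Q (sum F A)" if "\<And>a. a \<in> A \<Longrightarrow> ?Q (F a)" for F and A :: "(nat \<times> nat \<times> int) set"
    using that by (induction A rule: infinite_finite_induct) (auto simp: zero add simp del: plus_poly_mapping.rep_eq)
  have sum'': "?Q (sum F A)" if "\<And>a. a \<in> A \<Longrightarrow> ?Q (F a)" for F and A :: "int set"
    using that by (induction A rule: infinite_finite_induct) (auto simp: zero add simp del: plus_poly_mapping.rep_eq)
  have "?Q (Poly_Mapping.single n (Poly_Mapping.lookup w n))" for n
  proof -
    have "?Q (Poly_Mapping.single n (Poly_Mapping.single k (Poly_Mapping.lookup (Poly_Mapping.lookup w n) k)))"
      if k: "k \<in> Poly_Mapping.keys (Poly_Mapping.lookup w n)" for k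
    proof -
      obtain i j l where ijl: "k = (i, j, l)" by (cases k)
      have "l \<ge> 0" using assms(1) k unfolding wpos_def ijl by (auto simp: in_keys_iff)
      then have "k = (i, j, int (nat l))" using ijl by simp
      moreover have "wpos (Poly_Mapping.single n (Poly_Mapping.single (i, j, int (nat l)) x))" for x
        by (auto simp: wpos_def lookup_single when_def split: if_splits)
      ultimately show ?thesis using assms(4)[of n i j "nat l"] by metis
    qed
    then have "?Q (\<Sum>k\<in>Poly_Mapping.keys (Poly_Mapping.lookup w n).
       Poly_Mapping.single n (Poly_Mapping.single k (Poly_Mapping.lookup (Poly_Mapping.lookup w n) k)))"
      by (rule sum')
    moreover have "(\<Sum>k\<in>A. Poly_Mapping.single n (G k)) = Poly_Mapping.single n (sum G A)" 
      for G :: "nat \<times> nat \<times> int \<Rightarrow> 'a bpoly" and A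
      by (induction A rule: infinite_finite_induct) (auto simp: single_add)
    ultimately show ?thesis
      using poly_mapping_eq_sum_single[of "Poly_Mapping.lookup w n"] by simp
  qed
  then show ?thesis using poly_mapping_eq_sum_single[of w] sum''[of "Poly_Mapping.keys w"] by metis
qed

lemma bpoly_monom: "Poly_Mapping.single (i, j, int l) x = cst x * (bv ^ i * (cv ^ j * Dv (int l)))"
proof -
  have "bv ^ i = (Poly_Mapping.single (i, 0, 0) 1 :: 'a bpoly)" 
    by (induction i) (simp_all add: bv_def mult_single bpoly_zero_index)
  moreover have "cv ^ j = (Poly_Mapping.single (0, j, 0) 1 :: 'a bpoly)" 
    by (induction j) (simp_all add: cv_def mult_single bpoly_zero_index)
  ultimately show ?thesis by (simp add: Dv_def mult_single)
qed

text \<open>The common setting of the free algebra modulo the quantum relations and of the polynomial ring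
  (with \<open>q = 1\<close>, \<open>I = {0}\<close>); \<open>h\<close> is evaluation in the model. The normal form of \<open>h f\<close> is congruent
  to \<open>f\<close> modulo \<open>I\<close>, so \<open>I\<close> is the whole kernel of \<open>h\<close>.\<close>

locale presentation =
  fixes q :: "'k::field" and ga gb gc gd :: "'f::ring_1" and sc :: "'k \<Rightarrow> 'f"
    and h :: "'f \<Rightarrow> 'k wspace" and I :: "'f set"
  assumes q0: "q \<noteq> 0"
    and I0: "0 \<in> I" and I_add: "f \<in> I \<Longrightarrow> g \<in> I \<Longrightarrow> f + g \<in> I"
    and I_left: "g \<in> I \<Longrightarrow> f * g \<in> I" and I_right: "g \<in> I \<Longrightarrow> g * f \<in> I"
    and sc_one: "sc 1 = 1" and sc_mult: "sc c * sc c' = sc (c * c')" and sc_add: "sc (c + c') = sc c + sc c'"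
    and sc_central: "f * sc c = sc c * f"
    and rel: "ga * gb - sc q * gb * ga \<in> I" "ga * gc - sc q * gc * ga \<in> I" "gb * gd - sc q * gd * gb \<in> I"
      "gc * gd - sc q * gd * gc \<in> I" "gb * gc - gc * gb \<in> I" "ga * gd - gd * ga - sc (q - inverse q) * gb * gc \<in> I"
    and det: "g \<in> {ga, gb, gc, gd} \<Longrightarrow> g * (ga * gd - sc q * gb * gc) - (ga * gd - sc q * gb * gc) * g \<in> I"
    and h_one: "h 1 = 1" and h_add: "h (f + g) = h f + h g" and h_sc: "h (sc c * f) = scl (cst c) (h f)"
    and h_gen: "h (ga * f) = lA q (h f)" "h (gb * f) = scl bv (h f)" "h (gc * f) = scl cv (h f)" "h (gd * f) = lD q (h f)"
    and h_I: "f \<in> I \<Longrightarrow> h f = 0"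
    and gen_induct: "P 1 \<Longrightarrow> (\<And>f g. P f \<Longrightarrow> P g \<Longrightarrow> P (f + g)) \<Longrightarrow> (\<And>c f. P f \<Longrightarrow> P (sc c * f)) \<Longrightarrow>
      (\<And>f g. P f \<Longrightarrow> g \<in> {ga, gb, gc, gd} \<Longrightarrow> P (g * f)) \<Longrightarrow> P f"
begin

definition Dq :: 'f where "Dq = ga * gd - sc q * gb * gc"
definition eqI :: "'f \<Rightarrow> 'f \<Rightarrow> bool" (infix "\<bumpeq>" 50) where "f \<bumpeq> g \<longleftrightarrow> f - g \<in> I"

lemma I_minus: "x \<in> I \<Longrightarrow> - x \<in> I" using I_left[of x "- 1"] by simp

lemma eqI_refl [simp]: "f \<bumpeq> f" using I0 by (simp add: eqI_def)
lemma eqI_sym: "f \<bumpeq> g \<Longrightarrow> g \<bumpeq> f" using I_minus[of "f - g"] by (simp add: eqI_def)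
lemma eqI_trans [trans]: "f \<bumpeq> g \<Longrightarrow> g \<bumpeq> k \<Longrightarrow> f \<bumpeq> k" using I_add[of "f - g" "g - k"] by (simp add: eqI_def)
lemma eqI_left: "f \<bumpeq> g \<Longrightarrow> x * f \<bumpeq> x * g" using I_left[of "f - g" x] by (simp add: eqI_def algebra_simps)
lemma eqI_right: "f \<bumpeq> g \<Longrightarrow> f * x \<bumpeq> g * x" using I_right[of "f - g" x] by (simp add: eqI_def algebra_simps)
lemma eqI_add: "f \<bumpeq> g \<Longrightarrow> f' \<bumpeq> g' \<Longrightarrow> f + f' \<bumpeq> g + g'"
  using I_add[of "f - g" "f' - g'"] by (simp add: eqI_def algebra_simps)

definition qc :: "'k \<Rightarrow> 'f \<Rightarrow> 'f \<Rightarrow> bool" where "qc r u v \<longleftrightarrow> u * v \<bumpeq> sc r * (v * u)"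

lemma sc_left: "f * (sc x * g) = sc x * (f * g)"
  by (metis sc_central mult.assoc)

lemma sc_sc: "sc x * (sc y * f) = sc (x * y) * f"
  by (simp add: sc_mult[symmetric] mult.assoc)

lemma qc_move: assumes "qc r u v" shows "u * (v * f) \<bumpeq> sc r * (v * (u * f))"
  using eqI_right[OF assms[unfolded qc_def], of f] by (simp add: mult.assoc)

lemma qc_pow: assumes "qc r u v" shows "qc (r ^ n) u (v ^ n)"
proof (induction n)
  case (Suc n)
  have "u * (v * v ^ n) \<bumpeq> sc r * (v * (u * v ^ n))" by (rule qc_move[OF assms])
  also have "\<dots> \<bumpeq> sc r * (v * (sc (r ^ n) * (v ^ n * u)))" using Suc by (intro eqI_left) (simp add: qc_def)
  also have "\<dots> = sc (r ^ Suc n) * (v ^ Suc n * u)" by (simp add: sc_left[of v] sc_sc mult.assoc)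
  finally show ?case by (simp add: qc_def)
qed (simp add: qc_def sc_one)

lemma qc_inv: assumes "qc r u v" "r \<noteq> 0" shows "qc (inverse r) v u"
proof -
  have "sc (inverse r) * (u * v) \<bumpeq> sc (inverse r) * (sc r * (v * u))"
    using assms(1) by (intro eqI_left) (simp add: qc_def)
  then show ?thesis using assms(2) by (simp add: qc_def sc_sc sc_one eqI_sym)
qed

lemma qc_rel: "qc q ga gb" "qc q ga gc" "qc (inverse q) gd gb" "qc (inverse q) gd gc" "qc 1 gb gc" "qc 1 gc gb"
  "qc 1 gb gb" "qc 1 gc gc"
  using rel qc_inv[of q gb gd] qc_inv[of q gc gd] qc_inv[of 1 gb gc] q0
  by (simp_all add: qc_def eqI_def mult.assoc sc_one)

lemma qc_det: "x \<in> {ga, gb, gc, gd} \<Longrightarrow> qc 1 x Dq"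
  using det by (simp add: qc_def eqI_def Dq_def sc_one)

definition NF :: "'k \<Rightarrow> nat \<Rightarrow> nat \<Rightarrow> nat \<Rightarrow> 'f \<Rightarrow> 'f" where
  "NF x i j l f = sc x * (gb ^ i * (gc ^ j * (Dq ^ l * f)))"

lemmas sc_lefts = sc_left[of gb] sc_left[of gc] sc_left[of "gb ^ i" for i] sc_left[of "gc ^ i" for i] sc_left[of "Dq ^ i" for i]

lemma NF_move:
  assumes "qc r u gb" "qc s u gc" "qc 1 u Dq"
  shows "u * NF x i j l f \<bumpeq> NF (x * (r ^ i * s ^ j)) i j l (u * f)"
proof -
  have "u * (gb ^ i * (gc ^ j * (Dq ^ l * f))) \<bumpeq> sc (r ^ i) * (gb ^ i * (u * (gc ^ j * (Dq ^ l * f))))"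
    by (intro qc_move qc_pow assms)
  also have "\<dots> \<bumpeq> sc (r ^ i) * (gb ^ i * (sc (s ^ j) * (gc ^ j * (u * (Dq ^ l * f)))))"
    by (intro eqI_left qc_move qc_pow assms)
  also have "\<dots> \<bumpeq> sc (r ^ i) * (gb ^ i * (sc (s ^ j) * (gc ^ j * (sc (1 ^ l) * (Dq ^ l * (u * f))))))"
    by (intro eqI_left qc_move qc_pow assms)
  also have "\<dots> = sc (r ^ i * s ^ j) * (gb ^ i * (gc ^ j * (Dq ^ l * (u * f))))"
    by (simp add: sc_lefts sc_sc sc_one)
  finally have "sc x * (u * (gb ^ i * (gc ^ j * (Dq ^ l * f)))) \<bumpeq> sc x * (sc (r ^ i * s ^ j) * (gb ^ i * (gc ^ j * (Dq ^ l * (u * f)))))"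
    by (rule eqI_left)
  then show ?thesis by (simp add: NF_def sc_left[of u] sc_sc)
qed

lemma NF_add: "NF x i j l (f + g) = NF x i j l f + NF x i j l g"
  and NF_sc: "NF x i j l (sc y * f) = NF (x * y) i j l f"
  and NF_D: "NF x i j l (Dq * f) = NF x i j (Suc l) f"
  by (simp_all add: NF_def distrib_left sc_lefts sc_sc power_Suc2 mult.assoc del: power_Suc)

lemma NF_bc: "gb * NF x i j l f = NF x (Suc i) j l f" "gc * NF x i j l f \<bumpeq> NF x i (Suc j) l f"
proof -
  show "gb * NF x i j l f = NF x (Suc i) j l f" by (simp add: NF_def sc_lefts mult.assoc)
  have "gc * (gb ^ i * (gc ^ j * (Dq ^ l * f))) \<bumpeq> sc (1 ^ i) * (gb ^ i * (gc * (gc ^ j * (Dq ^ l * f))))"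
    by (intro qc_move qc_pow qc_rel)
  then have "sc x * (gc * (gb ^ i * (gc ^ j * (Dq ^ l * f)))) \<bumpeq> sc x * (sc (1 ^ i) * (gb ^ i * (gc * (gc ^ j * (Dq ^ l * f)))))"
    by (rule eqI_left)
  then show "gc * NF x i j l f \<bumpeq> NF x i (Suc j) l f" by (simp add: NF_def sc_lefts sc_one mult.assoc)
qed

lemma NF_cong: "f \<bumpeq> g \<Longrightarrow> NF x i j l f \<bumpeq> NF x i j l g"
  unfolding NF_def by (intro eqI_left)

lemma NF_bc_in: "NF x i j l (gb * (gc * f)) \<bumpeq> NF x (Suc i) (Suc j) l f"
proof -
  have "NF x i j l (gb * (gc * f)) \<bumpeq> gb * NF x i j l (gc * f)"
    by (rule eqI_sym) (use NF_move[OF qc_rel(7) qc_rel(5) qc_det, of x i j l "gc * f"] in simp)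
  also have "\<dots> \<bumpeq> gb * (gc * NF x i j l f)"
    by (rule eqI_left, rule eqI_sym) (use NF_move[OF qc_rel(6) qc_rel(8) qc_det, of x i j l f] in simp)
  also have "\<dots> \<bumpeq> gb * NF x i (Suc j) l f" by (intro eqI_left NF_bc)
  also have "\<dots> = NF x (Suc i) (Suc j) l f" by (rule NF_bc)
  finally show ?thesis .
qed

definition an :: "int \<Rightarrow> 'f" where "an n = (if n \<ge> 0 then ga ^ nat n else gd ^ nat (- n))"

lemma ga_an: "ga * an n = (if n \<ge> 0 then an (n + 1) else Dq * an (n + 1) + sc q * (gb * (gc * an (n + 1))))"
proof (cases "n \<ge> 0")
  case False
  then obtain m where m: "n = - int (Suc m)" by (metis int_cases not_le of_nat_0_le_iff)
  have "an n = gd * an (n + 1)" unfolding an_def m by (cases m) (simp_all add: nat_add_distrib)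
  then show ?thesis using False by (simp add: Dq_def algebra_simps)
next
  case True
  then have "nat (n + 1) = Suc (nat n)" by simp
  then show ?thesis using True by (simp add: an_def)
qed

lemma gd_an_neg: "n \<le> 0 \<Longrightarrow> gd * an n = an (n - 1)"
proof -
  assume "n \<le> 0"
  then obtain m where m: "n = - int m" by (metis int_cases2 le_minus_iff minus_zero nle_le of_nat_0_le_iff order_refl of_nat_0)
  show ?thesis unfolding an_def m by (cases m) (simp_all add: nat_add_distrib)
qed

lemma gd_an_pos: "n > 0 \<Longrightarrow> gd * an n \<bumpeq> Dq * an (n - 1) + sc (inverse q) * (gb * (gc * an (n - 1)))"
proof -
  assume "n > 0"
  then obtain m where m: "n = int (Suc m)" by (metis gr0_conv_Suc zero_less_imp_eq_int)
  have "nat n = Suc m" "nat (n - 1) = m" using m by auto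
  then have an: "an n = ga * an (n - 1)" using \<open>n > 0\<close> by (simp add: an_def)
  have "ga * gd - sc (q - inverse q) * gb * gc \<bumpeq> gd * ga"
    using rel(6) by (simp add: eqI_def algebra_simps)
  moreover have "ga * gd - sc (q - inverse q) * gb * gc = Dq + sc (inverse q) * (gb * gc)"
    using sc_add[of "q - inverse q" "inverse q"] by (simp add: Dq_def algebra_simps)
  ultimately have "gd * ga \<bumpeq> Dq + sc (inverse q) * (gb * gc)" by (simp add: eqI_sym)
  then have "gd * ga * an (n - 1) \<bumpeq> (Dq + sc (inverse q) * (gb * gc)) * an (n - 1)" by (rule eqI_right)
  then show ?thesis by (simp add: an algebra_simps)
qed

text \<open>A linear section of \<open>h\<close> on \<open>wpos\<close>: each basis vector goes to
  its ordered word in the generators. Negative exponents of \<open>D\<close> are truncated by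
  \<open>nat\<close>, so it is meaningful on \<open>wpos\<close> only.\<close>

definition sec :: "'k wspace \<Rightarrow> 'f" where
  "sec = plin (\<lambda>n. plin (\<lambda>k x. NF x (fst k) (fst (snd k)) (nat (snd (snd k))) (an n)))"

lemma NF_add_coef: "NF (x + y) i j l f = NF x i j l f + NF y i j l f" and NF_zero: "NF 0 i j l f = 0"
proof -
  have "sc 0 = 0" using sc_add[of 0 0] by simp
  then show "NF (x + y) i j l f = NF x i j l f + NF y i j l f" "NF 0 i j l f = 0"
    by (simp_all add: NF_def sc_add algebra_simps)
qed

lemma sec_add: "sec (v + w) = sec v + sec w"
  unfolding sec_def by (intro plin_add) (simp_all add: plin_add NF_add_coef NF_zero)

lemma sec_single: "sec (Poly_Mapping.single n (Poly_Mapping.single (i, j, l) x)) = NF x i j (nat l) (an n)"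
  by (simp add: sec_def plin_single NF_zero)

lemma sec_zero [simp]: "sec 0 = 0" by (simp add: sec_def)

text \<open>The section intertwines left multiplications modulo \<open>I\<close>: a generator
  q-commutes past \<open>b^i c^j D^l\<close>, and its product with \<open>an n\<close> is rewritten
  by the relations for \<open>a d\<close> and \<open>d a\<close>. Hence \<open>sec (h f)\<close> and
  \<open>f\<close> agree modulo \<open>I\<close> by induction on \<open>f\<close>, which bounds the
  kernel of \<open>h\<close>.\<close>

lemma sec_gen:
  assumes "wpos w"
  shows "sec (lA q w) \<bumpeq> ga * sec w" "sec (scl bv w) \<bumpeq> gb * sec w" "sec (scl cv w) \<bumpeq> gc * sec w" "sec (lD q w) \<bumpeq> gd * sec w"
  using assms
proof (induction rule: wpos_induct)
  case zero
  { case 1 then show ?case by (simp add: lA_def) next case 2 then show ?case by simp 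
    next case 3 then show ?case by simp next case 4 then show ?case by (simp add: lD_def) }
next
  case (add v w)
  { case 1 show ?case using eqI_add[OF add(3,7)] by (simp add: lA_def lsh_add sec_add distrib_left) next
    case 2 show ?case using eqI_add[OF add(4,8)] by (simp add: scl_add sec_add distrib_left) next
    case 3 show ?case using eqI_add[OF add(5,9)] by (simp add: scl_add sec_add distrib_left) next
    case 4 show ?case using eqI_add[OF add(6,10)] by (simp add: lD_def lsh_add sec_add distrib_left) }
next
  case (single n i j l x)
  { case 1
    let ?y = "x * (q ^ i * q ^ j)"
    have "ga * NF x i j l (an n) \<bumpeq> NF ?y i j l (ga * an n)"
      by (intro NF_move qc_rel qc_det) simp
    also have "\<dots> \<bumpeq> sec (lA q (Poly_Mapping.single n (Poly_Mapping.single (i, j, int l) x)))"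
    proof (cases "n \<ge> 0")
      case True
      then show ?thesis by (simp add: ga_an lA_def lsh_single kA_def wt_single sec_single power_add add.commute mult_ac)
    next
      case False
      have "nat (1 + int l) = Suc l" by simp
      then have "sec (lA q (Poly_Mapping.single n (Poly_Mapping.single (i, j, int l) x))) =
          NF ?y i j (Suc l) (an (n + 1)) + NF (?y * q) (Suc i) (Suc j) l (an (n + 1))"
        using False by (simp add: lA_def lsh_single kA_def wt_single tt_single single_add sec_add sec_single power_add add.commute mult_ac)
      moreover have "NF ?y i j l (ga * an n) \<bumpeq> NF ?y i j (Suc l) (an (n + 1)) + NF (?y * q) (Suc i) (Suc j) l (an (n + 1))"
        using False by (simp add: ga_an NF_add NF_D NF_sc del: mult.assoc) (intro eqI_add eqI_refl NF_bc_in)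
      ultimately show ?thesis by simp
    qed
    finally show ?case by (simp add: sec_single eqI_sym) 
  next
    case 2 show ?case by (simp add: scl_single bv_def mult_single sec_single NF_bc) 
  next
    case 3 show ?case using NF_bc(2) by (simp add: scl_single cv_def mult_single sec_single eqI_sym) 
  next
    case 4
    let ?y = "x * (inverse q ^ i * inverse q ^ j)"
    have "gd * NF x i j l (an n) \<bumpeq> NF ?y i j l (gd * an n)"
      by (intro NF_move qc_rel qc_det) simp
    also have "\<dots> \<bumpeq> sec (lD q (Poly_Mapping.single n (Poly_Mapping.single (i, j, int l) x)))"
    proof (cases "n \<le> 0")
      case True
      then show ?thesis 
        by (simp add: gd_an_neg lD_def lsh_single kD_def wt_single sec_single power_add mult_ac)
    next
      case False
      have "nat (1 + int l) = Suc l" by simp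
      then have "sec (lD q (Poly_Mapping.single n (Poly_Mapping.single (i, j, int l) x))) =
          NF ?y i j (Suc l) (an (n - 1)) + NF (?y * inverse q) (Suc i) (Suc j) l (an (n - 1))"
        using False by (simp add: lD_def lsh_single kD_def wt_single tt_single single_add sec_add sec_single power_add add.commute mult_ac)
      moreover have 1: "NF ?y i j l (gd * an n) \<bumpeq> NF ?y i j l (Dq * an (n - 1) + sc (inverse q) * (gb * (gc * an (n - 1))))"
        using False by (intro NF_cong gd_an_pos) simp
      moreover have 2: "NF ?y i j l (Dq * an (n - 1) + sc (inverse q) * (gb * (gc * an (n - 1)))) \<bumpeq> 
          NF ?y i j (Suc l) (an (n - 1)) + NF (?y * inverse q) (Suc i) (Suc j) l (an (n - 1))"
        unfolding NF_add NF_D NF_sc by (intro eqI_add eqI_refl NF_bc_in)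
      ultimately show ?thesis using eqI_trans[OF 1 2] by simp
    qed
    finally show ?case by (simp add: sec_single eqI_sym) }
qed

section \<open>Evaluation in the model and its kernel\<close>

lemma h_zero: "h 0 = 0" using h_add[of 0 0] by simp
lemma h_minus: "h (f - g) = h f - h g"
  using h_add[of "f - g" g] by simp

lemma h_mult: "h (f * g) = mul q (h f) (h g)"
proof (induction f rule: gen_induct)
  case (4 f x)
  then show ?case by (auto simp: mult.assoc h_gen mul_lA mul_lD mul_scl q0)
qed (simp_all add: h_one distrib_right h_add mul_add_left mult.assoc h_sc mul_scl)

lemma h_Dq: "h (Dq * f) = scl (Dv 1) (h f)"
proof -
  have "h (Dq * f) = lA q (lD q (h f)) - scl (cst q) (scl bv (scl cv (h f)))"
    by (simp add: Dq_def left_diff_distrib h_minus h_gen h_sc mult.assoc)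
  also have "\<dots> = scl (Dv 1) (h f)"
    by (rule poly_mapping_eqI) (simp add: lA_lD q0 scl_scl lookup_minus lookup_scl tt_def algebra_simps)
  finally show ?thesis .
qed

lemma h_pow: "h (gb ^ i * f) = scl (bv ^ i) (h f)" "h (gc ^ i * f) = scl (cv ^ i) (h f)" "h (Dq ^ i * f) = scl (Dv (int i)) (h f)"
  by (induction i) (simp_all add: h_gen mult.assoc scl_scl h_Dq Dv_mult Dv_zero)

lemma h_an: "h (an n) = Poly_Mapping.single n 1"
proof -
  have "h (ga ^ m) = (lA q ^^ m) 1" "h (gd ^ m) = (lD q ^^ m) 1" for m
    by (induction m) (simp_all add: h_one h_gen)
  then show ?thesis by (simp add: an_def lA_pow lD_pow)
qed

lemma h_sec: assumes "wpos w" shows "h (sec w) = w"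
  using assms
proof (induction rule: wpos_induct)
  case (single n i j l x)
  show ?case unfolding sec_single
    by (simp add: NF_def h_sc h_pow h_an scl_single bpoly_monom)
qed (simp_all add: h_zero h_add sec_add)

lemma wpos_add: "wpos v \<Longrightarrow> wpos w \<Longrightarrow> wpos (v + w)"
  unfolding wpos_def by (simp add: lookup_add) (metis add.right_neutral)

lemma wpos_single: "wpos (Poly_Mapping.single n (Poly_Mapping.single (i, j, int l) x))"
  by (auto simp: wpos_def lookup_single when_def split: if_splits)

lemma wpos_gen:
  assumes "wpos w" 
  shows "wpos (lA q w)" "wpos (lD q w)" "wpos (scl bv w)" "wpos (scl cv w)" "wpos (scl (cst x) w)"
  using assms
proof (induction rule: wpos_induct)
  case zero
  have "wpos 0" by (simp add: wpos_def)
  { case 1 then show ?case using \<open>wpos 0\<close> by (simp add: lA_def) next case 2 then show ?case using \<open>wpos 0\<close> by (simp add: lD_def)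
    next case 3 then show ?case using \<open>wpos 0\<close> by simp next case 4 then show ?case using \<open>wpos 0\<close> by simp
    next case 5 then show ?case using \<open>wpos 0\<close> by simp }
next
  case (add v w)
  { case 1 show ?case using add by (simp add: lA_def lsh_add wpos_add) next
    case 2 show ?case using add by (simp add: lD_def lsh_add wpos_add) next
    case 3 show ?case using add by (simp add: scl_add wpos_add) next
    case 4 show ?case using add by (simp add: scl_add wpos_add) next
    case 5 show ?case using add by (simp add: scl_add wpos_add) }
next
  case (single n i j l x)
  have *: "wpos (Poly_Mapping.single n (Poly_Mapping.single (i, j, int l + 1) x))" for n i j x
    using wpos_single[of n i j "Suc l" x] by (simp add: add.commute)
  { case 1 show ?case by (auto simp: lA_def lsh_single kA_def wt_single tt_single single_add intro!: wpos_add wpos_single *) next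
    case 2 show ?case by (auto simp: lD_def lsh_single kD_def wt_single tt_single single_add intro!: wpos_add wpos_single *) next
    case 3 show ?case by (simp add: scl_single bv_def mult_single wpos_single) next
    case 4 show ?case by (simp add: scl_single cv_def mult_single wpos_single) next
    case 5 show ?case by (simp add: scl_single mult_single bpoly_zero_index wpos_single) }
qed

lemma sec_sc: "sec (scl (cst c) w) = sc c * sec w"
proof (induction w rule: poly_mapping_single_induct)
  case (single n \<beta>)
  show ?case
  proof (induction \<beta> rule: poly_mapping_single_induct)
    case (single k x)
    show ?case by (cases k) (simp add: scl_single mult_single bpoly_zero_index sec_single NF_def sc_sc)
  next
    case (add f g)
    show ?case
      using add by (simp only: single_add scl_add sec_add distrib_left)
  qed
qed (simp add: scl_add sec_add distrib_left)

lemma h_wpos: "wpos (h f)" and sec_h: "sec (h f) \<bumpeq> f"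
proof -
  have one: "sec 1 = 1"
    using sec_single[of 0 0 0 0 1] by (simp add: bpoly_zero_index NF_def sc_one an_def)
  have "wpos (h f) \<and> sec (h f) \<bumpeq> f"
  proof (induction f rule: gen_induct)
    case 1
    have "wpos 1" using wpos_single[of 0 0 0 0 1] by (simp add: bpoly_zero_index)
    then show ?case by (simp add: h_one one)
  next
    case (2 f g)
    then show ?case by (simp add: h_add sec_add eqI_add wpos_add)
  next
    case (3 c f)
    then show ?case by (simp add: h_sc sec_sc eqI_left wpos_gen)
  next
    case (4 f x)
    then have "sec (h (x * f)) \<bumpeq> x * sec (h f)" by (auto simp: h_gen sec_gen)
    also have "\<dots> \<bumpeq> x * f" using 4 by (intro eqI_left) simp
    finally show ?case using 4 by (auto simp: h_gen wpos_gen)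
  qed
  then show "wpos (h f)" "sec (h f) \<bumpeq> f" by auto
qed

lemma h_eq_0_iff: "h f = 0 \<longleftrightarrow> f \<in> I"
proof
  assume "h f = 0"
  then have "0 \<bumpeq> f" using sec_h[of f] by simp
  then show "f \<in> I" using eqI_sym[of 0 f] by (simp add: eqI_def)
qed (rule h_I)

end

section \<open>Passing to the localization at the determinant\<close>

lemma scl_central: "mul q x (scl (Dv l) y) = scl (Dv l) (mul q x y)"
  by (rule poly_mapping_eqI)
    (simp add: lookup_mul lookup_scl sg_mult wt_Dv sum_distrib_left mult_ac)

text \<open>The fraction \<open>x / s^n\<close> goes to \<open>D^(-n) h x\<close>. Because
  \<open>h\<close> is injective and \<open>D\<close> is invertible in the model, equality of
  fractions is equality of these images; and a power of \<open>D\<close> moves any element of the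
  model into \<open>wpos\<close>.\<close>

lemma localization_model:
  fixes q :: "'k::field"
  assumes "q \<noteq> 0" and "central_element M s" and h: "h \<in> ring_hom M (Wring q)"
    and inj: "\<And>x. x \<in> carrier M \<Longrightarrow> h x = 0 \<Longrightarrow> x = \<zero>\<^bsub>M\<^esub>"
    and hs: "h s = Poly_Mapping.single 0 (Dv 1)"
    and surj: "\<And>w. wpos w \<Longrightarrow> w \<in> h ` carrier M"
  obtains \<theta> where "\<theta> \<in> ring_iso (localization M s) (Wring q)"
    "\<And>x n. x \<in> carrier M \<Longrightarrow> \<theta> (loc_frac M s x n) = scl (Dv (- int n)) (h x)"
proof -
  interpret central_element M s by fact
  interpret W: ring "Wring q" using assms(1) by (rule ring_Wring)
  interpret L: ring "localization M s" by (rule loc_ring)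
  have h_mult: "h (x \<otimes>\<^bsub>M\<^esub> y) = mul q (h x) (h y)" and h_add: "h (x \<oplus>\<^bsub>M\<^esub> y) = h x + h y"
    if "x \<in> carrier M" "y \<in> carrier M" for x y
    using ring_hom_mult[OF h that] ring_hom_add[OF h that] by simp_all
  have h_one: "h \<one>\<^bsub>M\<^esub> = 1" using ring_hom_one[OF h] by simp
  have h_pow: "h (s [^]\<^bsub>M\<^esub> n \<otimes>\<^bsub>M\<^esub> x) = scl (Dv (int n)) (h x)" if "x \<in> carrier M" for n :: nat and x
    using that
  proof (induction n arbitrary: x)
    case 0
    then show ?case by (simp add: Dv_zero)
  next
    case (Suc n)
    have "h (s [^]\<^bsub>M\<^esub> Suc n \<otimes>\<^bsub>M\<^esub> x) = h (s [^]\<^bsub>M\<^esub> n \<otimes>\<^bsub>M\<^esub> (s \<otimes>\<^bsub>M\<^esub> x))" using Suc.prems by (simp add: m_assoc)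
    also have "\<dots> = scl (Dv (int n)) (h (s \<otimes>\<^bsub>M\<^esub> x))" using Suc.prems by (intro Suc.IH) simp
    also have "\<dots> = scl (Dv (int (Suc n))) (h x)"
      using Suc.prems by (simp add: h_mult[OF s_closed] hs mul_coef scl_scl Dv_mult add.commute)
    finally show ?case .
  qed
  have h0: "h \<zero>\<^bsub>M\<^esub> = 0" using h_add[of "\<zero>\<^bsub>M\<^esub>" "\<zero>\<^bsub>M\<^esub>"] by simp
  have h_inj: "x = y" if "x \<in> carrier M" "y \<in> carrier M" "h x = h y" for x y
  proof -
    have "h (x \<oplus>\<^bsub>M\<^esub> \<ominus>\<^bsub>M\<^esub> y) = h (y \<oplus>\<^bsub>M\<^esub> \<ominus>\<^bsub>M\<^esub> y)" using that by (simp add: h_add)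
    then have "h (x \<oplus>\<^bsub>M\<^esub> \<ominus>\<^bsub>M\<^esub> y) = 0" using that by (simp add: r_neg h0)
    then have "x \<oplus>\<^bsub>M\<^esub> \<ominus>\<^bsub>M\<^esub> y = \<zero>\<^bsub>M\<^esub>" using that by (intro inj) auto
    then show ?thesis using that by (metis a_inv_closed minus_equality minus_minus)
  qed
  define \<theta> where "\<theta> U = (SOME w. \<exists>x n. x \<in> carrier M \<and> U = loc_frac M s x n \<and> w = scl (Dv (- int n)) (h x))" for U
  have scl_cancel: "v = w" if "scl (Dv l) v = scl (Dv l) w" for l and v w :: "'k wspace"
    using arg_cong[OF that, of "scl (Dv (- l))"] by (simp add: scl_scl Dv_mult Dv_zero)
  have wd: "loc_frac M s x n = loc_frac M s y m \<longleftrightarrow> scl (Dv (- int n)) (h x) = scl (Dv (- int m)) (h y)"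
    if xy: "x \<in> carrier M" "y \<in> carrier M" for x y n m
  proof
    assume "loc_frac M s x n = loc_frac M s y m"
    then obtain k where "s [^]\<^bsub>M\<^esub> (k + m) \<otimes>\<^bsub>M\<^esub> x = s [^]\<^bsub>M\<^esub> (k + n) \<otimes>\<^bsub>M\<^esub> y" using loc_frac_eq_iff[OF xy] by blast
    then have "scl (Dv (int (k + m))) (h x) = scl (Dv (int (k + n))) (h y)" using h_pow xy by metis
    then have "scl (Dv (- int (k + n + m))) (scl (Dv (int (k + m))) (h x)) = scl (Dv (- int (k + n + m))) (scl (Dv (int (k + n))) (h y))"
      by simp
    then show "scl (Dv (- int n)) (h x) = scl (Dv (- int m)) (h y)" by (simp add: scl_scl Dv_mult)
  next
    assume "scl (Dv (- int n)) (h x) = scl (Dv (- int m)) (h y)"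
    then have "scl (Dv (int (n + m))) (scl (Dv (- int n)) (h x)) = scl (Dv (int (n + m))) (scl (Dv (- int m)) (h y))" by simp
    then have "scl (Dv (int m)) (h x) = scl (Dv (int n)) (h y)" by (simp add: scl_scl Dv_mult)
    then have "s [^]\<^bsub>M\<^esub> m \<otimes>\<^bsub>M\<^esub> x = s [^]\<^bsub>M\<^esub> n \<otimes>\<^bsub>M\<^esub> y" using xy by (intro h_inj) (simp_all add: h_pow)
    then show "loc_frac M s x n = loc_frac M s y m" using xy by (intro loc_frac_eqI[where k = 0]) auto
  qed
  have \<theta>: "\<theta> (loc_frac M s x n) = scl (Dv (- int n)) (h x)" if "x \<in> carrier M" for x n
    unfolding \<theta>_def
  proof (rule some_equality)
    show "\<exists>x' n'. x' \<in> carrier M \<and> loc_frac M s x n = loc_frac M s x' n' \<and> scl (Dv (- int n)) (h x) = scl (Dv (- int n')) (h x')"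
      using that by blast
    show "w = scl (Dv (- int n)) (h x)"
      if "\<exists>x' n'. x' \<in> carrier M \<and> loc_frac M s x n = loc_frac M s x' n' \<and> w = scl (Dv (- int n')) (h x')" for w
      using that wd \<open>x \<in> carrier M\<close> by metis
  qed
  have "\<theta> \<in> ring_hom (localization M s) (Wring q)"
  proof (rule ring_hom_memI)
    show "\<theta> \<one>\<^bsub>localization M s\<^esub> = \<one>\<^bsub>Wring q\<^esub>" by (simp add: loc_one \<theta> h_one Dv_zero)
    fix U V assume "U \<in> carrier (localization M s)" "V \<in> carrier (localization M s)"
    then obtain x n y m where xy: "x \<in> carrier M" "y \<in> carrier M"
      "U = loc_frac M s x n" "V = loc_frac M s y m" unfolding loc_carrier by blast
    show "\<theta> (U \<otimes>\<^bsub>localization M s\<^esub> V) = \<theta> U \<otimes>\<^bsub>Wring q\<^esub> \<theta> V"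
      using xy by (simp add: loc_mult \<theta> h_mult scl_central mul_scl scl_scl Dv_mult add.commute)
    have "\<theta> (U \<oplus>\<^bsub>localization M s\<^esub> V) = scl (Dv (- int (n + m))) (scl (Dv (int m)) (h x) + scl (Dv (int n)) (h y))"
      using xy by (simp add: loc_add \<theta> h_add h_pow)
    then show "\<theta> (U \<oplus>\<^bsub>localization M s\<^esub> V) = \<theta> U \<oplus>\<^bsub>Wring q\<^esub> \<theta> V"
      using xy by (simp add: \<theta> scl_add scl_scl Dv_mult)
  qed simp
  moreover have "bij_betw \<theta> (carrier (localization M s)) (carrier (Wring q))"
  proof (rule bij_betw_imageI)
    show "inj_on \<theta> (carrier (localization M s))"
      by (rule inj_onI) (metis loc_carrier \<theta> wd)
    have "w \<in> \<theta> ` carrier (localization M s)" for w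
    proof -
      \<comment> \<open>An upper bound \<open>N\<close> of this set of negated exponents clears all
        denominators of \<open>w\<close> at once.\<close>
      have "finite (\<Union>n\<in>Poly_Mapping.keys w. (\<lambda>k. nat (- snd (snd k))) ` Poly_Mapping.keys (Poly_Mapping.lookup w n))" (is "finite ?S")
        by auto
      then obtain N where N: "\<And>k. k \<in> ?S \<Longrightarrow> k \<le> N" by (meson finite_nat_set_iff_bounded_le)
      have "wpos (scl (Dv (int N)) w)"
        unfolding wpos_def
      proof (intro allI impI)
        fix n i j l assume *: "Poly_Mapping.lookup (Poly_Mapping.lookup (scl (Dv (int N)) w) n) (i, j, l) \<noteq> 0"
        have sh: "Poly_Mapping.lookup (Dv a * \<beta>) (i, j, l) = Poly_Mapping.lookup \<beta> (i, j, l - a)" for a and \<beta> :: "'k bpoly"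
          by (induction \<beta> rule: poly_mapping_single_induct)
            (auto simp: Dv_def mult_single lookup_single when_def lookup_add distrib_left)
        from * have nz: "Poly_Mapping.lookup (Poly_Mapping.lookup w n) (i, j, l - int N) \<noteq> 0"
          by (simp add: lookup_scl sh)
        then have "Poly_Mapping.lookup w n \<noteq> 0" by auto
        then have "nat (- (l - int N)) \<in> ?S" using nz
          by (intro UN_I[of n]) (auto simp: in_keys_iff intro!: image_eqI[of _ _ "(i, j, l - int N)"])
        then have "nat (- (l - int N)) \<le> N" by (rule N)
        then show "l \<ge> 0" by simp
      qed
      then obtain x where x: "x \<in> carrier M" "scl (Dv (int N)) w = h x" using surj by blast
      then have "\<theta> (loc_frac M s x N) = scl (Dv (- int N)) (scl (Dv (int N)) w)" by (simp add: \<theta>)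
      then have "\<theta> (loc_frac M s x N) = w" by (simp add: scl_scl Dv_mult Dv_zero)
      then show ?thesis using x by force
    qed
    then show "\<theta> ` carrier (localization M s) = carrier (Wring q)" by auto
  qed
  ultimately have "\<theta> \<in> ring_iso (localization M s) (Wring q)" by (simp add: ring_iso_def)
  then show ?thesis using \<theta> that by blast
qed

section \<open>The quantum case\<close>

fun gop :: "'k::field \<Rightarrow> gen \<Rightarrow> 'k wspace \<Rightarrow> 'k wspace" where
  "gop q Ga = lA q" | "gop q Gb = scl bv" | "gop q Gc = scl cv" | "gop q Gd = lD q"

lemma gop_add: "gop q x (v + w) = gop q x v + gop q x w"
  by (cases x) (simp_all add: lA_def lD_def lsh_add scl_add)

lemma gop_cst: "gop q x (scl (cst c) w) = scl (cst c) (gop q x w)"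
  by (cases x) (simp_all add: lA_scl lD_scl scl_scl wt_cst mult.commute)

definition hF :: "'k::field \<Rightarrow> (gen, 'k) free_alg \<Rightarrow> 'k wspace" where
  "hF q = plin (\<lambda>u c. scl (cst c) (foldr (gop q) u 1))"

lemma hF_add: "hF q (f + g) = hF q f + hF q g"
  unfolding hF_def by (rule plin_add) (simp_all add: scl_add_left single_add)

lemma hF_single: "hF q (Poly_Mapping.single u c) = scl (cst c) (foldr (gop q) u 1)"
  unfolding hF_def by (rule plin_single) simp

lemma hF_gen: "hF q (fgen x * f) = gop q x (hF q f)"
proof (induction f rule: poly_mapping_single_induct)
  case (single u c)
  show ?case by (simp add: fgen_def mult_single plus_list_def hF_single gop_cst)
qed (simp add: distrib_left hF_add gop_add)

lemma hF_scalar: "hF q (fscalar c * f) = scl (cst c) (hF q f)"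
proof (induction f rule: poly_mapping_single_induct)
  case (single u c)
  show ?case by (simp add: fscalar_def mult_single plus_list_def hF_single scl_scl)
qed (simp add: distrib_left hF_add scl_add)

lemma hF_one: "hF (q :: 'k::field) 1 = 1"
proof -
  have "Poly_Mapping.single [] 1 = (1 :: (gen, 'k) free_alg)"
    using fscalar_one by (simp add: fscalar_def)
  moreover have "hF q (Poly_Mapping.single [] 1) = 1" unfolding hF_single by simp
  ultimately show ?thesis by simp
qed

lemma hF_mult:
  assumes "q \<noteq> 0" shows "hF q (f * g) = mul q (hF q f) (hF q g)"
proof (induction f rule: poly_mapping_single_induct)
  case (single u c)
  have m: "mul q (gop q x v) w = gop q x (mul q v w)" for x v w
    by (cases x) (simp_all add: mul_lA mul_lD mul_scl assms)
  show ?case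
  proof (induction u)
    case Nil
    have "Poly_Mapping.single [] c = fscalar c * (1 :: (gen, 'a) free_alg)" by (simp add: fscalar_def)
    then show ?case by (simp only: hF_scalar hF_one mult.assoc mul_scl mult_1_left mul_e0)
  next
    case (Cons x u)
    have "Poly_Mapping.single (x # u) c = fgen x * Poly_Mapping.single u c" by (simp add: fgen_def mult_single plus_list_def)
    then show ?case using Cons by (simp add: mult.assoc hF_gen m)
  qed
qed (simp add: distrib_right hF_add mul_add_left)

lemma ideal_OqM2_ideal: "ideal (OqM2_ideal q) ring_of_type_algebra"
proof -
  interpret ring "ring_of_type_algebra :: (gen, 'a) free_alg ring" by (rule ring_from_type)
  show ?thesis unfolding OqM2_ideal_def by (rule genideal_ideal) (simp add: ring_of_type_algebra_def)
qed

lemma type_ring_simps: "carrier ring_of_type_algebra = UNIV" "f \<otimes>\<^bsub>ring_of_type_algebra\<^esub> g = f * g"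
  "f \<oplus>\<^bsub>ring_of_type_algebra\<^esub> g = f + g" "\<one>\<^bsub>ring_of_type_algebra\<^esub> = 1" "\<zero>\<^bsub>ring_of_type_algebra\<^esub> = 0"
  by (auto simp: ring_of_type_algebra_def)

lemma hF_zero: "hF q 0 = 0"
  by (simp add: hF_def)

lemma hF_diff: "hF q (f - g) = hF q f - hF q g"
  using hF_add[of q "f - g" g] by simp

lemma presentation_OqM2:
  fixes q :: "'k::field"
  assumes "q \<noteq> 0"
  shows "presentation q (fgen Ga) (fgen Gb) (fgen Gc) (fgen Gd) fscalar (hF q) (OqM2_ideal q)"
proof -
  let ?F = "ring_of_type_algebra :: (gen, 'k) free_alg ring"
  interpret F: ring ?F by (rule ring_from_type)
  interpret ideal "OqM2_ideal q" ?F by (rule ideal_OqM2_ideal)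
  have rel: "OqM2_relations q \<subseteq> OqM2_ideal q"
    unfolding OqM2_ideal_def by (rule F.genideal_self) (simp add: type_ring_simps)
  have uminus: "\<ominus>\<^bsub>?F\<^esub> g = - g" for g
    by (rule F.minus_equality) (simp_all add: type_ring_simps)
  define K where "K = {f. hF q f = 0}"
  have "ideal K ?F"
  proof (rule idealI)
    show "subgroup K (add_monoid ?F)"
      by (rule F.add.subgroupI)
       (auto simp: K_def type_ring_simps hF_add uminus hF_zero hF_diff[of q 0, simplified] intro: exI[of _ 0] simp flip: a_inv_def)
  next
    fix f g assume "f \<in> K"
    then show "g \<otimes>\<^bsub>?F\<^esub> f \<in> K" "f \<otimes>\<^bsub>?F\<^esub> g \<in> K" by (simp_all add: K_def type_ring_simps hF_mult assms)
  qed (rule F.ring_axioms)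
  moreover have "OqM2_relations q \<subseteq> K"
  proof -
    have g: "hF q (fgen x) = gop q x (Poly_Mapping.single 0 1)" for x using hF_gen[of q x 1] by (simp add: hF_one)
    have c: "hF q (fscalar c) = Poly_Mapping.single 0 (cst c)" for c
      using hF_scalar[of q c 1] scl_single[of "cst c" 0 1] by (simp add: hF_one)
    have gens: "hF q (fgen Ga) = Poly_Mapping.single 1 1" "hF q (fgen Gb) = Poly_Mapping.single 0 bv"
      "hF q (fgen Gc) = Poly_Mapping.single 0 cv" "hF q (fgen Gd) = Poly_Mapping.single (- 1) 1"
      unfolding g by (simp_all only: gop.simps lA_def lD_def lsh_single scl_single) (simp_all add: kA_def kD_def)
    have kap1: "kap q 1 k = kA q k" "kap q (- 1) k = kD q k" for k
      by (simp_all add: kap_def)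
    have "tt q - tt (inverse q) - cst (q - inverse q) * bv * cv = 0"
      by (simp add: tt_def single_diff algebra_simps)
    then have tt: "cst (q - inverse q) * (bv * cv) = tt q - tt (inverse q)" by (simp add: mult.assoc)
    note calc = hF_diff hF_mult[OF assms] gens c mul_single_single kap1 wt_bv wt_cv
    show ?thesis
      unfolding K_def OqM2_relations_def Let_def
    proof (clarify, elim insertE emptyE)
    qed (simp_all only: calc mem_Collect_eq, simp_all add: kA_def kD_def mult.assoc tt single_diff[symmetric] cst_mult mult.commute[of cv] assms
        mult.assoc[of "cst q" "cst (inverse q)", symmetric])
  qed
  ultimately have K: "OqM2_ideal q \<subseteq> K"
    unfolding OqM2_ideal_def by (rule F.genideal_minimal)
  show ?thesis
  proof (rule presentation.intro)
    show "q \<noteq> 0" by fact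
    show "0 \<in> OqM2_ideal q" using zero_closed by (simp add: type_ring_simps)
    show "f + g \<in> OqM2_ideal q" if "f \<in> OqM2_ideal q" "g \<in> OqM2_ideal q" for f g
      using a_closed[OF that] by (simp add: type_ring_simps)
    show "f * g \<in> OqM2_ideal q" "g * f \<in> OqM2_ideal q" if "g \<in> OqM2_ideal q" for f g
      using I_l_closed[OF that, of f] I_r_closed[OF that, of f] by (auto simp: type_ring_simps)
    show "fscalar (c + c') = fscalar c + fscalar c'" for c c' :: 'k
      by (simp add: fscalar_def single_add)
    show "g * (fgen Ga * fgen Gd - fscalar q * fgen Gb * fgen Gc) -
         (fgen Ga * fgen Gd - fscalar q * fgen Gb * fgen Gc) * g \<in> OqM2_ideal q" 
      if "g \<in> {fgen Ga, fgen Gb, fgen Gc, fgen Gd}" for g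
      using that qdet_commutes_gen[OF assms] by auto
    show "hF q f = 0" if "f \<in> OqM2_ideal q" for f using K that by (auto simp: K_def)
    show "P f" if "P 1" and "\<And>f g. P f \<Longrightarrow> P g \<Longrightarrow> P (f + g)" and "\<And>c f. P f \<Longrightarrow> P (fscalar c * f)" and
      "\<And>f g. P f \<Longrightarrow> g \<in> {fgen Ga, fgen Gb, fgen Gc, fgen Gd} \<Longrightarrow> P (g * f)" for P and f :: "(gen, 'k) free_alg"
    proof (induction f rule: poly_mapping_single_induct)
      case (single u c)
      show ?case
      proof (induction u)
        case Nil
        then show ?case using that(3)[OF that(1), of c] by (simp add: fscalar_def)
      next
        case (Cons x u)
        have "P (fgen x * Poly_Mapping.single u c)" using Cons by (cases x) (auto intro: that)
        then show ?case by (simp add: fgen_def mult_single plus_list_def)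
      qed
    qed (rule that)
  qed (use rel fscalar_central in \<open>simp_all add: OqM2_relations_def Let_def fscalar_mult fscalar_one hF_one hF_add hF_scalar hF_gen\<close>)
qed

lemma OqGL2_model:
  fixes q :: "'k::field"
  assumes "q \<noteq> 0"
  obtains \<theta> where "\<theta> \<in> ring_iso (OqGL2 q) (Wring q)"
proof -
  let ?F = "ring_of_type_algebra :: (gen, 'k) free_alg ring"
  interpret presentation q "fgen Ga" "fgen Gb" "fgen Gc" "fgen Gd" fscalar "hF q" "OqM2_ideal q"
    using assms by (rule presentation_OqM2)
  interpret F: ring ?F by (rule ring_from_type)
  interpret W: ring "Wring q" using assms by (rule ring_Wring)
  interpret H: ring_hom_ring ?F "Wring q" "hF q"
    by (rule ring_hom_ringI[OF F.ring_axioms W.ring_axioms]) (simp_all add: type_ring_simps h_add h_mult h_one)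
  have ker: "a_kernel ?F (Wring q) (hF q) = OqM2_ideal q"
    unfolding a_kernel_def' type_ring_simps Wring_simps h_eq_0_iff by simp
  define g where "g U = the_elem (hF q ` U)" for U
  have iso: "g \<in> ring_iso (OqM2 q) (Wring q \<lparr>carrier := hF q ` UNIV\<rparr>)"
    using H.FactRing_iso_set_aux unfolding ker OqM2_def g_def by (simp add: type_ring_simps)
  then have g: "g \<in> ring_hom (OqM2 q) (Wring q)" and bij: "bij_betw g (carrier (OqM2 q)) (hF q ` UNIV)"
    by (auto simp: ring_iso_def ring_hom_def)
  have gf: "g (OqM2_ideal q +>\<^bsub>?F\<^esub> f) = hF q f" for f
  proof -
    have "hF q ` (OqM2_ideal q +>\<^bsub>?F\<^esub> f) = {hF q f}"
    proof -
      have "OqM2_ideal q +>\<^bsub>?F\<^esub> f = {u + f |u. u \<in> OqM2_ideal q}"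
        by (auto simp: a_r_coset_def' type_ring_simps)
      then show ?thesis using I0 h_add h_I by (auto simp: image_iff)
    qed
    then show ?thesis by (simp add: g_def)
  qed
  interpret Q: ring "OqM2 q" by (rule ring_OqM2)
  have g0: "g \<zero>\<^bsub>OqM2 q\<^esub> = 0"
    using ring_hom_zero[OF g Q.ring_axioms W.ring_axioms] by simp
  show ?thesis
  proof (rule localization_model[OF assms qdet_central[OF assms] g])
    show "x = \<zero>\<^bsub>OqM2 q\<^esub>" if "x \<in> carrier (OqM2 q)" "g x = 0" for x
      using bij that g0 by (metis Q.zero_closed bij_betw_imp_inj_on inj_onD)
    have "hF q (fgen Ga * fgen Gd - fscalar q * fgen Gb * fgen Gc) = scl (Dv 1) 1"
      using h_Dq[of 1] by (simp add: Dq_def h_one)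
    then show "g (qdet q) = Poly_Mapping.single 0 (Dv 1)"
      using scl_single[of "Dv 1" 0 1] by (simp add: qdet_def gf)
    show "w \<in> g ` carrier (OqM2 q)" if "wpos w" for w
      using bij h_sec[OF that] by (metis UNIV_I bij_betw_imp_surj_on image_eqI)
    show thesis if "\<theta> \<in> ring_iso (localization (OqM2 q) (qdet q)) (Wring q)" for \<theta>
      using \<open>\<And>\<theta>. \<theta> \<in> ring_iso (OqGL2 q) (Wring q) \<Longrightarrow> thesis\<close> that by (simp add: OqGL2_def)
  qed
qed

section \<open>The Poisson bracket on the model\<close>

lift_definition Eul :: "'k::field wspace \<Rightarrow> 'k wspace" is "\<lambda>w n. eul (w n)"
  by (erule rev_finite_subset) auto

lemma lookup_Eul: "Poly_Mapping.lookup (Eul w) n = eul (Poly_Mapping.lookup w n)"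
  by (simp add: Eul.rep_eq)

lemma Eul_add: "Eul (v + w) = Eul v + Eul w"
  by (rule poly_mapping_eqI) (simp add: lookup_Eul lookup_add wt_add)

lemma Eul_single: "Eul (Poly_Mapping.single n \<beta>) = Poly_Mapping.single n (eul \<beta>)"
  by (rule poly_mapping_eqI) (simp add: lookup_Eul lookup_single when_def)

text \<open>\<open>pbr x w\<close> is \<open>{w, x}\<close>, in this order.\<close>

fun pbr :: "gen \<Rightarrow> 'k::field wspace \<Rightarrow> 'k wspace" where
  "pbr Ga w = lsh 1 (\<lambda>n. if n < 0 then of_int (2 * n) * bv * cv else 0) 1 w - lA 1 (Eul w)"
| "pbr Gb w = lsh 0 (\<lambda>n. of_int n * bv) 1 w"
| "pbr Gc w = lsh 0 (\<lambda>n. of_int n * cv) 1 w"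
| "pbr Gd w = lD 1 (Eul w) + lsh (- 1) (\<lambda>n. if n > 0 then of_int (2 * n) * bv * cv else 0) 1 w"

lemma pbr_add: "pbr x (v + w) = pbr x v + pbr x w"
  by (cases x) (simp_all add: lA_def lD_def lsh_add Eul_add)

text \<open>The Leibniz rule for \<open>\<beta> e_n\<close>. For \<open>a\<close>:
  \<open>{b, a} = - a b\<close> and \<open>{c, a} = - a c\<close> give the term with
  \<open>eul \<beta>\<close>, and \<open>{d^m, a} = - 2 m b c d^(m - 1)\<close> gives the other one,
  present for \<open>n = - m < 0\<close> only. The case of \<open>d\<close> is symmetric, with the
  opposite sign at \<open>eul \<beta>\<close>.\<close>

lemma pbr_single:
  "pbr Ga (Poly_Mapping.single n \<beta>) = Poly_Mapping.single (n + 1) ((if n < 0 then of_int (2 * n) * bv * cv * \<beta> else 0) - kA 1 n * eul \<beta>)"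
  "pbr Gb (Poly_Mapping.single n \<beta>) = Poly_Mapping.single n (of_int n * bv * \<beta>)"
  "pbr Gc (Poly_Mapping.single n \<beta>) = Poly_Mapping.single n (of_int n * cv * \<beta>)"
  "pbr Gd (Poly_Mapping.single n \<beta>) = Poly_Mapping.single (n - 1) (kD 1 n * eul \<beta> + (if n > 0 then of_int (2 * n) * bv * cv * \<beta> else 0))"
  by (simp_all add: lA_def lD_def lsh_single Eul_single add.commute flip: single_diff single_add)

text \<open>\<open>hbr x y w\<close> is the bracket of the generators \<open>x\<close> and
  \<open>y\<close> times \<open>w\<close>, computed in the model.\<close>

fun hbr :: "gen \<Rightarrow> gen \<Rightarrow> 'k::field wspace \<Rightarrow> 'k wspace" where
  "hbr Ga Gb w = lA 1 (scl bv w)"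
| "hbr Ga Gc w = lA 1 (scl cv w)"
| "hbr Gb Gd w = scl bv (lD 1 w)"
| "hbr Gc Gd w = scl cv (lD 1 w)"
| "hbr Ga Gd w = scl (2 * bv * cv) w"
| "hbr Gb Ga w = - lA 1 (scl bv w)"
| "hbr Gc Ga w = - lA 1 (scl cv w)"
| "hbr Gd Gb w = - scl bv (lD 1 w)"
| "hbr Gd Gc w = - scl cv (lD 1 w)"
| "hbr Gd Ga w = - scl (2 * bv * cv) w"
| "hbr _ _ _ = 0"

lemma hbr_add: "hbr x y (v + w) = hbr x y v + hbr x y w"
  by (cases x; cases y) (simp_all add: lA_def lD_def lsh_add scl_add)

lemma eul_simps: "eul bv = bv" "eul cv = cv" "eul (tt 1) = 2 * bv * cv"
proof -
  show "eul bv = bv" "eul cv = cv" by (simp_all add: wt_bv wt_cv)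
  have "eul (Dv 1) = 0" by (simp add: wt_Dv)
  then show "eul (tt 1) = 2 * bv * cv" by (simp add: tt_def wt_add eul_mult \<open>eul bv = bv\<close> \<open>eul cv = cv\<close>)
qed

lemma single_cong: "x = y \<Longrightarrow> Poly_Mapping.single m x = Poly_Mapping.single m y" by simp

lemma pbr_gop: "pbr x (gop 1 y w) = gop 1 y (pbr x w) + hbr y x w"
proof (induction w rule: poly_mapping_single_induct)
  case (single n \<beta>)
  \<comment> \<open>The constants \<open>kA\<close>, \<open>kD\<close> and the conditionals of
    \<open>pbr\<close> switch at \<open>0\<close> and are evaluated at \<open>n\<close> and its
    neighbours, so the borderline values \<open>- 1\<close>, \<open>0\<close> and \<open>1\<close>
    are separated.\<close>
  have c: "n \<le> - 2 \<or> n = - 1 \<or> n = 0 \<or> n = 1 \<or> n \<ge> 2" by linarith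
  show ?case
    using c
    apply (cases x; cases y)
    apply (simp_all only: gop.simps hbr.simps lA_def lD_def lsh_single scl_single pbr_single
        single_add[symmetric] single_diff[symmetric] single_uminus[symmetric] sg_one power_one wt_const_one add_0_right)
    apply (elim disjE; simp add: kA_def kD_def eul_mult eul_simps wt_one; (simp add: algebra_simps)?;
        (simp only: single_add[symmetric] single_diff[symmetric] single_uminus[symmetric])?;
        (rule single_cong)?; (simp add: algebra_simps)?)+
    done
next
  case (add v w)
  then show ?case by (simp add: gop_add pbr_add hbr_add del: pbr.simps gop.simps)
qed

text \<open>Coefficients of degree zero are Poisson central; this serves for scalars and for powers
  of \<open>D\<close>.\<close>

lemma pbr_scl: "eul \<beta> = 0 \<Longrightarrow> pbr x (scl \<beta> w) = scl \<beta> (pbr x w)"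
proof (induction w rule: poly_mapping_single_induct)
  case (single n \<gamma>)
  then show ?case by (cases x) (simp_all add: scl_single pbr_single eul_mult algebra_simps del: pbr.simps)
qed (simp add: scl_add pbr_add del: pbr.simps)

section \<open>Evaluation of commutative polynomials in the model\<close>

definition wm :: "(gen \<Rightarrow>\<^sub>0 nat) \<Rightarrow> 'k::field wspace" where
  "wm m = (lA 1 ^^ Poly_Mapping.lookup m Ga) ((lD 1 ^^ Poly_Mapping.lookup m Gd)
     (scl (bv ^ Poly_Mapping.lookup m Gb * cv ^ Poly_Mapping.lookup m Gc) 1))"

definition hP :: "(gen, 'k::field) mpoly \<Rightarrow> 'k wspace" where
  "hP = plin (\<lambda>m c. scl (cst c) (wm m))"

lemma hP_add: "hP (f + g) = hP f + hP g"
  unfolding hP_def by (rule plin_add) (simp_all add: scl_add_left single_add)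

lemma hP_single: "hP (Poly_Mapping.single m c) = scl (cst c) (wm m)"
  unfolding hP_def by (rule plin_single) simp

lemma hP_one: "hP 1 = (1 :: 'k::field wspace)"
proof -
  have "hP (Poly_Mapping.single 0 1) = (1 :: 'k wspace)" unfolding hP_single by (simp add: wm_def)
  then show ?thesis by simp
qed

lemma wm_gen: "wm (Poly_Mapping.single x 1 + m) = gop 1 x (wm m)"
proof -
  have AD: "lD 1 (lA 1 w) = lA 1 (lD (1::'a) w)" for w by (simp add: lA_lD lD_lA)
  have DA: "lD 1 ((lA 1 ^^ k) w) = (lA 1 ^^ k) (lD (1::'a) w)" for w k
    by (induction k) (simp_all add: AD)
  have ls: "scl \<beta> (lA 1 w) = lA 1 (scl \<beta> w)" "scl \<beta> (lD 1 w) = lD 1 (scl \<beta> (w :: 'a wspace))" for w \<beta>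
    by (simp_all add: lA_scl lD_scl)
  have A: "scl \<beta> ((lA 1 ^^ k) w) = (lA 1 ^^ k) (scl \<beta> (w :: 'a wspace))" for w k \<beta>
    by (induction k arbitrary: w) (simp_all add: ls)
  have D: "scl \<beta> ((lD 1 ^^ k) w) = (lD 1 ^^ k) (scl \<beta> (w :: 'a wspace))" for w k \<beta>
    by (induction k arbitrary: w) (simp_all add: ls)
  show ?thesis
    by (cases x) (simp_all add: wm_def lookup_add lookup_single DA A D scl_scl mult_ac)
qed

lemma hP_gen: "hP (mvar x * f) = gop 1 x (hP f)"
proof (induction f rule: poly_mapping_single_induct)
  case (single m c)
  show ?case using gop_cst[of 1 x c "wm m"] by (simp add: mvar_def mult_single hP_single wm_gen[simplified])
qed (simp add: distrib_left hP_add gop_add)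

lemma hP_scalar: "hP (Poly_Mapping.single 0 c * f) = scl (cst c) (hP f)"
proof (induction f rule: poly_mapping_single_induct)
  case (single m d)
  show ?case by (simp add: mult_single hP_single scl_scl)
qed (simp add: distrib_left hP_add scl_add)

lemma hP_zero: "hP 0 = 0"
  by (simp add: hP_def)

lemma hP_diff: "hP (f - g) = hP f - hP g"
  using hP_add[of "f - g" g] by simp

text \<open>The set of all \<open>f\<close> such that \<open>P g\<close> implies
  \<open>P (f * g)\<close> for every \<open>g\<close> is closed under products, so
  \<open>mpoly_induct\<close> applies to it.\<close>

lemma mpoly_gen_induct:
  fixes f :: "(gen, 'k::field) mpoly"
  assumes "P 1" and add: "\<And>f g. P f \<Longrightarrow> P g \<Longrightarrow> P (f + g)" and "\<And>c f. P f \<Longrightarrow> P (Poly_Mapping.single 0 c * f)"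
    and "\<And>f x. P f \<Longrightarrow> P (mvar x * f)"
  shows "P f"
proof -
  have "\<forall>g. P g \<longrightarrow> P (f * g)"
  proof (induction f rule: mpoly_induct)
    case (mult f1 f2)
    then show ?case by (simp add: mult.assoc)
  qed (use assms in \<open>auto simp: distrib_right\<close>)
  then show ?thesis using assms(1) by (metis mult_1_right)
qed

lemma hP_mult: "hP (f * g) = mul 1 (hP f) (hP g)"
proof (induction f rule: mpoly_gen_induct)
  case (4 f x)
  have "mul 1 (gop 1 x v) w = gop 1 x (mul 1 v w)" for v w :: "'a wspace"
    by (cases x) (simp_all add: mul_lA mul_lD mul_scl)
  then show ?case using 4 by (simp add: mult.assoc hP_gen)
qed (simp_all add: hP_one distrib_right hP_add mul_add_left mult.assoc hP_scalar mul_scl)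

lemma presentation_OM2: 
  "presentation (1 :: 'k::field) (mvar Ga) (mvar Gb) (mvar Gc) (mvar Gd) (Poly_Mapping.single 0) hP {0}"
proof (rule presentation.intro)
  show "hP f = (0 :: 'k wspace)" if "f \<in> {0}" for f using that by (simp add: hP_def)
  show "P f" if "P 1" and "\<And>f g. P f \<Longrightarrow> P g \<Longrightarrow> P (f + g)" and "\<And>c f. P f \<Longrightarrow> P (Poly_Mapping.single 0 c * f)" and
      "\<And>f g. P f \<Longrightarrow> g \<in> {mvar Ga, mvar Gb, mvar Gc, mvar Gd} \<Longrightarrow> P (g * f)" for P and f :: "(gen, 'k) mpoly"
  proof (rule mpoly_gen_induct[of P])
    show "P (mvar x * f)" if "P f" for f x using \<open>P f\<close> by (cases x) (auto intro: \<open>\<And>f g. P f \<Longrightarrow> g \<in> {mvar Ga, mvar Gb, mvar Gc, mvar Gd} \<Longrightarrow> P (g * f)\<close>)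
  qed (use that in auto)
  show "Poly_Mapping.single 0 (c + c') = Poly_Mapping.single 0 c + (Poly_Mapping.single 0 c' :: (gen, 'k) mpoly)" for c c'
    by (rule single_add)
qed (simp_all add: mult_single hP_one hP_add hP_scalar hP_gen, (simp_all add: mult_ac)?)

lemma hP_bracket: "hP (M2_bracket f (mvar x)) = pbr x (hP f)"
proof (induction f rule: mpoly_gen_induct)
  case 1
  have "M2_bracket (1 :: (gen, 'a) mpoly) (mvar x) = 0" using M2_bracket_const[of 1] by simp
  moreover have "pbr x (1 :: 'a wspace) = 0"
    using pbr_single[of 0 "1 :: 'a bpoly"] by (cases x) (simp_all add: wt_one del: pbr.simps)
  ultimately show ?case by (simp add: hP_one hP_zero del: pbr.simps)
next
  case (3 c f)
  have "eul (cst c) = 0" by (simp add: wt_cst)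
  then show ?case using 3 by (simp add: M2_bracket_mult M2_bracket_const hP_scalar pbr_scl del: pbr.simps)
next
  case (4 f y)
  have two: "hP (2 * g) = scl 2 (hP g)" for g :: "(gen, 'a) mpoly"
    using hP_scalar[of 2 g] by simp
  have "hP (gen_bracket y x * f) = hbr y x (hP f)"
    by (cases y; cases x) (simp_all add: mult.assoc hP_gen two hP_diff[of 0, simplified] scl_scl hP_zero)
  then show ?case using 4 
    by (simp add: M2_bracket_mult M2_bracket_gen hP_add hP_gen pbr_gop del: pbr.simps gop.simps)
qed (simp add: M2_bracket_add hP_add pbr_add del: pbr.simps)

text \<open>Stability under brackets with the four variables suffices: \<open>M2_bracket f\<close>
  is a derivation in its second argument, and the determinant is Poisson central, so denominators
  pass through the bracket.\<close>

lemma OGL2_model: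
  obtains \<theta> :: "((gen, 'k::field) mpoly \<times> nat) set \<Rightarrow> 'k wspace" where "\<theta> \<in> ring_iso OGL2 (Wring 1)"
    "\<And>I. ideal I OGL2 \<Longrightarrow> poisson_ideal I OGL2 GL2_bracket \<longleftrightarrow> (\<forall>x. \<forall>w\<in>\<theta> ` I. pbr x w \<in> \<theta> ` I)"
proof -
  interpret P: presentation "1 :: 'k" "mvar Ga" "mvar Gb" "mvar Gc" "mvar Gd" "Poly_Mapping.single 0" hP "{0}"
    by (rule presentation_OM2)
  interpret C: poisson_central "OM2 :: (gen, 'k) mpoly ring" M2_bracket M2_det by (rule poisson_central_M2)
  have hom: "hP \<in> ring_hom OM2 (Wring (1 :: 'k))"
    by (rule ring_hom_memI) (simp_all add: OM2_simps hP_mult hP_add hP_one)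
  obtain \<theta> where iso: "\<theta> \<in> ring_iso (localization OM2 M2_det) (Wring (1 :: 'k))"
    and \<theta>: "\<And>x n. x \<in> carrier OM2 \<Longrightarrow> \<theta> (loc_frac OM2 M2_det x n) = scl (Dv (- int n)) (hP x)"
  proof (rule localization_model[OF _ C.central_element_axioms hom])
    show "x = \<zero>\<^bsub>OM2\<^esub>" if "hP x = 0" for x :: "(gen, 'k) mpoly"
      using P.h_eq_0_iff[of x] that by (simp add: OM2_simps)
    have "hP (M2_det :: (gen, 'k) mpoly) = scl (Dv 1) 1"
      using P.h_Dq[of 1] by (simp add: P.Dq_def M2_det_def hP_one)
    then show "hP (M2_det :: (gen, 'k) mpoly) = Poly_Mapping.single 0 (Dv 1)"
      using scl_single[of "Dv 1" 0 1] by simp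
    show "w \<in> hP ` carrier OM2" if "wpos w" for w :: "'k wspace"
      using P.h_sec[OF that] by (metis OM2_simps(1) UNIV_I image_eqI)
  qed auto
  let ?fr = "loc_frac (OM2 :: (gen, 'k) mpoly ring) M2_det"
  have carr: "x \<in> carrier OM2" for x :: "(gen, 'k) mpoly" by (simp add: OM2_simps)
  have fr: "?fr x n \<in> carrier OGL2" for x n unfolding OGL2_def by (rule C.loc_frac_closed[OF carr])
  have \<theta>_inj: "inj_on \<theta> (carrier OGL2)" using iso by (simp add: ring_iso_def bij_betw_def OGL2_def)
  have br: "GL2_bracket (?fr x n) (?fr y m) = ?fr (M2_bracket x y) (n + m)" for x y n m
    unfolding GL2_bracket_def by (rule C.loc_bracket_frac[OF carr carr])
  have \<theta>_br: "\<theta> (?fr (M2_bracket f (mvar x)) n) = pbr x (\<theta> (?fr f n))" for f x n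
    by (simp add: \<theta>[OF carr] hP_bracket pbr_scl wt_Dv del: pbr.simps)
  have main: "poisson_ideal I OGL2 GL2_bracket \<longleftrightarrow> (\<forall>x. \<forall>w\<in>\<theta> ` I. pbr x w \<in> \<theta> ` I)" if I: "ideal I OGL2" for I
  proof -
    interpret I: ideal I OGL2 by fact
    have el: "\<exists>f n. U = ?fr f n" if "U \<in> I" for U
      using I.Icarr[OF that] unfolding OGL2_def C.loc_carrier by blast
    show ?thesis
    proof
      assume P: "poisson_ideal I OGL2 GL2_bracket"
      show "\<forall>x. \<forall>w\<in>\<theta> ` I. pbr x w \<in> \<theta> ` I"
      proof (intro allI ballI)
        fix x w assume "w \<in> \<theta> ` I"
        then obtain f n where f: "?fr f n \<in> I" "w = \<theta> (?fr f n)" using el by blast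
        have "GL2_bracket (?fr f n) (?fr (mvar x) 0) \<in> I" using P f fr by (simp add: poisson_ideal_def)
        then have "?fr (M2_bracket f (mvar x)) n \<in> I" by (simp add: br)
        then show "pbr x w \<in> \<theta> ` I" using \<theta>_br[of f x n] f by (metis image_eqI)
      qed
    next
      assume *: "\<forall>x. \<forall>w\<in>\<theta> ` I. pbr x w \<in> \<theta> ` I"
      have "GL2_bracket U V \<in> I" if UV: "U \<in> I" "V \<in> carrier OGL2" for U V
      proof -
        obtain f n where f: "U = ?fr f n" using el UV by blast
        obtain g m where g: "V = ?fr g m" using UV(2) unfolding OGL2_def C.loc_carrier by blast
        have mult: "?fr (u * h) (l + p) \<in> I" if "?fr h p \<in> I" for u h l p
          using I.I_l_closed[OF that fr[of u l]] C.loc_mult[OF carr carr, of u l h p] by (simp add: OGL2_def OM2_simps)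
        have "?fr (M2_bracket f g) n \<in> I"
        proof (induction g rule: mpoly_induct)
          case (const c)
          have "?fr 0 n = \<zero>\<^bsub>OGL2\<^esub>" unfolding OGL2_def using C.loc_zero_frac[of n] by (simp add: OM2_simps)
          then show ?case using I.zero_closed by (simp add: M2_bracket_const_right)
        next
          case (var x)
          have "pbr x (\<theta> U) \<in> \<theta> ` I" using * UV by blast
          then obtain U' where "U' \<in> I" "\<theta> U' = \<theta> (?fr (M2_bracket f (mvar x)) n)" using \<theta>_br[of f x n] f by auto
          then show ?case using \<theta>_inj I.Icarr fr by (metis inj_onD)
        next
          case (add g1 g2)
          have "?fr (M2_bracket f g1) n \<oplus>\<^bsub>OGL2\<^esub> ?fr (M2_bracket f g2) n = ?fr (M2_bracket f g1 + M2_bracket f g2) n"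
            using C.loc_add_same[OF carr carr] unfolding OGL2_def OM2_simps by blast
          then show ?case using additive_subgroup.a_closed[OF ideal.axioms(1)[OF I] , OF add] by (simp add: M2_bracket_add_right)
        next
          case (mult g1 g2)
          have "?fr (g1 * M2_bracket f g2) (0 + n) \<in> I" "?fr (g2 * M2_bracket f g1) (0 + n) \<in> I"
            using mult \<open>\<And>u h l p. ?fr h p \<in> I \<Longrightarrow> ?fr (u * h) (l + p) \<in> I\<close> by blast+
          moreover have "?fr (g1 * M2_bracket f g2) n \<oplus>\<^bsub>OGL2\<^esub> ?fr (g2 * M2_bracket f g1) n =
             ?fr (g1 * M2_bracket f g2 + g2 * M2_bracket f g1) n"
            using C.loc_add_same[OF carr carr] unfolding OGL2_def OM2_simps by blast
          ultimately show ?case using additive_subgroup.a_closed[OF ideal.axioms(1)[OF I], of "?fr (g1 * M2_bracket f g2) n" "?fr (g2 * M2_bracket f g1) n"]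
            by (simp add: M2_bracket_mult_right mult.commute)
        qed
        then have "?fr (1 * M2_bracket f g) (m + n) \<in> I" by (rule mult)
        then show ?thesis by (simp add: f g br add.commute)
      qed
      then show "poisson_ideal I OGL2 GL2_bracket" using I by (simp add: poisson_ideal_def)
    qed
  qed
  show ?thesis by (rule that[OF iso[folded OGL2_def]]) (rule main)
qed

section \<open>Transport along ring isomorphisms\<close>

locale riso = R: ring R + S: ring S for R :: "('a, 'm) ring_scheme" and S :: "('b, 'n) ring_scheme" +
  fixes h :: "'a \<Rightarrow> 'b" assumes iso: "h \<in> ring_iso R S"
begin

sublocale H: ring_hom_ring R S h
  using iso by (intro ring_hom_ringI2) (auto simp: ring_iso_def R.ring_axioms S.ring_axioms)

lemma bij: "bij_betw h (carrier R) (carrier S)" using iso by (simp add: ring_iso_def)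

lemma riso_inv: "riso S R (inv_into (carrier R) h)"
  by (intro riso.intro riso_axioms.intro S.ring_axioms R.ring_axioms ring_iso_set_sym iso)

lemma inv_image: "P \<subseteq> carrier R \<Longrightarrow> inv_into (carrier R) h ` (h ` P) = P"
  using bij by (simp add: bij_betw_def inv_into_image_cancel)

lemma image_inv: "P \<subseteq> carrier S \<Longrightarrow> h ` (inv_into (carrier R) h ` P) = P"
  using bij by (simp add: bij_betw_def image_inv_into_cancel)

lemma mem_image_iff: "P \<subseteq> carrier R \<Longrightarrow> x \<in> carrier R \<Longrightarrow> h x \<in> h ` P \<longleftrightarrow> x \<in> P"
  using bij by (auto simp: bij_betw_def inj_on_def)

lemma ideal_image:
  assumes "ideal I R" shows "ideal (h ` I) S"
proof (rule idealI)
  interpret I: ideal I R by fact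
  show "subgroup (h ` I) (add_monoid S)"
  proof (rule S.add.subgroupI)
    show "h ` I \<subseteq> carrier S" using I.Icarr by auto
    show "h ` I \<noteq> {}" using I.zero_closed by blast
    fix a assume "a \<in> h ` I"
    then obtain x where x: "x \<in> I" "a = h x" by blast
    then show "\<ominus>\<^bsub>S\<^esub> a \<in> h ` I" using H.hom_a_inv[of x] I.Icarr[of x] I.a_inv_closed[of x]
      by (metis image_eqI)
    fix b assume "b \<in> h ` I"
    then obtain y where y: "y \<in> I" "b = h y" by blast
    then have "a \<oplus>\<^bsub>S\<^esub> b = h (x \<oplus>\<^bsub>R\<^esub> y)" using x I.Icarr by simp
    then show "a \<oplus>\<^bsub>S\<^esub> b \<in> h ` I" using x y additive_subgroup.a_closed[OF I.is_additive_subgroup] by (metis image_eqI)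
  qed
next
  interpret I: ideal I R by fact
  fix a s assume "a \<in> h ` I" "s \<in> carrier S"
  then obtain x r where x: "x \<in> I" "a = h x" and r: "r \<in> carrier R" "s = h r"
    using bij unfolding bij_betw_def by (metis imageE)
  show "s \<otimes>\<^bsub>S\<^esub> a \<in> h ` I" using x r I.Icarr I.I_l_closed[of x r] by (metis H.hom_mult image_eqI)
  show "a \<otimes>\<^bsub>S\<^esub> s \<in> h ` I" using x r I.Icarr I.I_r_closed[of x r] by (metis H.hom_mult image_eqI)
qed (rule S.ring_axioms)

lemma ideal_prod_image:
  assumes "ideal I R" "ideal J R" "z \<in> ideal_prod R I J" shows "h z \<in> ideal_prod S (h ` I) (h ` J)"
  using assms(3)
proof (induction rule: ideal_prod.induct)
  case (prod i j)
  then have "h i \<otimes>\<^bsub>S\<^esub> h j \<in> ideal_prod S (h ` I) (h ` J)" by (intro ideal_prod.prod) auto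
  then show ?case using prod ideal.Icarr[OF assms(1)] ideal.Icarr[OF assms(2)] by simp
next
  case (sum s1 s2)
  have "ideal_prod R I J \<subseteq> carrier R" by (rule R.ideal_prod_in_carrier[OF assms(1,2)])
  then show ?case using sum ideal_prod.sum[OF sum(3,4)] by (simp add: subset_iff)
qed

lemma spec_image:
  assumes "P \<in> spec R" shows "h ` P \<in> spec S"
proof -
  have P: "ideal P R" "P \<noteq> carrier R" 
    and prime: "\<And>I J. ideal I R \<Longrightarrow> ideal J R \<Longrightarrow> ideal_prod R I J \<subseteq> P \<Longrightarrow> I \<subseteq> P \<or> J \<subseteq> P"
    using assms by (auto simp: spec_def prime_ideal_nc_def)
  have Pc: "P \<subseteq> carrier R" using ideal.Icarr[OF P(1)] by auto
  let ?g = "inv_into (carrier R) h"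
  have "I \<subseteq> h ` P \<or> J \<subseteq> h ` P" if I: "ideal I S" and J: "ideal J S" and IJ: "ideal_prod S I J \<subseteq> h ` P" for I J
  proof -
    have c: "I \<subseteq> carrier S" "J \<subseteq> carrier S" using ideal.Icarr[OF I] ideal.Icarr[OF J] by auto
    have g: "ideal (?g ` I) R" "ideal (?g ` J) R"
      using I J riso.ideal_image[OF riso_inv] by auto
    have "ideal_prod R (?g ` I) (?g ` J) \<subseteq> P"
    proof
      fix z assume z: "z \<in> ideal_prod R (?g ` I) (?g ` J)"
      then have "h z \<in> h ` P" using ideal_prod_image[OF g z] IJ image_inv c by auto
      moreover have "z \<in> carrier R" using z R.ideal_prod_in_carrier[OF g] by auto
      ultimately show "z \<in> P" using mem_image_iff Pc by blast
    qed
    then have "?g ` I \<subseteq> P \<or> ?g ` J \<subseteq> P" using prime g by blast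
    then show ?thesis using image_inv[OF c(1)] image_inv[OF c(2)] by (metis image_mono)
  qed
  moreover have "h ` P \<noteq> carrier S"
    using P(2) Pc inv_image[OF Pc] bij by (metis bij_betw_def inv_image order_refl)
  ultimately show ?thesis using ideal_image[OF P(1)] by (auto simp: spec_def prime_ideal_nc_def)
qed

lemma maximalideal_image:
  assumes "maximalideal P R" shows "maximalideal (h ` P) S"
proof (rule maximalidealI)
  interpret P: maximalideal P R by fact
  have Pc: "P \<subseteq> carrier R" using P.Icarr by auto
  show "ideal (h ` P) S" by (intro ideal_image P.ideal_axioms)
  show "carrier S \<noteq> h ` P" using P.I_notcarr Pc inv_image[OF Pc] bij by (metis bij_betw_def inv_image order_refl)
  fix J assume J: "ideal J S" "h ` P \<subseteq> J" "J \<subseteq> carrier S"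
  let ?g = "inv_into (carrier R) h"
  have g: "ideal (?g ` J) R" by (rule riso.ideal_image[OF riso_inv J(1)])
  moreover have "P \<subseteq> ?g ` J" using J(2) inv_image[OF Pc] by (metis image_mono)
  moreover have "?g ` J \<subseteq> carrier R" using ideal.Icarr[OF g] by auto
  ultimately have "?g ` J = P \<or> ?g ` J = carrier R" by (rule P.I_maximal)
  then show "J = h ` P \<or> J = carrier S" using image_inv[OF J(3)] bij by (metis bij_betw_def)
qed

lemma primeideal_image:
  assumes "primeideal P R" "cring S" shows "primeideal (h ` P) S"
proof (rule primeidealI)
  interpret P: primeideal P R by fact
  have Pc: "P \<subseteq> carrier R" using P.Icarr by auto
  show "ideal (h ` P) S" by (intro ideal_image P.ideal_axioms)
  show "carrier S \<noteq> h ` P" using P.I_notcarr Pc inv_image[OF Pc] bij by (metis bij_betw_def inv_image order_refl)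
  fix a b assume "a \<in> carrier S" "b \<in> carrier S" and ab: "a \<otimes>\<^bsub>S\<^esub> b \<in> h ` P"
  then obtain x y where xy: "x \<in> carrier R" "a = h x" "y \<in> carrier R" "b = h y"
    using bij unfolding bij_betw_def by (metis imageE)
  then have "h (x \<otimes>\<^bsub>R\<^esub> y) \<in> h ` P" using ab by simp
  then have "x \<otimes>\<^bsub>R\<^esub> y \<in> P" using mem_image_iff[OF Pc, of "x \<otimes>\<^bsub>R\<^esub> y"] xy by blast
  then show "a \<in> h ` P \<or> b \<in> h ` P" using P.I_prime xy by blast
qed (rule assms)

lemma prim_image:
  assumes "P \<in> prim R" shows "h ` P \<in> prim S"
proof -
  obtain M :: "('a, 'a set) module" where M: "simple_left_module R M" "P = annihilator R M"
    using assms by (auto simp: prim_def)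
  let ?g = "inv_into (carrier R) h"
  \<comment> \<open>The carrier keeps the type \<open>'a set\<close>, whereas \<open>prim S\<close>
    ranges over modules on \<open>'b set\<close>; \<open>annihilator_simple_in_prim\<close> bridges
    this at the end.\<close>
  define N :: "('b, 'a set) module" where
    "N = \<lparr>carrier = carrier M, monoid.mult = monoid.mult M, one = one M, ring.zero = ring.zero M, add = add M,
      module.smult = (\<lambda>a x. module.smult M (?g a) x)\<rparr>"
  have sel: "carrier N = carrier M" "\<zero>\<^bsub>N\<^esub> = \<zero>\<^bsub>M\<^esub>" "add N = add M" "a \<odot>\<^bsub>N\<^esub> x = ?g a \<odot>\<^bsub>M\<^esub> x" for a x
    by (simp_all add: N_def)
  interpret M: left_module R M using M(1) by (simp add: simple_left_module_def)
  interpret G: riso S R ?g by (rule riso_inv)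
  have "abelian_group N"
  proof (rule abelian_groupI)
    fix x assume "x \<in> carrier N"
    then show "\<exists>y\<in>carrier N. y \<oplus>\<^bsub>N\<^esub> x = \<zero>\<^bsub>N\<^esub>"
      by (intro bexI[of _ "\<ominus>\<^bsub>M\<^esub> x"]) (simp_all add: sel M.l_neg)
  qed (simp_all add: sel M.a_ac)
  then have lm: "left_module S N"
    by (intro left_module.intro left_module_axioms.intro S.ring_axioms)
      (simp_all add: sel M.smult_closed M.smult_l_distr M.smult_r_distr M.smult_assoc M.smult_one)
  have sub: "submodule K R M" if "submodule K S N" for K
  proof -
    interpret K: submodule K S N by fact
    show ?thesis
    proof (intro submodule.intro submodule_axioms.intro)
      show "subgroup K (add_monoid M)" using K.subgroup_axioms unfolding subgroup_def by (simp add: sel m_inv_def)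
      fix a x assume "a \<in> carrier R" "x \<in> K"
      then show "a \<odot>\<^bsub>M\<^esub> x \<in> K" using K.smult_closed[of "h a" x] bij by (simp add: sel bij_betw_def inv_into_f_f)
    qed
  qed
  have "simple_left_module S N"
    using lm sub M(1) by (simp add: simple_left_module_def sel)
  moreover have "annihilator S N = h ` P"
  proof -
    have "a \<in> annihilator S N \<longleftrightarrow> a \<in> carrier S \<and> ?g a \<in> P" for a
      using G.H.hom_closed[of a] by (auto simp: annihilator_def sel M(2))
    moreover have "a \<in> carrier S \<and> ?g a \<in> P \<longleftrightarrow> a \<in> h ` P" for a
    proof
      assume "a \<in> carrier S \<and> ?g a \<in> P"
      then show "a \<in> h ` P" using bij by (metis bij_betw_inv_into_right image_eqI)
    next
      assume "a \<in> h ` P"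
      then obtain x where x: "x \<in> P" "a = h x" by blast
      then have "x \<in> carrier R" by (simp add: M(2) annihilator_def)
      then show "a \<in> carrier S \<and> ?g a \<in> P" using x bij by (simp add: bij_betw_inv_into_left)
    qed
    ultimately show ?thesis by blast
  qed
  ultimately show ?thesis using annihilator_simple_in_prim by metis
qed

lemma image_iff:
  assumes "P \<subseteq> carrier R"
  shows "h ` P \<in> spec S \<longleftrightarrow> P \<in> spec R" "h ` P \<in> prim S \<longleftrightarrow> P \<in> prim R" "ideal (h ` P) S \<longleftrightarrow> ideal P R"
    "maximalideal (h ` P) S \<longleftrightarrow> maximalideal P R"
    "cring R \<Longrightarrow> cring S \<Longrightarrow> primeideal (h ` P) S \<longleftrightarrow> primeideal P R"
  using spec_image prim_image ideal_image maximalideal_image primeideal_image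
    riso.spec_image[OF riso_inv, of "h ` P"] riso.prim_image[OF riso_inv, of "h ` P"] riso.ideal_image[OF riso_inv, of "h ` P"]
    riso.maximalideal_image[OF riso_inv, of "h ` P"] riso.primeideal_image[OF riso_inv, of "h ` P"]
  unfolding inv_image[OF assms] by blast+

end

lemma spec_carrier: "P \<in> spec R \<Longrightarrow> P \<subseteq> carrier R"
  using ideal.Icarr[of P R] by (auto simp: spec_def prime_ideal_nc_def)

text \<open>Only a bijection of the carriers is assumed, because the map to be used is not
  multiplicative. The image of \<open>I\<close> need not be an ideal, but the members of
  \<open>B'\<close> are ideals, so containing it is the same as containing the ideal it
  generates.\<close>

lemma image_closed_zariski:
  assumes R': "ring R'" "A' \<subseteq> spec R'" and S': "ring S'" "B' \<subseteq> spec S'" and f: "bij_betw f (carrier R') (carrier S')"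
      and AB': "\<And>P. P \<subseteq> carrier R' \<Longrightarrow> f ` P \<in> B' \<longleftrightarrow> P \<in> A'" and I: "ideal I R'"
  shows "\<exists>J. ideal J S' \<and> image f ` {P \<in> A'. I \<subseteq> P} = {P \<in> B'. J \<subseteq> P}"
proof -
  interpret S': ring S' by fact
  have Ic: "I \<subseteq> carrier R'" using ideal.Icarr[OF I] by auto
  then have fI: "f ` I \<subseteq> carrier S'" using f by (auto simp: bij_betw_def)
  have id: "ideal Q S'" if "Q \<in> B'" for Q using S'(2) that by (auto simp: spec_def prime_ideal_nc_def)
  have gen: "Idl\<^bsub>S'\<^esub> (f ` I) \<subseteq> Q \<longleftrightarrow> f ` I \<subseteq> Q" if "Q \<in> B'" for Q
    using S'.genideal_minimal[OF id[OF that]] S'.genideal_self[OF fI] by blast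
  have "image f ` {P \<in> A'. I \<subseteq> P} = {P \<in> B'. f ` I \<subseteq> P}"
  proof (intro equalityI subsetI)
    fix Q assume "Q \<in> image f ` {P \<in> A'. I \<subseteq> P}"
    then obtain P where P: "P \<in> A'" "I \<subseteq> P" "Q = f ` P" by blast
    then show "Q \<in> {P \<in> B'. f ` I \<subseteq> P}" using AB' spec_carrier[OF subsetD[OF R'(2) P(1)]] by (auto intro: image_mono)
  next
    fix Q assume Q: "Q \<in> {P \<in> B'. f ` I \<subseteq> P}"
    then have Qc: "Q \<subseteq> carrier S'" using spec_carrier S'(2) by blast
    define P where "P = {x \<in> carrier R'. f x \<in> Q}"
    have "f ` P = Q" using Qc f by (auto simp: P_def bij_betw_def)
    moreover have "P \<subseteq> carrier R'" by (auto simp: P_def)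
    moreover have "I \<subseteq> P" using Q Ic by (auto simp: P_def)
    ultimately show "Q \<in> image f ` {P \<in> A'. I \<subseteq> P}" using AB' Q by blast
  qed
  also have "\<dots> = {P \<in> B'. Idl\<^bsub>S'\<^esub> (f ` I) \<subseteq> P}" using gen by blast
  finally show ?thesis using S'.genideal_ideal[OF fI] by blast
qed

lemma homeomorphic_map_zariski:
  assumes R: "ring R" "A \<subseteq> spec R" and S: "ring S" "B \<subseteq> spec S" and g: "bij_betw g (carrier R) (carrier S)"
    and AB: "\<And>P. P \<subseteq> carrier R \<Longrightarrow> g ` P \<in> B \<longleftrightarrow> P \<in> A"
  shows "homeomorphic_map (zariski R A) (zariski S B) (image g)"
proof -
  let ?g = "inv_into (carrier R) g"
  have gi: "bij_betw ?g (carrier S) (carrier R)" using g by (rule bij_betw_inv_into)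
  have BA: "?g ` Q \<in> A \<longleftrightarrow> Q \<in> B" if "Q \<subseteq> carrier S" for Q
  proof -
    have "g ` (?g ` Q) = Q" using that g by (simp add: bij_betw_def image_inv_into_cancel)
    moreover have "?g ` Q \<subseteq> carrier R" using gi that by (auto simp: bij_betw_def)
    ultimately show ?thesis using AB by metis
  qed
  have inv: "?g ` (g ` P) = P" if "P \<in> A" for P
    using spec_carrier[OF subsetD[OF R(2) that]] g by (simp add: bij_betw_def inv_into_image_cancel)
  have inv': "g ` (?g ` Q) = Q" if "Q \<in> B" for Q
    using spec_carrier[OF subsetD[OF S(2) that]] g by (simp add: bij_betw_def image_inv_into_cancel)
  have gAB: "g ` P \<in> B" if "P \<in> A" for P using AB spec_carrier[OF subsetD[OF R(2) that]] that by blast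
  have gBA: "?g ` Q \<in> A" if "Q \<in> B" for Q using BA spec_carrier[OF subsetD[OF S(2) that]] that by blast
  note top = closedin_zariski[OF R] closedin_zariski[OF S]
  have c1: "closedin (zariski S B) (image g ` C)" if C: "closedin (zariski R A) C" for C
  proof -
    obtain I where I: "ideal I R" "C = {P \<in> A. I \<subseteq> P}" using C unfolding top by blast
    show ?thesis using image_closed_zariski[OF R S g AB I(1)] unfolding top I(2) .
  qed
  have c2: "closedin (zariski R A) (image ?g ` C)" if C: "closedin (zariski S B) C" for C
  proof -
    obtain I where I: "ideal I S" "C = {P \<in> B. I \<subseteq> P}" using C unfolding top by blast
    show ?thesis using image_closed_zariski[OF S R gi BA I(1)] unfolding top I(2) .
  qed
  have "homeomorphic_maps (zariski R A) (zariski S B) (image g) (image ?g)"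
    unfolding homeomorphic_maps_def continuous_map_closedin
  proof (intro conjI allI impI ballI)
    fix C assume C: "closedin (zariski S B) C"
    then have "C \<subseteq> B" using closedin_subset top(3) by metis
    then have "{x \<in> A. g ` x \<in> C} = image ?g ` C"
      using inv inv' gBA by (intro equalityI subsetI) (metis (mono_tags, lifting) image_eqI mem_Collect_eq, auto)
    then have "{x \<in> topspace (zariski R A). g ` x \<in> C} = image ?g ` C" by (simp add: top)
    then show "closedin (zariski R A) {x \<in> topspace (zariski R A). g ` x \<in> C}" using c2[OF C] by simp
  next
    fix C assume C: "closedin (zariski R A) C"
    then have "C \<subseteq> A" using closedin_subset top(1) by metis
    then have "{x \<in> B. ?g ` x \<in> C} = image g ` C"
      using inv inv' gAB by (intro equalityI subsetI) (metis (mono_tags, lifting) image_eqI mem_Collect_eq, auto)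
    then have "{x \<in> topspace (zariski S B). ?g ` x \<in> C} = image g ` C" by (simp add: top)
    then show "closedin (zariski S B) {x \<in> topspace (zariski S B). ?g ` x \<in> C}" using c1[OF C] by simp
  qed (use inv inv' gAB gBA in \<open>auto simp: top\<close>)
  then show ?thesis by (rule homeomorphic_maps_map[THEN iffD1, THEN conjunct1])
qed

section \<open>Left ideals of the model and simple modules\<close>

definition lid :: "'k::field \<Rightarrow> 'k wspace set \<Rightarrow> bool" where
  "lid q L \<longleftrightarrow> 0 \<in> L \<and> (\<forall>x\<in>L. \<forall>y\<in>L. x + y \<in> L) \<and> (\<forall>r. \<forall>x\<in>L. mul q r x \<in> L)"

lemma lidD: assumes "lid q L"
  shows "0 \<in> L" "x \<in> L \<Longrightarrow> y \<in> L \<Longrightarrow> x + y \<in> L" "x \<in> L \<Longrightarrow> mul q r x \<in> L" "x \<in> L \<Longrightarrow> scl \<beta> x \<in> L"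
    "x \<in> L \<Longrightarrow> - x \<in> L" "x \<in> L \<Longrightarrow> y \<in> L \<Longrightarrow> x - y \<in> L"
proof -
  show s: "x \<in> L \<Longrightarrow> scl \<beta> x \<in> L" for x \<beta> using assms mul_coef[of q \<beta> x] unfolding lid_def by metis
  have m: "scl (- 1) x = - x" for x :: "'a wspace" by (rule poly_mapping_eqI) (simp add: lookup_scl)
  show n: "x \<in> L \<Longrightarrow> - x \<in> L" for x using s[of x "- 1"] by (simp add: m)
  show a: "x \<in> L \<Longrightarrow> y \<in> L \<Longrightarrow> x + y \<in> L" for x y using assms unfolding lid_def by blast
  show "x \<in> L \<Longrightarrow> y \<in> L \<Longrightarrow> x - y \<in> L" using a[of x "- y"] n[of y] by simp
qed (use assms in \<open>auto simp: lid_def\<close>)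

lemma Wring_uminus: "q \<noteq> 0 \<Longrightarrow> \<ominus>\<^bsub>Wring q\<^esub> x = - x"
proof -
  assume "q \<noteq> 0"
  then interpret ring "Wring q" by (rule ring_Wring)
  show ?thesis by (rule minus_equality) simp_all
qed

lemma ideal_Wring:
  assumes "q \<noteq> 0" shows "ideal I (Wring q) \<longleftrightarrow> lid q I \<and> (\<forall>r. \<forall>x\<in>I. mul q x r \<in> I)"
proof
  interpret ring "Wring q" using assms by (rule ring_Wring)
  { assume "ideal I (Wring q)"
    then interpret I: ideal I "Wring q" .
    show "lid q I \<and> (\<forall>r. \<forall>x\<in>I. mul q x r \<in> I)"
      using I.zero_closed additive_subgroup.a_closed[OF I.is_additive_subgroup] I.I_l_closed I.I_r_closed
      by (auto simp: lid_def) }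
  assume I: "lid q I \<and> (\<forall>r. \<forall>x\<in>I. mul q x r \<in> I)"
  show "ideal I (Wring q)"
  proof (rule idealI)
    show "subgroup I (add_monoid (Wring q))"
      using I lidD[of q I] Wring_uminus[OF assms] by (intro add.subgroupI) (auto simp: a_inv_def)
  qed (use I lidD[of q I] in \<open>auto intro: ring_axioms\<close>)
qed

definition max_lid :: "'k::field \<Rightarrow> 'k wspace set \<Rightarrow> bool" where
  "max_lid q L \<longleftrightarrow> lid q L \<and> 1 \<notin> L \<and> (\<forall>L'. lid q L' \<longrightarrow> L \<subseteq> L' \<longrightarrow> 1 \<notin> L' \<longrightarrow> L' = L)"

lemma exists_max_lid:
  assumes "lid q L0" "1 \<notin> L0" obtains L where "L0 \<subseteq> L" "max_lid q L"
proof -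
  let ?A = "{L. lid q L \<and> 1 \<notin> L \<and> L0 \<subseteq> L}"
  have "\<exists>M\<in>?A. \<forall>L\<in>?A. M \<subseteq> L \<longrightarrow> L = M"
  proof (rule subset_Zorn_nonempty)
    show "?A \<noteq> {}" using assms by blast
    fix C assume C: "C \<noteq> {}" "subset.chain ?A C"
    have "lid q (\<Union>C)"
      unfolding lid_def
    proof (intro conjI ballI allI)
      show "0 \<in> \<Union>C" using C by (auto simp: subset.chain_def lid_def)
      show "mul q r x \<in> \<Union>C" if x: "x \<in> \<Union>C" for r x
      proof -
        obtain U where U: "x \<in> U" "U \<in> C" using x by blast
        then have "lid q U" using C by (auto simp: subset.chain_def)
        then show ?thesis using U unfolding lid_def by blast
      qed
      fix x y assume "x \<in> \<Union>C" "y \<in> \<Union>C"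
      then obtain U V where UV: "x \<in> U" "y \<in> V" "U \<in> C" "V \<in> C" by blast
      then have "U \<subseteq> V \<or> V \<subseteq> U" using C by (auto simp: subset.chain_def)
      then obtain Z where Z: "Z \<in> C" "x \<in> Z" "y \<in> Z" using UV by blast
      then have "lid q Z" using C by (auto simp: subset.chain_def)
      then show "x + y \<in> \<Union>C" using Z unfolding lid_def by blast
    qed
    then show "\<Union>C \<in> ?A" using C by (auto simp: subset.chain_def)
  qed
  then obtain L where L: "lid q L" "1 \<notin> L" "L0 \<subseteq> L" "\<And>L'. lid q L' \<Longrightarrow> 1 \<notin> L' \<Longrightarrow> L0 \<subseteq> L' \<Longrightarrow> L \<subseteq> L' \<Longrightarrow> L' = L"
    by auto
  then have "max_lid q L" unfolding max_lid_def by (metis order_trans)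
  then show ?thesis using L that by blast
qed

text \<open>The annihilator of the quotient by the left ideal \<open>L\<close>, that is, the largest
  two-sided ideal inside \<open>L\<close>.\<close>

definition core :: "'k::field \<Rightarrow> 'k wspace set \<Rightarrow> 'k wspace set" where
  "core q L = {a. \<forall>r. mul q a r \<in> L}"

lemma simple_quotient_module:
  assumes q: "q \<noteq> 0" and L: "max_lid q L"
  shows "\<exists>M :: ('k::field wspace, 'k wspace set) module. simple_left_module (Wring q) M \<and> annihilator (Wring q) M = core q L"
proof -
  have lid: "lid q L" and one: "1 \<notin> L" using L by (auto simp: max_lid_def)
  note D = lidD[OF lid]
  define cl where "cl x = {y. y - x \<in> L}" for x
  define rp where "rp U = (SOME x. cl x = U)" for U
  have cl_eq: "cl x = cl y \<longleftrightarrow> x - y \<in> L" for x y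
  proof
    assume "cl x = cl y"
    moreover have "x \<in> cl x" using D(1) by (simp add: cl_def)
    ultimately show "x - y \<in> L" by (auto simp: cl_def)
  next
    assume *: "x - y \<in> L"
    have "u - x \<in> L \<longleftrightarrow> u - y \<in> L" for u using D(2)[OF _ *, of "u - x"] D(6)[OF _ *, of "u - y"] by auto
    then show "cl x = cl y" by (auto simp: cl_def)
  qed
  have cl0: "cl x = cl 0 \<longleftrightarrow> x \<in> L" for x using cl_eq[of x 0] by simp
  have rp: "rp (cl x) - x \<in> L" for x
    using someI[of "\<lambda>z. cl z = cl x" x] cl_eq by (auto simp: rp_def)
  define M :: "('k wspace, 'k wspace set) module" where
    "M = \<lparr>carrier = range cl, monoid.mult = undefined, one = undefined, ring.zero = cl 0,
       add = (\<lambda>U V. cl (rp U + rp V)), module.smult = (\<lambda>a U. cl (mul q a (rp U)))\<rparr>"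
  have add: "cl x \<oplus>\<^bsub>M\<^esub> cl y = cl (x + y)" for x y
    using D(2)[OF rp[of x] rp[of y]] by (simp add: M_def cl_eq algebra_simps)
  have mul_diff: "mul q a (x - y) = mul q a x - mul q a y" for a x y
    using mul_add_right[of q a "x - y" y] by simp
  have sm: "a \<odot>\<^bsub>M\<^esub> cl x = cl (mul q a x)" for a x
    using D(3)[OF rp[of x], of a] by (simp add: M_def cl_eq mul_diff)
  have sel: "carrier M = range cl" "\<zero>\<^bsub>M\<^esub> = cl 0" by (simp_all add: M_def)
  have "abelian_group M"
  proof (rule abelian_groupI)
    fix U assume "U \<in> carrier M"
    then obtain x where "U = cl x" by (auto simp: sel)
    then show "\<exists>V\<in>carrier M. V \<oplus>\<^bsub>M\<^esub> U = \<zero>\<^bsub>M\<^esub>"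
      by (intro bexI[of _ "cl (- x)"]) (auto simp: add sel)
  qed (auto simp: sel add algebra_simps)
  then have lm: "left_module (Wring q) M"
    by (intro left_module.intro left_module_axioms.intro ring_Wring[OF q])
      (auto simp: sel sm add mul_add_left mul_add_right mul_assoc[OF q])
  have "N = {\<zero>\<^bsub>M\<^esub>} \<or> N = carrier M" if N: "submodule N (Wring q) M" for N
  proof -
    interpret N: submodule N "Wring q" M by fact
    have sub: "N \<subseteq> range cl" using N.subset by (simp add: sel)
    define L' where "L' = {x. cl x \<in> N}"
    have z: "cl 0 \<in> N" using N.one_closed by (simp add: sel)
    have "lid q L'"
      unfolding lid_def L'_def
      using z N.m_closed N.smult_closed by (auto simp flip: add sm)
    moreover have "L \<subseteq> L'" using z cl0 unfolding L'_def by (metis CollectI subsetI)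
    ultimately have "1 \<in> L' \<or> L' = L" using L by (auto simp: max_lid_def)
    then show ?thesis
    proof
      assume "1 \<in> L'"
      then have "cl x \<in> N" for x using N.smult_closed[of x "cl 1"] by (simp add: L'_def sm)
      then have "N = range cl" using sub by blast
      then show ?thesis by (simp add: sel)
    next
      assume "L' = L"
      then have "U = cl 0" if U: "U \<in> N" for U
      proof -
        obtain x where "U = cl x" using U sub by blast
        then show ?thesis using U cl0 \<open>L' = L\<close> unfolding L'_def by blast
      qed
      then have "N = {cl 0}" using z by blast
      then show ?thesis by (simp add: sel)
    qed
  qed
  moreover have "carrier M \<noteq> {\<zero>\<^bsub>M\<^esub>}" using one cl0[of 1] unfolding sel by blast
  ultimately have "simple_left_module (Wring q) M" using lm by (simp add: simple_left_module_def)
  moreover have "annihilator (Wring q) M = core q L"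
    unfolding annihilator_def core_def sel by (simp add: sm cl0)
  ultimately show ?thesis by blast
qed

section \<open>Homogeneous ideals of the coefficient ring\<close>

definition bideal :: "'k::field bpoly set \<Rightarrow> bool" where
  "bideal p \<longleftrightarrow> 0 \<in> p \<and> (\<forall>x\<in>p. \<forall>y\<in>p. x + y \<in> p) \<and> (\<forall>r. \<forall>x\<in>p. r * x \<in> p)"

definition homog :: "'k::field bpoly set \<Rightarrow> bool" where
  "homog p \<longleftrightarrow> (\<forall>x\<in>p. \<forall>j. hc j x \<in> p)"

definition bprime :: "'k::field bpoly set \<Rightarrow> bool" where
  "bprime p \<longleftrightarrow> bideal p \<and> 1 \<notin> p \<and> (\<forall>x y. x * y \<in> p \<longrightarrow> x \<in> p \<or> y \<in> p)"

definition Iw :: "'k::field bpoly set \<Rightarrow> 'k wspace set" where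
  "Iw p = {w. \<forall>n. Poly_Mapping.lookup w n \<in> p}"

lemma bidealD: assumes "bideal p"
  shows "0 \<in> p" "x \<in> p \<Longrightarrow> y \<in> p \<Longrightarrow> x + y \<in> p" "x \<in> p \<Longrightarrow> r * x \<in> p" "x \<in> p \<Longrightarrow> x * r \<in> p"
    "x \<in> p \<Longrightarrow> - x \<in> p" "x \<in> p \<Longrightarrow> y \<in> p \<Longrightarrow> x - y \<in> p"
proof -
  show m: "x \<in> p \<Longrightarrow> r * x \<in> p" for x r using assms by (simp add: bideal_def)
  from m[of x r] show "x \<in> p \<Longrightarrow> x * r \<in> p" by (simp add: mult.commute[of x r])
  show n: "x \<in> p \<Longrightarrow> - x \<in> p" for x using m[of x "- 1"] by simp
  show a: "x \<in> p \<Longrightarrow> y \<in> p \<Longrightarrow> x + y \<in> p" for x y using assms by (simp add: bideal_def)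
  show "x \<in> p \<Longrightarrow> y \<in> p \<Longrightarrow> x - y \<in> p" using a[of x "- y"] n[of y] by simp
qed (use assms in \<open>simp add: bideal_def\<close>)

lemma bideal_add_cancel: "bideal p \<Longrightarrow> x = a + s \<Longrightarrow> x \<in> p \<Longrightarrow> s \<in> p \<Longrightarrow> a \<in> p"
  using bidealD(6)[of p x s] by simp

lemma bideal_sum: "bideal p \<Longrightarrow> (\<And>a. a \<in> A \<Longrightarrow> f a \<in> p) \<Longrightarrow> sum f A \<in> p"
  by (induction A rule: infinite_finite_induct) (auto intro: bidealD)

lemma bideal_unit_mult: 
  assumes "bideal p" "u * v = 1" "u * x \<in> p" shows "x \<in> p"
proof -
  have "x = v * (u * x)" using assms(2) by (simp add: mult.assoc[symmetric] mult.commute)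
  then show ?thesis using bidealD(3)[OF assms(1,3), of v] by simp
qed

lemma bideal_Dv: "bideal p \<Longrightarrow> Dv l * x \<in> p \<Longrightarrow> x \<in> p"
  by (rule bideal_unit_mult[of p "Dv l" "Dv (- l)"]) (simp_all add: Dv_mult Dv_zero)

lemma bideal_cst: "bideal p \<Longrightarrow> c \<noteq> 0 \<Longrightarrow> cst c * x \<in> p \<Longrightarrow> x \<in> p"
  by (rule bideal_unit_mult[of p "cst c" "cst (inverse c)"]) (simp_all add: cst_mult)

definition degs :: "'k::field bpoly \<Rightarrow> nat set" where
  "degs \<beta> = (\<lambda>k. fst k + fst (snd k)) ` Poly_Mapping.keys \<beta>"

lemma finite_degs [simp]: "finite (degs \<beta>)" by (simp add: degs_def)

lemma wt_decomp: "wt h \<beta> = (\<Sum>j\<in>degs \<beta>. cst (h j) * hc j \<beta>)"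
proof (rule poly_mapping_eqI)
  fix k
  have *: "Poly_Mapping.lookup (cst c * x) k = c * Poly_Mapping.lookup x k" for c and x :: "'a bpoly"
    by (induction x rule: poly_mapping_single_induct) (auto simp: mult_single lookup_single when_def lookup_add algebra_simps)
  have "Poly_Mapping.lookup (\<Sum>j\<in>degs \<beta>. cst (h j) * hc j \<beta>) k =
      (\<Sum>j\<in>degs \<beta>. if j = fst k + fst (snd k) then h j * Poly_Mapping.lookup \<beta> k else 0)"
    unfolding lookup_sum by (intro sum.cong refl) (simp add: * lookup_wt)
  also have "\<dots> = h (fst k + fst (snd k)) * Poly_Mapping.lookup \<beta> k"
    by (auto simp: degs_def in_keys_iff)
  finally show "Poly_Mapping.lookup (wt h \<beta>) k = Poly_Mapping.lookup (\<Sum>j\<in>degs \<beta>. cst (h j) * hc j \<beta>) k"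
    by (simp add: lookup_wt)
qed

lemma hc_decomp: "\<beta> = (\<Sum>j\<in>degs \<beta>. hc j \<beta>)"
proof -
  have "wt (\<lambda>_. 1) \<beta> = \<beta>" by (rule poly_mapping_eqI) (simp add: lookup_wt)
  then show ?thesis using wt_decomp[of "\<lambda>_. 1" \<beta>] by simp
qed

lemma bideal_from_hc: "bideal p \<Longrightarrow> (\<And>j. hc j \<beta> \<in> p) \<Longrightarrow> \<beta> \<in> p"
  by (subst hc_decomp) (rule bideal_sum)

lemma homog_wt: "bideal p \<Longrightarrow> homog p \<Longrightarrow> \<beta> \<in> p \<Longrightarrow> wt h \<beta> \<in> p"
  by (subst wt_decomp, intro bideal_sum bidealD) (auto simp: homog_def)

lemma sg_inverse: "r \<noteq> 0 \<Longrightarrow> sg (inverse r) (sg r \<beta>) = \<beta>"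
  by (simp add: sg_sg)

lemma homog_sg_iff: "bideal p \<Longrightarrow> homog p \<Longrightarrow> r \<noteq> 0 \<Longrightarrow> sg r \<beta> \<in> p \<longleftrightarrow> \<beta> \<in> p"
  using homog_wt[of p "sg r \<beta>" "\<lambda>i. inverse r ^ i"] homog_wt[of p \<beta> "\<lambda>i. r ^ i"] sg_inverse[of r \<beta>] by auto

lemma hc_mult: "hc n (x * y) = (\<Sum>i\<le>n. hc i x * hc (n - i) y)"
proof (induction x rule: poly_mapping_single_induct)
  case (single k c)
  show ?case
  proof (induction y rule: poly_mapping_single_induct)
    case (single l d)
    let ?a = "fst k + fst (snd k)" and ?b = "fst l + fst (snd l)"
    have "(\<Sum>i\<le>n. hc i (Poly_Mapping.single k c) * hc (n - i) (Poly_Mapping.single l d)) =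
       (\<Sum>i\<le>n. if i = ?a then (if ?b = n - ?a then Poly_Mapping.single (k + l) (c * d) else 0) else 0)"
      by (intro sum.cong refl) (auto simp: wt_single mult_single)
    also have "\<dots> = (if ?a \<le> n \<and> ?b = n - ?a then Poly_Mapping.single (k + l) (c * d) else 0)"
      by (simp add: sum.delta)
    finally show ?case by (auto simp: mult_single wt_single)
  qed (simp add: distrib_left wt_add sum.distrib)
qed (simp add: distrib_right wt_add sum.distrib)

lemma hc_mult_homogeneous:
  assumes "hc i x = x" shows "hc n (x * y) = (if i \<le> n then x * hc (n - i) y else 0)"
proof -
  have "hc j x = (if j = i then x else 0)" for j
  proof (cases "j = i")
    case False
    have "hc j (hc i x) = 0" using False by (intro poly_mapping_eqI) (simp add: lookup_wt)
    then show ?thesis using assms False by simp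
  qed (simp add: assms)
  then have "hc n (x * y) = (\<Sum>j\<le>n. if j = i then x * hc (n - i) y else 0)"
    unfolding hc_mult by (intro sum.cong refl) auto
  then show ?thesis by (simp add: sum.delta)
qed

lemma bideal_multiples: "bideal (range (times z))" and homog_multiples: "hc i z = z \<Longrightarrow> homog (range (times z))"
  for z :: "'k::field bpoly"
proof -
  show "bideal (range (times z))"
    unfolding bideal_def by (auto simp: distrib_left[symmetric] mult.left_commute[of _ z] intro!: image_eqI[of 0 _ 0])
  show "homog (range (times z))" if "hc i z = z"
    unfolding homog_def using hc_mult_homogeneous[OF that] by (auto intro!: image_eqI[of 0 _ 0])
qed

text \<open>The parameters are recorded in \<open>S\<close> because products over disjoint sets of
  parameters turn out to be comaximal.\<close>

inductive_set ttprod :: "'k::field set \<Rightarrow> 'k bpoly set" for S where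
  one: "1 \<in> ttprod S"
| tt: "r \<in> S \<Longrightarrow> u \<in> ttprod S \<Longrightarrow> tt r * u \<in> ttprod S"

lemma ttprod_mult: "u \<in> ttprod S \<Longrightarrow> v \<in> ttprod S \<Longrightarrow> u * v \<in> ttprod S"
  by (induction rule: ttprod.induct) (auto simp: mult.assoc intro: ttprod.intros)

lemma ttprod_sg: "u \<in> ttprod S \<Longrightarrow> (\<And>t. t \<in> S \<Longrightarrow> r ^ 2 * t \<in> S) \<Longrightarrow> sg r u \<in> ttprod S"
  by (induction rule: ttprod.induct) (auto simp: sg_mult sg_tt intro: ttprod.intros)

lemma ttprod_kap: "kap q n k \<in> ttprod UNIV"
proof -
  have A: "kA q m \<in> ttprod UNIV" "kD q m \<in> ttprod UNIV" for m
    using ttprod.tt[of _ UNIV 1] ttprod.one by (auto simp: kA_def kD_def)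
  have "kapP q m k \<in> ttprod UNIV" "kapN q m k \<in> ttprod UNIV" for m
    by (induction m) (auto intro: ttprod.one ttprod_mult A ttprod_sg)
  then show ?thesis by (simp add: kap_def)
qed

text \<open>The lowest part of \<open>tt r\<close> is the unit \<open>D\<close>. Hence in each
  degree \<open>j\<close> the component of \<open>tt r * \<beta>\<close> is \<open>D\<close> times
  that of \<open>\<beta>\<close> plus a multiple of the component of degree \<open>j - 2\<close>,
  which lies in \<open>p\<close> by induction.\<close>

lemma homog_tt_cancel:
  assumes p: "bideal p" "homog p" and m: "tt r * \<beta> \<in> p" shows "\<beta> \<in> p"
proof (rule bideal_from_hc[OF p(1)])
  fix j show "hc j \<beta> \<in> p"
  proof (induction j rule: less_induct)
    case (less j)
    have D: "hc 0 (Dv 1) = Dv 1" and bc: "hc 2 (cst r * bv * cv) = cst r * bv * cv"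
      by (simp_all add: Dv_def bv_def cv_def mult_single wt_single)
    have "hc j (tt r * \<beta>) = Dv 1 * hc j \<beta> + (if 2 \<le> j then cst r * bv * cv * hc (j - 2) \<beta> else 0)"
      unfolding tt_def distrib_right wt_add hc_mult_homogeneous[OF D] hc_mult_homogeneous[OF bc] by simp
    moreover have "hc j (tt r * \<beta>) \<in> p" using p(2) m by (simp add: homog_def)
    moreover have "(if 2 \<le> j then cst r * bv * cv * hc (j - 2) \<beta> else 0) \<in> p"
      using less[of "j - 2"] bidealD(1,3)[OF p(1)] by auto
    ultimately have "Dv 1 * hc j \<beta> \<in> p" by (rule bideal_add_cancel[OF p(1)])
    then show ?case by (rule bideal_Dv[OF p(1)])
  qed
qed

lemma homog_ttprod_cancel:
  assumes p: "bideal p" "homog p" and "u \<in> ttprod S" "u * \<beta> \<in> p" shows "\<beta> \<in> p"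
  using assms(3,4) by (induction rule: ttprod.induct) (auto simp: mult.assoc intro: homog_tt_cancel[OF p])

text \<open>The two elements differ by a nonzero scalar times \<open>b c\<close>, and
  \<open>tt r\<close> minus a multiple of \<open>b c\<close> is the unit \<open>D\<close>.\<close>

lemma tt_comaximal:
  assumes p: "bideal p" and rt: "r \<noteq> t" and m: "tt r * \<beta> \<in> p" "tt t * \<beta> \<in> p" shows "\<beta> \<in> p"
proof -
  have "tt r * \<beta> - tt t * \<beta> = cst (r - t) * (bv * cv * \<beta>)"
    by (simp add: tt_def single_diff algebra_simps)
  then have "cst (r - t) * (bv * cv * \<beta>) \<in> p" using bidealD(6)[OF p m] by simp
  then have "bv * cv * \<beta> \<in> p" by (rule bideal_cst[OF p, rotated]) (use rt in simp)
  from bidealD(6)[OF p m(1) bidealD(3)[OF p this, of "cst r"]]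
  have "Dv 1 * \<beta> \<in> p" by (simp add: tt_def algebra_simps)
  then show ?thesis by (rule bideal_Dv[OF p])
qed

lemma ttprod_comaximal:
  assumes p: "bideal p" and ST: "S \<inter> T = {}" and u: "u \<in> ttprod S" and v: "v \<in> ttprod T"
    and m: "u * \<beta> \<in> p" "v * \<beta> \<in> p" shows "\<beta> \<in> p"
proof -
  have s: "\<beta> \<in> p" if v: "v \<in> ttprod T" and r: "r \<in> S" and m: "tt r * \<beta> \<in> p" "v * \<beta> \<in> p" for r v \<beta>
    using v m
  proof (induction arbitrary: \<beta> rule: ttprod.induct)
    case (tt t v)
    have "v * \<beta> \<in> p"
    proof (rule tt_comaximal[OF p, of r t])
      show "r \<noteq> t" using r tt ST by auto
      show "tt r * (v * \<beta>) \<in> p" using bidealD(3)[OF p tt(4), of v] by (simp add: mult_ac)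
      show "tt t * (v * \<beta>) \<in> p" using tt(5) by (simp add: mult.assoc)
    qed
    then show ?case using tt by blast
  qed simp
  show ?thesis using u m
  proof (induction arbitrary: rule: ttprod.induct)
    case (tt r u)
    have "u * \<beta> \<in> p"
    proof (rule s[OF v tt(1)])
      show "tt r * (u * \<beta>) \<in> p" using tt(4) by (simp add: mult.assoc)
      show "v * (u * \<beta>) \<in> p" using bidealD(3)[OF p m(2), of u] by (simp add: mult_ac)
    qed
    then show ?case using tt by blast
  qed simp
qed

section \<open>The ideals attached to homogeneous ideals\<close>

lemma mem_Iw_single: "bideal p \<Longrightarrow> Poly_Mapping.single n \<beta> \<in> Iw p \<longleftrightarrow> \<beta> \<in> p"
  using bidealD(1)[of p] by (auto simp: Iw_def lookup_single when_def)

lemma lid_Iw: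
  assumes p: "bideal p" "homog p" shows "lid q (Iw p)" and "x \<in> Iw p \<Longrightarrow> mul q x r \<in> Iw p"
proof -
  show "lid q (Iw p)"
    unfolding lid_def Iw_def
    by (auto simp: lookup_add lookup_mul intro!: bideal_sum[OF p(1)] bidealD(1,2,3)[OF p(1)] homog_wt[OF p])
  show "x \<in> Iw p \<Longrightarrow> mul q x r \<in> Iw p"
    unfolding Iw_def by (auto simp: lookup_mul mult.assoc intro!: bideal_sum[OF p(1)] bidealD(4)[OF p(1)])
qed

lemma ideal_Iw: "q \<noteq> 0 \<Longrightarrow> bideal p \<Longrightarrow> homog p \<Longrightarrow> ideal (Iw p) (Wring q)"
  by (simp add: ideal_Wring lid_Iw)

text \<open>A leading coefficient argument: with \<open>n\<close> and \<open>m\<close> the highest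
  places where \<open>x\<close> and \<open>y\<close> leave \<open>p\<close>, the coefficient of the
  product at \<open>n + m\<close> is, modulo \<open>p\<close>, the product of these two
  coefficients, the second twisted by \<open>sg\<close>, times \<open>kap q n m\<close>. The twist
  preserves \<open>p\<close>, and \<open>kap q n m\<close> is outside \<open>p\<close> because it is
  a product of factors \<open>tt r\<close>, each cancellable modulo \<open>p\<close>.\<close>

lemma Iw_completely_prime:
  assumes q: "q \<noteq> 0" and p: "bprime p" "homog p" and xy: "mul q x y \<in> Iw p"
  shows "x \<in> Iw p \<or> y \<in> Iw p"
proof (rule ccontr)
  have id: "bideal p" and one: "1 \<notin> p" and prime: "\<And>x y. x * y \<in> p \<Longrightarrow> x \<in> p \<or> y \<in> p"
    using p(1) by (auto simp: bprime_def)
  note D = bidealD[OF id]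
  assume "\<not> (x \<in> Iw p \<or> y \<in> Iw p)"
  have top: "\<exists>n. Poly_Mapping.lookup z n \<notin> p \<and> (\<forall>m>n. Poly_Mapping.lookup z m \<in> p)" if "z \<notin> Iw p" for z
  proof -
    let ?S = "{n \<in> Poly_Mapping.keys z. Poly_Mapping.lookup z n \<notin> p}"
    have "?S \<noteq> {}" using that D(1) by (simp add: Iw_def in_keys_iff) metis
    moreover have fin: "finite ?S" by simp
    ultimately have "Max ?S \<in> ?S" by (rule Max_in[rotated])
    moreover have "Poly_Mapping.lookup z m \<in> p" if "m > Max ?S" for m
    proof (rule ccontr)
      assume *: "Poly_Mapping.lookup z m \<notin> p"
      then have "m \<in> ?S" using D(1) by (auto simp: in_keys_iff)
      then show False using Max_ge[OF fin] that by (meson leD)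
    qed
    ultimately show ?thesis by blast
  qed
  obtain n where n: "Poly_Mapping.lookup x n \<notin> p" "\<And>k. k > n \<Longrightarrow> Poly_Mapping.lookup x k \<in> p"
    using top[of x] \<open>\<not> (x \<in> Iw p \<or> y \<in> Iw p)\<close> by blast
  obtain m where m: "Poly_Mapping.lookup y m \<notin> p" "\<And>k. k > m \<Longrightarrow> Poly_Mapping.lookup y k \<in> p"
    using top[of y] \<open>\<not> (x \<in> Iw p \<or> y \<in> Iw p)\<close> by blast
  define F where "F k = Poly_Mapping.lookup x k * kap q k (n + m - k) * sg (q powi k) (Poly_Mapping.lookup y (n + m - k))" for k
  have "n \<in> Poly_Mapping.keys x" using n(1) D(1) by (auto simp: in_keys_iff)
  then have "Poly_Mapping.lookup (mul q x y) (n + m) = F n + sum F (Poly_Mapping.keys x - {n})"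
    unfolding lookup_mul F_def by (subst sum.remove[of _ n]) auto
  moreover have "sum F (Poly_Mapping.keys x - {n}) \<in> p"
  proof (rule bideal_sum[OF id])
    fix k assume "k \<in> Poly_Mapping.keys x - {n}"
    then consider "k > n" | "n + m - k > m" by force
    then show "F k \<in> p"
    proof cases
      case 1
      then show ?thesis using n(2) by (simp add: F_def mult.assoc D)
    next
      case 2
      then show ?thesis using m(2) by (simp add: F_def D homog_wt[OF id p(2)])
    qed
  qed
  moreover have "Poly_Mapping.lookup (mul q x y) (n + m) \<in> p" using xy by (simp add: Iw_def)
  ultimately have "F n \<in> p" using bideal_add_cancel[OF id] by blast
  moreover have "kap q n m \<notin> p"
    using homog_ttprod_cancel[OF id p(2) ttprod_kap, of q n m 1] one by auto
  moreover have "sg (q powi n) (Poly_Mapping.lookup y m) \<notin> p"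
    using m(1) homog_sg_iff[OF id p(2)] q by simp
  ultimately show False using n(1) prime by (simp add: F_def) blast
qed

lemma completely_prime_imp_spec:
  assumes "q \<noteq> 0" "ideal P (Wring q)" "1 \<notin> P" "\<And>x y. mul q x y \<in> P \<Longrightarrow> x \<in> P \<or> y \<in> P"
  shows "P \<in> spec (Wring q)"
proof -
  have "I \<subseteq> P \<or> J \<subseteq> P" if IJ: "ideal_prod (Wring q) I J \<subseteq> P" for I J
  proof (rule ccontr)
    assume "\<not> (I \<subseteq> P \<or> J \<subseteq> P)"
    then obtain x y where xy: "x \<in> I" "x \<notin> P" "y \<in> J" "y \<notin> P" by auto
    have "mul q x y \<in> P" using subsetD[OF IJ ideal_prod.prod[OF xy(1,3)]] by simp
    then show False using assms(4) xy by blast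
  qed
  then show ?thesis using assms by (auto simp: spec_def prime_ideal_nc_def)
qed

lemma Iw_in_spec: 
  assumes "q \<noteq> 0" "bprime p" "homog p" shows "Iw p \<in> spec (Wring q)"
proof (rule completely_prime_imp_spec[OF assms(1) ideal_Iw])
  show "1 \<notin> Iw p" using assms(2) mem_Iw_single[of p 0 1] by (auto simp: bprime_def)
qed (use assms Iw_completely_prime in \<open>auto simp: bprime_def\<close>)

text \<open>Comparing \<open>G w\<close> with \<open>lam m g w\<close> removes one component of \<open>w\<close> at the cost of a factor \<open>g\<close>.\<close>

lemma gradation_elimination:
  assumes P: "lid q P" and G: "\<And>w. w \<in> P \<Longrightarrow> G w \<in> P"
    and lookup_G: "\<And>w n. Poly_Mapping.lookup (G w) n = cst (lam n) * g * Poly_Mapping.lookup w n"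
    and lam: "inj lam" and x: "x \<in> P"
  shows "\<exists>N. Poly_Mapping.single n (g ^ N * Poly_Mapping.lookup x n) \<in> P"
  using x
proof (induction "card (Poly_Mapping.keys x - {n})" arbitrary: x rule: less_induct)
  case less
  show ?case
  proof (cases "Poly_Mapping.keys x - {n} = {}")
    case True
    then have "Poly_Mapping.lookup x k = 0" if "k \<noteq> n" for k using that by (auto simp: in_keys_iff)
    then have "x = Poly_Mapping.single n (Poly_Mapping.lookup x n)"
      by (intro poly_mapping_eqI) (auto simp: lookup_single when_def)
    then show ?thesis using less.prems by (intro exI[of _ 0]) simp
  next
    case False
    then obtain m where m: "m \<in> Poly_Mapping.keys x" "m \<noteq> n" by blast
    define y where "y = G x - scl (cst (lam m) * g) x"
    have y: "Poly_Mapping.lookup y k = cst (lam k - lam m) * g * Poly_Mapping.lookup x k" for k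
      by (simp add: y_def lookup_minus lookup_G lookup_scl single_diff algebra_simps)
    have "y \<in> P" unfolding y_def by (rule lidD(6)[OF P G[OF less.prems] lidD(4)[OF P less.prems]])
    moreover have "Poly_Mapping.keys y - {n} \<subset> Poly_Mapping.keys x - {n}"
    proof -
      have "Poly_Mapping.keys y \<subseteq> Poly_Mapping.keys x - {m}" by (auto simp: in_keys_iff y)
      then show ?thesis using m by auto
    qed
    then have "card (Poly_Mapping.keys y - {n}) < card (Poly_Mapping.keys x - {n})"
      by (intro psubset_card_mono) auto
    ultimately obtain N where "Poly_Mapping.single n (g ^ N * Poly_Mapping.lookup y n) \<in> P"
      using less.hyps by blast
    then have "scl (cst (inverse (lam n - lam m))) (Poly_Mapping.single n (g ^ N * Poly_Mapping.lookup y n)) \<in> P"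
      by (rule lidD(4)[OF P])
    moreover have "lam n - lam m \<noteq> 0" using lam m(2) by (auto simp: inj_def)
    then have "cst (inverse (lam n - lam m)) * (cst (lam n - lam m) * z) = z" for z
      by (simp add: mult.assoc[symmetric] cst_mult)
    then have "cst (inverse (lam n - lam m)) * (g ^ N * Poly_Mapping.lookup y n) = g ^ Suc N * Poly_Mapping.lookup x n"
      by (simp add: y mult_ac)
    ultimately show ?thesis by (metis scl_single)
  qed
qed

lemma graded_from_cancel:
  assumes P: "lid q P" and G: "\<And>w. w \<in> P \<Longrightarrow> G w \<in> P"
    and lookup_G: "\<And>w n. Poly_Mapping.lookup (G w) n = cst (lam n) * g * Poly_Mapping.lookup w n"
    and lam: "inj lam" and cancel: "\<And>y. scl g y \<in> P \<Longrightarrow> y \<in> P" and x: "x \<in> P"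
  shows "Poly_Mapping.single n (Poly_Mapping.lookup x n) \<in> P"
proof -
  obtain N where "scl (g ^ N) (Poly_Mapping.single n (Poly_Mapping.lookup x n)) \<in> P"
    using gradation_elimination[OF P G lookup_G lam x] by (auto simp: scl_single)
  then show ?thesis by (induction N) (auto simp: scl_scl[symmetric] intro: cancel)
qed

definition base :: "'k::field wspace set \<Rightarrow> 'k bpoly set" where
  "base P = {\<beta>. Poly_Mapping.single 0 \<beta> \<in> P}"

lemma bideal_base: assumes "lid q P" shows "bideal (base P)"
  unfolding bideal_def base_def using lidD[OF assms]
  by (auto simp: single_add) (metis scl_single)

text \<open>Right multiplication by \<open>e_(-n)\<close> moves a component at \<open>n\<close> to
  place \<open>0\<close> at the cost of the factor \<open>kap q n (- n)\<close>, which cancels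
  modulo a homogeneous ideal. Thus all places have the same coefficient ideal.\<close>

lemma graded_eq_Iw:
  assumes q: "q \<noteq> 0" and P: "ideal P (Wring q)" and homog: "homog (base P)"
    and graded: "\<And>x n. x \<in> P \<Longrightarrow> Poly_Mapping.single n (Poly_Mapping.lookup x n) \<in> P"
  shows "P = Iw (base P)"
proof -
  have lid: "lid q P" and right: "\<And>x r. x \<in> P \<Longrightarrow> mul q x r \<in> P" using P q by (auto simp: ideal_Wring)
  note id = bideal_base[OF lid]
  have el: "Poly_Mapping.single n \<beta> \<in> P \<longleftrightarrow> \<beta> \<in> base P" for n \<beta>
  proof
    assume "Poly_Mapping.single n \<beta> \<in> P"
    then have "mul q (Poly_Mapping.single n \<beta>) (Poly_Mapping.single (- n) 1) \<in> P" by (rule right)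
    then have "kap q n (- n) * \<beta> \<in> base P" by (simp add: mul_single_single base_def mult.commute)
    then show "\<beta> \<in> base P" by (rule homog_ttprod_cancel[OF id homog ttprod_kap])
  next
    assume "\<beta> \<in> base P"
    then have "mul q (Poly_Mapping.single 0 \<beta>) (Poly_Mapping.single n 1) \<in> P" by (intro right) (simp add: base_def)
    then show "Poly_Mapping.single n \<beta> \<in> P" by (simp add: mul_single_single)
  qed
  show ?thesis
  proof (intro equalityI subsetI)
    fix x assume "x \<in> P" then show "x \<in> Iw (base P)" using graded el by (auto simp: Iw_def)
  next
    fix x assume "x \<in> Iw (base P)"
    then have *: "Poly_Mapping.single n (Poly_Mapping.lookup x n) \<in> P" for n using el by (auto simp: Iw_def)
    have "(\<Sum>n\<in>A. Poly_Mapping.single n (Poly_Mapping.lookup x n)) \<in> P" for A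
      by (induction A rule: infinite_finite_induct) (auto intro: lidD[OF lid] *)
    then show "x \<in> P" using poly_mapping_eq_sum_single[of x] by metis
  qed
qed

section \<open>Graded primes, quantum side\<close>

text \<open>Elements that scale like \<open>b\<close> and \<open>c\<close> are normal: they move
  across any \<open>x\<close> at the price of the diagonal automorphism with factor
  \<open>q^n\<close> at place \<open>n\<close>.\<close>

lemma normal_left: "q \<noteq> 0 \<Longrightarrow> (\<And>r. sg r g = cst r * g) \<Longrightarrow>
    mul q x (Poly_Mapping.single 0 g) = scl g (lsh 0 (\<lambda>n. cst (q powi n)) 1 x)"
  and normal_right: "q \<noteq> 0 \<Longrightarrow> (\<And>r. sg r g = cst r * g) \<Longrightarrow>
    scl g x = mul q (lsh 0 (\<lambda>n. cst (q powi (- n))) 1 x) (Poly_Mapping.single 0 g)"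
  by (rule poly_mapping_eqI; simp add: lookup_mul_coef_right lookup_scl lookup_lsh power_int_minus mult_ac;
    simp add: mult.assoc[symmetric] cst_mult)+

lemma degs_subset: assumes "degs \<beta> \<subseteq> {j}" shows "hc j \<beta> = \<beta>"
proof (rule poly_mapping_eqI)
  fix k
  have "fst k + fst (snd k) = j" if "k \<in> Poly_Mapping.keys \<beta>"
    using that assms unfolding degs_def by blast
  then show "Poly_Mapping.lookup (hc j \<beta>) k = Poly_Mapping.lookup \<beta> k"
    by (auto simp: lookup_wt in_keys_iff)
qed

text \<open>The combination \<open>sg s \<beta> - s^i \<beta>\<close> has no component of degree
  \<open>i\<close>, and the other components survive up to nonzero scalars. The closure condition
  keeps the accumulated parameters inside \<open>S\<close>, as \<open>sg s\<close> maps
  \<open>tt t\<close> to \<open>tt (s^2 t)\<close>.\<close>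

lemma sg_hc_elimination:
  assumes p: "bideal p" and S: "s \<in> S" "\<And>t. t \<in> S \<Longrightarrow> s ^ 2 * t \<in> S"
    and step: "\<And>\<beta>. \<beta> \<in> p \<Longrightarrow> tt s * sg s \<beta> \<in> p" and inj: "\<And>i j. i \<noteq> j \<Longrightarrow> s ^ i \<noteq> s ^ (j::nat)"
    and u: "u \<in> ttprod S" "u * \<beta> \<in> p"
  shows "\<exists>v\<in>ttprod S. v * hc j \<beta> \<in> p"
  using u
proof (induction "card (degs \<beta> - {j})" arbitrary: \<beta> u rule: less_induct)
  case less
  show ?case
  proof (cases "degs \<beta> - {j} = {}")
    case True
    then show ?thesis using less.prems degs_subset[of \<beta> j] by (intro bexI[of _ u]) auto
  next
    case False
    then obtain i where i: "i \<in> degs \<beta>" "i \<noteq> j" by blast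
    define \<gamma> where "\<gamma> = sg s \<beta> - cst (s ^ i) * \<beta>"
    \<comment> \<open>Both \<open>u * \<beta>\<close> and
      \<open>tt s * sg s u * sg s \<beta>\<close> are in \<open>p\<close>; their multipliers are
      merged, so that one factor \<open>v\<close> serves both terms of
      \<open>\<gamma>\<close>.\<close>
    define v where "v = u * (tt s * sg s u)"
    have v: "v \<in> ttprod S" unfolding v_def using less.prems S by (intro ttprod_mult ttprod.tt ttprod_sg) auto
    have "u * (tt s * sg s (u * \<beta>)) - (cst (s ^ i) * (tt s * sg s u)) * (u * \<beta>) \<in> p"
      by (rule bidealD(6)[OF p bidealD(3)[OF p step[OF less.prems(2)]] bidealD(3)[OF p less.prems(2)]])
    moreover have "u * (tt s * sg s (u * \<beta>)) - (cst (s ^ i) * (tt s * sg s u)) * (u * \<beta>) = v * \<gamma>"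
      by (simp add: v_def \<gamma>_def sg_mult algebra_simps)
    ultimately have v\<gamma>: "v * \<gamma> \<in> p" by simp
    have \<gamma>: "\<gamma> = wt (\<lambda>l. s ^ l - s ^ i) \<beta>"
    proof -
      have "cst c * \<beta> = wt (\<lambda>_. c) \<beta>" for c
        by (induction \<beta> rule: poly_mapping_single_induct) (auto simp: mult_single wt_single wt_add distrib_left)
      then show ?thesis unfolding \<gamma>_def
        by (intro poly_mapping_eqI) (simp add: lookup_wt lookup_minus algebra_simps)
    qed
    have "degs \<gamma> \<subseteq> degs \<beta> - {i}"
      by (auto simp: degs_def \<gamma> in_keys_iff lookup_wt)
    then have "degs \<gamma> - {j} \<subset> degs \<beta> - {j}" using i by auto
    then have "card (degs \<gamma> - {j}) < card (degs \<beta> - {j})" by (intro psubset_card_mono) auto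
    then obtain v' where v': "v' \<in> ttprod S" "v' * hc j \<gamma> \<in> p" using less.hyps[OF _ v v\<gamma>] by blast
    have "s ^ j - s ^ i \<noteq> 0" using inj[of j i] i by simp
    moreover have "cst (s ^ j - s ^ i) * (v' * hc j \<beta>) \<in> p" using v'(2) by (simp add: \<gamma> wt_hc mult_ac)
    ultimately have "v' * hc j \<beta> \<in> p" by (rule bideal_cst[OF p])
    then show ?thesis using v'(1) by blast
  qed
qed

context
  fixes q :: "'k::field"
  assumes q0: "q \<noteq> 0" and nroot: "\<And>n::nat. n > 0 \<Longrightarrow> q ^ n \<noteq> 1"
begin

lemma q_powi_inj: "q powi m = q powi n \<longleftrightarrow> m = n"
proof -
  have *: "m = n" if "q powi m = q powi n" "m \<ge> n" for m n
  proof (rule ccontr)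
    assume "m \<noteq> n"
    have "q powi (m - n) = 1" using that q0 by (simp add: power_int_diff)
    moreover have "q powi (m - n) = q ^ nat (m - n)" using that by (simp add: power_int_def)
    ultimately show False using nroot[of "nat (m - n)"] that \<open>m \<noteq> n\<close> by simp
  qed
  show ?thesis using *[of m n] *[of n m] by (metis linear)
qed

lemma homog_base:
  assumes "ideal P (Wring q)" shows "homog (base P)"
proof -
  have lid: "lid q P" and right: "\<And>x r. x \<in> P \<Longrightarrow> mul q x r \<in> P" using assms q0 by (auto simp: ideal_Wring)
  note id = bideal_base[OF lid]
  have s1: "tt q * sg q \<beta> \<in> base P" if "\<beta> \<in> base P" for \<beta>
  proof -
    have "mul q (Poly_Mapping.single 1 1) (mul q (Poly_Mapping.single 0 \<beta>) (Poly_Mapping.single (- 1) 1)) \<in> P"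
      using that lidD(3)[OF lid] right by (simp add: base_def)
    then show ?thesis by (simp add: mul_single_single base_def kap_def kA_def)
  qed
  have s2: "tt (inverse q) * sg (inverse q) \<beta> \<in> base P" if "\<beta> \<in> base P" for \<beta>
  proof -
    have "mul q (Poly_Mapping.single (- 1) 1) (mul q (Poly_Mapping.single 0 \<beta>) (Poly_Mapping.single 1 1)) \<in> P"
      using that lidD(3)[OF lid] right by (simp add: base_def)
    then show ?thesis by (simp add: mul_single_single base_def kap_def kD_def)
  qed
  have inj1: "q ^ i \<noteq> q ^ j" if "i \<noteq> j" for i j
    using q_powi_inj[of "int i" "int j"] that by simp
  then have inj2: "inverse q ^ i \<noteq> inverse q ^ j" if "i \<noteq> j" for i j
    using that by (simp add: power_inverse)
  show ?thesis
    unfolding homog_def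
  proof (intro ballI allI)
    fix \<beta> j assume \<beta>: "\<beta> \<in> base P"
    \<comment> \<open>Elimination with \<open>q\<close> yields parameters that are positive powers,
      elimination with \<open>inverse q\<close> negative ones. The two sets are disjoint because
      \<open>q\<close> is not a root of unity, so the accumulated factors are comaximal.\<close>
    let ?S = "{q powi m |m. m > 0}" and ?T = "{q powi m |m. m < 0}"
    have 1: "q ^ 2 * t \<in> ?S" if t: "t \<in> ?S" for t
    proof -
      obtain m where "m > 0" "t = q powi m" using t by blast
      then have "q ^ 2 * t = q powi (m + 2)" using q0 by (simp add: power_int_add)
      then show ?thesis using \<open>m > 0\<close> by force
    qed
    have 2: "inverse q ^ 2 * t \<in> ?T" if t: "t \<in> ?T" for t
    proof -
      obtain m where "m < 0" "t = q powi m" using t by blast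
      then have "inverse q ^ 2 * t = q powi (m - 2)" using q0 by (simp add: power_int_diff field_simps)
      then show ?thesis using \<open>m < 0\<close> by force
    qed
    have qS: "q \<in> ?S" by (auto intro!: exI[of _ 1])
    have iT: "inverse q \<in> ?T" by (auto intro!: exI[of _ "- 1"] simp: power_int_minus)
    have b: "1 * \<beta> \<in> base P" using \<beta> by simp
    obtain u where u: "u \<in> ttprod ?S" "u * hc j \<beta> \<in> base P"
      using sg_hc_elimination[OF id qS 1 s1 inj1 ttprod.one b, of j] by blast
    obtain v where v: "v \<in> ttprod ?T" "v * hc j \<beta> \<in> base P"
      using sg_hc_elimination[OF id iT 2 s2 inj2 ttprod.one b, of j] by blast
    have "?S \<inter> ?T = {}" using q_powi_inj by auto
    then show "hc j \<beta> \<in> base P" by (rule ttprod_comaximal[OF id _ u(1) v(1) u(2) v(2)])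
  qed
qed

text \<open>By normality of \<open>g\<close>, both the multiples of \<open>g\<close> and the set of
  all \<open>y\<close> with \<open>scl g y \<in> P\<close> are two-sided ideals. Their product lies
  in \<open>P\<close>, and the former is not contained in \<open>P\<close>.\<close>

lemma spec_cancel_normal:
  assumes P: "P \<in> spec (Wring q)" and g: "\<And>r. sg r g = cst r * g" and gP: "Poly_Mapping.single 0 g \<notin> P"
    and y: "scl g y \<in> P"
  shows "y \<in> P"
proof -
  have Pi: "ideal P (Wring q)" using P by (simp add: spec_def prime_ideal_nc_def)
  then have lid: "lid q P" and right: "\<And>x r. x \<in> P \<Longrightarrow> mul q x r \<in> P" using q0 by (auto simp: ideal_Wring)
  note as = mul_assoc[OF q0]
  define I where "I = range (scl g)"
  define J where "J = {y. scl g y \<in> P}"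
  have left: "mul q r (scl g x) = scl g (mul q (lsh 0 (\<lambda>n. cst (q powi n)) 1 r) x)" for r x
    by (metis as mul_coef mul_scl normal_left[OF q0 g])
  have left': "mul q (scl g r) x = mul q (lsh 0 (\<lambda>n. cst (q powi (- n))) 1 r) (scl g x)" for r x
    by (metis as mul_coef normal_right[OF q0 g])
  have "lid q I"
    unfolding lid_def I_def using left by (auto simp flip: scl_add intro!: image_eqI[of 0 _ 0])
  then have I: "ideal I (Wring q)"
    using q0 by (auto simp: ideal_Wring I_def mul_scl)
  have "lid q J"
    unfolding lid_def J_def using lidD[OF lid] by (auto simp: scl_add) (metis left' mul_scl)
  then have J: "ideal J (Wring q)"
    using q0 right by (auto simp: ideal_Wring J_def simp flip: mul_scl)
  have "ideal_prod (Wring q) I J \<subseteq> P"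
  proof
    fix z assume "z \<in> ideal_prod (Wring q) I J"
    then show "z \<in> P"
    proof (induction rule: ideal_prod.induct)
      case (prod i j)
      then obtain r where "i = scl g r" by (auto simp: I_def)
      then show ?case using prod left'[of r j] lidD(3)[OF lid] by (simp add: J_def)
    qed (simp add: lidD[OF lid])
  qed
  then have "I \<subseteq> P \<or> J \<subseteq> P" using P I J by (auto simp: spec_def prime_ideal_nc_def)
  moreover have "Poly_Mapping.single 0 g \<in> I"
    unfolding I_def using scl_single[of g 0 1] by (intro image_eqI[of _ _ 1]) simp_all
  ultimately show ?thesis using gP y by (auto simp: J_def)
qed

lemma spec_graded:
  assumes P: "P \<in> spec (Wring q)" and g: "\<And>r. sg r g = cst r * g" and gP: "Poly_Mapping.single 0 g \<notin> P"
  shows "P = Iw (base P)"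
proof -
  have Pi: "ideal P (Wring q)" using P by (simp add: spec_def prime_ideal_nc_def)
  then have lid: "lid q P" and right: "\<And>x r. x \<in> P \<Longrightarrow> mul q x r \<in> P" using q0 by (auto simp: ideal_Wring)
  show ?thesis
  proof (rule graded_eq_Iw[OF q0 Pi homog_base[OF Pi]])
    fix x n assume "x \<in> P"
    then show "Poly_Mapping.single n (Poly_Mapping.lookup x n) \<in> P"
    proof (rule graded_from_cancel[OF lid, of "\<lambda>w. mul q w (Poly_Mapping.single 0 g)" "\<lambda>n. q powi n" g, rotated -1])
      show "inj (\<lambda>n. q powi n)" using q_powi_inj by (simp add: inj_def)
      show "y \<in> P" if "scl g y \<in> P" for y using spec_cancel_normal[OF P g gP that] .
    qed (simp_all add: right lookup_mul_coef_right g mult_ac)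
  qed
qed

text \<open>For a homogeneous generator, the principal ideal of coefficients yields a two-sided
  ideal of the model, so primeness of \<open>P\<close> applies to homogeneous \<open>x\<close> and
  \<open>y\<close>. Arbitrary elements are treated by comparing their components of lowest degree
  outside \<open>base P\<close>.\<close>

lemma bprime_base:
  assumes P: "P \<in> spec (Wring q)" and eq: "P = Iw (base P)"
  shows "bprime (base P)"
proof -
  have Pi: "ideal P (Wring q)" and "P \<noteq> UNIV" using P by (auto simp: spec_def prime_ideal_nc_def)
  then have lid: "lid q P" and right: "\<And>x r. x \<in> P \<Longrightarrow> mul q x r \<in> P" using q0 by (auto simp: ideal_Wring)
  let ?p = "base P"
  note id = bideal_base[OF lid] and hom = homog_base[OF Pi]
  have hom_prime: "x \<in> ?p \<or> y \<in> ?p" if xy: "x * y \<in> ?p" "hc i x = x" "hc j y = y" for x y i j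
  proof -
    have pr: "bideal (range (times z)) \<and> homog (range (times z))" if "hc i z = z" for z :: "'k bpoly" and i
      using bideal_multiples homog_multiples[OF that] by blast
    let ?I = "Iw (range (times x))" and ?J = "Iw (range (times y))"
    have I: "ideal ?I (Wring q)" and J: "ideal ?J (Wring q)"
      using pr xy q0 by (auto intro!: ideal_Iw)
    have "ideal_prod (Wring q) ?I ?J \<subseteq> Iw ?p"
    proof
      fix z assume "z \<in> ideal_prod (Wring q) ?I ?J"
      then show "z \<in> Iw ?p"
      proof (induction rule: ideal_prod.induct)
        case (prod u v)
        have "Poly_Mapping.lookup (mul q u v) N \<in> ?p" for N
          unfolding lookup_mul
        proof (rule bideal_sum[OF id])
          fix n
          obtain \<beta> where \<beta>: "Poly_Mapping.lookup u n = x * \<beta>" using prod(1) by (auto simp: Iw_def image_iff)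
          obtain \<gamma> where \<gamma>: "Poly_Mapping.lookup v (N - n) = y * \<gamma>" using prod(2) by (auto simp: Iw_def image_iff)
          have "sg (q powi n) (hc j y) = cst ((q powi n) ^ j) * hc j y"
            by (induction y rule: poly_mapping_single_induct) (auto simp: wt_single wt_add mult_single distrib_left)
          then have c: "sg (q powi n) y = cst ((q powi n) ^ j) * y" by (simp add: xy(3))
          have "Poly_Mapping.lookup u n * kap q n (N - n) * sg (q powi n) (Poly_Mapping.lookup v (N - n)) =
             (\<beta> * kap q n (N - n) * cst ((q powi n) ^ j) * sg (q powi n) \<gamma>) * (x * y)"
            by (simp add: \<beta> \<gamma> sg_mult c mult_ac)
          then show "Poly_Mapping.lookup u n * kap q n (N - n) * sg (q powi n) (Poly_Mapping.lookup v (N - n)) \<in> ?p"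
            using bidealD(3)[OF id xy(1)] by simp
        qed
        then show ?case by (simp add: Iw_def)
      next
        case (sum s1 s2)
        then show ?case using lidD(2)[OF lid] eq by auto
      qed
    qed
    then have "?I \<subseteq> P \<or> ?J \<subseteq> P" using P I J eq by (auto simp: spec_def prime_ideal_nc_def)
    moreover have "Poly_Mapping.single 0 z \<in> Iw (range (times z))" for z :: "'k bpoly"
      by (auto simp: Iw_def lookup_single when_def intro: image_eqI[of _ _ 1] image_eqI[of _ _ 0])
    ultimately show ?thesis by (auto simp: base_def)
  qed
  have "x \<in> ?p \<or> y \<in> ?p" if xy: "x * y \<in> ?p" for x y
  proof (rule ccontr)
    assume no: "\<not> (x \<in> ?p \<or> y \<in> ?p)"
    have low: "\<exists>i. hc i z \<notin> ?p \<and> (\<forall>k<i. hc k z \<in> ?p)" if "z \<notin> ?p" for z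
      using exists_least_iff[of "\<lambda>i. hc i z \<notin> ?p"] bideal_from_hc[OF id, of z] that by blast
    obtain i where i: "hc i x \<notin> ?p" "\<And>k. k < i \<Longrightarrow> hc k x \<in> ?p" using low no by blast
    obtain j where j: "hc j y \<notin> ?p" "\<And>k. k < j \<Longrightarrow> hc k y \<in> ?p" using low no by blast
    let ?F = "\<lambda>k. hc k x * hc (i + j - k) y"
    have "hc (i + j) (x * y) = ?F i + sum ?F ({..i + j} - {i})"
      unfolding hc_mult by (subst sum.remove[of _ i]) auto
    moreover have "sum ?F ({..i + j} - {i}) \<in> ?p"
    proof (rule bideal_sum[OF id])
      fix k assume "k \<in> {..i + j} - {i}"
      then have "k < i \<or> i + j - k < j" by auto
      then show "?F k \<in> ?p" using i(2) j(2) bidealD(3,4)[OF id] by blast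
    qed
    moreover have "hc (i + j) (x * y) \<in> ?p" using hom xy by (simp add: homog_def)
    ultimately have "?F i \<in> ?p" using bideal_add_cancel[OF id] by blast
    then have "hc i x * hc j y \<in> ?p" by simp
    moreover have "hc k (hc k z) = hc k z" for k and z :: "'k bpoly" by (rule poly_mapping_eqI) (simp add: lookup_wt)
    ultimately show False using hom_prime i(1) j(1) by blast
  qed
  moreover have "1 \<notin> ?p"
  proof
    assume "1 \<in> ?p"
    then have "1 \<in> P" by (simp add: base_def)
    then have "x \<in> P" for x using lidD(3)[OF lid, of 1 x] by simp
    then show False using \<open>P \<noteq> UNIV\<close> by auto
  qed
  ultimately show ?thesis using id by (simp add: bprime_def)
qed

lemma spec_graded_iff:
  assumes g: "\<And>r. sg r g = cst r * g" and gP: "Poly_Mapping.single 0 g \<notin> P"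
  shows "P \<in> spec (Wring q) \<longleftrightarrow> (\<exists>p. bprime p \<and> homog p \<and> P = Iw p)"
proof
  assume P: "P \<in> spec (Wring q)"
  then have "ideal P (Wring q)" by (simp add: spec_def prime_ideal_nc_def)
  then show "\<exists>p. bprime p \<and> homog p \<and> P = Iw p"
    using spec_graded[OF P g gP] bprime_base[OF P] homog_base by blast
qed (use Iw_in_spec[OF q0] in blast)

end

section \<open>Graded primes, Poisson side\<close>

definition wpoisson :: "'k::field wspace set \<Rightarrow> bool" where
  "wpoisson P \<longleftrightarrow> ideal P (Wring 1) \<and> (\<forall>x. \<forall>w\<in>P. pbr x w \<in> P)"

lemma eul_cst_mult: "eul (cst c * x) = cst c * eul x"
  by (rule wt_cst_mult)

lemma eul_tt_pow: "tt 1 * eul (tt 1 ^ m) = of_nat m * (2 * bv * cv) * tt 1 ^ m"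
proof (induction m)
  case (Suc m)
  have eq: "tt 1 * eul (tt 1 ^ Suc m) = tt 1 * (tt 1 * eul (tt 1 ^ m)) + tt 1 * (2 * bv * cv) * tt 1 ^ m"
    by (simp add: eul_mult eul_simps algebra_simps)
  show ?case unfolding eq Suc by (simp add: algebra_simps)
qed (simp add: wt_one)

lemma eul_tt_Suc: "eul (tt 1 ^ Suc m) = of_nat (Suc m) * (2 * bv * cv) * tt 1 ^ m"
proof -
  have "eul (tt 1 ^ Suc m) = tt 1 * eul (tt 1 ^ m) + 2 * bv * cv * tt 1 ^ m"
    by (simp add: eul_mult eul_simps)
  then show ?thesis by (simp add: eul_tt_pow algebra_simps)
qed

lemma eul_bc: "eul (2 * bv * cv) = 2 * (2 * bv * cv)"
proof -
  have "eul (2 :: 'a bpoly) = 0" using wt_cst[of of_nat "2 :: 'a"] by simp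
  then show ?thesis by (simp add: eul_mult eul_simps)
qed

lemma eul_of_nat_mult: "eul (of_nat n * x) = of_nat n * eul x"
  using eul_cst_mult[of "of_nat n" x] by simp

lemma eul_hc: "eul (hc j \<beta>) = of_nat j * hc j (\<beta> :: 'k::field bpoly)"
proof -
  have "eul (hc j \<beta>) = cst (of_nat j) * hc j \<beta>"
    by (induction \<beta> rule: poly_mapping_single_induct)
      (auto simp: wt_single mult_single wt_add distrib_left simp del: single_of_nat)
  then show ?thesis by simp
qed

lemma tt_bc_comaximal:
  assumes p: "bideal p" and m: "tt 1 * u \<in> p" "(bv * cv) * ((bv * cv) * u) \<in> p" shows "u \<in> p"
proof -
  have "Dv 1 * (Dv 1 * u) = (Dv 1 - bv * cv) * (tt 1 * u) + (bv * cv) * ((bv * cv) * u)"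
    by (simp add: tt_def algebra_simps)
  then have "Dv 1 * (Dv 1 * u) \<in> p" using bidealD(2)[OF p bidealD(3)[OF p m(1), of "Dv 1 - bv * cv"] m(2)] by simp
  then show ?thesis by (intro bideal_Dv[OF p, of 1 u] bideal_Dv[OF p, of 1 "Dv 1 * u"])
qed

text \<open>The infinitesimal form of the elimination of degrees: \<open>eul\<close> replaces
  \<open>sg\<close>, and its eigenvalues \<open>of_nat i\<close> are distinct in characteristic
  zero. Each step raises the power of \<open>tt 1\<close> by one.\<close>

lemma tt_hc_elimination:
  fixes p :: "'k::field_char_0 bpoly set"
  assumes p: "bideal p" and step: "\<And>\<beta>. \<beta> \<in> p \<Longrightarrow> tt 1 * eul \<beta> \<in> p" and u: "tt 1 ^ N * \<beta> \<in> p"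
  shows "\<exists>N. tt 1 ^ N * hc j \<beta> \<in> p"
  using u
proof (induction "card (degs \<beta> - {j})" arbitrary: \<beta> N rule: less_induct)
  case less
  show ?case
  proof (cases "degs \<beta> - {j} = {}")
    case True
    then show ?thesis using less.prems degs_subset[of \<beta> j] by (intro exI[of _ N]) auto
  next
    case False
    then obtain i where i: "i \<in> degs \<beta>" "i \<noteq> j" by blast
    define \<gamma> where "\<gamma> = eul \<beta> - cst (of_nat i) * \<beta>"
    have eq: "tt 1 ^ Suc N * eul \<beta> = tt 1 * eul (tt 1 ^ N * \<beta>) - of_nat N * (2 * bv * cv) * (tt 1 ^ N * \<beta>)"
    proof -
      have "tt 1 * eul (tt 1 ^ N * \<beta>) = tt 1 ^ Suc N * eul \<beta> + (tt 1 * eul (tt 1 ^ N)) * \<beta>"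
        by (simp add: eul_mult algebra_simps)
      then show ?thesis unfolding eul_tt_pow by (simp add: algebra_simps)
    qed
    have 1: "tt 1 ^ Suc N * eul \<beta> \<in> p"
      unfolding eq by (rule bidealD(6)[OF p step[OF less.prems] bidealD(3)[OF p less.prems]])
    have "tt 1 ^ Suc N * \<gamma> = tt 1 ^ Suc N * eul \<beta> - (cst (of_nat i) * tt 1) * (tt 1 ^ N * \<beta>)"
      by (simp add: \<gamma>_def algebra_simps)
    then have v: "tt 1 ^ Suc N * \<gamma> \<in> p" using bidealD(6)[OF p 1 bidealD(3)[OF p less.prems, of "cst (of_nat i) * tt 1"]] by simp
    have \<gamma>: "\<gamma> = wt (\<lambda>l. of_nat l - of_nat i) \<beta>"
    proof -
      have cm: "cst c * \<beta> = wt (\<lambda>_. c) \<beta>" for c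
        by (induction \<beta> rule: poly_mapping_single_induct) (auto simp: mult_single wt_single wt_add distrib_left)
      show ?thesis unfolding \<gamma>_def cm
        by (intro poly_mapping_eqI) (simp add: lookup_wt lookup_minus algebra_simps)
    qed
    have "degs \<gamma> \<subseteq> degs \<beta> - {i}"
      by (auto simp: degs_def \<gamma> in_keys_iff lookup_wt)
    then have "degs \<gamma> - {j} \<subset> degs \<beta> - {j}" using i by auto
    then have "card (degs \<gamma> - {j}) < card (degs \<beta> - {j})" by (intro psubset_card_mono) auto
    then obtain M where M: "tt 1 ^ M * hc j \<gamma> \<in> p" using less.hyps[OF _ v] by blast
    have "(of_nat j :: 'k) - of_nat i \<noteq> 0" using i by simp
    moreover have "cst (of_nat j - of_nat i) * (tt 1 ^ M * hc j \<beta>) \<in> p" using M by (simp add: \<gamma> wt_hc mult_ac)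
    ultimately have "tt 1 ^ M * hc j \<beta> \<in> p" by (rule bideal_cst[OF p])
    then show ?thesis by blast
  qed
qed

lemma homog_base_poisson:
  fixes P :: "'k::field_char_0 wspace set"
  assumes "wpoisson P" shows "homog (base P)"
proof -
  have Pi: "ideal P (Wring 1)" and br: "\<And>x w. w \<in> P \<Longrightarrow> pbr x w \<in> P" using assms by (auto simp: wpoisson_def)
  then have lid: "lid 1 P" by (simp add: ideal_Wring)
  let ?p = "base P"
  note p = bideal_base[OF lid]
  have s1: "tt 1 * eul \<beta> \<in> ?p" if "\<beta> \<in> ?p" for \<beta>
  proof -
    have "mul 1 (Poly_Mapping.single (- 1) 1) (pbr Ga (Poly_Mapping.single 0 \<beta>)) \<in> P"
      using that by (intro lidD(3)[OF lid] br) (simp add: base_def)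
    then have "- (tt 1 * eul \<beta>) \<in> ?p"
      unfolding pbr_single mul_single_single by (simp add: base_def kap_def kD_def kA_def)
    from bidealD(5)[OF p this] show ?thesis by simp
  qed
  \<comment> \<open>Bracketing with \<open>a\<close> and then with \<open>d\<close> returns to place
    \<open>0\<close>. The extra term \<open>2 b c\<close>, which stems from the bracket of
    \<open>a\<close> and \<open>d\<close>, is what makes powers of \<open>tt 1\<close>
    removable.\<close>
  have s2: "tt 1 * eul (eul \<beta>) + 2 * bv * cv * eul \<beta> \<in> ?p" if "\<beta> \<in> ?p" for \<beta>
  proof -
    have "pbr Gd (pbr Ga (Poly_Mapping.single 0 \<beta>)) \<in> P" using that by (intro br) (simp add: base_def)
    then have "- (tt 1 * eul (eul \<beta>) + 2 * bv * cv * eul \<beta>) \<in> ?p"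
      unfolding pbr_single using wt_diff[of of_nat 0 "eul \<beta>"] by (simp add: base_def kD_def kA_def)
    from bidealD(5)[OF p this] show ?thesis by (simp add: add.commute)
  qed
  \<comment> \<open>Inserting \<open>z = tt 1 ^ Suc m * \<gamma>\<close> in \<open>s2\<close>
    leaves, modulo multiples of \<open>z\<close>, only
    \<open>n * n * s * s * tt 1 ^ m * \<gamma>\<close>; here homogeneity makes
    \<open>eul \<gamma>\<close> a multiple of \<open>\<gamma>\<close>. So
    \<open>tt 1 ^ m * \<gamma>\<close> is carried into the ideal by \<open>tt 1\<close> as well as
    by the square of \<open>b c\<close>, and these are comaximal.\<close>
  have down: "tt 1 ^ m * \<gamma> \<in> ?p" if \<gamma>: "\<gamma> = hc j \<beta>" and m: "tt 1 ^ Suc m * \<gamma> \<in> ?p" for m \<gamma> j \<beta>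
  proof (rule tt_bc_comaximal[OF p])
    show "tt 1 * (tt 1 ^ m * \<gamma>) \<in> ?p" using m by (simp add: mult.assoc)
    define s :: "'k bpoly" where "s = 2 * bv * cv"
    define n :: "'k bpoly" where "n = of_nat (Suc m)"
    let ?z = "tt 1 ^ Suc m * \<gamma>"
    have e\<gamma>: "eul \<gamma> = of_nat j * \<gamma>" using eul_hc \<gamma> by simp
    have ez: "eul ?z = n * (s * (tt 1 ^ m * \<gamma>)) + of_nat j * ?z"
      unfolding eul_mult[of "tt 1 ^ Suc m"] eul_tt_Suc e\<gamma> by (simp add: s_def n_def algebra_simps)
    have es: "eul (s * (tt 1 ^ m * \<gamma>)) = 2 * s * (tt 1 ^ m * \<gamma>) + s * (eul (tt 1 ^ m) * \<gamma>) + of_nat j * (s * (tt 1 ^ m * \<gamma>))"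
    proof -
      have "eul s = 2 * s" unfolding s_def by (rule eul_bc)
      then show ?thesis unfolding eul_mult[of s] eul_mult[of "tt 1 ^ m"] e\<gamma> by (simp add: algebra_simps)
    qed
    have t: "tt 1 * (s * (eul (tt 1 ^ m) * \<gamma>)) = of_nat m * (s * (s * (tt 1 ^ m * \<gamma>)))"
    proof -
      have "tt 1 * eul (tt 1 ^ m) = of_nat m * s * tt 1 ^ m" unfolding s_def by (rule eul_tt_pow)
      from arg_cong[OF this, of "\<lambda>x. x * (s * \<gamma>)"] show ?thesis by (simp add: mult_ac)
    qed
    have "tt 1 * eul (eul ?z) + s * eul ?z =
        n * (tt 1 * eul (s * (tt 1 ^ m * \<gamma>))) + of_nat j * (tt 1 * eul ?z) + s * eul ?z"
      unfolding ez wt_add n_def eul_of_nat_mult by (simp add: algebra_simps)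
    also have "\<dots> = n * (2 * s + of_nat j * s) * ?z + n * (of_nat m * (s * (s * (tt 1 ^ m * \<gamma>)))) +
        of_nat j * tt 1 * eul ?z + s * eul ?z"
      unfolding es distrib_left t by (simp add: algebra_simps)
    also have "\<dots> = (n * (2 * s + of_nat j * s) + of_nat j * (tt 1 * of_nat j + s + n * s)) * ?z + n * n * (s * (s * (tt 1 ^ m * \<gamma>)))"
      unfolding ez n_def by (simp add: algebra_simps)
    finally have "n * n * (s * (s * (tt 1 ^ m * \<gamma>))) \<in> ?p"
      using bideal_add_cancel[OF p, of _ "n * n * (s * (s * (tt 1 ^ m * \<gamma>)))"] s2[OF m] bidealD(3)[OF p m]
      unfolding s_def by (metis (no_types, lifting) add.commute)
    moreover have "n * n * (s * (s * (tt 1 ^ m * \<gamma>))) = cst (4 * of_nat (Suc m) ^ 2) * (bv * cv * (bv * cv * (tt 1 ^ m * \<gamma>)))"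
    proof -
      define M :: 'k where "M = of_nat (Suc m)"
      have "cst M = n" unfolding M_def n_def by (rule single_of_nat)
      then have "n * n * 4 = cst M * cst M * cst 4" by simp
      also have "\<dots> = cst (M * M * 4)" by (simp only: cst_mult)
      also have "M * M * 4 = 4 * of_nat (Suc m) ^ 2" by (simp only: M_def power2_eq_square mult_ac)
      finally have "n * n * 4 = cst (4 * of_nat (Suc m) ^ 2)" .
      then have "cst (4 * of_nat (Suc m) ^ 2) * (bv * cv * (bv * cv * (tt 1 ^ m * \<gamma>))) = n * n * 4 * (bv * cv * (bv * cv * (tt 1 ^ m * \<gamma>)))"
        by simp
      then show ?thesis by (simp add: s_def algebra_simps)
    qed
    ultimately have "cst (4 * of_nat (Suc m) ^ 2) * (bv * cv * (bv * cv * (tt 1 ^ m * \<gamma>))) \<in> ?p" by simp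
    then show "bv * cv * (bv * cv * (tt 1 ^ m * \<gamma>)) \<in> ?p" 
      by (rule bideal_cst[OF p, rotated]) (simp del: of_nat_Suc)
  qed
  show ?thesis
    unfolding homog_def
  proof (intro ballI allI)
    fix \<beta> j assume "\<beta> \<in> ?p"
    then have "tt 1 ^ 0 * \<beta> \<in> ?p" by simp
    then obtain N where "tt 1 ^ N * hc j \<beta> \<in> ?p" using tt_hc_elimination[OF p s1] by blast
    then show "hc j \<beta> \<in> ?p" by (induction N) (auto dest: down[OF refl] simp del: power_Suc)
  qed
qed

lemma lookup_pbr: "Poly_Mapping.lookup (pbr Gb w) n = cst (of_int n) * bv * Poly_Mapping.lookup w n"
  "Poly_Mapping.lookup (pbr Gc w) n = cst (of_int n) * cv * Poly_Mapping.lookup w n" for w :: "'k::field wspace"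
proof -
  have "(of_nat k :: 'k bpoly) = cst (of_nat k)" for k by (induction k) (simp_all add: single_add)
  then have "(of_int n :: 'k bpoly) = cst (of_int n)" by (cases n) (simp_all add: single_uminus single_diff del: of_nat_Suc)
  then show "Poly_Mapping.lookup (pbr Gb w) n = cst (of_int n) * bv * Poly_Mapping.lookup w n"
    "Poly_Mapping.lookup (pbr Gc w) n = cst (of_int n) * cv * Poly_Mapping.lookup w n"
    by (simp_all add: lookup_lsh)
qed

lemma graded_poisson:
  fixes P :: "'k::field_char_0 wspace set"
  assumes P: "wpoisson P" and g: "g \<in> {bv, cv}" and cancel: "\<And>y. scl g y \<in> P \<Longrightarrow> y \<in> P"
  shows "P = Iw (base P)"
proof -
  have Pi: "ideal P (Wring 1)" and br: "\<And>x w. w \<in> P \<Longrightarrow> pbr x w \<in> P" using P by (auto simp: wpoisson_def)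
  then have lid: "lid 1 P" by (simp add: ideal_Wring)
  have inj: "inj (of_int :: int \<Rightarrow> 'k)" by (simp add: inj_def)
  obtain x0 where x0: "\<And>w n. Poly_Mapping.lookup (pbr x0 w) n = cst (of_int n) * g * Poly_Mapping.lookup (w :: 'k wspace) n"
    using g lookup_pbr by (metis insertE singletonD)
  show ?thesis
    using graded_from_cancel[OF lid br x0 inj cancel] by (intro graded_eq_Iw[OF _ Pi homog_base_poisson[OF P]]) auto
qed

lemma wpoisson_Iw:
  assumes p: "bideal p" "homog p" shows "wpoisson (Iw p)"
proof -
  have "pbr x w \<in> Iw p" if "w \<in> Iw p" for x w
  proof -
    have w: "Poly_Mapping.lookup w n \<in> p" for n using that by (simp add: Iw_def)
    have 1: "lsh m \<kappa> 1 w \<in> Iw p" for m \<kappa> using bidealD(3)[OF p(1) w] by (simp add: Iw_def lookup_lsh)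
    have 2: "lsh m \<kappa> 1 (Eul w) \<in> Iw p" for m \<kappa>
      using bidealD(3)[OF p(1) homog_wt[OF p w]] by (simp add: Iw_def lookup_lsh lookup_Eul)
    note L = lidD[OF lid_Iw(1)[OF p, of 1]]
    show ?thesis by (cases x) (simp_all add: lA_def lD_def 1 2 L(2,6))
  qed
  then show ?thesis using ideal_Iw[OF _ p, of 1] by (simp add: wpoisson_def)
qed

section \<open>The stratum of ideals containing \<open>b\<close> and \<open>c\<close>\<close>

text \<open>The ideal generated by \<open>b\<close> and \<open>c\<close>.\<close>

definition bc0 :: "'k::field bpoly set" where
  "bc0 = {\<beta>. \<forall>l. Poly_Mapping.lookup \<beta> (0, 0, l) = 0}"

lemma lookup_mult_single:
  "Poly_Mapping.lookup (Poly_Mapping.single (i, j, m) c * (\<beta> :: 'k::field bpoly)) (0, 0, l) =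
    (if i = 0 \<and> j = 0 then c * Poly_Mapping.lookup \<beta> (0, 0, l - m) else 0)"
  by (induction \<beta> rule: poly_mapping_single_induct)
    (auto simp: mult_single lookup_single when_def distrib_left lookup_add)

lemma bideal_bc0: "bideal (bc0 :: 'k::field bpoly set)"
proof -
  have "r * x \<in> bc0" if "x \<in> bc0" for r x :: "'k bpoly"
  proof (induction r rule: poly_mapping_single_induct)
    case (single k c)
    show ?case using that by (cases k) (auto simp: bc0_def lookup_mult_single)
  qed (auto simp: bc0_def distrib_right lookup_add)
  then show "bideal (bc0 :: 'k bpoly set)" by (auto simp: bideal_def bc0_def lookup_add)
qed

lemma tt_bc0: "tt (r :: 'k::field) - Dv 1 \<in> bc0"
proof -
  have "bv * cv \<in> (bc0 :: 'k bpoly set)" using lookup_mult_single[of 1 0 0 "1 :: 'k" cv] by (simp add: bc0_def bv_def)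
  from bidealD(3)[OF bideal_bc0 this, of "cst r"] show ?thesis by (simp add: tt_def mult.assoc)
qed

lemma sg_bc0: "sg r \<beta> - \<beta> \<in> bc0"
  by (simp add: bc0_def lookup_minus lookup_wt)

lemma bc0_mult_cong:
  assumes "x - x' \<in> bc0" "y - y' \<in> bc0" shows "x * y - x' * y' \<in> bc0"
proof -
  have "x * y - x' * y' = y * (x - x') + x' * (y - y')" by (simp add: algebra_simps)
  then show ?thesis using bidealD(2)[OF bideal_bc0 bidealD(3)[OF bideal_bc0 assms(1)] bidealD(3)[OF bideal_bc0 assms(2)]] by simp
qed

lemma bc0_trans: "x - y \<in> bc0 \<Longrightarrow> y - z \<in> bc0 \<Longrightarrow> x - z \<in> bc0"
  using bidealD(2)[OF bideal_bc0, of "x - y" "y - z"] by simp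

lemma bc0_refl: "x - x \<in> bc0" using bidealD(1)[OF bideal_bc0] by simp

lemma bc0_sym: "x - y \<in> bc0 \<Longrightarrow> y - x \<in> bc0" using bidealD(5)[OF bideal_bc0, of "x - y"] by simp

lemma kap_bc0: "kap q n k - kap r n k \<in> bc0"
proof -
  have tt: "tt q' - tt r' \<in> bc0" for q' r' using bc0_trans[OF tt_bc0 bc0_sym[OF tt_bc0]] .
  have sg: "sg q' x - sg r' y \<in> bc0" if "x - y \<in> bc0" for q' r' x y
    using bc0_trans[OF sg_bc0 bc0_trans[OF that bc0_sym[OF sg_bc0]]] .
  have "kA q m - kA r m \<in> bc0" "kD q m - kD r m \<in> bc0" for m by (auto simp: kA_def kD_def tt bc0_refl[of 1, simplified])
  then have "kapP q m k - kapP r m k \<in> bc0" "kapN q m k - kapN r m k \<in> bc0" for m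
    by (induction m) (simp_all add: bc0_refl[of 1, simplified] bc0_mult_cong sg)
  then show ?thesis by (simp add: kap_def)
qed

text \<open>Modulo \<open>b\<close> and \<open>c\<close> every \<open>tt r\<close> becomes
  \<open>D\<close> and every \<open>sg r\<close> the identity, so the parameter disappears from the
  product.\<close>

lemma mul_cong_bc0: "mul q x y - mul r x y \<in> Iw bc0"
proof -
  have "F q n N - F r n N \<in> bc0" if "F = (\<lambda>q n N. Poly_Mapping.lookup x n * kap q n (N - n) * sg (q powi n) (Poly_Mapping.lookup y (N - n)))" for F n N
    unfolding that using bc0_trans[OF sg_bc0 bc0_sym[OF sg_bc0]] by (intro bc0_mult_cong bc0_refl kap_bc0)
  then show ?thesis
    unfolding Iw_def mem_Collect_eq lookup_minus lookup_mul sum_subtractf[symmetric]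
    by (intro allI bideal_sum[OF bideal_bc0]) blast
qed

lemma Iw_bc0_subset:
  assumes q: "q \<noteq> 0" and P: "lid q P" and bc: "Poly_Mapping.single 0 bv \<in> P" "Poly_Mapping.single 0 cv \<in> P"
  shows "Iw bc0 \<subseteq> P"
proof
  have el: "Poly_Mapping.single n (Poly_Mapping.single (i, j, l) x) \<in> P" if "i > 0 \<or> j > 0" for n i j l and x :: 'a
  proof -
    \<comment> \<open>As \<open>P\<close> is only a left ideal, \<open>b\<close> and
      \<open>c\<close> must stand on the right; the factor \<open>inverse (q powi n)\<close> undoes
      the twist of moving them across \<open>e_n\<close>.\<close>
    have *: "mul q (Poly_Mapping.single n (cst (inverse (q powi n)) * Poly_Mapping.single k x)) (Poly_Mapping.single 0 g) =
      Poly_Mapping.single n (Poly_Mapping.single k x * g)" (is "?l = _") if "g = bv \<or> g = cv" for k g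
    proof -
      have "?l = Poly_Mapping.single n (cst (inverse (q powi n)) * Poly_Mapping.single k x * (cst (q powi n) * g))"
        using that by (auto simp: mul_single_single wt_bv wt_cv)
      also have "\<dots> = Poly_Mapping.single n ((cst (inverse (q powi n)) * cst (q powi n)) * (Poly_Mapping.single k x * g))"
        by (simp only: mult_ac)
      also have "cst (inverse (q powi n)) * cst (q powi n) = 1" using q by (simp add: cst_mult)
      finally show ?thesis by simp
    qed
    from that show ?thesis
    proof
      assume "i > 0"
      then have "Poly_Mapping.single (i, j, l) x = Poly_Mapping.single (i - 1, j, l) x * bv" by (simp add: bv_def mult_single)
      then show ?thesis using *[of bv "(i - 1, j, l)"] lidD(3)[OF P bc(1)] by metis
    next
      assume "j > 0"
      then have "Poly_Mapping.single (i, j, l) x = Poly_Mapping.single (i, j - 1, l) x * cv" by (simp add: cv_def mult_single)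
      then show ?thesis using *[of cv "(i, j - 1, l)"] lidD(3)[OF P bc(2)] by metis
    qed
  qed
  have add: "(\<Sum>k\<in>A. Poly_Mapping.single n (G k)) = Poly_Mapping.single n (sum G A)"
    for G :: "nat \<times> nat \<times> int \<Rightarrow> 'a bpoly" and A n
    by (induction A rule: infinite_finite_induct) (auto simp: single_add)
  have el': "Poly_Mapping.single n \<beta> \<in> P" if \<beta>: "\<beta> \<in> bc0" for n \<beta>
  proof -
    have a: "Poly_Mapping.single n (Poly_Mapping.single k (Poly_Mapping.lookup \<beta> k)) \<in> P" for k
    proof (cases k)
      case (fields i j l)
      show ?thesis
      proof (cases "i = 0 \<and> j = 0")
        case True
        then show ?thesis using \<beta> lidD(1)[OF P] by (simp add: fields bc0_def)
      qed (use el fields in auto)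
    qed
    have "(\<Sum>k\<in>A. Poly_Mapping.single n (Poly_Mapping.single k (Poly_Mapping.lookup \<beta> k))) \<in> P" for A
      by (induction A rule: infinite_finite_induct) (auto intro: lidD(1,2)[OF P] a)
    then have "Poly_Mapping.single n (\<Sum>k\<in>Poly_Mapping.keys \<beta>. Poly_Mapping.single k (Poly_Mapping.lookup \<beta> k)) \<in> P"
      unfolding add[symmetric] .
    then show ?thesis unfolding poly_mapping_eq_sum_single[symmetric] .
  qed
  fix w :: "'a wspace" assume "w \<in> Iw bc0"
  then have *: "Poly_Mapping.single n (Poly_Mapping.lookup w n) \<in> P" for n using el' by (simp add: Iw_def)
  have "(\<Sum>n\<in>A. Poly_Mapping.single n (Poly_Mapping.lookup w n)) \<in> P" for A
    by (induction A rule: infinite_finite_induct) (auto intro: lidD(1,2)[OF P] *)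
  then have "(\<Sum>n\<in>Poly_Mapping.keys w. Poly_Mapping.single n (Poly_Mapping.lookup w n)) \<in> P" .
  then show "w \<in> P" unfolding poly_mapping_eq_sum_single[symmetric] .
qed

context
  fixes P :: "'k::field wspace set"
  assumes sub: "Iw bc0 \<subseteq> P"
begin

lemma lid_change: assumes "lid q P" shows "lid r P"
proof -
  have "mul r s x \<in> P" if "x \<in> P" for s x
    using lidD(2)[OF assms subsetD[OF sub mul_cong_bc0[of r s x q]] lidD(3)[OF assms that, of s]] by simp
  then show ?thesis using assms by (auto simp: lid_def)
qed

lemma mul_change: assumes "lid q P" shows "mul r x y \<in> P \<longleftrightarrow> mul s x y \<in> P"
proof -
  have "mul s x y \<in> P" if "mul r x y \<in> P" for r s
    using lidD(2)[OF assms subsetD[OF sub mul_cong_bc0[of s x y r]] that] by simp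
  then show ?thesis by blast
qed

lemma ideal_change: assumes "q \<noteq> 0" "lid r P" shows "ideal P (Wring q)"
proof -
  have "mul q x s \<in> P" if "x \<in> P" for x s
  proof -
    have "mul 1 s x \<in> P" using lidD(3)[OF lid_change[OF assms(2)] that] .
    then have "mul 1 x s \<in> P" by (simp add: mul_one_commute[of x])
    then show ?thesis using mul_change[OF assms(2)] by blast
  qed
  then show ?thesis using lid_change[OF assms(2)] assms(1) by (simp add: ideal_Wring)
qed

end

lemma spec_change:
  fixes P :: "'k::field wspace set"
  assumes sub: "Iw bc0 \<subseteq> P" and q: "q \<noteq> 0" shows "P \<in> spec (Wring q) \<longleftrightarrow> primeideal P (Wring 1)"
proof
  assume "primeideal P (Wring 1)"
  then interpret Q: primeideal P "Wring (1 :: 'k)" .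
  have lid: "lid 1 P" using Q.ideal_axioms by (simp add: ideal_Wring)
  show "P \<in> spec (Wring q)"
  proof (rule completely_prime_imp_spec[OF q ideal_change[OF sub q lid]])
    show "1 \<notin> P" using Q.one_imp_carrier Q.I_notcarr by auto
    show "x \<in> P \<or> y \<in> P" if "mul q x y \<in> P" for x y
      using Q.I_prime[of x y] mul_change[OF sub lid] that by simp blast
  qed
next
  assume P: "P \<in> spec (Wring q)"
  then have Pi: "ideal P (Wring q)" and ne: "P \<noteq> UNIV" by (auto simp: spec_def prime_ideal_nc_def)
  have lid: "lid q P" using Pi q by (simp add: ideal_Wring)
  have lid1: "lid 1 P" by (rule lid_change[OF sub lid])
  have prime: "x \<in> P \<or> y \<in> P" if xy: "mul 1 x y \<in> P" for x y
  proof -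
    \<comment> \<open>\<open>J z\<close> is \<open>P\<close> plus the multiples of \<open>z\<close>.
      Modulo \<open>P\<close> all products agree and the one at parameter \<open>1\<close> is
      commutative, so this is a two-sided ideal for \<open>mul q\<close> too; the prime condition on
      ideals thus becomes one on elements.\<close>
    define J where "J z = {u. \<exists>r. u - mul 1 r z \<in> P}" for z
    have J: "ideal (J z) (Wring q)" and PJ: "P \<subseteq> J z" and zJ: "z \<in> J z" for z
    proof -
      show PJ: "P \<subseteq> J z" by (auto simp: J_def intro!: exI[of _ 0])
      show "z \<in> J z" using lidD(1)[OF lid] by (auto simp: J_def intro!: exI[of _ 1])
      have "lid 1 (J z)"
        unfolding lid_def
      proof (intro conjI ballI allI)
        show "0 \<in> J z" using PJ lidD(1)[OF lid] by blast
        fix u v assume "u \<in> J z" "v \<in> J z"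
        then obtain r s where "u - mul 1 r z \<in> P" "v - mul 1 s z \<in> P" by (auto simp: J_def)
        then have "(u - mul 1 r z) + (v - mul 1 s z) \<in> P" by (rule lidD(2)[OF lid])
        then have "u + v - mul 1 (r + s) z \<in> P" by (simp add: mul_add_left algebra_simps)
        then show "u + v \<in> J z" by (auto simp: J_def)
      next
        fix s u assume "u \<in> J z"
        then obtain r where "u - mul 1 r z \<in> P" by (auto simp: J_def)
        then have "mul 1 s (u - mul 1 r z) \<in> P" by (rule lidD(3)[OF lid1])
        moreover have "mul 1 s (u - mul 1 r z) = mul 1 s u - mul 1 (mul 1 s r) z"
          using mul_add_right[of 1 s "u - mul 1 r z" "mul 1 r z"] by (simp add: mul_assoc algebra_simps)
        ultimately show "mul 1 s u \<in> J z" by (auto simp: J_def)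
      qed
      then show "ideal (J z) (Wring q)"
        using sub PJ by (intro ideal_change[of "J z"] q) auto
    qed
    have "ideal_prod (Wring q) (J x) (J y) \<subseteq> P"
    proof
      fix z assume "z \<in> ideal_prod (Wring q) (J x) (J y)"
      then show "z \<in> P"
      proof (induction rule: ideal_prod.induct)
        case (prod u v)
        obtain r where r: "u - mul 1 r x \<in> P" using prod(1) by (auto simp: J_def)
        obtain s where s: "v - mul 1 s y \<in> P" using prod(2) by (auto simp: J_def)
        have "mul 1 v (u - mul 1 r x) \<in> P" "mul 1 (mul 1 r x) (v - mul 1 s y) \<in> P" "mul 1 (mul 1 r s) (mul 1 x y) \<in> P"
          using lidD(3)[OF lid1] r s xy by blast+
        then have "mul 1 v (u - mul 1 r x) + (mul 1 (mul 1 r x) (v - mul 1 s y) + mul 1 (mul 1 r s) (mul 1 x y)) \<in> P"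
          by (intro lidD(2)[OF lid])
        moreover have "mul 1 v (u - mul 1 r x) + (mul 1 (mul 1 r x) (v - mul 1 s y) + mul 1 (mul 1 r s) (mul 1 x y)) = mul 1 u v"
        proof -
          have d: "mul 1 a (b - c) = mul 1 a b - mul 1 a c" for a b c :: "'k wspace"
            using mul_add_right[of 1 a "b - c" c] by simp
          have "mul 1 (mul 1 r x) (mul 1 s y) = mul 1 r (mul 1 (mul 1 x s) y)" by (simp add: mul_assoc)
          also have "\<dots> = mul 1 r (mul 1 (mul 1 s x) y)" by (simp only: mul_one_commute[of x s])
          also have "\<dots> = mul 1 (mul 1 r s) (mul 1 x y)" by (simp add: mul_assoc)
          finally have f: "mul 1 (mul 1 r x) (mul 1 s y) = mul 1 (mul 1 r s) (mul 1 x y)" .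
          show ?thesis unfolding d f mul_one_commute[of "mul 1 r x" v] mul_one_commute[of v u] by simp
        qed
        ultimately have "mul 1 u v \<in> P" by simp
        then show ?case using mul_change[OF sub lid] by simp blast
      qed (simp add: lidD(2)[OF lid])
    qed
    then have "J x \<subseteq> P \<or> J y \<subseteq> P" using P J by (auto simp: spec_def prime_ideal_nc_def)
    then show ?thesis using zJ by blast
  qed
  show "primeideal P (Wring 1)"
    using prime ne by (intro primeidealI ideal_change[OF sub _ lid] cring_Wring_one) auto
qed

section \<open>The common description of the two spectra\<close>

definition model_prime :: "'k::field wspace set \<Rightarrow> bool" where
  "model_prime P \<longleftrightarrow> (\<exists>p. bprime p \<and> homog p \<and> P = Iw p) \<or>
     (Poly_Mapping.single 0 bv \<in> P \<and> Poly_Mapping.single 0 cv \<in> P \<and> primeideal P (Wring 1))"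

lemma sg_bv: "sg r bv = cst r * bv" and sg_cv: "sg r cv = cst r * cv"
  by (simp_all add: wt_bv wt_cv)

lemma spec_iff_model_prime:
  fixes q :: "'k::field"
  assumes q: "q \<noteq> 0" "\<And>n::nat. n > 0 \<Longrightarrow> q ^ n \<noteq> 1"
  shows "P \<in> spec (Wring q) \<longleftrightarrow> model_prime P"
proof (cases "Poly_Mapping.single 0 bv \<in> P \<and> Poly_Mapping.single 0 cv \<in> P")
  case True
  have "P \<in> spec (Wring q) \<longleftrightarrow> primeideal P (Wring 1)" if "lid r P" "r \<noteq> 0" for r
    using spec_change[OF Iw_bc0_subset[OF that(2,1)] q(1)] True by blast
  moreover have "lid q P" if "P \<in> spec (Wring q)" using that q(1) by (simp add: spec_def prime_ideal_nc_def ideal_Wring)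
  moreover have "lid 1 P" if "primeideal P (Wring 1)"
    using primeideal.axioms(1)[OF that] by (simp add: ideal_Wring)
  ultimately show ?thesis using True q(1) Iw_in_spec[OF q(1)] unfolding model_prime_def by (metis zero_neq_one)
next
  case False
  then show ?thesis
    using spec_graded_iff[OF q sg_bv] spec_graded_iff[OF q sg_cv] unfolding model_prime_def by blast
qed

text \<open>All brackets of generators are divisible by \<open>b\<close> or \<open>c\<close>;
  consequently every ideal containing both is a Poisson ideal.\<close>

lemma pbr_Iw_bc0: "pbr x w \<in> Iw bc0" for w :: "'k::field_char_0 wspace"
proof -
  have bc: "\<beta> * z \<in> bc0" if "\<beta> = bv \<or> \<beta> = cv" for \<beta> z :: "'k bpoly"
    using that lookup_mult_single[of 1 0 0 1 z] lookup_mult_single[of 0 1 0 1 z] by (auto simp: bc0_def bv_def cv_def)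
  have e: "eul \<beta> \<in> bc0" for \<beta> :: "'k bpoly" by (simp add: bc0_def lookup_wt)
  have m: "c * \<beta> * z \<in> bc0" "c * bv * \<beta> * z \<in> bc0" if "\<beta> = bv \<or> \<beta> = cv" for c \<beta> z :: "'k bpoly"
    using bidealD(3)[OF bideal_bc0 bc[OF that], of c z] bidealD(3)[OF bideal_bc0 bc[OF that], of "c * bv" z]
    by (simp_all add: mult.assoc)
  have l: "\<kappa> * eul \<beta> \<in> bc0" for \<kappa> \<beta> :: "'k bpoly" using bidealD(3)[OF bideal_bc0 e] .
  have z: "0 \<in> (bc0 :: 'k bpoly set)" by (rule bidealD(1)[OF bideal_bc0])
  show ?thesis
    by (cases x) (auto simp: Iw_def lA_def lD_def lookup_lsh lookup_Eul lookup_minus lookup_add m l z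
        intro!: bidealD(2,5,6)[OF bideal_bc0])
qed

lemma pspec_iff_model_prime:
  fixes P :: "'k::field_char_0 wspace set"
  shows "wpoisson P \<and> primeideal P (Wring 1) \<longleftrightarrow> model_prime P"
proof
  assume *: "wpoisson P \<and> primeideal P (Wring 1)"
  show "model_prime P"
  proof (cases "Poly_Mapping.single 0 bv \<in> P \<and> Poly_Mapping.single 0 cv \<in> P")
    case False
    then obtain g :: "'k bpoly" where g: "g \<in> {bv, cv}" "Poly_Mapping.single 0 g \<notin> P" by blast
    interpret Q: primeideal P "Wring (1 :: 'k)" using * by blast
    have "y \<in> P" if "scl g y \<in> P" for y
      using Q.I_prime[of "Poly_Mapping.single 0 g" y] that g(2) by (simp add: mul_coef)
    then have eq: "P = Iw (base P)" using graded_poisson[of P g] * g(1) by blast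
    have lid: "lid 1 P" using Q.ideal_axioms by (simp add: ideal_Wring)
    have "x \<in> base P \<or> y \<in> base P" if "x * y \<in> base P" for x y
      using Q.I_prime[of "Poly_Mapping.single 0 x" "Poly_Mapping.single 0 y"] that
      by (simp add: base_def mul_single_single)
    moreover have "1 \<notin> base P" using Q.one_imp_carrier Q.I_notcarr by (auto simp: base_def)
    ultimately have "bprime (base P)" using bideal_base[OF lid] by (simp add: bprime_def)
    then show ?thesis using eq homog_base_poisson[of P] * unfolding model_prime_def by blast
  qed (use * in \<open>simp add: model_prime_def\<close>)
next
  assume "model_prime P"
  then consider p where "bprime p" "homog p" "P = Iw p" | "Poly_Mapping.single 0 bv \<in> P" "Poly_Mapping.single 0 cv \<in> P" "primeideal P (Wring 1)"
    unfolding model_prime_def by blast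
  then show "wpoisson P \<and> primeideal P (Wring 1)"
  proof cases
    case 1
    have id: "bideal p" "1 \<notin> p" using 1 by (auto simp: bprime_def)
    have "primeideal P (Wring 1)"
      unfolding 1(3)
      using Iw_completely_prime[OF _ 1(1,2), of 1] mem_Iw_single[OF id(1), of 0 1] id(2)
      by (intro primeidealI ideal_Iw id 1 cring_Wring_one) auto
    then show ?thesis using wpoisson_Iw[OF id(1) 1(2)] 1(3) by simp
  next
    case 2
    interpret Q: primeideal P "Wring (1 :: 'k)" by fact
    have lid: "lid 1 P" using Q.ideal_axioms by (simp add: ideal_Wring)
    have sub: "Iw bc0 \<subseteq> P" using Iw_bc0_subset[OF _ lid 2(1,2)] by simp
    have "wpoisson P" using pbr_Iw_bc0 sub Q.ideal_axioms by (auto simp: wpoisson_def)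
    then show ?thesis using 2(3) by blast
  qed
qed

section \<open>Dickson's lemma\<close>

lemma nat_seq_mono_subseq:
  fixes s :: "nat \<Rightarrow> nat"
  shows "\<exists>f::nat \<Rightarrow> nat. strict_mono f \<and> (\<forall>i j. i < j \<longrightarrow> s (f i) \<le> s (f j))"
proof -
  have "\<exists>i\<ge>n. \<forall>j\<ge>i. s i \<le> s j" for n
  proof -
    define m where "m = (LEAST x. \<exists>i\<ge>n. s i = x)"
    have "\<exists>i\<ge>n. s i = m" unfolding m_def by (rule LeastI_ex) blast
    then obtain i where i: "i \<ge> n" "s i = m" by blast
    have "m \<le> s j" if "j \<ge> n" for j unfolding m_def by (rule Least_le) (use that in blast)
    then show ?thesis using i by (intro exI[of _ i]) auto
  qed
  then obtain h where h: "\<And>n. h n \<ge> n" "\<And>n j. j \<ge> h n \<Longrightarrow> s (h n) \<le> s j" by metis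
  \<comment> \<open>\<open>h n\<close> is a place at or after \<open>n\<close> whose value is at
    most all later ones; each new index is such a place in the tail just after the previous
    index.\<close>
  define f where "f = rec_nat (h 0) (\<lambda>_ x. h (Suc x))"
  have f: "\<exists>m. f n = h m" "f n < f (Suc n)" for n
    using h(1)[of "Suc (f n)"] by (cases n; auto simp: f_def)+
  have sm: "strict_mono f" using f(2) by (simp add: strict_mono_Suc_iff)
  moreover have "s (f i) \<le> s (f j)" if "i < j" for i j
  proof -
    obtain m where "f i = h m" using f(1) by blast
    moreover have "f i < f j" using sm that by (simp add: strict_mono_def)
    ultimately show ?thesis using h(2)[of m "f j"] by simp
  qed
  ultimately show ?thesis by blast
qed

lemma nat_funs_mono_subseq:
  fixes s :: "nat \<Rightarrow> 'a" and Fs :: "('a \<Rightarrow> nat) list"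
  shows "\<exists>f::nat \<Rightarrow> nat. strict_mono f \<and> (\<forall>F\<in>set Fs. \<forall>i j. i < j \<longrightarrow> F (s (f i)) \<le> F (s (f j)))"
proof (induction Fs)
  case Nil
  show ?case by (intro exI[of _ id]) (simp add: strict_mono_def)
next
  case (Cons F Fs)
  then obtain f :: "nat \<Rightarrow> nat" where f: "strict_mono f" "\<And>G i j. G \<in> set Fs \<Longrightarrow> i < j \<Longrightarrow> G (s (f i)) \<le> G (s (f j))" by blast
  obtain g :: "nat \<Rightarrow> nat" where g: "strict_mono g" "\<And>i j. i < j \<Longrightarrow> F (s (f (g i))) \<le> F (s (f (g j)))"
    using nat_seq_mono_subseq[of "\<lambda>i. F (s (f i))"] by blast
  have sm: "strict_mono (f \<circ> g)" using f(1) g(1) by (rule strict_mono_o)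
  have "G (s ((f \<circ> g) i)) \<le> G (s ((f \<circ> g) j))" if G: "G \<in> set (F # Fs)" and ij: "i < j" for G i j
  proof (cases "G = F")
    case True
    then show ?thesis using g(2)[OF ij] by simp
  next
    case False
    then have "G \<in> set Fs" using G by simp
    then show ?thesis using f(2)[OF _ strict_monoD[OF g(1) ij]] by simp
  qed
  then show ?case using sm by blast
qed

text \<open>The order is pulled back along finitely many functions to \<open>nat\<close>, so that
  signs of integers can be compared as well as sizes. If it failed, one could choose a sequence in
  which no term dominates an earlier one, against the existence of a subsequence monotone for all
  \<open>Fs\<close>.\<close>

lemma dickson:
  fixes Fs :: "('a \<Rightarrow> nat) list"
  shows "\<exists>N0. finite N0 \<and> N0 \<subseteq> N \<and> (\<forall>m\<in>N. \<exists>m0\<in>N0. \<forall>F\<in>set Fs. F m0 \<le> F m)"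
proof (rule ccontr)
  assume no: "\<not> ?thesis"
  define bad where "bad A = (SOME m. m \<in> N \<and> (\<forall>m0\<in>A. \<exists>F\<in>set Fs. \<not> F m0 \<le> F m))" for A
  have bad: "bad A \<in> N \<and> (\<forall>m0\<in>A. \<exists>F\<in>set Fs. \<not> F m0 \<le> F (bad A))" if "finite A" "A \<subseteq> N" for A
    unfolding bad_def
  proof (rule someI_ex, rule ccontr)
    assume "\<nexists>m. m \<in> N \<and> (\<forall>m0\<in>A. \<exists>F\<in>set Fs. \<not> F m0 \<le> F m)"
    then have "\<forall>m\<in>N. \<exists>m0\<in>A. \<forall>F\<in>set Fs. F m0 \<le> F m" by blast
    with that have "finite A \<and> A \<subseteq> N \<and> (\<forall>m\<in>N. \<exists>m0\<in>A. \<forall>F\<in>set Fs. F m0 \<le> F m)" by (intro conjI)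
    then show False by (rule notE[OF no, OF exI])
  qed
  define A where "A = rec_nat {} (\<lambda>_ A. insert (bad A) A)"
  have A: "finite (A n)" "A n \<subseteq> N" for n
    by (induction n) (auto simp: A_def bad)
  define s where "s n = bad (A n)" for n
  have mem: "s i \<in> A j" if "i < j" for i j
    using that by (induction j) (auto simp: A_def s_def less_Suc_eq)
  obtain f :: "nat \<Rightarrow> nat" where f: "strict_mono f" "\<And>F i j. F \<in> set Fs \<Longrightarrow> i < j \<Longrightarrow> F (s (f i)) \<le> F (s (f j))"
    using nat_funs_mono_subseq[of Fs s] by blast
  have "s (f 0) \<in> A (f 1)" using mem strict_monoD[OF f(1), of 0 1] by simp
  then obtain F where "F \<in> set Fs" "\<not> F (s (f 0)) \<le> F (s (f 1))" using bad[OF A] unfolding s_def by blast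
  then show False using f(2)[of F 0 1] by simp
qed

section \<open>Monomials\<close>

type_synonym ix = "int \<times> nat \<times> nat \<times> int"

fun wgt :: "ix \<Rightarrow> int" where "wgt (n, i, j, l) = \<bar>n\<bar> + int i + int j + \<bar>l\<bar>"

text \<open>A lexicographic rank in natural numbers, hence well-founded. Adding the weight makes
  \<open>n\<close> and \<open>l\<close> nonnegative, and \<open>j\<close> is determined by the rest.
  Multiplication by a generator raises no weight by more than one; \<open>n\<close> comes directly
  after the weight to settle the ties in \<open>Rel_A\<close> and \<open>Rel_d\<close>.\<close>

fun rk :: "ix \<Rightarrow> nat \<times> nat \<times> nat \<times> nat" where
  "rk (n, i, j, l) = (let w = wgt (n, i, j, l) in (nat w, nat (n + w), nat (l + w), i))"

lemma rk_less: "rk (n, i, j, l) < rk (n', i', j', l') \<longleftrightarrow>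
    wgt (n, i, j, l) < wgt (n', i', j', l') \<or> wgt (n, i, j, l) = wgt (n', i', j', l') \<and>
     (n < n' \<or> n = n' \<and> (l < l' \<or> l = l' \<and> i < i'))"
proof -
  define w w' where "w = wgt (n, i, j, l)" and "w' = wgt (n', i', j', l')"
  have nn: "0 \<le> w" "0 \<le> n + w" "0 \<le> l + w" "0 \<le> w'" "0 \<le> n' + w'" "0 \<le> l' + w'" by (auto simp: w_def w'_def)
  have "rk (n, i, j, l) = (nat w, nat (n + w), nat (l + w), i)" "rk (n', i', j', l') = (nat w', nat (n' + w'), nat (l' + w'), i')"
    by (simp_all only: rk.simps Let_def w_def w'_def)
  moreover have "nat x < nat y \<longleftrightarrow> x < y" "nat x \<le> nat y \<longleftrightarrow> x \<le> y" if "0 \<le> x" "0 \<le> y" for x y using that by auto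
  ultimately have "rk (n, i, j, l) < rk (n', i', j', l') \<longleftrightarrow> w < w' \<or> w \<le> w' \<and> (n + w < n' + w' \<or> n + w \<le> n' + w' \<and> (l + w < l' + w' \<or> l + w \<le> l' + w' \<and> i < i'))"
    using nn by simp
  also have "\<dots> \<longleftrightarrow> w < w' \<or> w = w' \<and> (n < n' \<or> n = n' \<and> (l < l' \<or> l = l' \<and> i < i'))" by auto
  finally show ?thesis by (simp only: w_def w'_def)
qed

lemma rk_inj: assumes "rk m = rk m'" shows "m = m'"
proof -
  obtain n i j l where m: "m = (n, i, j, l)" by (cases m)
  obtain n' i' j' l' where m': "m' = (n', i', j', l')" by (cases m')
  have "\<not> rk m < rk m'" "\<not> rk m' < rk m" using assms by auto
  then have "n = n'" "l = l'" "i = i'" "wgt m = wgt m'"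
    unfolding m m' rk_less by linarith+
  then have "int j = int j'" by (simp add: m m')
  then show ?thesis using \<open>n = n'\<close> \<open>l = l'\<close> \<open>i = i'\<close> by (simp add: m m')
qed

fun mono_w :: "ix \<Rightarrow> 'k::field wspace" where
  "mono_w (n, i, j, l) = Poly_Mapping.single n (Poly_Mapping.single (i, j, l) 1)"

section \<open>Endomorphisms of simple modules are scalar\<close>

text \<open>Quillen's lemma. Without an eigenvalue, \<open>k[\<phi>] - {0}\<close> acts by bijections, as \<open>k\<close> is algebraically
  closed. Monomials applied to a vector \<open>v\<close> generate \<open>M\<close> over \<open>k[\<phi>]\<close>, and by Dickson's lemma one
  \<open>f \<noteq> 0\<close> serves as leading coefficient of all relations among them. Hence after inverting \<open>f\<close> the
  module is free with \<open>v\<close> in a basis, so each \<open>\<phi> - \<alpha>\<close> divides a power of \<open>f\<close>: every \<open>\<alpha>\<close> is a root of \<open>f\<close>.\<close>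

locale simple_wmod =
  fixes q :: "'k::field" and M :: "('k wspace, 'b, 'c) module_scheme"
  assumes q0: "q \<noteq> 0" and simple: "simple_left_module (Wring q) M"
begin

sublocale V: left_module "Wring q" M
  using simple by (simp add: simple_left_module_def)

abbreviation vadd (infixl "\<oplus>\<^sub>V" 65) where "vadd \<equiv> add M"
abbreviation act (infixr "\<odot>\<^sub>V" 70) where "act \<equiv> module.smult M"
abbreviation "VC \<equiv> carrier M"

lemma act_closed [simp]: "x \<in> VC \<Longrightarrow> r \<odot>\<^sub>V x \<in> VC" using V.smult_closed[of r x] by simp
lemma act_add_left: "x \<in> VC \<Longrightarrow> (r + s) \<odot>\<^sub>V x = r \<odot>\<^sub>V x \<oplus>\<^sub>V s \<odot>\<^sub>V x" using V.smult_l_distr[of r s x] by simp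
lemma act_add: "x \<in> VC \<Longrightarrow> y \<in> VC \<Longrightarrow> r \<odot>\<^sub>V (x \<oplus>\<^sub>V y) = r \<odot>\<^sub>V x \<oplus>\<^sub>V r \<odot>\<^sub>V y" using V.smult_r_distr[of r x y] by simp
lemma act_mul: "x \<in> VC \<Longrightarrow> r \<odot>\<^sub>V s \<odot>\<^sub>V x = mul q r s \<odot>\<^sub>V x" using V.smult_assoc[of r s x] by simp
lemma act_one [simp]: "x \<in> VC \<Longrightarrow> 1 \<odot>\<^sub>V x = x" using V.smult_one[of x] by simp
lemma act_zero [simp]: "r \<odot>\<^sub>V \<zero>\<^bsub>M\<^esub> = \<zero>\<^bsub>M\<^esub>" using smult_zero_right[OF simple, of r] by simp
lemma act_zero_left [simp]: "x \<in> VC \<Longrightarrow> 0 \<odot>\<^sub>V x = \<zero>\<^bsub>M\<^esub>" using smult_zero_left[OF simple, of x] by simp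

definition vsc :: "'k \<Rightarrow> 'b \<Rightarrow> 'b" where "vsc c x = Poly_Mapping.single 0 (cst c) \<odot>\<^sub>V x"

lemma vsc_closed [simp]: "x \<in> VC \<Longrightarrow> vsc c x \<in> VC" by (simp add: vsc_def)
lemma vsc_add: "x \<in> VC \<Longrightarrow> y \<in> VC \<Longrightarrow> vsc c (x \<oplus>\<^sub>V y) = vsc c x \<oplus>\<^sub>V vsc c y" by (simp add: vsc_def act_add)
lemma vsc_add_left: "x \<in> VC \<Longrightarrow> vsc (c + d) x = vsc c x \<oplus>\<^sub>V vsc d x" by (simp add: vsc_def act_add_left single_add)
lemma vsc_vsc: "x \<in> VC \<Longrightarrow> vsc c (vsc d x) = vsc (c * d) x"
  by (simp add: vsc_def act_mul mul_single_single wt_cst cst_mult)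
lemma vsc_one [simp]: "x \<in> VC \<Longrightarrow> vsc 1 x = x" by (simp add: vsc_def)
lemma vsc_zero [simp]: "x \<in> VC \<Longrightarrow> vsc 0 x = \<zero>\<^bsub>M\<^esub>" "vsc c \<zero>\<^bsub>M\<^esub> = \<zero>\<^bsub>M\<^esub>" by (simp_all add: vsc_def)
lemma act_vsc: "x \<in> VC \<Longrightarrow> r \<odot>\<^sub>V vsc c x = vsc c (r \<odot>\<^sub>V x)"
proof -
  have "mul q r (Poly_Mapping.single 0 (cst c)) = mul q (Poly_Mapping.single 0 (cst c)) r"
    by (rule poly_mapping_eqI) (simp add: lookup_mul_coef_right mul_coef lookup_scl wt_cst mult.commute)
  then show "x \<in> VC \<Longrightarrow> r \<odot>\<^sub>V vsc c x = vsc c (r \<odot>\<^sub>V x)" by (simp add: vsc_def act_mul)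
qed
lemma act_diff:
  assumes "x \<in> VC" "r \<odot>\<^sub>V x = s \<odot>\<^sub>V x" shows "(r - s) \<odot>\<^sub>V x = \<zero>\<^bsub>M\<^esub>"
  using act_add_left[OF assms(1), of r "- s"] act_add_left[OF assms(1), of s "- s"] assms by simp

lemma submodule_eq:
  assumes "N \<subseteq> VC" "\<zero>\<^bsub>M\<^esub> \<in> N" "\<And>x y. x \<in> N \<Longrightarrow> y \<in> N \<Longrightarrow> x \<oplus>\<^sub>V y \<in> N" "\<And>r x. x \<in> N \<Longrightarrow> r \<odot>\<^sub>V x \<in> N"
  shows "N = {\<zero>\<^bsub>M\<^esub>} \<or> N = VC"
proof -
  have neg: "\<ominus>\<^bsub>M\<^esub> x = (- 1) \<odot>\<^sub>V x" if "x \<in> VC" for x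
    using smult_uminus[OF simple, of 1 x] that by (simp add: Wring_uminus[OF q0])
  have "submodule N (Wring q) M"
  proof (intro submodule.intro submodule_axioms.intro V.M.add.subgroupI)
    show "N \<noteq> {}" using assms(2) by blast
    show "\<ominus>\<^bsub>M\<^esub> x \<in> N" if "x \<in> N" for x using neg[of x] assms(1,4) that by auto
  qed (use assms in auto)
  then show ?thesis using simple unfolding simple_left_module_def by blast
qed

lemma generates: assumes "x \<in> VC" "x \<noteq> \<zero>\<^bsub>M\<^esub>" "y \<in> VC" shows "\<exists>r. y = r \<odot>\<^sub>V x"
proof -
  let ?N = "{r \<odot>\<^sub>V x |r. True}"
  have "?N = {\<zero>\<^bsub>M\<^esub>} \<or> ?N = VC"
  proof (rule submodule_eq)
    show "\<zero>\<^bsub>M\<^esub> \<in> ?N" using act_zero_left[OF assms(1)] by (metis (mono_tags, lifting) mem_Collect_eq)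
    show "u \<oplus>\<^sub>V w \<in> ?N" if "u \<in> ?N" "w \<in> ?N" for u w
      using that act_add_left[OF assms(1), symmetric] by auto
    show "r \<odot>\<^sub>V u \<in> ?N" if "u \<in> ?N" for r u using that act_mul[OF assms(1)] by auto
  qed (use assms in auto)
  moreover have "x \<in> ?N" using act_one[OF assms(1)] by (metis (mono_tags, lifting) mem_Collect_eq)
  ultimately show ?thesis using assms by auto
qed

end

locale simple_endo = simple_wmod q M
  for q :: "'k::{alg_closed_field, field_char_0}" and M :: "('k wspace, 'b, 'c) module_scheme" +
  fixes \<phi> :: "'b \<Rightarrow> 'b"
  assumes \<phi>_closed: "x \<in> carrier M \<Longrightarrow> \<phi> x \<in> carrier M"
    and \<phi>_add: "x \<in> carrier M \<Longrightarrow> y \<in> carrier M \<Longrightarrow> \<phi> (x \<oplus>\<^bsub>M\<^esub> y) = \<phi> x \<oplus>\<^bsub>M\<^esub> \<phi> y"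
    and \<phi>_smult: "x \<in> carrier M \<Longrightarrow> \<phi> (r \<odot>\<^bsub>M\<^esub> x) = r \<odot>\<^bsub>M\<^esub> \<phi> x"
begin

lemma \<phi>_vsc: "x \<in> VC \<Longrightarrow> \<phi> (vsc c x) = vsc c (\<phi> x)" by (simp add: vsc_def \<phi>_smult)
lemma \<phi>_zero [simp]: "\<phi> \<zero>\<^bsub>M\<^esub> = \<zero>\<^bsub>M\<^esub>" using \<phi>_smult[of "\<zero>\<^bsub>M\<^esub>" 0] \<phi>_closed[of "\<zero>\<^bsub>M\<^esub>"] by simp
lemmas \<phi>_closed' [simp] = \<phi>_closed

definition pact :: "'k poly \<Rightarrow> 'b \<Rightarrow> 'b" where
  "pact p x = fold_coeffs (\<lambda>c y. vsc c x \<oplus>\<^sub>V \<phi> y) p \<zero>\<^bsub>M\<^esub>"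

lemma pact_zero [simp]: "pact 0 x = \<zero>\<^bsub>M\<^esub>" by (simp add: pact_def)

lemma pact_pCons: "x \<in> VC \<Longrightarrow> pact (pCons c p) x = vsc c x \<oplus>\<^sub>V \<phi> (pact p x)"
  by (cases "p = 0 \<and> c = 0") (auto simp: pact_def fold_coeffs_pCons_not_0_0_eq fold_coeffs_pCons_coeff_not_0_eq)

lemma pact_closed [simp]: "x \<in> VC \<Longrightarrow> pact p x \<in> VC"
  by (induction p rule: pCons_induct) (auto simp: pact_pCons)

lemma pact_const: "x \<in> VC \<Longrightarrow> pact [:c:] x = vsc c x" by (simp add: pact_pCons)

lemma pact_zero_right [simp]: "pact p \<zero>\<^bsub>M\<^esub> = \<zero>\<^bsub>M\<^esub>"
  by (induction p rule: pCons_induct) (auto simp: pact_pCons)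

lemma pact_add_left: "x \<in> VC \<Longrightarrow> pact (p + r) x = pact p x \<oplus>\<^sub>V pact r x"
  by (induction p r rule: poly_induct2) (auto simp: pact_pCons vsc_add_left \<phi>_add V.M.a_ac)

lemma pact_add: "x \<in> VC \<Longrightarrow> y \<in> VC \<Longrightarrow> pact p (x \<oplus>\<^sub>V y) = pact p x \<oplus>\<^sub>V pact p y"
  by (induction p rule: pCons_induct) (auto simp: pact_pCons vsc_add \<phi>_add V.M.a_ac)

lemma pact_smult: "x \<in> VC \<Longrightarrow> pact (smult c p) x = vsc c (pact p x)"
  by (induction p rule: pCons_induct) (auto simp: pact_pCons vsc_add vsc_vsc \<phi>_vsc)

lemma pact_mult: "x \<in> VC \<Longrightarrow> pact (p * r) x = pact p (pact r x)"
  by (induction p rule: pCons_induct) (auto simp: pact_pCons pact_add_left pact_smult)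

lemma pact_act: "x \<in> VC \<Longrightarrow> pact p (s \<odot>\<^sub>V x) = s \<odot>\<^sub>V pact p x"
  by (induction p rule: pCons_induct) (auto simp: pact_pCons act_add act_vsc \<phi>_smult)

lemma pact_vsc: "x \<in> VC \<Longrightarrow> pact p (vsc c x) = vsc c (pact p x)"
  by (simp add: vsc_def pact_act)

end

context simple_endo
begin

text \<open>Schur's lemma: a polynomial in \<open>\<phi>\<close> commutes with the action, so its
  kernel and its image are submodules.\<close>

lemma pact_kernel_image:
  "{x \<in> VC. pact p x = \<zero>\<^bsub>M\<^esub>} = {\<zero>\<^bsub>M\<^esub>} \<or> {x \<in> VC. pact p x = \<zero>\<^bsub>M\<^esub>} = VC"
  "pact p ` VC = {\<zero>\<^bsub>M\<^esub>} \<or> pact p ` VC = VC"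
proof -
  show "{x \<in> VC. pact p x = \<zero>\<^bsub>M\<^esub>} = {\<zero>\<^bsub>M\<^esub>} \<or> {x \<in> VC. pact p x = \<zero>\<^bsub>M\<^esub>} = VC"
    by (rule submodule_eq) (auto simp: pact_add pact_act)
  show "pact p ` VC = {\<zero>\<^bsub>M\<^esub>} \<or> pact p ` VC = VC"
  proof (rule submodule_eq)
    show "\<zero>\<^bsub>M\<^esub> \<in> pact p ` VC" by (rule image_eqI[of _ _ "\<zero>\<^bsub>M\<^esub>"]) simp_all
    show "x \<oplus>\<^sub>V y \<in> pact p ` VC" if "x \<in> pact p ` VC" "y \<in> pact p ` VC" for x y
      using that by (auto simp: pact_add[symmetric])
    show "r \<odot>\<^sub>V x \<in> pact p ` VC" if "x \<in> pact p ` VC" for r x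
      using that by (auto simp: pact_act[symmetric])
  qed auto
qed

lemma pact_linear_eq: 
  assumes "x \<in> VC" "pact [:- \<alpha>, 1:] x = \<zero>\<^bsub>M\<^esub>" shows "\<phi> x = vsc \<alpha> x"
proof -
  have "vsc \<alpha> x \<oplus>\<^sub>V (vsc (- \<alpha>) x \<oplus>\<^sub>V \<phi> x) = vsc \<alpha> x" using assms by (simp add: pact_pCons)
  then have "(vsc \<alpha> x \<oplus>\<^sub>V vsc (- \<alpha>) x) \<oplus>\<^sub>V \<phi> x = vsc \<alpha> x" using assms(1) by (simp add: V.M.a_assoc)
  then show ?thesis using assms(1) by (simp add: vsc_add_left[symmetric])
qed

context
  assumes noev: "\<And>\<alpha>. \<exists>x\<in>VC. \<phi> x \<noteq> vsc \<alpha> x"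
begin

lemma pact_linear: "x \<in> VC \<Longrightarrow> pact [:- \<alpha>, 1:] x = \<zero>\<^bsub>M\<^esub> \<Longrightarrow> x = \<zero>\<^bsub>M\<^esub>"
  and pact_linear_surj: "y \<in> VC \<Longrightarrow> \<exists>x\<in>VC. y = pact [:- \<alpha>, 1:] x"
proof -
  obtain z where z: "z \<in> VC" "pact [:- \<alpha>, 1:] z \<noteq> \<zero>\<^bsub>M\<^esub>" using noev[of \<alpha>] pact_linear_eq by blast
  then have "{x \<in> VC. pact [:- \<alpha>, 1:] x = \<zero>\<^bsub>M\<^esub>} = {\<zero>\<^bsub>M\<^esub>}" using pact_kernel_image(1)[of "[:- \<alpha>, 1:]"] by blast
  then show "x \<in> VC \<Longrightarrow> pact [:- \<alpha>, 1:] x = \<zero>\<^bsub>M\<^esub> \<Longrightarrow> x = \<zero>\<^bsub>M\<^esub>" by blast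
  have "pact [:- \<alpha>, 1:] ` VC = VC" using pact_kernel_image(2)[of "[:- \<alpha>, 1:]"] z by blast
  then show "y \<in> VC \<Longrightarrow> \<exists>x\<in>VC. y = pact [:- \<alpha>, 1:] x" by blast
qed

lemma pact_inj: "p \<noteq> 0 \<Longrightarrow> x \<in> VC \<Longrightarrow> pact p x = \<zero>\<^bsub>M\<^esub> \<Longrightarrow> x = \<zero>\<^bsub>M\<^esub>"
proof (induction "degree p" arbitrary: p x rule: less_induct)
  case less
  show ?case
  proof (cases "degree p = 0")
    case True
    then obtain c where c: "p = [:c:]" by (metis degree_eq_zeroE)
    have "vsc (inverse c) (vsc c x) = \<zero>\<^bsub>M\<^esub>" using less.prems c by (simp add: pact_const)
    then show ?thesis using less.prems c by (simp add: vsc_vsc)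
  next
    case False
    then obtain \<alpha> where "poly p \<alpha> = 0" using alg_closed_imp_poly_has_root[of p] by blast
    then obtain r where r: "p = [:- \<alpha>, 1:] * r" by (metis dvdE poly_eq_0_iff_dvd)
    then have r0: "r \<noteq> 0" using less.prems by auto
    then have "degree r < degree p" unfolding r by (subst degree_mult_eq) auto
    moreover have "pact r x = \<zero>\<^bsub>M\<^esub>"
      using less.prems pact_linear[of "pact r x" \<alpha>] unfolding r by (simp add: pact_mult del: mult_pCons_left)
    ultimately show ?thesis using less.hyps r0 less.prems by blast
  qed
qed

section \<open>Monomials applied to one vector, over the polynomials in
  \<open>\<phi>\<close>\<close>

context
  fixes v assumes v: "v \<in> VC" "v \<noteq> \<zero>\<^bsub>M\<^esub>"
begin

definition e :: "ix \<Rightarrow> 'b" where "e m = mono_w m \<odot>\<^sub>V v"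

lemma e_closed [simp]: "e m \<in> VC" using v by (simp add: e_def)

text \<open>The span of the vectors \<open>e m\<close> over the polynomials in
  \<open>\<phi>\<close>, built term by term so that inductions need no finite sums.\<close>

inductive_set Sp :: "ix set \<Rightarrow> 'b set" for S where
  zero: "\<zero>\<^bsub>M\<^esub> \<in> Sp S"
| add: "u \<in> Sp S \<Longrightarrow> m \<in> S \<Longrightarrow> pact g (e m) \<oplus>\<^sub>V u \<in> Sp S"

lemma Sp_carrier: "u \<in> Sp S \<Longrightarrow> u \<in> VC"
  by (induction rule: Sp.induct) auto

lemma Sp_plus: "u \<in> Sp S \<Longrightarrow> w \<in> Sp S \<Longrightarrow> u \<oplus>\<^sub>V w \<in> Sp S"
  by (induction rule: Sp.induct) (auto simp: Sp_carrier V.M.a_assoc intro: Sp.intros)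

lemma Sp_pact: "u \<in> Sp S \<Longrightarrow> pact g u \<in> Sp S"
  by (induction rule: Sp.induct) (auto simp: Sp_carrier pact_add pact_mult[symmetric] intro: Sp.intros)

lemma Sp_mono: "u \<in> Sp S \<Longrightarrow> S \<subseteq> T \<Longrightarrow> u \<in> Sp T"
  by (induction rule: Sp.induct) (auto intro: Sp.intros)

lemma Sp_e: "m \<in> S \<Longrightarrow> e m \<in> Sp S"
  using Sp.add[OF Sp.zero, of m S "[:1:]"] by (simp add: pact_const)

lemma Sp_vsc: "u \<in> Sp S \<Longrightarrow> vsc c u \<in> Sp S"
  using Sp_pact[of u S "[:c:]"] by (simp add: pact_const Sp_carrier)

lemma Sp_act: "u \<in> Sp S \<Longrightarrow> (\<And>m. m \<in> S \<Longrightarrow> t \<odot>\<^sub>V e m \<in> Sp T) \<Longrightarrow> t \<odot>\<^sub>V u \<in> Sp T"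
proof (induction rule: Sp.induct)
  case zero
  show ?case by (simp add: Sp.zero)
next
  case (add u m g)
  have "pact g (t \<odot>\<^sub>V e m) \<in> Sp T" by (rule Sp_pact[OF add.prems[OF add.hyps(2)]])
  then have "pact g (t \<odot>\<^sub>V e m) \<oplus>\<^sub>V t \<odot>\<^sub>V u \<in> Sp T" using add.IH[OF add.prems] by (rule Sp_plus)
  then show ?case by (simp add: act_add Sp_carrier[OF add.hyps(1)] pact_act)
qed

lemma scl_e: "vsc c (e m) = scl (cst c) (mono_w m) \<odot>\<^sub>V v"
  using v by (simp add: vsc_def e_def act_mul mul_coef)

lemma Sp_UNIV: assumes "x \<in> VC" shows "x \<in> Sp UNIV"
proof -
  have "r \<odot>\<^sub>V v \<in> Sp UNIV" for r
  proof (induction r rule: poly_mapping_single_induct)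
    case (single n \<beta>)
    show ?case
    proof (induction \<beta> rule: poly_mapping_single_induct)
      case (single k c)
      obtain i j l where k: "k = (i, j, l)" by (cases k)
      have "Poly_Mapping.single n (Poly_Mapping.single k c) \<odot>\<^sub>V v = vsc c (e (n, i, j, l))"
        by (simp add: scl_e scl_single mult_single k bpoly_zero_index)
      then show ?case using Sp_vsc[OF Sp_e] by simp
    qed (use v in \<open>simp add: single_add act_add_left Sp_plus\<close>)
  qed (use v in \<open>simp add: act_add_left Sp_plus\<close>)
  then show ?thesis using generates[OF v assms] by auto
qed

definition low :: "ix \<Rightarrow> ix set" where "low m = {m1. rk m1 < rk m}"

text \<open>\<open>g\<close> occurs as the leading coefficient of a relation with leading monomial
  \<open>m\<close>.\<close>

definition Rel :: "ix \<Rightarrow> 'k poly \<Rightarrow> bool" where "Rel m g \<longleftrightarrow> pact g (e m) \<in> Sp (low m)"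

text \<open>The action of \<open>t\<close> commutes with polynomials in \<open>\<phi>\<close>, so it
  carries a relation with leading monomial \<open>m\<close> to one with leading monomial
  \<open>m'\<close> and, up to the scalar \<open>u\<close>, the same leading coefficient.\<close>

lemma Rel_step:
  assumes t: "t \<odot>\<^sub>V e m = vsc u (e m')" "u \<noteq> 0" and low: "\<And>m1. rk m1 < rk m \<Longrightarrow> t \<odot>\<^sub>V e m1 \<in> Sp (low m')"
    and R: "Rel m g"
  shows "Rel m' g"
proof -
  have "t \<odot>\<^sub>V pact g (e m) \<in> Sp (low m')" using R low unfolding Rel_def by - (rule Sp_act[of _ "low m"], auto simp: low_def simp del: rk.simps)
  then have "vsc u (pact g (e m')) \<in> Sp (low m')" by (simp add: pact_act[symmetric] t(1) pact_vsc)
  then have "vsc (inverse u) (vsc u (pact g (e m'))) \<in> Sp (low m')" by (rule Sp_vsc)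
  then show ?thesis using t(2) by (simp add: Rel_def vsc_vsc)
qed

lemma act_e: "t \<odot>\<^sub>V e m = mul q t (mono_w m) \<odot>\<^sub>V v"
  using v by (simp add: e_def act_mul)

lemma e_bcD: "Poly_Mapping.single 0 bv \<odot>\<^sub>V e (n, i, j, l) = e (n, Suc i, j, l)"
  "Poly_Mapping.single 0 cv \<odot>\<^sub>V e (n, i, j, l) = e (n, i, Suc j, l)"
  "Poly_Mapping.single 0 (Dv s) \<odot>\<^sub>V e (n, i, j, l) = e (n, i, j, l + s)"
  unfolding act_e by (simp_all add: e_def mul_coef scl_single bv_def cv_def Dv_def mult_single add.commute)

lemma e_A: "Poly_Mapping.single 1 1 \<odot>\<^sub>V e (n, i, j, l) = (if n \<ge> 0 then vsc (q ^ (i + j)) (e (n + 1, i, j, l))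
    else vsc (q ^ (i + j)) (e (n + 1, i, j, l + 1)) \<oplus>\<^sub>V vsc (q * q ^ (i + j)) (e (n + 1, Suc i, Suc j, l)))"
proof -
  have "mul q (Poly_Mapping.single 1 1) (mono_w (n, i, j, l)) = (if n \<ge> 0 then scl (cst (q ^ (i + j))) (mono_w (n + 1, i, j, l))
    else scl (cst (q ^ (i + j))) (mono_w (n + 1, i, j, l + 1)) + scl (cst (q * q ^ (i + j))) (mono_w (n + 1, Suc i, Suc j, l)))"
    by (simp add: lA_eq[symmetric] lA_def lsh_single kA_def wt_single scl_single mult_single bpoly_zero_index tt_single single_add add.commute)
  then show ?thesis unfolding act_e scl_e using v by (simp add: act_add_left)
qed

lemma e_D: "Poly_Mapping.single (- 1) 1 \<odot>\<^sub>V e (n, i, j, l) = (if n \<le> 0 then vsc (inverse q ^ (i + j)) (e (n - 1, i, j, l))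
    else vsc (inverse q ^ (i + j)) (e (n - 1, i, j, l + 1)) \<oplus>\<^sub>V vsc (inverse q * inverse q ^ (i + j)) (e (n - 1, Suc i, Suc j, l)))"
proof -
  have "mul q (Poly_Mapping.single (- 1) 1) (mono_w (n, i, j, l)) = (if n \<le> 0 then scl (cst (inverse q ^ (i + j))) (mono_w (n - 1, i, j, l))
    else scl (cst (inverse q ^ (i + j))) (mono_w (n - 1, i, j, l + 1)) + scl (cst (inverse q * inverse q ^ (i + j))) (mono_w (n - 1, Suc i, Suc j, l)))"
    by (simp add: lD_eq[symmetric] lD_def lsh_single kD_def wt_single scl_single mult_single bpoly_zero_index tt_single single_add)
  then show ?thesis unfolding act_e scl_e using v by (simp add: act_add_left)
qed

lemma Sp_low: "rk m1 < rk m \<Longrightarrow> e m1 \<in> Sp (low m)"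
  by (rule Sp_e) (simp add: low_def)

lemma Rel_b: "Rel (n, i, j, l) g \<Longrightarrow> Rel (n, Suc i, j, l) g"
proof (rule Rel_step[where t = "Poly_Mapping.single 0 bv" and u = 1])
  fix m1 assume m1: "rk m1 < rk (n, i, j, l)"
  obtain n1 i1 j1 l1 where m1': "m1 = (n1, i1, j1, l1)" by (cases m1)
  show "Poly_Mapping.single 0 bv \<odot>\<^sub>V e m1 \<in> Sp (low (n, Suc i, j, l))"
  proof -
    have "wgt (n1, Suc i1, j1, l1) = wgt (n1, i1, j1, l1) + 1" "wgt (n, Suc i, j, l) = wgt (n, i, j, l) + 1" by simp_all
    then have "rk (n1, Suc i1, j1, l1) < rk (n, Suc i, j, l)" using m1 unfolding m1' rk_less by linarith
    then show ?thesis unfolding m1' e_bcD by (rule Sp_low)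
  qed
qed (simp_all add: e_bcD)

lemma Rel_c: "Rel (n, i, j, l) g \<Longrightarrow> Rel (n, i, Suc j, l) g"
proof (rule Rel_step[where t = "Poly_Mapping.single 0 cv" and u = 1])
  fix m1 assume m1: "rk m1 < rk (n, i, j, l)"
  obtain n1 i1 j1 l1 where m1': "m1 = (n1, i1, j1, l1)" by (cases m1)
  show "Poly_Mapping.single 0 cv \<odot>\<^sub>V e m1 \<in> Sp (low (n, i, Suc j, l))"
  proof -
    have "wgt (n1, i1, Suc j1, l1) = wgt (n1, i1, j1, l1) + 1" "wgt (n, i, Suc j, l) = wgt (n, i, j, l) + 1" by simp_all
    then have "rk (n1, i1, Suc j1, l1) < rk (n, i, Suc j, l)" using m1 unfolding m1' rk_less by linarith
    then show ?thesis unfolding m1' e_bcD by (rule Sp_low)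
  qed
qed (simp_all add: e_bcD)

lemma Rel_D:
  assumes s: "s = 1 \<and> l \<ge> 0 \<or> s = - 1 \<and> l \<le> 0" shows "Rel (n, i, j, l) g \<Longrightarrow> Rel (n, i, j, l + s) g"
proof (rule Rel_step[where t = "Poly_Mapping.single 0 (Dv s)" and u = 1])
  fix m1 assume m1: "rk m1 < rk (n, i, j, l)"
  obtain n1 i1 j1 l1 where m1': "m1 = (n1, i1, j1, l1)" by (cases m1)
  have "rk (n1, i1, j1, l1 + s) < rk (n, i, j, l + s)"
  proof -
    have W: "wgt (n, i, j, l + s) = wgt (n, i, j, l) + 1" using s by auto
    have "wgt (n1, i1, j1, l1 + s) = wgt (n1, i1, j1, l1) + 1 \<or>
        wgt (n1, i1, j1, l1 + s) = wgt (n1, i1, j1, l1) - 1" using s by auto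
    then show ?thesis using m1 s W unfolding m1' rk_less by linarith
  qed
  then show "Poly_Mapping.single 0 (Dv s) \<odot>\<^sub>V e m1 \<in> Sp (low (n, i, j, l + s))"
    unfolding m1' e_bcD by (rule Sp_low)
qed (simp_all add: e_bcD)

lemma Rel_A: "n \<ge> 0 \<Longrightarrow> Rel (n, i, j, l) g \<Longrightarrow> Rel (n + 1, i, j, l) g"
proof (rule Rel_step[where t = "Poly_Mapping.single 1 1" and u = "q ^ (i + j)"])
  fix m1 assume n: "n \<ge> 0" and m1: "rk m1 < rk (n, i, j, l)"
  obtain n1 i1 j1 l1 where m1': "m1 = (n1, i1, j1, l1)" by (cases m1)
  have W: "wgt (n + 1, i, j, l) = wgt (n, i, j, l) + 1" using n by simp
  have "rk (n1 + 1, i1, j1, l1) < rk (n + 1, i, j, l)" if n1: "n1 \<ge> 0"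
  proof -
    have "wgt (n1 + 1, i1, j1, l1) = wgt (n1, i1, j1, l1) + 1" using n1 by simp
    then show ?thesis using m1 W unfolding m1' rk_less by linarith
  qed
  moreover have "rk (n1 + 1, i1, j1, l1 + 1) < rk (n + 1, i, j, l)" if n1: "n1 < 0"
  proof -
    have "wgt (n1 + 1, i1, j1, l1 + 1) \<le> wgt (n1, i1, j1, l1)" using n1 by simp
    then show ?thesis using m1 W unfolding m1' rk_less by linarith
  qed
  \<comment> \<open>The weights can tie here, since \<open>b c\<close> adds two and the step in
    \<open>n\<close> removes one; the tie is decided by \<open>n1 < 0 \<le> n\<close>.\<close>
  moreover have "rk (n1 + 1, Suc i1, Suc j1, l1) < rk (n + 1, i, j, l)" if n1: "n1 < 0"
  proof -
    have "wgt (n1 + 1, Suc i1, Suc j1, l1) = wgt (n1, i1, j1, l1) + 1" using n1 by simp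
    then show ?thesis using m1 W n n1 unfolding m1' rk_less by linarith
  qed
  ultimately show "Poly_Mapping.single 1 1 \<odot>\<^sub>V e m1 \<in> Sp (low (n + 1, i, j, l))"
    unfolding m1' e_A by (auto simp del: rk.simps intro!: Sp_plus Sp_vsc Sp_low)
qed (simp_all add: e_A q0)

lemma Rel_d: "n \<le> 0 \<Longrightarrow> Rel (n, i, j, l) g \<Longrightarrow> Rel (n - 1, i, j, l) g"
proof (rule Rel_step[where t = "Poly_Mapping.single (- 1) 1" and u = "inverse q ^ (i + j)"])
  fix m1 assume n: "n \<le> 0" and m1: "rk m1 < rk (n, i, j, l)"
  obtain n1 i1 j1 l1 where m1': "m1 = (n1, i1, j1, l1)" by (cases m1)
  have W: "wgt (n - 1, i, j, l) = wgt (n, i, j, l) + 1" using n by simp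
  have "rk (n1 - 1, i1, j1, l1) < rk (n - 1, i, j, l)" if n1: "n1 \<le> 0"
  proof -
    have "wgt (n1 - 1, i1, j1, l1) = wgt (n1, i1, j1, l1) + 1" using n1 by simp
    then show ?thesis using m1 W unfolding m1' rk_less by linarith
  qed
  moreover have "rk (n1 - 1, i1, j1, l1 + 1) < rk (n - 1, i, j, l)" if n1: "n1 > 0"
  proof -
    have "wgt (n1 - 1, i1, j1, l1 + 1) \<le> wgt (n1, i1, j1, l1)" using n1 by simp
    then show ?thesis using m1 W unfolding m1' rk_less by linarith
  qed
  \<comment> \<open>If the weights tied, so would those of \<open>m1\<close> and \<open>m\<close>;
    the smaller rank of \<open>m1\<close> would then give \<open>n1 \<le> n\<close>, against
    \<open>n1 > 0 \<ge> n\<close>.\<close>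
  moreover have "rk (n1 - 1, Suc i1, Suc j1, l1) < rk (n - 1, i, j, l)" if n1: "n1 > 0"
  proof -
    have "wgt (n1 - 1, Suc i1, Suc j1, l1) = wgt (n1, i1, j1, l1) + 1" using n1 by simp
    then show ?thesis using m1 W n n1 unfolding m1' rk_less by linarith
  qed
  ultimately show "Poly_Mapping.single (- 1) 1 \<odot>\<^sub>V e m1 \<in> Sp (low (n - 1, i, j, l))"
    unfolding m1' e_D by (auto simp del: rk.simps intro!: Sp_plus Sp_vsc Sp_low)
qed (simp_all add: e_D q0)

text \<open>\<open>Rel_A\<close>, \<open>Rel_d\<close> and \<open>Rel_D\<close> lead away from zero
  only, so two exponents are comparable only if their \<open>n\<close> and their \<open>l\<close>
  have equal signs. Complementary indicators express equality of signs by inequalities.\<close>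

definition ixfuns :: "(ix \<Rightarrow> nat) list" where
  "ixfuns = [\<lambda>(n, i, j, l). nat \<bar>n\<bar>, \<lambda>(n, i, j, l). if n \<ge> 0 then 1 else 0, \<lambda>(n, i, j, l). if n \<ge> 0 then 0 else 1,
     \<lambda>(n, i, j, l). i, \<lambda>(n, i, j, l). j,
     \<lambda>(n, i, j, l). nat \<bar>l\<bar>, \<lambda>(n, i, j, l). if l \<ge> 0 then 1 else 0, \<lambda>(n, i, j, l). if l \<ge> 0 then 0 else 1]"

lemma Rel_mono:
  assumes "\<forall>F\<in>set ixfuns. F m \<le> F m'" "Rel m g" shows "Rel m' g"
proof -
  obtain n i j l where m: "m = (n, i, j, l)" by (cases m)
  obtain n' i' j' l' where m': "m' = (n', i', j', l')" by (cases m')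
  have le: "nat \<bar>n\<bar> \<le> nat \<bar>n'\<bar>" "n \<ge> 0 \<longleftrightarrow> n' \<ge> 0" "i \<le> i'" "j \<le> j'" "nat \<bar>l\<bar> \<le> nat \<bar>l'\<bar>" "l \<ge> 0 \<longleftrightarrow> l' \<ge> 0"
    using assms(1) by (auto simp: ixfuns_def m m' split: if_splits)
  have b: "Rel (n, i + k, j, l) g" for k
    using assms(2) by (induction k) (auto simp: m dest: Rel_b)
  have c: "Rel (n, i', j + k, l) g" for k
    using b[of "i' - i"] le(3) by (induction k) (auto dest: Rel_c)
  have 1: "Rel (n, i', j', l) g" using c[of "j' - j"] le(4) by simp
  have 2: "Rel (n, i', j', l') g"
  proof (cases "l \<ge> 0")
    case True
    have "Rel (n, i', j', l + int k) g" for k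
    proof (induction k)
      case (Suc k)
      then show ?case using Rel_D[of 1 "l + int k" n i' j' g] True by (simp add: algebra_simps)
    qed (use 1 in simp)
    moreover have "l + int (nat (l' - l)) = l'" using True le(5,6) by linarith
    ultimately show ?thesis by metis
  next
    case False
    have "Rel (n, i', j', l - int k) g" for k
    proof (induction k)
      case (Suc k)
      then show ?case using Rel_D[of "- 1" "l - int k" n i' j' g] False by (simp add: algebra_simps)
    qed (use 1 in simp)
    moreover have "l - int (nat (l - l')) = l'" using False le(5,6) by linarith
    ultimately show ?thesis by metis
  qed
  show ?thesis
  proof (cases "n \<ge> 0")
    case True
    have "Rel (n + int k, i', j', l') g" for k
    proof (induction k)
      case (Suc k)
      then show ?case using Rel_A[of "n + int k" i' j' l' g] True by (simp add: algebra_simps)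
    qed (use 2 in simp)
    moreover have "n + int (nat (n' - n)) = n'" using True le(1,2) by linarith
    ultimately show ?thesis unfolding m' by metis
  next
    case False
    have "Rel (n - int k, i', j', l') g" for k
    proof (induction k)
      case (Suc k)
      then show ?case using Rel_d[of "n - int k" i' j' l' g] False by (simp add: algebra_simps)
    qed (use 2 in simp)
    moreover have "n - int (nat (n - n')) = n'" using False le(1,2) by linarith
    ultimately show ?thesis unfolding m' by metis
  qed
qed

definition Lead :: "ix set" where "Lead = {m. \<exists>g. g \<noteq> 0 \<and> Rel m g}"

lemma uniform_leading: "\<exists>f. f \<noteq> 0 \<and> (\<forall>m\<in>Lead. Rel m f)"
proof -
  from dickson[of Lead ixfuns] obtain N0 where D: "finite N0" "N0 \<subseteq> Lead"
    "\<forall>m\<in>Lead. \<exists>m0\<in>N0. \<forall>F\<in>set ixfuns. F m0 \<le> F m" by (elim exE conjE)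
  note N0 = D(1,2) bspec[OF D(3)]
  have "\<forall>m\<in>N0. \<exists>g. g \<noteq> 0 \<and> Rel m g"
  proof
    fix m assume "m \<in> N0"
    then show "\<exists>g. g \<noteq> 0 \<and> Rel m g" using N0(2) unfolding Lead_def by (rule_tac CollectD) (rule subsetD)
  qed
  from bchoice[OF this] obtain g where g: "\<And>m. m \<in> N0 \<Longrightarrow> g m \<noteq> 0 \<and> Rel m (g m)" by auto
  have "Rel m (prod g N0)" if m: "m \<in> Lead" for m
  proof -
    obtain m0 where m0: "m0 \<in> N0" "\<forall>F\<in>set ixfuns. F m0 \<le> F m" using N0(3)[OF m] by blast
    then have R: "Rel m (g m0)" using Rel_mono g by blast
    have "prod g N0 = prod g (N0 - {m0}) * g m0" using prod.remove[OF N0(1) m0(1), of g] by (simp add: mult.commute)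
    then show ?thesis using Sp_pact[OF R[unfolded Rel_def], of "prod g (N0 - {m0})"] by (simp add: Rel_def pact_mult)
  qed
  moreover have "prod g N0 \<noteq> 0" using g N0(1) by simp
  ultimately show ?thesis by blast
qed

text \<open>A factor \<open>f\<close> allows a monomial in \<open>Lead\<close> to be replaced by
  monomials of lower rank; as the rank is well-founded, finitely many factors suffice.\<close>

lemma reduce_Lead:
  assumes f: "\<And>m. m \<in> Lead \<Longrightarrow> Rel m f" and u: "u \<in> VC"
  shows "\<exists>K. pact (f ^ K) u \<in> Sp (- Lead)"
proof -
  have gen: "\<exists>K. pact (f ^ K) u \<in> Sp (- Lead)" if "u \<in> Sp S" "\<And>m. m \<in> S \<Longrightarrow> \<exists>K. pact (f ^ K) (e m) \<in> Sp (- Lead)" for u S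
    using that
  proof (induction rule: Sp.induct)
    case (add u m g)
    obtain K where K: "pact (f ^ K) u \<in> Sp (- Lead)" using add by blast
    obtain L where L: "pact (f ^ L) (e m) \<in> Sp (- Lead)" using add by blast
    have uc: "u \<in> VC" using add(1) by (rule Sp_carrier)
    have "pact (f ^ L) (pact (f ^ K) u) \<in> Sp (- Lead)" "pact (f ^ K * g) (pact (f ^ L) (e m)) \<in> Sp (- Lead)"
      using K L by (auto intro: Sp_pact)
    then have "pact (f ^ K * g * f ^ L) (e m) \<oplus>\<^sub>V pact (f ^ L * f ^ K) u \<in> Sp (- Lead)"
      using uc by (intro Sp_plus) (simp_all only: pact_mult e_closed pact_closed)
    moreover have "f ^ K * g * f ^ L = f ^ (K + L) * g" "f ^ L * f ^ K = f ^ (K + L)" by (simp_all add: power_add mult_ac)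
    ultimately have "pact (f ^ (K + L)) (pact g (e m)) \<oplus>\<^sub>V pact (f ^ (K + L)) u \<in> Sp (- Lead)"
      using uc by (simp add: pact_mult)
    then have "pact (f ^ (K + L)) (pact g (e m) \<oplus>\<^sub>V u) \<in> Sp (- Lead)"
      using uc by (simp add: pact_add)
    then show ?case by blast
  qed (simp add: Sp.zero)
  have "\<exists>K. pact (f ^ K) (e m) \<in> Sp (- Lead)" for m
  proof (induction "rk m" arbitrary: m rule: less_induct)
    case less
    show ?case
    proof (cases "m \<in> Lead")
      case False
      then have "pact (f ^ 0) (e m) \<in> Sp (- Lead)" using Sp_e[of m "- Lead"] pact_const[of "e m" 1] by (simp add: one_pCons)
      then show ?thesis by blast
    next
      case True
      then have "pact f (e m) \<in> Sp (low m)" using f by (simp add: Rel_def)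
      then obtain K where "pact (f ^ K) (pact f (e m)) \<in> Sp (- Lead)" using gen[of "pact f (e m)" "low m"] less by (auto simp: low_def)
      then have "pact (f ^ Suc K) (e m) \<in> Sp (- Lead)" by (simp add: pact_mult[symmetric] mult.commute)
      then show ?thesis by blast
    qed
  qed
  then show ?thesis using gen[OF Sp_UNIV[OF u]] by blast
qed

lemma Sp_insert: "u \<in> Sp (insert m S) \<Longrightarrow> \<exists>h. \<exists>w\<in>Sp S. u = pact h (e m) \<oplus>\<^sub>V w"
proof (induction rule: Sp.induct)
  case zero
  show ?case by (intro exI[of _ 0] bexI[of _ "\<zero>\<^bsub>M\<^esub>"]) (auto intro: Sp.zero)
next
  case (add u m' g)
  then obtain h w where hw: "w \<in> Sp S" "u = pact h (e m) \<oplus>\<^sub>V w" by blast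
  have wc: "w \<in> VC" using hw(1) by (rule Sp_carrier)
  show ?case
  proof (cases "m' = m")
    case True
    then have "pact g (e m') \<oplus>\<^sub>V u = pact (g + h) (e m) \<oplus>\<^sub>V w" using hw(2) wc by (simp add: pact_add_left V.M.a_assoc)
    then show ?thesis using hw(1) by blast
  next
    case False
    then have "pact g (e m') \<oplus>\<^sub>V w \<in> Sp S" using add hw(1) by (intro Sp.add) auto
    moreover have "pact g (e m') \<oplus>\<^sub>V u = pact h (e m) \<oplus>\<^sub>V (pact g (e m') \<oplus>\<^sub>V w)"
      using hw(2) wc by (simp add: V.M.a_lcomm)
    ultimately show ?thesis by blast
  qed
qed

lemma Sp_finite: "u \<in> Sp S \<Longrightarrow> \<exists>F. finite F \<and> F \<subseteq> S \<and> u \<in> Sp F"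
proof (induction rule: Sp.induct)
  case zero
  show ?case by (intro exI[of _ "{}"]) (auto intro: Sp.zero)
next
  case (add u m g)
  then obtain F where F: "finite F" "F \<subseteq> S" "u \<in> Sp F" by blast
  then have "pact g (e m) \<oplus>\<^sub>V u \<in> Sp (insert m F)" using Sp_mono[of u F "insert m F"] by (intro Sp.add) auto
  then show ?case using F add(2) by (intro exI[of _ "insert m F"]) auto
qed

abbreviation ix0 :: ix where "ix0 \<equiv> (0, 0, 0, 0)"

lemma e_ix0: "e ix0 = v"
  unfolding e_def mono_w.simps unfolding bpoly_zero_index single_one using v by simp

lemma rk_ix0: "m \<noteq> ix0 \<Longrightarrow> rk ix0 < rk m"
proof -
  assume "m \<noteq> ix0"
  moreover have "\<not> rk m < rk ix0" by (cases m) (auto simp: rk_less simp del: rk.simps)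
  ultimately show ?thesis using rk_inj[of m ix0] by (meson linorder_neqE)
qed

text \<open>In a relation among monomials outside \<open>Lead\<close> the coefficient of the highest
  one vanishes by definition of \<open>Lead\<close>, so monomials are removed from the top. The term
  \<open>pact g v\<close> never interferes: \<open>v\<close> is \<open>e ix0\<close>, and
  \<open>ix0\<close> has the least rank. When only that term is left, \<open>pact_inj\<close>
  applies.\<close>

lemma independent:
  assumes "u \<in> Sp (- Lead - {ix0})" "pact g v \<oplus>\<^sub>V u = \<zero>\<^bsub>M\<^esub>" shows "g = 0"
proof -
  obtain F where F: "finite F" "F \<subseteq> - Lead - {ix0}" "u \<in> Sp F" using Sp_finite[OF assms(1)] by blast
  have "\<forall>u\<in>Sp F. F \<subseteq> - Lead - {ix0} \<longrightarrow> pact g v \<oplus>\<^sub>V u = \<zero>\<^bsub>M\<^esub> \<longrightarrow> g = 0"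
    using F(1)
  proof (induction F rule: finite_ranking_induct[where f = rk])
    case empty
    have "u = \<zero>\<^bsub>M\<^esub>" if "u \<in> Sp {}" for u using that by (cases rule: Sp.cases) auto
    then show ?case using pact_inj[of g v] v by (metis V.M.r_zero pact_closed)
  next
    case (insert x S)
    show ?case
    proof (intro ballI impI)
      fix u assume u: "u \<in> Sp (insert x S)" and sub: "insert x S \<subseteq> - Lead - {ix0}" and z: "pact g v \<oplus>\<^sub>V u = \<zero>\<^bsub>M\<^esub>"
      show "g = 0"
      proof (cases "x \<in> S")
        case True
        then have "u \<in> Sp S" "S \<subseteq> - Lead - {ix0}" using u sub by (simp_all add: insert_absorb)
        then show ?thesis using insert(3) z by blast
      next
        case False
        obtain h w where hw: "w \<in> Sp S" "u = pact h (e x) \<oplus>\<^sub>V w" using Sp_insert[OF u] by blast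
        have wc: "w \<in> VC" using hw(1) by (rule Sp_carrier)
        have "S \<subseteq> low x" 
        proof
          fix y assume "y \<in> S"
          then have "rk y \<le> rk x" "y \<noteq> x" using insert(2) False by auto
          then show "y \<in> low x" using rk_inj[of y x] by (auto simp: low_def le_less)
        qed
        then have w: "w \<in> Sp (low x)" using hw(1) Sp_mono by blast
        have "e ix0 \<in> Sp (low x)" using sub rk_ix0[of x] by (intro Sp_low) auto
        then have "pact g v \<in> Sp (low x)" using Sp_pact by (simp add: e_ix0)
        then have "vsc (- 1) (pact g v \<oplus>\<^sub>V w) \<in> Sp (low x)" using w by (intro Sp_vsc Sp_plus)
        moreover have "pact h (e x) = vsc (- 1) (pact g v \<oplus>\<^sub>V w)"
        proof -
          have 0: "pact h (e x) \<oplus>\<^sub>V (pact g v \<oplus>\<^sub>V w) = \<zero>\<^bsub>M\<^esub>" using z hw(2) wc v by (simp add: V.M.a_lcomm)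
          have c: "vsc 1 y \<oplus>\<^sub>V vsc (- 1) y = \<zero>\<^bsub>M\<^esub>" if "y \<in> VC" for y using vsc_add_left[OF that, of 1 "- 1"] that by simp
          have y: "pact g v \<oplus>\<^sub>V w \<in> VC" using wc v by simp
          have "pact h (e x) = pact h (e x) \<oplus>\<^sub>V ((pact g v \<oplus>\<^sub>V w) \<oplus>\<^sub>V vsc (- 1) (pact g v \<oplus>\<^sub>V w))" using c[OF y] y by simp
          also have "\<dots> = (pact h (e x) \<oplus>\<^sub>V (pact g v \<oplus>\<^sub>V w)) \<oplus>\<^sub>V vsc (- 1) (pact g v \<oplus>\<^sub>V w)" using V.M.a_assoc[of "pact h (e x)" "pact g v \<oplus>\<^sub>V w" "vsc (- 1) (pact g v \<oplus>\<^sub>V w)"] y by (simp only: e_closed pact_closed vsc_closed)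
          finally show ?thesis using 0 y by simp
        qed
        ultimately have "Rel x h" by (simp add: Rel_def)
        then have "h = 0" using sub by (auto simp: Lead_def)
        then have "u = w" using hw(2) wc by simp
        then show ?thesis using insert(3) hw(1) sub z by blast
      qed
    qed
  qed
  then show ?thesis using F assms(2) by blast
qed

lemma contradiction: False
proof -
  obtain f where f: "f \<noteq> 0" "\<And>m. m \<in> Lead \<Longrightarrow> Rel m f" using uniform_leading by blast
  have "ix0 \<notin> Lead"
  proof
    assume "ix0 \<in> Lead"
    then obtain g where g: "g \<noteq> 0" "pact g v \<in> Sp (low ix0)" by (auto simp: Lead_def Rel_def e_ix0)
    have "\<not> rk m < rk ix0" for m using rk_ix0[of m] by (metis order.asym order.irrefl)
    then have "low ix0 = {}" unfolding low_def by blast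
    then have "pact g v \<in> Sp {}" using g(2) by simp
    then have "pact g v = \<zero>\<^bsub>M\<^esub>" by (cases rule: Sp.cases) auto
    then show False using pact_inj g(1) v by blast
  qed
  then have ins: "- Lead = insert ix0 (- Lead - {ix0})" by auto
  have "poly f \<alpha> = 0" for \<alpha>
  proof -
    obtain w where w: "w \<in> VC" "v = pact [:- \<alpha>, 1:] w" using pact_linear_surj[OF v(1)] by blast
    obtain K where "pact (f ^ K) w \<in> Sp (- Lead)" using reduce_Lead[OF f(2) w(1)] by blast
    then obtain h s where hs: "s \<in> Sp (- Lead - {ix0})" "pact (f ^ K) w = pact h v \<oplus>\<^sub>V s"
      using Sp_insert[of "pact (f ^ K) w" ix0 "- Lead - {ix0}"] ins by (auto simp: e_ix0)
    have sc: "s \<in> VC" using hs(1) by (rule Sp_carrier)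
    let ?y = "[:- \<alpha>, 1:]"
    have "pact (f ^ K) v = pact (f ^ K * ?y) w" using pact_mult[OF w(1), of "f ^ K" ?y] w(2) by simp
    also have "\<dots> = pact ?y (pact (f ^ K) w)" by (simp only: mult.commute[of "f ^ K"] pact_mult[OF w(1)])
    also have "\<dots> = pact ?y (pact h v) \<oplus>\<^sub>V pact ?y s" unfolding hs(2) using v sc by (intro pact_add) auto
    also have "pact ?y (pact h v) = pact (?y * h) v" by (rule pact_mult[OF v(1), symmetric])
    finally have eq: "pact (f ^ K) v = pact (?y * h) v \<oplus>\<^sub>V pact ?y s" .
    have "pact (?y * h - f ^ K) v \<oplus>\<^sub>V pact ?y s = \<zero>\<^bsub>M\<^esub>"
    proof -
      have "pact (?y * h - f ^ K) v \<oplus>\<^sub>V pact ?y s = pact (- (f ^ K)) v \<oplus>\<^sub>V (pact (?y * h) v \<oplus>\<^sub>V pact ?y s)"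
        using v sc pact_add_left[OF v(1), of "- (f ^ K)" "?y * h"] by (simp add: V.M.a_assoc del: mult_pCons_left)
      also have "\<dots> = pact (- (f ^ K) + f ^ K) v" unfolding eq[symmetric] by (rule pact_add_left[OF v(1), symmetric])
      finally show ?thesis by simp
    qed
    moreover have "pact ?y s \<in> Sp (- Lead - {ix0})" using hs(1) by (rule Sp_pact)
    ultimately have "?y * h - f ^ K = 0" by (intro independent)
    then have "poly (?y * h) \<alpha> = poly (f ^ K) \<alpha>" by (simp del: mult_pCons_left)
    then show ?thesis by (simp add: poly_power)
  qed
  then show False using f(1) poly_all_0_iff_0[of f] by blast
qed

end

end

lemma scalar: "\<exists>\<alpha>. \<forall>x\<in>VC. \<phi> x = vsc \<alpha> x"
proof (rule ccontr)
  assume no: "\<not> ?thesis"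
  have "\<exists>x\<in>VC. x \<noteq> \<zero>\<^bsub>M\<^esub>"
    using simple V.M.zero_closed unfolding simple_left_module_def by blast
  then show False using contradiction no by blast
qed

end

section \<open>Normal elements acting on simple modules\<close>

lemma annihilator_Wring: "annihilator (Wring q) M = {r. \<forall>x\<in>carrier M. r \<odot>\<^bsub>M\<^esub> x = \<zero>\<^bsub>M\<^esub>}"
  by (simp add: annihilator_def)

lemma annihilator_Dv:
  fixes q :: "'k::{alg_closed_field, field_char_0}"
  assumes q: "q \<noteq> 0" and M: "simple_left_module (Wring q) M"
  shows "\<exists>l. Poly_Mapping.single 0 (Dv 1 - cst l) \<in> annihilator (Wring q) M"
proof -
  interpret I: simple_wmod q M by (rule simple_wmod.intro[OF q M])
  let ?D = "Poly_Mapping.single 0 (Dv 1) :: 'k wspace"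
  have comm: "mul q r ?D = mul q ?D r" for r
    
  proof -
    have "scl (Dv 1) (1 :: 'k wspace) = ?D" using scl_single[of "Dv 1" 0 "1 :: 'k bpoly"] by simp
    then show ?thesis using scl_central[of q r 1 1] mul_e0_right[of q r] by (simp add: mul_coef)
  qed
  interpret E: simple_endo q M "\<lambda>x. ?D \<odot>\<^bsub>M\<^esub> x"
    by unfold_locales (simp_all add: q M I.act_add I.act_mul comm)
  obtain l where l: "\<And>x. x \<in> carrier M \<Longrightarrow> ?D \<odot>\<^bsub>M\<^esub> x = Poly_Mapping.single 0 (cst l) \<odot>\<^bsub>M\<^esub> x"
    using E.scalar unfolding I.vsc_def by blast
  have "(?D - Poly_Mapping.single 0 (cst l)) \<odot>\<^bsub>M\<^esub> x = \<zero>\<^bsub>M\<^esub>" if "x \<in> carrier M" for x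
    using I.act_diff[OF that l[OF that]] .
  then show ?thesis unfolding annihilator_Wring single_diff[symmetric] by blast
qed

text \<open>A normal element that does not kill \<open>M\<close> acts bijectively, and the quotient of two normal
  elements inducing the same automorphism acts \<open>Wring q\<close>-linearly, hence as a scalar.\<close>

lemma annihilator_normal:
  fixes q :: "'k::{alg_closed_field, field_char_0}"
  assumes q: "q \<noteq> 0" and M: "simple_left_module (Wring q) M"
    and g: "\<And>r. sg r g = cst r * g" and g': "\<And>r. sg r g' = cst r * g'"
    and gM: "Poly_Mapping.single 0 g \<notin> annihilator (Wring q) M"
  shows "\<exists>\<alpha>. Poly_Mapping.single 0 (g' - cst \<alpha> * g) \<in> annihilator (Wring q) M"
proof -
  interpret I: simple_wmod q M by (rule simple_wmod.intro[OF q M])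
  let ?G = "Poly_Mapping.single 0 g" and ?G' = "Poly_Mapping.single 0 g'"
  \<comment> \<open>The twists for moving \<open>g\<close> across \<open>r\<close> in the two
    directions. They depend only on how \<open>g\<close> scales, so the same \<open>\<sigma>\<close>
    serves \<open>g'\<close>.\<close>
  define \<tau> where "\<tau> = lsh 0 (\<lambda>n. cst (q powi n)) 1"
  define \<sigma> where "\<sigma> = lsh 0 (\<lambda>n. cst (q powi (- n))) 1"
  have \<tau>: "r \<odot>\<^bsub>M\<^esub> (?G \<odot>\<^bsub>M\<^esub> x) = ?G \<odot>\<^bsub>M\<^esub> (\<tau> r \<odot>\<^bsub>M\<^esub> x)" if "x \<in> carrier M" for r x
    using normal_left[OF q g, of r] that by (simp add: I.act_mul \<tau>_def mul_coef)
  have \<sigma>: "?G \<odot>\<^bsub>M\<^esub> (r \<odot>\<^bsub>M\<^esub> x) = \<sigma> r \<odot>\<^bsub>M\<^esub> (?G \<odot>\<^bsub>M\<^esub> x)" if "x \<in> carrier M" for r x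
    unfolding I.act_mul[OF that] mul_coef normal_right[OF q g] \<sigma>_def ..
  have \<sigma>': "?G' \<odot>\<^bsub>M\<^esub> (r \<odot>\<^bsub>M\<^esub> x) = \<sigma> r \<odot>\<^bsub>M\<^esub> (?G' \<odot>\<^bsub>M\<^esub> x)" if "x \<in> carrier M" for r x
    unfolding I.act_mul[OF that] mul_coef normal_right[OF q g'] \<sigma>_def ..
  have "\<exists>z. z \<in> carrier M \<and> ?G \<odot>\<^bsub>M\<^esub> z \<noteq> \<zero>\<^bsub>M\<^esub>"
    using gM unfolding annihilator_Wring by (simp only: mem_Collect_eq Ball_def not_all not_imp simp_thms)
  then obtain z where zz: "z \<in> carrier M \<and> ?G \<odot>\<^bsub>M\<^esub> z \<noteq> \<zero>\<^bsub>M\<^esub>" ..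
  note z = conjunct1[OF zz] conjunct2[OF zz]
  define K where "K = {x \<in> carrier M. ?G \<odot>\<^bsub>M\<^esub> x = \<zero>\<^bsub>M\<^esub>}"
  have "K = {\<zero>\<^bsub>M\<^esub>} \<or> K = carrier M"
  proof (rule I.submodule_eq)
    show "K \<subseteq> carrier M" "\<zero>\<^bsub>M\<^esub> \<in> K" by (simp_all add: K_def)
    show "x \<oplus>\<^bsub>M\<^esub> y \<in> K" if "x \<in> K" "y \<in> K" for x y using that by (simp add: K_def I.act_add)
    show "r \<odot>\<^bsub>M\<^esub> x \<in> K" if "x \<in> K" for r x using that \<sigma>[of x r] by (simp add: K_def)
  qed
  then have ker: "x = \<zero>\<^bsub>M\<^esub>" if "x \<in> carrier M" "?G \<odot>\<^bsub>M\<^esub> x = \<zero>\<^bsub>M\<^esub>" for x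
    using z that unfolding K_def by blast
  define J where "J = {?G \<odot>\<^bsub>M\<^esub> x |x. x \<in> carrier M}"
  have "J = {\<zero>\<^bsub>M\<^esub>} \<or> J = carrier M"
  proof (rule I.submodule_eq)
    show "J \<subseteq> carrier M" by (auto simp: J_def)
    show "\<zero>\<^bsub>M\<^esub> \<in> J" unfolding J_def mem_Collect_eq by (rule exI[of _ "\<zero>\<^bsub>M\<^esub>"]) simp
    show "x \<oplus>\<^bsub>M\<^esub> y \<in> J" if xy: "x \<in> J" "y \<in> J" for x y
    proof -
      obtain u v where uv: "u \<in> carrier M" "v \<in> carrier M" "x = ?G \<odot>\<^bsub>M\<^esub> u" "y = ?G \<odot>\<^bsub>M\<^esub> v" using xy unfolding J_def by blast
      show ?thesis unfolding J_def mem_Collect_eq by (rule exI[of _ "u \<oplus>\<^bsub>M\<^esub> v"]) (simp add: uv I.act_add)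
    qed
    show "r \<odot>\<^bsub>M\<^esub> x \<in> J" if x: "x \<in> J" for r x
    proof -
      obtain u where u: "u \<in> carrier M" "x = ?G \<odot>\<^bsub>M\<^esub> u" using x unfolding J_def by blast
      show ?thesis unfolding J_def mem_Collect_eq by (rule exI[of _ "\<tau> r \<odot>\<^bsub>M\<^esub> u"]) (simp add: u \<tau>)
    qed
  qed
  moreover have "?G \<odot>\<^bsub>M\<^esub> z \<in> J" unfolding J_def using z(1) by blast
  ultimately have J: "J = carrier M" using z(2) by blast
  have surj: "\<exists>x. x \<in> carrier M \<and> ?G \<odot>\<^bsub>M\<^esub> x = y" if y: "y \<in> carrier M" for y
  proof -
    obtain x where x: "x \<in> carrier M" "y = ?G \<odot>\<^bsub>M\<^esub> x" using y J unfolding J_def by blast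
    then show ?thesis by (intro exI[of _ x]) simp
  qed
  have inj: "x = y" if xy: "x \<in> carrier M" "y \<in> carrier M" "?G \<odot>\<^bsub>M\<^esub> x = ?G \<odot>\<^bsub>M\<^esub> y" for x y
  proof -
    have n: "u \<oplus>\<^bsub>M\<^esub> I.vsc (- 1) u = \<zero>\<^bsub>M\<^esub>" if "u \<in> carrier M" for u
      using I.vsc_add_left[OF that, of 1 "- 1"] that by simp
    have "?G \<odot>\<^bsub>M\<^esub> (x \<oplus>\<^bsub>M\<^esub> I.vsc (- 1) y) = \<zero>\<^bsub>M\<^esub>" using xy n[of "?G \<odot>\<^bsub>M\<^esub> y"] by (simp add: I.act_add I.act_vsc)
    then have x: "x \<oplus>\<^bsub>M\<^esub> I.vsc (- 1) y = \<zero>\<^bsub>M\<^esub>" using ker xy by simp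
    have "x = x \<oplus>\<^bsub>M\<^esub> (I.vsc (- 1) y \<oplus>\<^bsub>M\<^esub> y)" using n[OF xy(2)] xy I.V.M.a_comm[of y "I.vsc (- 1) y"] by simp
    also have "\<dots> = y" using x xy I.V.M.a_assoc[of x "I.vsc (- 1) y" y] by simp
    finally show ?thesis .
  qed
  obtain \<phi> where \<phi>: "\<And>u. u \<in> carrier M \<Longrightarrow> \<phi> u \<in> carrier M"
    "\<And>u. u \<in> carrier M \<Longrightarrow> ?G \<odot>\<^bsub>M\<^esub> \<phi> u = ?G' \<odot>\<^bsub>M\<^esub> u"
  proof -
    have "\<forall>u\<in>carrier M. \<exists>x. x \<in> carrier M \<and> ?G \<odot>\<^bsub>M\<^esub> x = ?G' \<odot>\<^bsub>M\<^esub> u"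
      by (intro ballI surj I.act_closed)
    from bchoice[OF this] obtain \<phi> where \<phi>': "\<forall>u\<in>carrier M. \<phi> u \<in> carrier M \<and> ?G \<odot>\<^bsub>M\<^esub> \<phi> u = ?G' \<odot>\<^bsub>M\<^esub> u" ..
    show ?thesis by (rule that[of \<phi>]) (use \<phi>' in simp_all)
  qed
  interpret E: simple_endo q M \<phi>
  proof
    fix x y r assume x: "x \<in> carrier M"
    show "\<phi> (r \<odot>\<^bsub>M\<^esub> x) = r \<odot>\<^bsub>M\<^esub> \<phi> x"
      by (rule inj) (simp_all add: \<phi> x \<sigma> \<sigma>')
    assume y: "y \<in> carrier M"
    show "\<phi> (x \<oplus>\<^bsub>M\<^esub> y) = \<phi> x \<oplus>\<^bsub>M\<^esub> \<phi> y"
      by (rule inj) (simp_all add: \<phi> x y I.act_add)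
  qed (simp_all add: q M \<phi>)
  obtain \<alpha> where \<alpha>: "\<And>x. x \<in> carrier M \<Longrightarrow> \<phi> x = I.vsc \<alpha> x" using E.scalar by blast
  have "(?G' - Poly_Mapping.single 0 (cst \<alpha> * g)) \<odot>\<^bsub>M\<^esub> x = \<zero>\<^bsub>M\<^esub>" if x: "x \<in> carrier M" for x
  proof (rule I.act_diff[OF x])
    have "?G' \<odot>\<^bsub>M\<^esub> x = I.vsc \<alpha> (?G \<odot>\<^bsub>M\<^esub> x)" using \<phi>(2)[OF x] \<alpha>[OF x] x by (simp add: I.act_vsc)
    then show "?G' \<odot>\<^bsub>M\<^esub> x = Poly_Mapping.single 0 (cst \<alpha> * g) \<odot>\<^bsub>M\<^esub> x"
      using x by (simp add: I.vsc_def I.act_mul mul_coef scl_single)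
  qed
  then show ?thesis unfolding annihilator_Wring single_diff[symmetric] by blast
qed

section \<open>Points of the graded strata\<close>

definition ev :: "'k::field \<Rightarrow> 'k \<Rightarrow> 'k \<Rightarrow> 'k bpoly \<Rightarrow> 'k" where
  "ev x y l = plin (\<lambda>k c. c * x ^ fst k * y ^ fst (snd k) * l powi snd (snd k))"

lemma ev_add: "ev x y l (f + h) = ev x y l f + ev x y l h"
  unfolding ev_def by (rule plin_add) (simp_all add: algebra_simps)

lemma ev_single: "ev x y l (Poly_Mapping.single (i, j, m) c) = c * x ^ i * y ^ j * l powi m"
  unfolding ev_def by (subst plin_single) simp_all

lemma ev_zero [simp]: "ev x y l 0 = 0"
  by (simp add: ev_def)

lemma ev_mult: assumes l: "l \<noteq> 0" shows "ev x y l (f * h) = ev x y l f * ev x y l h"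
proof (induction f rule: poly_mapping_single_induct)
  case (single k c)
  show ?case
  proof (induction h rule: poly_mapping_single_induct)
    case (single k' c')
    obtain i j m where k: "k = (i, j, m)" by (cases k)
    obtain i' j' m' where k': "k' = (i', j', m')" by (cases k')
    show ?case unfolding k k' mult_single using l
      by (simp add: ev_single power_add power_int_add)
  qed (simp_all add: distrib_left ev_add)
qed (simp_all add: distrib_right ev_add)

lemma ev_cst: "ev x y l (cst c) = c"
  using ev_single[of x y l 0 0 0 c] by (simp add: bpoly_zero_index)

lemma ev_one [simp]: "ev x y l 1 = 1"
  using ev_cst[of x y l 1] by simp

lemma ev_bv: "ev x y l bv = x" and ev_cv: "ev x y l cv = y"
  by (simp_all add: bv_def cv_def ev_single)

lemma ev_sum: "ev x y l (sum F A) = (\<Sum>a\<in>A. ev x y l (F a))"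
  by (induction A rule: infinite_finite_induct) (simp_all add: ev_add)

lemma ev_diff: "ev x y l (f - h) = ev x y l f - ev x y l h"
  using ev_add[of x y l "f - h" h] by simp

text \<open>Modulo \<open>p\<close>, \<open>D\<close> is the scalar \<open>l\<close> and
  \<open>b\<close>, \<open>c\<close> are \<open>x\<close>, \<open>y\<close> times \<open>g\<close>:
  geometrically, the line through \<open>(x, y)\<close> at \<open>D = l\<close>. Letting
  \<open>g\<close> be either \<open>b\<close> or \<open>c\<close> covers both charts of the
  projective line of ratios.\<close>

definition strat :: "'k::field bpoly \<Rightarrow> 'k \<Rightarrow> 'k \<Rightarrow> 'k \<Rightarrow> 'k bpoly set \<Rightarrow> bool" where
  "strat g x y l p \<longleftrightarrow> g \<in> {bv, cv} \<and> bprime p \<and> homog p \<and> g \<notin> p \<and> Dv 1 - cst l \<in> p \<and>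
     bv - cst x * g \<in> p \<and> cv - cst y * g \<in> p"

context
  fixes g x y l and p :: "'k::field bpoly set"
  assumes strat: "strat g x y l p"
begin

lemma p_bideal: "bideal p" and p_homog: "homog p" and p_one: "1 \<notin> p" and p_g: "g \<notin> p"
  and p_prime: "u * v \<in> p \<Longrightarrow> u \<in> p \<or> v \<in> p"
  using strat unfolding strat_def bprime_def by blast+

lemma strat_l: "l \<noteq> 0"
proof
  assume "l = 0"
  then have "Dv 1 * 1 \<in> p" using strat by (simp add: strat_def)
  then show False using bideal_Dv[OF p_bideal] p_one by blast
qed

lemma strat_ev_g: "ev x y l g = 1"
proof -
  have z: "z = 1" if z: "g - cst z * g \<in> p" for z
  proof (rule ccontr)
    assume "z \<noteq> 1"
    then have nz: "1 - z \<noteq> 0" by simp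
    have "g - cst z * g = cst (1 - z) * g" by (simp add: single_diff algebra_simps)
    then have "cst (1 - z) * g \<in> p" using z by simp
    then show False using bideal_cst[OF p_bideal nz] p_g by blast
  qed
  have "g = bv \<or> g = cv" and "bv - cst x * g \<in> p" "cv - cst y * g \<in> p" using strat by (auto simp: strat_def)
  then show ?thesis using z[of x] z[of y] by (auto simp: ev_bv ev_cv)
qed

lemma cong_mult: "u - u' \<in> p \<Longrightarrow> v - v' \<in> p \<Longrightarrow> u * v - u' * v' \<in> p"
proof -
  assume *: "u - u' \<in> p" "v - v' \<in> p"
  have "u * v - u' * v' = v * (u - u') + u' * (v - v')" by (simp add: algebra_simps)
  then show ?thesis
    using bidealD(2)[OF p_bideal bidealD(3)[OF p_bideal *(1), of v] bidealD(3)[OF p_bideal *(2), of u']] by simp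
qed

lemma cong_power: "u - u' \<in> p \<Longrightarrow> u ^ n - u' ^ n \<in> p"
  by (induction n) (simp_all add: cong_mult bidealD(1)[OF p_bideal])

lemma cst_power: "cst z ^ n = cst (z ^ n)"
  by (induction n) (simp_all add: cst_mult)

lemma Dv_power: "Dv 1 ^ n = Dv (int n)"
  by (induction n) (simp_all add: Dv_mult Dv_zero)

lemma strat_Dv: "Dv m - cst (l powi m) \<in> p"
proof -
  have D: "Dv (int n) - cst (l ^ n) \<in> p" for n
    using cong_power[of "Dv 1" "cst l" n] strat by (simp add: strat_def cst_power Dv_power)
  show ?thesis
  proof (cases "m \<ge> 0")
    case True
    then show ?thesis using D[of "nat m"] by (simp add: power_int_def)
  next
    case False
    define n where "n = nat (- m)"
    have m: "m = - int n" using False by (simp add: n_def)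
    have i: "cst (inverse (l ^ n)) * cst (l ^ n) = 1" "Dv (- int n) * Dv (int n) = 1"
      using strat_l by (simp_all add: cst_mult Dv_mult Dv_zero)
    have "Dv (- int n) - cst (inverse (l ^ n)) =
        Dv (- int n) * (cst (inverse (l ^ n)) * cst (l ^ n)) - cst (inverse (l ^ n)) * (Dv (- int n) * Dv (int n))"
      by (simp only: i mult_1_right)
    also have "\<dots> = - (Dv (- int n) * cst (inverse (l ^ n)) * (Dv (int n) - cst (l ^ n)))"
      by (simp only: right_diff_distrib minus_diff_eq mult_ac)
    also have "\<dots> \<in> p" by (rule bidealD(5)[OF p_bideal bidealD(3)[OF p_bideal D]])
    finally show ?thesis by (simp add: m power_int_minus)
  qed
qed

text \<open>The quotient by \<open>p\<close> is generated by \<open>g\<close>, and a component of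
  degree \<open>j\<close> becomes its value at the point times \<open>g ^ j\<close>. As powers of
  \<open>g\<close> avoid \<open>p\<close>, these values decide membership in
  \<open>p\<close>.\<close>

lemma strat_cong: "hc j f - cst (ev x y l (hc j f)) * g ^ j \<in> p"
proof (induction f rule: poly_mapping_single_induct)
  case (single k c)
  obtain i i' m where k: "k = (i, i', m)" by (cases k)
  show ?case
  proof (cases "i + i' = j")
    case False
    then show ?thesis by (simp add: wt_single k bidealD(1)[OF p_bideal])
  next
    case True
    have b: "bv ^ i = Poly_Mapping.single (i, 0, 0) (1 :: 'k)"
      by (induction i) (simp_all add: bv_def mult_single bpoly_zero_index)
    have c: "cv ^ i' = Poly_Mapping.single (0, i', 0) (1 :: 'k)"
      by (induction i') (simp_all add: cv_def mult_single bpoly_zero_index)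
    have eq: "Poly_Mapping.single (i, i', m) c = cst c * (bv ^ i * (cv ^ i' * Dv m))"
      by (simp add: b c Dv_def mult_single)
    have "bv ^ i - (cst x * g) ^ i \<in> p" "cv ^ i' - (cst y * g) ^ i' \<in> p"
      using strat by (auto simp: strat_def intro: cong_power)
    then have "bv ^ i * (cv ^ i' * Dv m) - (cst x * g) ^ i * ((cst y * g) ^ i' * cst (l powi m)) \<in> p"
      by (intro cong_mult strat_Dv)
    from bidealD(3)[OF p_bideal this, of "cst c"]
    have "Poly_Mapping.single (i, i', m) c - cst c * ((cst x * g) ^ i * ((cst y * g) ^ i' * cst (l powi m))) \<in> p"
      by (simp only: right_diff_distrib eq)
    moreover have "cst c * ((cst x * g) ^ i * ((cst y * g) ^ i' * cst (l powi m))) = cst (c * x ^ i * y ^ i' * l powi m) * g ^ j"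
      by (simp add: power_mult_distrib cst_power cst_mult[symmetric] True[symmetric] power_add mult_ac)
    ultimately show ?thesis using True by (simp add: wt_single k ev_single)
  qed
next
  case (add f h)
  have "hc j (f + h) - cst (ev x y l (hc j (f + h))) * g ^ j =
      (hc j f - cst (ev x y l (hc j f)) * g ^ j) + (hc j h - cst (ev x y l (hc j h)) * g ^ j)"
    by (simp add: wt_add ev_add single_add algebra_simps)
  then show ?case using bidealD(2)[OF p_bideal add] by (simp only:)
qed

lemma strat_mem: "f \<in> p \<longleftrightarrow> (\<forall>j. ev x y l (hc j f) = 0)"
proof
  assume f: "f \<in> p"
  show "\<forall>j. ev x y l (hc j f) = 0"
  proof (rule allI, rule ccontr)
    fix j assume nz: "ev x y l (hc j f) \<noteq> 0"
    have "hc j f \<in> p" using f p_homog by (simp add: homog_def)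
    then have "cst (ev x y l (hc j f)) * g ^ j \<in> p" using bidealD(6)[OF p_bideal _ strat_cong, of "hc j f" j f] by simp
    then have "g ^ j \<in> p" by (rule bideal_cst[OF p_bideal nz])
    moreover have "g ^ n \<notin> p" for n using p_prime p_one p_g by (induction n) auto
    ultimately show False by blast
  qed
next
  assume *: "\<forall>j. ev x y l (hc j f) = 0"
  show "f \<in> p"
  proof (rule bideal_from_hc[OF p_bideal])
    show "hc j f \<in> p" for j using strat_cong[of j f] * by simp
  qed
qed

lemma strat_ev: "f \<in> p \<Longrightarrow> ev x y l f = 0"
  by (subst hc_decomp) (simp add: ev_sum strat_mem)

text \<open>Combined with \<open>strat_unique\<close>, this makes \<open>p\<close> maximal among the
  homogeneous primes that avoid \<open>g\<close>.\<close>

lemma strat_maximal: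
  assumes "bprime p'" "homog p'" "p \<subseteq> p'" "g \<notin> p'" shows "strat g x y l p'"
  using strat assms unfolding strat_def by blast

end

lemma strat_unique: "strat g x y l p \<Longrightarrow> strat g x y l p' \<Longrightarrow> p = p'"
  using strat_mem by blast

definition model_primitive :: "'k::field wspace set \<Rightarrow> bool" where
  "model_primitive P \<longleftrightarrow> (\<exists>g x y l p. strat g x y l p \<and> P = Iw p) \<or>
     (Poly_Mapping.single 0 bv \<in> P \<and> Poly_Mapping.single 0 cv \<in> P \<and> maximalideal P (Wring 1))"

text \<open>The left annihilator of a vector \<open>v\<close> on which \<open>b, c, D\<close> act by \<open>x, y, l\<close>: since \<open>b e_n = q^(-n) e_n b\<close>,
  they act on \<open>e_n v\<close> by \<open>q^(-n) x, q^(-n) y, l\<close>.\<close>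

definition point_lid :: "'k::field \<Rightarrow> 'k \<Rightarrow> 'k \<Rightarrow> 'k \<Rightarrow> 'k wspace set" where
  "point_lid q x y l = {w. \<forall>n. ev x y l (sg (inverse (q powi n)) (Poly_Mapping.lookup w n)) = 0}"

lemma lid_point_lid: assumes q: "q \<noteq> 0" and l: "l \<noteq> 0" shows "lid q (point_lid q x y l)"
proof -
  have "mul q r w \<in> point_lid q x y l" if w: "w \<in> point_lid q x y l" for r w
  proof -
    have "ev x y l (sg (inverse (q powi N)) (Poly_Mapping.lookup (mul q r w) N)) = 0" for N
    proof -
      have "inverse (q powi N) * q powi n = inverse (q powi (N - n))" for n
        using q by (simp add: power_int_diff field_simps)
      then have "ev x y l (sg (inverse (q powi N)) (sg (q powi n) (Poly_Mapping.lookup w (N - n)))) = 0" for n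
        using w by (simp only: sg_sg) (simp add: point_lid_def)
      then show ?thesis by (simp add: lookup_mul wt_sum sg_mult ev_sum ev_mult[OF l])
    qed
    then show ?thesis by (simp add: point_lid_def)
  qed
  then show ?thesis by (auto simp: lid_def point_lid_def lookup_add wt_add ev_add)
qed

lemma point_lid_single: "Poly_Mapping.single 0 f \<in> point_lid q x y l \<longleftrightarrow> ev x y l f = 0"
  by (auto simp: point_lid_def lookup_single when_def)

lemma Iw_subset_point_lid: assumes s: "strat g x y l p" shows "Iw p \<subseteq> point_lid q x y l"
proof
  fix w assume "w \<in> Iw p"
  then have "wt h (Poly_Mapping.lookup w n) \<in> p" for h n
    using homog_wt[OF p_bideal[OF s] p_homog[OF s]] by (simp add: Iw_def)
  then show "w \<in> point_lid q x y l" using strat_ev[OF s] by (simp add: point_lid_def)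
qed

text \<open>\<open>g\<close> has value \<open>1\<close> at the point, so \<open>g - 1\<close> lies
  in \<open>point_lid\<close>, and a proper left ideal above it cannot contain
  \<open>g\<close>.\<close>

lemma exists_max_lid_strat:
  assumes s: "strat g x y l p" and q: "q \<noteq> 0"
  obtains L where "max_lid q L" "point_lid q x y l \<subseteq> L" "Iw p \<subseteq> L" "Poly_Mapping.single 0 g \<notin> L"
proof -
  have "1 \<notin> point_lid q x y l" using point_lid_single[of 1 q x y l] by simp
  then obtain L where L: "point_lid q x y l \<subseteq> L" "max_lid q L"
    using exists_max_lid[OF lid_point_lid[OF q strat_l[OF s]]] by metis
  have lid: "lid q L" and one: "1 \<notin> L" using L(2) by (auto simp: max_lid_def)
  have "Poly_Mapping.single 0 (g - 1) \<in> L"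
    using L(1) point_lid_single[of "g - 1" q x y l] strat_ev_g[OF s] by (auto simp: ev_diff)
  then have "Poly_Mapping.single 0 g \<notin> L"
    using lidD(6)[OF lid, of "Poly_Mapping.single 0 g" "Poly_Mapping.single 0 (g - 1)"] one by (auto simp: single_diff)
  then show ?thesis using that L Iw_subset_point_lid[OF s] by blast
qed

lemma core_ideal:
  assumes q: "q \<noteq> 0" and L: "max_lid q L"
  shows "core q L \<in> prim (Wring q)" "core q L \<subseteq> L" "ideal P (Wring q) \<Longrightarrow> P \<subseteq> L \<Longrightarrow> P \<subseteq> core q L"
proof -
  show "core q L \<in> prim (Wring q)"
    using simple_quotient_module[OF q L] unfolding prim_def by blast
  show "core q L \<subseteq> L"
  proof
    fix a assume "a \<in> core q L"
    then have "mul q a 1 \<in> L" unfolding core_def by blast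
    then show "a \<in> L" by (simp only: mul_e0_right)
  qed
  show "ideal P (Wring q) \<Longrightarrow> P \<subseteq> L \<Longrightarrow> P \<subseteq> core q L"
    by (auto simp: ideal_Wring[OF q] core_def)
qed

section \<open>Primitive ideals\<close>

lemma lid_sum: "lid q L \<Longrightarrow> (\<And>a. a \<in> A \<Longrightarrow> f a \<in> L) \<Longrightarrow> sum f A \<in> L"
  by (induction A rule: infinite_finite_induct) (auto simp: lid_def)

lemma ideal_Wring_one: "ideal J (Wring 1) \<longleftrightarrow> lid 1 J" for J :: "'k::field wspace set"
proof -
  have "mul 1 x r \<in> J" if "lid 1 J" "x \<in> J" for x r
    using lidD(3)[OF that, of r] by (simp only: mul_one_commute[of x r])
  then show ?thesis using ideal_Wring[of "1 :: 'k" J] by auto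
qed

lemma maximalideal_iff_max_lid: "maximalideal P (Wring 1) \<longleftrightarrow> max_lid 1 P" for P :: "'k::field wspace set"
proof -
  interpret cring "Wring (1 :: 'k)" by (rule cring_Wring_one)
  have one: "J = UNIV \<longleftrightarrow> 1 \<in> J" if "lid 1 J" for J :: "'k wspace set"
    using lidD(3)[OF that, of 1] by auto
  show ?thesis
  proof
    assume "maximalideal P (Wring 1)"
    then interpret P: maximalideal P "Wring (1 :: 'k)" .
    have "lid 1 P" using P.ideal_axioms by (simp add: ideal_Wring_one)
    moreover have "1 \<notin> P" using one[OF calculation] P.I_notcarr by auto
    moreover have "L' = P" if "lid 1 L'" "P \<subseteq> L'" "1 \<notin> L'" for L'
      using P.I_maximal[of L'] that by (auto simp: ideal_Wring_one)
    ultimately show "max_lid 1 P" by (simp add: max_lid_def)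
  next
    assume P: "max_lid 1 P"
    show "maximalideal P (Wring 1)"
    proof (rule maximalidealI)
      show "ideal P (Wring 1)" "carrier (Wring 1) \<noteq> P" using P by (auto simp: ideal_Wring_one max_lid_def)
      show "J = P \<or> J = carrier (Wring 1)" if "ideal J (Wring 1)" "P \<subseteq> J" "J \<subseteq> carrier (Wring 1)" for J
        using that P one[of J] by (auto simp: ideal_Wring_one max_lid_def)
    qed
  qed
qed

text \<open>Modulo \<open>b\<close> and \<open>c\<close> multiplication commutes, so an element
  killing one nonzero vector of \<open>M\<close> kills all of \<open>M\<close>. Thus
  \<open>M\<close> is a copy of the quotient by its annihilator, and simplicity means that this
  ideal is maximal.\<close>

lemma annihilator_maximal:
  fixes P :: "'k::field wspace set"
  assumes q: "q \<noteq> 0" and M: "simple_left_module (Wring q) M"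
    and bc: "Poly_Mapping.single 0 bv \<in> annihilator (Wring q) M" "Poly_Mapping.single 0 cv \<in> annihilator (Wring q) M"
    and P: "P = annihilator (Wring q) M" "P \<in> spec (Wring q)"
  shows "maximalideal P (Wring 1)"
proof -
  interpret I: simple_wmod q M by (rule simple_wmod.intro[OF q M])
  have lid: "lid q P" using P(2) q by (simp add: spec_def prime_ideal_nc_def ideal_Wring)
  have sub: "Iw bc0 \<subseteq> P" using Iw_bc0_subset[OF q lid] bc P(1) by simp
  have mem: "r \<in> P \<longleftrightarrow> (\<forall>x\<in>carrier M. r \<odot>\<^bsub>M\<^esub> x = \<zero>\<^bsub>M\<^esub>)" for r by (simp add: P(1) annihilator_Wring)
  have ann: "r \<in> P" if x: "x \<in> carrier M" "x \<noteq> \<zero>\<^bsub>M\<^esub>" and r: "r \<odot>\<^bsub>M\<^esub> x = \<zero>\<^bsub>M\<^esub>" for r x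
  proof -
    have "r \<odot>\<^bsub>M\<^esub> y = \<zero>\<^bsub>M\<^esub>" if y: "y \<in> carrier M" for y
    proof -
      obtain s where s: "y = s \<odot>\<^bsub>M\<^esub> x" using I.generates[OF x y] by blast
      have "mul q r s - mul q s r = (mul q r s - mul 1 r s) + (mul 1 s r - mul q s r)"
        using mul_one_commute[of r s] by simp
      also have "\<dots> \<in> P" using lidD(2)[OF lid] sub mul_cong_bc0 by blast
      finally have "(mul q r s - mul q s r) \<odot>\<^bsub>M\<^esub> x = \<zero>\<^bsub>M\<^esub>" using mem x(1) by blast
      then have "mul q r s \<odot>\<^bsub>M\<^esub> x = mul q s r \<odot>\<^bsub>M\<^esub> x"
        using I.act_add_left[OF x(1), of "mul q r s - mul q s r" "mul q s r"] x(1) by simp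
      then show ?thesis using r x(1) by (simp add: s I.act_mul[symmetric])
    qed
    then show ?thesis using mem by blast
  qed
  obtain x where x: "x \<in> carrier M" "x \<noteq> \<zero>\<^bsub>M\<^esub>"
    using M I.V.M.zero_closed unfolding simple_left_module_def by blast
  have "1 \<notin> P" using mem x I.act_one by metis
  moreover have "L' = P" if L': "lid 1 L'" "P \<subseteq> L'" "1 \<notin> L'" for L'
  proof (rule ccontr)
    assume "L' \<noteq> P"
    then obtain r where r: "r \<in> L'" "r \<notin> P" using L'(2) by blast
    have Lq: "lid q L'" using lid_change[OF _ L'(1)] sub L'(2) by blast
    have "r \<odot>\<^bsub>M\<^esub> x \<noteq> \<zero>\<^bsub>M\<^esub>" using ann[OF x] r(2) by blast
    then obtain s where s: "x = s \<odot>\<^bsub>M\<^esub> (r \<odot>\<^bsub>M\<^esub> x)" using I.generates[of "r \<odot>\<^bsub>M\<^esub> x" x] x(1) by auto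
    have "(1 - mul q s r) \<odot>\<^bsub>M\<^esub> x = \<zero>\<^bsub>M\<^esub>"
      by (rule I.act_diff[OF x(1)]) (use s x(1) in \<open>simp add: I.act_mul\<close>)
    then have "1 - mul q s r \<in> L'" using ann[OF x] L'(2) by blast
    then show False using lidD(2)[OF Lq _ lidD(3)[OF Lq r(1), of s]] L'(3) by fastforce
  qed
  ultimately show ?thesis
    using lid_change[OF sub lid] by (simp add: maximalideal_iff_max_lid max_lid_def)
qed

lemma exists_strat:
  fixes q :: "'k::{alg_closed_field, field_char_0}"
  assumes q: "q \<noteq> 0" and M: "simple_left_module (Wring q) M" and g: "g \<in> {bv, cv}"
    and gM: "Poly_Mapping.single 0 g \<notin> annihilator (Wring q) M"
  obtains x y l where "Poly_Mapping.single 0 (Dv 1 - cst l) \<in> annihilator (Wring q) M"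
    "Poly_Mapping.single 0 (bv - cst x * g) \<in> annihilator (Wring q) M"
    "Poly_Mapping.single 0 (cv - cst y * g) \<in> annihilator (Wring q) M"
proof -
  have g': "sg r g = cst r * g" for r using g sg_bv[of r] sg_cv[of r] by auto
  show ?thesis
    using annihilator_Dv[OF q M] annihilator_normal[OF q M g' sg_bv gM] annihilator_normal[OF q M g' sg_cv gM] that by blast
qed

lemma prim_iff_model_primitive:
  fixes q :: "'k::{alg_closed_field, field_char_0}"
  assumes q: "q \<noteq> 0" "\<And>n::nat. n > 0 \<Longrightarrow> q ^ n \<noteq> 1"
  shows "P \<in> prim (Wring q) \<longleftrightarrow> model_primitive P"
proof
  assume P: "P \<in> prim (Wring q)"
  then obtain M :: "('k wspace, 'k wspace set) module" where M: "simple_left_module (Wring q) M" "P = annihilator (Wring q) M"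
    unfolding prim_def by blast
  have spec: "P \<in> spec (Wring q)" using prim_subset_spec[of "Wring q"] P by blast
  show "model_primitive P"
  proof (cases "Poly_Mapping.single 0 bv \<in> P \<and> Poly_Mapping.single 0 cv \<in> P")
    case True
    then show ?thesis using annihilator_maximal[OF q(1) M(1) _ _ M(2) spec] M(2) by (simp add: model_primitive_def)
  next
    case False
    then obtain g :: "'k bpoly" where g: "g \<in> {bv, cv}" "Poly_Mapping.single 0 g \<notin> P" by blast
    have "P \<in> spec (Wring q) \<longleftrightarrow> (\<exists>p. bprime p \<and> homog p \<and> P = Iw p)"
      by (rule spec_graded_iff[OF q _ g(2)]) (use g(1) sg_bv sg_cv in auto)
    then obtain p where p: "bprime p" "homog p" "P = Iw p" using spec by blast
    obtain x y l where "Poly_Mapping.single 0 (Dv 1 - cst l) \<in> P"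
      "Poly_Mapping.single 0 (bv - cst x * g) \<in> P" "Poly_Mapping.single 0 (cv - cst y * g) \<in> P"
      using exists_strat[OF q(1) M(1) g(1)] g(2) unfolding M(2) by metis
    then have "strat g x y l p"
      using p g mem_Iw_single[of p 0] by (simp add: strat_def bprime_def)
    then show ?thesis using p(3) unfolding model_primitive_def by blast
  qed
next
  assume "model_primitive P"
  then consider g x y l p where "strat g x y l p" "P = Iw p"
    | "Poly_Mapping.single 0 bv \<in> P" "Poly_Mapping.single 0 cv \<in> P" "maximalideal P (Wring 1)"
    unfolding model_primitive_def by blast
  then show "P \<in> prim (Wring q)"
  proof cases
    case 1
    note s = 1(1)
    \<comment> \<open>The core of \<open>L\<close> is a primitive ideal containing
      \<open>Iw p\<close>. It is prime and avoids \<open>g\<close>, hence is graded, and maximality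
      of \<open>p\<close> among such primes leaves no room for it to be larger.\<close>
    obtain L where L: "max_lid q L" "Iw p \<subseteq> L" "Poly_Mapping.single 0 g \<notin> L"
      using exists_max_lid_strat[OF s q(1)] by metis
    note C = core_ideal[OF q(1) L(1)]
    have gC: "Poly_Mapping.single 0 g \<notin> core q L" using C(2) L(3) by blast
    have "core q L \<in> spec (Wring q)" using prim_subset_spec[of "Wring q"] C(1) by blast
    moreover have "core q L \<in> spec (Wring q) \<longleftrightarrow> (\<exists>p. bprime p \<and> homog p \<and> core q L = Iw p)"
      by (rule spec_graded_iff[OF q _ gC]) (use s sg_bv sg_cv in \<open>auto simp: strat_def\<close>)
    ultimately obtain p' where p': "bprime p'" "homog p'" "core q L = Iw p'" by blast
    have sub: "Iw p \<subseteq> Iw p'" using C(3)[OF ideal_Iw[OF q(1) p_bideal[OF s] p_homog[OF s]] L(2)] p'(3) by simp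
    have b: "bideal p'" using p'(1) by (simp add: bprime_def)
    have "p \<subseteq> p'" using sub mem_Iw_single[OF p_bideal[OF s], of 0] mem_Iw_single[OF b, of 0] by blast
    moreover have "g \<notin> p'" using gC p'(3) mem_Iw_single[OF b, of 0] by simp
    ultimately have "p = p'" using strat_unique[OF s] strat_maximal[OF s p'(1,2)] by blast
    then show ?thesis using C(1) p'(3) 1(2) by simp
  next
    case 2
    have P1: "max_lid 1 P" using 2(3) by (simp add: maximalideal_iff_max_lid)
    have lid: "lid 1 P" using P1 by (simp add: max_lid_def)
    have sub: "Iw bc0 \<subseteq> P" using Iw_bc0_subset[OF _ lid 2(1,2)] by simp
    have "L' = P" if L': "lid q L'" "P \<subseteq> L'" "1 \<notin> L'" for L'
    proof -
      have "lid 1 L'" using lid_change[OF _ L'(1)] sub L'(2) by blast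
      then show ?thesis using P1 L' unfolding max_lid_def by blast
    qed
    then have m: "max_lid q P" using P1 lid_change[OF sub lid] by (simp add: max_lid_def)
    have "core q P = P" using core_ideal(2)[OF q(1) m] core_ideal(3)[OF q(1) m ideal_change[OF sub q(1) lid]] by blast
    then show ?thesis using core_ideal(1)[OF q(1) m] by simp
  qed
qed

section \<open>Poisson primitive ideals\<close>

lemma mul_one_scl: "mul 1 x (scl \<beta> y) = scl \<beta> (mul 1 x y)"
  unfolding mul_one_commute[of x] by (rule mul_scl)

lemma hbr_power:
  assumes J: "lid 1 J" and h: "(\<gamma>, g) \<in> {(Gb, bv), (Gc, cv)}" and m: "scl (g ^ Suc N) w \<in> J"
  shows "scl (g ^ N) (hbr \<gamma> x w) \<in> J"
proof -
  have m': "scl (g ^ N) (scl g w) \<in> J" using m by (simp add: scl_scl mult.commute)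
  have neg: "scl \<beta> (- u) = - scl \<beta> u" for \<beta> and u :: "'a wspace"
    by (rule poly_mapping_eqI) (simp add: lookup_scl)
  have A: "scl (g ^ N) (lA 1 (scl g w)) \<in> J"
    using lidD(3)[OF J m', of "Poly_Mapping.single 1 1"] by (simp add: mul_one_scl lA_eq)
  have D: "scl (g ^ N) (scl g (lD 1 w)) \<in> J"
    using lidD(3)[OF J m', of "Poly_Mapping.single (- 1) 1"] by (simp add: mul_one_scl lD_eq)
  show ?thesis
    using h A D lidD(1)[OF J] lidD(5)[OF J A] by (cases x) (auto simp: neg)
qed

text \<open>\<open>g\<close> is Poisson normal: the extra term of the Leibniz rule for
  \<open>scl g w\<close> contains the factor \<open>g\<close> again, so \<open>N\<close> further
  powers of \<open>g\<close> bring it into \<open>J\<close>.\<close>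

lemma pbr_power:
  assumes J: "wpoisson J" and h: "(\<gamma>, g) \<in> {(Gb, bv), (Gc, cv)}"
  shows "scl (g ^ N) w \<in> J \<Longrightarrow> scl (g ^ N) (pbr x w) \<in> J"
proof (induction N arbitrary: w)
  case 0
  then show ?case using J by (simp add: wpoisson_def)
next
  case (Suc N)
  have lid: "lid 1 J" using J by (simp add: wpoisson_def ideal_Wring_one)
  have "scl (g ^ N) (scl g w) \<in> J" using Suc.prems by (simp add: scl_scl mult.commute)
  then have "scl (g ^ N) (pbr x (scl g w)) \<in> J" by (rule Suc.IH)
  moreover have "pbr x (scl g w) = scl g (pbr x w) + hbr \<gamma> x w" using pbr_gop[of x \<gamma> w] h by auto
  ultimately have "scl (g ^ N) (scl g (pbr x w)) + scl (g ^ N) (hbr \<gamma> x w) \<in> J" by (simp add: scl_add)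
  from lidD(6)[OF lid this hbr_power[OF lid h Suc.prems, of x]] show ?case by (simp add: scl_scl mult.commute)
qed

definition sat :: "'k::field bpoly \<Rightarrow> 'k wspace set \<Rightarrow> 'k wspace set" where
  "sat g J = {w. \<exists>N. scl (g ^ N) w \<in> J}"

lemma wpoisson_sat:
  assumes J: "wpoisson J" and g: "g \<in> {bv, cv}" shows "wpoisson (sat g J)"
proof -
  have lid: "lid 1 J" using J by (simp add: wpoisson_def ideal_Wring_one)
  obtain \<gamma> where h: "(\<gamma>, g) \<in> {(Gb, bv), (Gc, cv)}" using g by blast
  have "lid 1 (sat g J)"
    unfolding lid_def
  proof (intro conjI ballI allI)
    show "0 \<in> sat g J" using lidD(1)[OF lid] by (simp add: sat_def)
    fix v assume "v \<in> sat g J"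
    then obtain N where N: "scl (g ^ N) v \<in> J" by (auto simp: sat_def)
    show "mul 1 r v \<in> sat g J" for r
      using lidD(3)[OF lid N, of r] unfolding sat_def mul_one_scl by blast
    fix w assume "w \<in> sat g J"
    then obtain K where K: "scl (g ^ K) w \<in> J" by (auto simp: sat_def)
    have "scl (g ^ (N + K)) (v + w) \<in> J"
      using lidD(2)[OF lid lidD(4)[OF lid N, of "g ^ K"] lidD(4)[OF lid K, of "g ^ N"]]
      by (simp add: scl_add scl_scl power_add mult.commute)
    then show "v + w \<in> sat g J" unfolding sat_def by blast
  qed
  then show ?thesis using pbr_power[OF J h] unfolding wpoisson_def ideal_Wring_one sat_def by blast
qed

lemma Iw_multiples:
  assumes J: "lid 1 J" and z: "Poly_Mapping.single 0 z \<in> J" shows "Iw (range (times z)) \<subseteq> J"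
proof
  fix w assume w: "w \<in> Iw (range (times z))"
  have "Poly_Mapping.single n (Poly_Mapping.lookup w n) \<in> J" for n
  proof -
    obtain \<beta> where "Poly_Mapping.lookup w n = z * \<beta>" using w by (auto simp: Iw_def)
    then have "Poly_Mapping.single n (Poly_Mapping.lookup w n) = mul 1 (Poly_Mapping.single n \<beta>) (Poly_Mapping.single 0 z)"
      by (simp add: mul_one_commute[of "Poly_Mapping.single n \<beta>"] mul_coef scl_single)
    then show ?thesis using lidD(3)[OF J z] by simp
  qed
  then show "w \<in> J" by (subst poly_mapping_eq_sum_single) (intro lid_sum[OF J])
qed

text \<open>Quillen's lemma for the simple module with annihilator \<open>L\<close> plays the part
  of the Nullstellensatz: it puts \<open>D - l\<close>, \<open>b - x g\<close> and
  \<open>c - y g\<close> in \<open>L\<close>. Being homogeneous, each generates a Poisson ideal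
  inside \<open>L\<close>, and the assumption \<open>largest\<close> moves that ideal into
  \<open>Iw p\<close>.\<close>

lemma strat_of_max_lid:
  fixes p :: "'k::{alg_closed_field, field_char_0} bpoly set"
  assumes L: "max_lid 1 L" and sub: "Iw p \<subseteq> L" and largest: "\<And>J. wpoisson J \<Longrightarrow> J \<subseteq> L \<Longrightarrow> J \<subseteq> Iw p"
    and p: "bprime p" "homog p" and g: "g \<in> {bv, cv}" "Poly_Mapping.single 0 g \<notin> L"
  obtains x y l where "strat g x y l p"
proof -
  have lid: "lid 1 L" using L by (simp add: max_lid_def)
  have b: "bideal p" using p(1) by (simp add: bprime_def)
  have one: "(1 :: 'k) \<noteq> 0" by simp
  obtain M :: "('k wspace, 'k wspace set) module" where M: "simple_left_module (Wring 1) M" "annihilator (Wring 1) M = core 1 L"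
    using simple_quotient_module[OF one L] by blast
  have "core 1 L = L"
    using core_ideal(2)[OF one L] core_ideal(3)[OF one L] lid by (auto simp: ideal_Wring_one)
  then obtain x y l where xyl: "Poly_Mapping.single 0 (Dv 1 - cst l) \<in> L"
    "Poly_Mapping.single 0 (bv - cst x * g) \<in> L" "Poly_Mapping.single 0 (cv - cst y * g) \<in> L"
    using exists_strat[OF one M(1) g(1)] g(2) unfolding M(2) by metis
  have mem: "z \<in> p" if z: "Poly_Mapping.single 0 z \<in> L" "hc i z = z" for z i
  proof -
    have "Iw (range (times z)) \<subseteq> Iw p"
      by (intro largest wpoisson_Iw bideal_multiples homog_multiples[OF z(2)] Iw_multiples[OF lid z(1)])
    moreover have "Poly_Mapping.single 0 z \<in> Iw (range (times z))"
      using mem_Iw_single[OF bideal_multiples, of 0 z z] image_eqI[of z "times z" 1 UNIV] by simp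
    ultimately show ?thesis using mem_Iw_single[OF b, of 0] by blast
  qed
  have hg: "hc 1 g = g" using g(1) by (auto simp: wt_bv wt_cv)
  have "Dv 1 - cst l \<in> p" by (rule mem[OF xyl(1), of 0]) (simp add: wt_diff wt_Dv wt_cst)
  moreover have "bv - cst x * g \<in> p" by (rule mem[OF xyl(2), of 1]) (simp add: wt_diff wt_bv wt_cst_mult hg[simplified])
  moreover have "cv - cst y * g \<in> p" by (rule mem[OF xyl(3), of 1]) (simp add: wt_diff wt_cv wt_cst_mult hg[simplified])
  moreover have "g \<notin> p" using sub g(2) mem_Iw_single[OF b, of 0 g] by blast
  ultimately have "strat g x y l p" using p g(1) by (simp add: strat_def)
  then show ?thesis by (rule that)
qed

text \<open>Saturating a Poisson ideal below \<open>L\<close> with respect to \<open>g\<close> makes it graded, and the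
  homogeneous components of its base are then evaluated at the point defining \<open>L\<close>.\<close>

lemma strat_largest:
  fixes p :: "'k::field_char_0 bpoly set"
  assumes s: "strat g x y l p" and L: "max_lid 1 L" "point_lid 1 x y l \<subseteq> L" "Poly_Mapping.single 0 g \<notin> L"
    and J: "wpoisson J" "J \<subseteq> L"
  shows "J \<subseteq> Iw p"
proof -
  have lid: "lid 1 L" and one: "1 \<notin> L" using L(1) by (auto simp: max_lid_def)
  have g: "g \<in> {bv, cv}" using s by (simp add: strat_def)
  have sat: "wpoisson (sat g J)" by (rule wpoisson_sat[OF J(1) g])
  have ev0: "ev x y l f = 0" if f: "Poly_Mapping.single 0 f \<in> L" for f
  proof (rule ccontr)
    let ?c = "ev x y l f"
    assume nz: "?c \<noteq> 0"
    have "Poly_Mapping.single 0 (f - cst ?c) \<in> L"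
      using L(2) point_lid_single[of "f - cst ?c" 1 x y l] by (auto simp: ev_diff ev_cst)
    then have "Poly_Mapping.single 0 (cst ?c) \<in> L"
      using lidD(6)[OF lid f, of "Poly_Mapping.single 0 (f - cst ?c)"] by (simp add: single_diff)
    from lidD(4)[OF lid this, of "cst (inverse ?c)"] show False using one nz by (simp add: scl_single cst_mult)
  qed
  have g1: "Poly_Mapping.single 0 (g - 1) \<in> L"
    using L(2) point_lid_single[of "g - 1" 1 x y l] strat_ev_g[OF s] by (auto simp: ev_diff)
  \<comment> \<open>\<open>g\<close> acts as \<open>1\<close> modulo \<open>L\<close>, so it can be
    cancelled there.\<close>
  have can: "w \<in> L" if w: "scl g w \<in> L" for w
  proof -
    have "mul 1 w (Poly_Mapping.single 0 (g - 1)) = scl (g - 1) w" unfolding mul_one_commute[of w] mul_coef ..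
    then have "scl (g - 1) w \<in> L" using lidD(3)[OF lid g1, of w] by simp
    moreover have "scl g w - scl (g - 1) w = w" by (rule poly_mapping_eqI) (simp add: lookup_scl lookup_minus algebra_simps)
    ultimately show ?thesis using lidD(6)[OF lid w] by metis
  qed
  have "scl (g ^ N) w \<in> L \<Longrightarrow> w \<in> L" for N w
    by (induction N) (auto simp: scl_scl[symmetric] intro: can)
  then have satL: "sat g J \<subseteq> L" using J(2) unfolding sat_def by blast
  have "w \<in> sat g J" if "scl g w \<in> sat g J" for w
    using that unfolding sat_def mem_Collect_eq scl_scl power_Suc2[symmetric] by blast
  then have eq: "sat g J = Iw (base (sat g J))" using graded_poisson[OF sat g] by blast
  have hom: "homog (base (sat g J))" by (rule homog_base_poisson[OF sat])
  have "base (sat g J) \<subseteq> p"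
  proof
    fix f assume "f \<in> base (sat g J)"
    then have "hc j f \<in> base (sat g J)" for j using hom by (simp add: homog_def)
    then have "Poly_Mapping.single 0 (hc j f) \<in> L" for j using satL by (auto simp: base_def)
    then show "f \<in> p" using strat_mem[OF s] ev0 by blast
  qed
  then have "Iw (base (sat g J)) \<subseteq> Iw p" by (auto simp: Iw_def)
  moreover have "J \<subseteq> sat g J" unfolding sat_def by (auto intro: exI[of _ 0])
  ultimately show ?thesis using eq by blast
qed

definition wpprim :: "'k::field wspace set \<Rightarrow> bool" where
  "wpprim P \<longleftrightarrow> (\<exists>L. maximalideal L (Wring 1) \<and> wpoisson P \<and> P \<subseteq> L \<and>
     (\<forall>J. wpoisson J \<longrightarrow> J \<subseteq> L \<longrightarrow> J \<subseteq> P))"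

text \<open>Primitive ideals are compared as subspaces of the prime spectra, so \<open>P\<close> may
  be taken prime; this supplies the dichotomy between graded ideals and ideals containing
  \<open>b\<close> and \<open>c\<close>.\<close>

lemma wpprim_iff_model_primitive:
  fixes P :: "'k::{alg_closed_field, field_char_0} wspace set"
  assumes model_prime: "model_prime P"
  shows "wpprim P \<longleftrightarrow> model_primitive P"
proof
  assume "wpprim P"
  then obtain L where L: "max_lid 1 L" "P \<subseteq> L" "\<And>J. wpoisson J \<Longrightarrow> J \<subseteq> L \<Longrightarrow> J \<subseteq> P"
    unfolding wpprim_def maximalideal_iff_max_lid by blast
  have lid: "lid 1 L" using L(1) by (simp add: max_lid_def)
  show "model_primitive P"
  proof (cases "Poly_Mapping.single 0 bv \<in> L \<and> Poly_Mapping.single 0 cv \<in> L")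
    case True
    then have "Iw bc0 \<subseteq> L" using Iw_bc0_subset[OF _ lid] by simp
    then have "wpoisson L" using lid pbr_Iw_bc0 unfolding wpoisson_def ideal_Wring_one by blast
    then have "P = L" using L(2,3) by blast
    then show ?thesis using True L(1) by (simp add: model_primitive_def maximalideal_iff_max_lid)
  next
    case False
    then obtain g :: "'k bpoly" where g: "g \<in> {bv, cv}" "Poly_Mapping.single 0 g \<notin> L" by blast
    then obtain p where p: "bprime p" "homog p" "P = Iw p" using model_prime L(2) unfolding model_prime_def by blast
    have "\<exists>x y l. strat g x y l p"
      using strat_of_max_lid[OF L(1) L(2)[unfolded p(3)] L(3)[unfolded p(3)] p(1,2) g] by metis
    then show ?thesis using p(3) unfolding model_primitive_def by blast
  qed
next
  assume "model_primitive P"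
  have P: "wpoisson P" using pspec_iff_model_prime model_prime by blast
  from \<open>model_primitive P\<close> consider g x y l p where "strat g x y l p" "P = Iw p" | "maximalideal P (Wring 1)"
    unfolding model_primitive_def by blast
  then show "wpprim P"
  proof cases
    case 1
    obtain L where L: "max_lid 1 L" "point_lid 1 x y l \<subseteq> L" "Iw p \<subseteq> L" "Poly_Mapping.single 0 g \<notin> L"
      using exists_max_lid_strat[OF 1(1), of 1] by (metis zero_neq_one)
    show ?thesis
      unfolding wpprim_def maximalideal_iff_max_lid
      using L(1,3) P strat_largest[OF 1(1) L(1,2,4)] 1(2) by blast
  next
    case 2
    then show ?thesis unfolding wpprim_def using P by blast
  qed
qed

theorem corollary1p3:
  fixes q :: "'k::{alg_closed_field, field_char_0}"
  assumes "q \<noteq> 0"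
    and "\<And>n::nat. n > 0 \<Longrightarrow> q ^ n \<noteq> 1"
  shows "\<exists>\<psi> :: ((gen, 'k) free_alg set \<times> nat) set set \<Rightarrow> ((gen, 'k) mpoly \<times> nat) set set.
    homeomorphic_map
      (zariski (OqGL2 q) (spec (OqGL2 q)))
      (zariski OGL2 (pspec OGL2 GL2_bracket)) \<psi> \<and>
    homeomorphic_map
      (subtopology (zariski (OqGL2 q) (spec (OqGL2 q))) (prim (OqGL2 q)))
      (subtopology (zariski OGL2 (pspec OGL2 GL2_bracket)) (pprim OGL2 GL2_bracket)) \<psi>"
proof -
  obtain \<theta> where \<theta>: "\<theta> \<in> ring_iso (OqGL2 q) (Wring q)" using OqGL2_model[OF assms(1)] .
  obtain \<eta> :: "((gen, 'k) mpoly \<times> nat) set \<Rightarrow> 'k wspace" where \<eta>: "\<eta> \<in> ring_iso OGL2 (Wring 1)"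
    "\<And>I. ideal I OGL2 \<Longrightarrow> poisson_ideal I OGL2 GL2_bracket \<longleftrightarrow> (\<forall>x. \<forall>w\<in>\<eta> ` I. pbr x w \<in> \<eta> ` I)"
    by (rule OGL2_model) blast
  have crings: "cring (OGL2 :: ((gen, 'k) mpoly \<times> nat) set ring)" "cring (Wring (1 :: 'k))"
    by (rule cring_OGL2 cring_Wring_one)+
  note rings = ring_OqGL2[OF assms(1)] cring.axioms(1)[OF crings(1)]
  interpret Q: riso "OqGL2 q" "Wring q" \<theta>
    by (intro riso.intro riso_axioms.intro rings ring_Wring assms(1) \<theta>)
  interpret C: riso OGL2 "Wring 1" \<eta>
    by (intro riso.intro riso_axioms.intro rings cring.axioms(1)[OF crings(2)] \<eta>(1))
  \<comment> \<open>The two coordinate rings are identified through the underlying set shared by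
    \<open>Wring q\<close> and \<open>Wring 1\<close>, although the products on it differ.\<close>
  define g where "g = inv_into (carrier OGL2) \<eta> \<circ> \<theta>"
  have bij: "bij_betw g (carrier (OqGL2 q)) (carrier OGL2)"
    unfolding g_def using Q.bij C.bij by (intro bij_betw_trans[of _ _ UNIV] bij_betw_inv_into) simp_all
  have \<eta>g: "\<eta> ` g ` P = \<theta> ` P" for P
    using C.image_inv[of "\<theta> ` P"] unfolding g_def image_comp[symmetric] by simp
  have gc: "g ` P \<subseteq> carrier OGL2" if "P \<subseteq> carrier (OqGL2 q)" for P
    using bij that by (auto simp: bij_betw_def)
  have poisson: "poisson_ideal I OGL2 GL2_bracket \<longleftrightarrow> wpoisson (\<eta> ` I)" if "I \<subseteq> carrier OGL2" for I
  proof (cases "ideal I OGL2")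
    case True
    then show ?thesis using \<eta>(2) C.image_iff(3)[OF that] by (simp add: wpoisson_def)
  next
    case False
    then show ?thesis using C.image_iff(3)[OF that] by (simp add: wpoisson_def poisson_ideal_def)
  qed
  have pspec: "I \<in> pspec OGL2 GL2_bracket \<longleftrightarrow> model_prime (\<eta> ` I)" if "I \<subseteq> carrier OGL2" for I
    unfolding pspec_iff_model_prime[symmetric] pspec_def using poisson[OF that] C.image_iff(5)[OF that crings] by simp
  have pprim: "I \<in> pprim OGL2 GL2_bracket \<longleftrightarrow> wpprim (\<eta> ` I)" if I: "I \<subseteq> carrier OGL2" for I
  proof
    assume "I \<in> pprim OGL2 GL2_bracket"
    then obtain N where N: "maximalideal N OGL2" "poisson_ideal I OGL2 GL2_bracket" "I \<subseteq> N"
      "\<And>J. poisson_ideal J OGL2 GL2_bracket \<Longrightarrow> J \<subseteq> N \<Longrightarrow> J \<subseteq> I" unfolding pprim_def by blast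
    interpret N: maximalideal N OGL2 by fact
    have Nc: "N \<subseteq> carrier OGL2" using N.Icarr by blast
    have "J \<subseteq> \<eta> ` I" if J: "wpoisson J" "J \<subseteq> \<eta> ` N" for J
    proof -
      let ?J = "inv_into (carrier OGL2) \<eta> ` J"
      have J': "\<eta> ` ?J = J" by (rule C.image_inv) simp
      have sub: "?J \<subseteq> N" using image_mono[OF J(2), of "inv_into (carrier OGL2) \<eta>"] C.inv_image[OF Nc] by simp
      then have "poisson_ideal ?J OGL2 GL2_bracket" using poisson[of ?J] Nc J(1) J' by simp
      then show ?thesis using image_mono[OF N(4)[OF _ sub], of \<eta>] J' by simp
    qed
    then show "wpprim (\<eta> ` I)"
      unfolding wpprim_def using N(1-3) poisson[OF I] C.image_iff(4)[OF Nc] image_mono[of I N \<eta>] by blast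
  next
    assume "wpprim (\<eta> ` I)"
    then obtain L where L: "maximalideal L (Wring 1)" "wpoisson (\<eta> ` I)" "\<eta> ` I \<subseteq> L"
      "\<And>J. wpoisson J \<Longrightarrow> J \<subseteq> L \<Longrightarrow> J \<subseteq> \<eta> ` I" unfolding wpprim_def by blast
    define N where "N = inv_into (carrier OGL2) \<eta> ` L"
    have LN: "\<eta> ` N = L" unfolding N_def by (rule C.image_inv) simp
    have Nc: "N \<subseteq> carrier OGL2" unfolding N_def using bij_betw_inv_into[OF C.bij] by (auto simp: bij_betw_def)
    have refl: "A \<subseteq> B" if "\<eta> ` A \<subseteq> \<eta> ` B" "A \<subseteq> carrier OGL2" "B \<subseteq> carrier OGL2" for A B
      using image_mono[OF that(1), of "inv_into (carrier OGL2) \<eta>"] C.inv_image that(2,3) by simp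
    have "J \<subseteq> I" if J: "poisson_ideal J OGL2 GL2_bracket" "J \<subseteq> N" for J
      using refl[of J I] L(4)[of "\<eta> ` J"] J Nc I poisson[of J] image_mono[OF J(2), of \<eta>] LN by blast
    then show "I \<in> pprim OGL2 GL2_bracket"
      unfolding pprim_def using L(1-3) LN C.image_iff(4)[OF Nc] poisson[OF I] refl[of I N] I Nc by blast
  qed
  have spec_iff: "g ` P \<in> pspec OGL2 GL2_bracket \<longleftrightarrow> P \<in> spec (OqGL2 q)" if P: "P \<subseteq> carrier (OqGL2 q)" for P
    using pspec[OF gc[OF P]] spec_iff_model_prime[OF assms, of "\<theta> ` P"] Q.image_iff(1)[OF P] unfolding \<eta>g by blast
  have prim_iff: "g ` P \<in> pprim OGL2 GL2_bracket \<longleftrightarrow> P \<in> prim (OqGL2 q)"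
    if P: "P \<subseteq> carrier (OqGL2 q)" "g ` P \<in> pspec OGL2 GL2_bracket" for P
    using pprim[OF gc[OF P(1)]] pspec[OF gc[OF P(1)]] P(2) wpprim_iff_model_primitive[of "\<theta> ` P"]
      prim_iff_model_primitive[OF assms, of "\<theta> ` P"] Q.image_iff(2)[OF P(1)] unfolding \<eta>g by blast
  have homeo: "homeomorphic_map (zariski (OqGL2 q) (spec (OqGL2 q))) (zariski OGL2 (pspec OGL2 GL2_bracket)) (image g)"
    by (rule homeomorphic_map_zariski[OF rings(1) subset_refl rings(2) pspec_subset_spec bij spec_iff])
  moreover have "homeomorphic_map (subtopology (zariski (OqGL2 q) (spec (OqGL2 q))) (prim (OqGL2 q)))
      (subtopology (zariski OGL2 (pspec OGL2 GL2_bracket)) (pprim OGL2 GL2_bracket)) (image g)"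
  proof (rule homeomorphic_map_subtopologies_alt[OF homeo])
    fix P assume "P \<in> topspace (zariski (OqGL2 q) (spec (OqGL2 q)))"
      and *: "g ` P \<in> topspace (zariski OGL2 (pspec OGL2 GL2_bracket))"
    then have "P \<subseteq> carrier (OqGL2 q)" using spec_carrier closedin_zariski(1)[OF rings(1) subset_refl] by metis
    then show "g ` P \<in> pprim OGL2 GL2_bracket \<longleftrightarrow> P \<in> prim (OqGL2 q)"
      using prim_iff * closedin_zariski(1)[OF rings(2) pspec_subset_spec, of GL2_bracket] by blast
  qed
  ultimately show ?thesis by blast
qed

end
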